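(* Let $d\ge 2$. Let $\underline{P}$ be the jump distribution of an aperiodic random walk on $\mathbb{Z}^d$; suppose that the jumps have expected value $0$ and that their distribution is B-type with scaling $B_n$ and limiting covariance matrix $\Sigma$. Let $(X_n)_{n\ge 0}$ be a random walk with local impurities associated with $\underline{P}$, with transition matrix $P$, finite impurity set $A$ and starting point $X_0=z$, such that: (i) $z$ lies in the infinite strongly connected component $Q$ of the directed graph $G=(\mathbb{Z}^d,E)$, $E=\{(u,v): P(u,v)\neq 0\}$, and $0\in Q$; (ii) there is an $\epsilon>0$ such that for every impurity $u\in A$ the jump $J$ from $u$ satisfies $\mathbb{E}(\|J\|^{\epsilon})<\infty$. Let $\eta^{X'}_n:[0,1]\to\mathbb{R}^d$ be the continuous function with $\eta^{X'}_n(t)=B_n^{-1}X_{nt}$ for $t=0,\frac1n,\frac2n,\ldots,1$, and linear between these points. Then, as $n\to\infty$, $$\eta^{X'}_n(t)\Rightarrow W_{\Sigma}(t),\qquad t\in[0,1],$$ where $W_\Sigma$ is a $d$-dimensional Wiener process with covariance matrix $\Sigma$ and $\Rightarrow$ denotes weak convergence in the space $C_d[0,1]$ of continuous functions $[0,1]\to\mathbb{R}^d$.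
   Context: $\|\cdot\|$ is the maximum ($L_\infty$) norm. Random walk: given a probability distribution $\underline{P}(y)$, $y\in\mathbb{Z}^d$, the random walk is $Y_n=y_0+\sum_{i=1}^n y_i$ with $y_0=z\in\mathbb{Z}^d$ and $y_1,y_2,\ldots$ i.i.d. with $P(y_i=y)=\underline{P}(y)$; its transition probabilities are $\underline{P}(x,y)=\underline{P}(y-x)$. Aperiodic: for all $x,z\in\mathbb{Z}^d$, if the random walk has positive $m$-step transition probability from $z$ to $x$ for some $m$, then there is $n_0$ (possibly depending on $x$ and $z$) such that the $n$-step transition probability from $z$ to $x$ is positive for all $n>n_0$. B-type: a random vector $\xi$ with $\mathbb{E}\|\xi\|^2=\infty$ is B-type if its expected value is $0$ and it belongs to the domain of attraction of the (non-degenerate) normal law. The scaling $B_n>0$ and the covariance matrix $\Sigma$ are such that, for i.i.d. copies $\xi_1,\xi_2,\ldots$ of $\xi$, $B_n^{-1}\sum_{k=1}^n\xi_k$ converges in distribution to the centered non-degenerate normal law on $\mathbb{R}^d$ with covariance matrix $\Sigma$. (Consequently $\lim_{n\to\infty}B_n/\sqrt n=\infty$.) Random walk with local impurities: a time-homogeneous Markov chain $X_0,X_1,\ldots$ on $\mathbb{Z}^d$ with transition probability matrix $P$ (not necessarily translation invariant) for which there is a finite set $A\subset\mathbb{Z}^d$ such that $P(u,v)=\underline{P}(u,v)$ for all $u\notin A$, $v\in\mathbb{Z}^d$. The points of $A$ are the impurities; the jump from $u$ is $J=X_{n+1}-X_n$ conditioned on $X_n=u$. A directed graph is strongly connected if there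 is a directed path from each vertex to each other vertex; a strongly connected component of $G$ is a maximal strongly connected subgraph (identified here with its vertex set).
   Formalization: The formal theorem adds that no edge of G leaves Q (P(u,v)=0 for u in Q, v not in Q); without it the claim fails, e.g. for one absorbing impurity v≠0 with P(v,v)=1, where the walk is trapped at v with positive probability. *)

theory Defs
  imports "HOL-Probability.Probability" "Graph_Theory.Digraph_Component"
begin

section \<open>Weak convergence on a topological space\<close>

definition borel_of :: "'a topology \<Rightarrow> 'a measure"
  where "borel_of T = sigma (topspace T) {U. openin T U}"

lemma borel_of_euclidean: "borel_of (euclidean :: 'a::topological_space topology) = borel"
  by (simp add: borel_of_def borel_def)

text \<open>
  The conditions on the measures are part of the definition, so that weak convergence of laws
  \<open>distr M (borel_of T) \<xi>\<close> includes the measurability of the random elements \<open>\<xi>\<close>.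
\<close>

definition weakly_converges ::
    "'a topology \<Rightarrow> (nat \<Rightarrow> 'a measure) \<Rightarrow> 'a measure \<Rightarrow> bool"
  where "weakly_converges T \<mu> \<nu> \<longleftrightarrow>
    (\<forall>n. prob_space (\<mu> n) \<and> sets (\<mu> n) = sets (borel_of T)) \<and>
    prob_space \<nu> \<and> sets \<nu> = sets (borel_of T) \<and>
    (\<forall>f. continuous_map T euclideanreal f \<and> bounded (f ` topspace T) \<longrightarrow>
       (\<lambda>n. \<integral>x. f x \<partial>\<mu> n) \<longlonglongrightarrow> (\<integral>x. f x \<partial>\<nu>))"


section \<open>The space of continuous functions on the unit interval\<close>

text \<open>
  Functions on \<open>[0,1]\<close> are represented by functions on \<^typ>\<open>real\<close> that are \<^term>\<open>undefined\<close>
  outside \<open>[0,1]\<close>.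
\<close>

definition C01 :: "(real \<Rightarrow> 'v::metric_space) set"
  where "C01 = {f \<in> extensional {0..1}. continuous_on {0..1} f}"

text \<open>
  The value \<open>0\<close> outside \<^term>\<open>C01\<close> is due to the locale \<^locale>\<open>Metric_space\<close>, which requires
  \<open>0 \<le> d f g\<close> for all \<open>f\<close> and \<open>g\<close>.
\<close>

definition C01_dist :: "(real \<Rightarrow> 'v::metric_space) \<Rightarrow> (real \<Rightarrow> 'v) \<Rightarrow> real"
  where "C01_dist f g =
    (if f \<in> C01 \<and> g \<in> C01 then SUP t\<in>{0..1}. dist (f t) (g t) else 0)"

definition C01_topology :: "(real \<Rightarrow> 'v::metric_space) topology"
  where "C01_topology = Metric_space.mtopology C01 C01_dist"

lemma C01_dist_bdd:
  assumes "f \<in> C01" "g \<in> C01"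
  shows "bdd_above ((\<lambda>t. dist (f t) (g t)) ` {0..1})"
proof -
  have "continuous_on {0..1} (\<lambda>t. dist (f t) (g t))"
    using assms by (auto simp: C01_def intro!: continuous_intros)
  then have "compact ((\<lambda>t. dist (f t) (g t)) ` {0..1})"
    by (rule compact_continuous_image) simp
  then show ?thesis
    by (simp add: bounded_imp_bdd_above compact_imp_bounded)
qed

lemma C01_dist_upper:
  assumes "f \<in> C01" "g \<in> C01" "t \<in> {0..1}"
  shows "dist (f t) (g t) \<le> C01_dist f g"
  using assms by (auto simp: C01_dist_def intro!: cSUP_upper[OF _ C01_dist_bdd])

lemma C01_dist_least:
  assumes "f \<in> C01" "g \<in> C01" "\<And>t. t \<in> {0..1} \<Longrightarrow> dist (f t) (g t) \<le> c"
  shows "C01_dist f g \<le> c"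
  using assms by (auto simp: C01_dist_def intro!: cSUP_least)

lemma Metric_space_C01: "Metric_space C01 C01_dist"
proof
  fix f g :: "real \<Rightarrow> 'a"
  show nn: "0 \<le> C01_dist f g"
  proof (cases "f \<in> C01 \<and> g \<in> C01")
    case True
    then show ?thesis
      using C01_dist_upper[of f g 0] order_trans[OF zero_le_dist] by fastforce
  qed (auto simp: C01_dist_def)
  show "C01_dist f g = C01_dist g f"
    by (simp add: C01_dist_def dist_commute conj_commute)
  assume fg: "f \<in> C01" "g \<in> C01"
  show "C01_dist f g = 0 \<longleftrightarrow> f = g"
  proof
    assume "C01_dist f g = 0"
    then have "f t = g t" if "t \<in> {0..1}" for t
      using C01_dist_upper[OF fg that] by simp
    then show "f = g"
      using fg by (auto simp: C01_def intro: extensionalityI)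
  next
    assume "f = g"
    then show "C01_dist f g = 0"
      using C01_dist_least[OF fg, of 0] nn by simp
  qed
  fix h :: "real \<Rightarrow> 'a"
  assume h: "h \<in> C01"
  show "C01_dist f h \<le> C01_dist f g + C01_dist g h"
    using C01_dist_upper[OF fg] C01_dist_upper[OF fg(2) h]
    by (intro C01_dist_least[OF fg(1) h]) (meson add_mono dist_triangle order_trans)
qed

lemma topspace_C01_topology: "topspace C01_topology = C01"
  unfolding C01_topology_def by (rule Metric_space.topspace_mtopology[OF Metric_space_C01])


section \<open>Normal laws and the Wiener process\<close>

definition pos_def_matrix :: "real^'d^'d \<Rightarrow> bool"
  where "pos_def_matrix S \<longleftrightarrow> transpose S = S \<and> (\<forall>v. v \<noteq> 0 \<longrightarrow> v \<bullet> (S *v v) > 0)"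

text \<open>
  The centered non-degenerate normal law with covariance matrix \<open>S\<close>: every non-trivial linear
  combination \<open>v \<bullet> x\<close> of the coordinates is normal with mean \<open>0\<close> and variance \<open>v \<bullet> S v\<close>.
\<close>

definition centered_normal_law :: "real^'d^'d \<Rightarrow> (real^'d) measure \<Rightarrow> bool"
  where "centered_normal_law S \<nu> \<longleftrightarrow>
    pos_def_matrix S \<and> prob_space \<nu> \<and> sets \<nu> = sets borel \<and>
    (\<forall>v. v \<noteq> 0 \<longrightarrow>
       distributed \<nu> lborel (\<lambda>x. v \<bullet> x) (normal_density 0 (sqrt (v \<bullet> (S *v v)))))"

definition wiener_process ::
    "'w measure \<Rightarrow> real^'d^'d \<Rightarrow> (real \<Rightarrow> 'w \<Rightarrow> real^'d) \<Rightarrow> bool"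
  where "wiener_process N S W \<longleftrightarrow>
    prob_space N \<and>
    (\<forall>t\<in>{0..1}. W t \<in> borel_measurable N) \<and>
    (\<forall>\<omega>\<in>space N. W 0 \<omega> = 0 \<and> continuous_on {0..1} (\<lambda>t. W t \<omega>)) \<and>
    (\<forall>s t. 0 \<le> s \<and> s < t \<and> t \<le> 1 \<longrightarrow>
       centered_normal_law ((t - s) *\<^sub>R S) (distr N borel (\<lambda>\<omega>. W t \<omega> - W s \<omega>))) \<and>
    (\<forall>k (t :: nat \<Rightarrow> real). 0 \<le> t 0 \<and> (\<forall>i<k. t i < t (Suc i)) \<and> t k \<le> 1 \<longrightarrow>
       prob_space.indep_vars N (\<lambda>_. borel) (\<lambda>i \<omega>. W (t (Suc i)) \<omega> - W (t i) \<omega>) {..<k})"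


section \<open>Random walks\<close>

definition real_vec :: "int^'d \<Rightarrow> real^'d"
  where "real_vec x = (\<chi> i. real_of_int (x $ i))"

text \<open>The maximum norm is \<^const>\<open>infnorm\<close>.\<close>

lemma infnorm_real_vec: "infnorm (real_vec x) = Max (range (\<lambda>i. \<bar>real_of_int (x $ i)\<bar>))"
proof -
  have "infnorm (real_vec x) = Sup (range (\<lambda>i. \<bar>real_vec x $ i\<bar>))"
    by (simp add: infnorm_cart full_SetCompr_eq)
  then show ?thesis
    by (simp add: cSup_eq_Max real_vec_def)
qed

definition walk_kernel :: "(int^'d) pmf \<Rightarrow> int^'d \<Rightarrow> (int^'d) pmf"
  where "walk_kernel p x = map_pmf (\<lambda>y. x + y) p"

lemma pmf_walk_kernel: "pmf (walk_kernel p u) v = pmf p (v - u)"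
  using pmf_map_inj'[of "\<lambda>y. u + y" p "v - u"] by (simp add: walk_kernel_def inj_def)

primrec nstep :: "('s \<Rightarrow> 's pmf) \<Rightarrow> nat \<Rightarrow> 's \<Rightarrow> 's pmf"
  where
    "nstep K 0 z = return_pmf z"
  | "nstep K (Suc n) z = bind_pmf (nstep K n z) K"

definition aperiodic_walk :: "(int^'d) pmf \<Rightarrow> bool"
  where "aperiodic_walk p \<longleftrightarrow>
    (\<forall>x z. (\<exists>m. pmf (nstep (walk_kernel p) m z) x > 0) \<longrightarrow>
       (\<exists>n\<^sub>0. \<forall>n>n\<^sub>0. pmf (nstep (walk_kernel p) n z) x > 0))"

text \<open>
  The i.i.d. copies of the jump are the coordinates of the infinite product space.
\<close>

definition scaled_sum_law :: "(int^'d) pmf \<Rightarrow> (nat \<Rightarrow> real) \<Rightarrow> nat \<Rightarrow> (real^'d) measure"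
  where "scaled_sum_law p B n =
    distr (\<Pi>\<^sub>M k\<in>(UNIV::nat set). measure_pmf p) borel
      (\<lambda>\<xi>. (1 / B n) *\<^sub>R (\<Sum>k\<in>{1..n}. real_vec (\<xi> k)))"

definition B_type :: "(int^'d) pmf \<Rightarrow> (nat \<Rightarrow> real) \<Rightarrow> real^'d^'d \<Rightarrow> bool"
  where "B_type p B S \<longleftrightarrow>
    (\<integral>\<^sup>+ y. ennreal ((infnorm (real_vec y))\<^sup>2) \<partial>measure_pmf p) = \<infinity> \<and>
    integrable (measure_pmf p) real_vec \<and>
    measure_pmf.expectation p real_vec = 0 \<and>
    (\<forall>n\<ge>1. B n > 0) \<and>
    (\<exists>\<nu>. centered_normal_law S \<nu> \<and> weakly_converges euclidean (scaled_sum_law p B) \<nu>)"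


section \<open>Random walks with local impurities\<close>

definition markov_chain ::
    "'w measure \<Rightarrow> ('s \<Rightarrow> 's pmf) \<Rightarrow> 's \<Rightarrow> (nat \<Rightarrow> 'w \<Rightarrow> 's) \<Rightarrow> bool"
  where "markov_chain M P z X \<longleftrightarrow>
    prob_space M \<and>
    (\<forall>n. X n \<in> measurable M (count_space UNIV)) \<and>
    (AE \<omega> in M. X 0 \<omega> = z) \<and>
    (\<forall>n x v. measure M {\<omega>\<in>space M. (\<forall>i\<le>n. X i \<omega> = x i) \<and> X (Suc n) \<omega> = v} =
       measure M {\<omega>\<in>space M. \<forall>i\<le>n. X i \<omega> = x i} * pmf (P (x n)) v)"

definition impurity_set :: "(int^'d \<Rightarrow> (int^'d) pmf) \<Rightarrow> (int^'d) pmf \<Rightarrow> (int^'d) set \<Rightarrow> bool"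
  where "impurity_set P p A \<longleftrightarrow>
    finite A \<and> (\<forall>u. u \<notin> A \<longrightarrow> (\<forall>v. pmf (P u) v = pmf (walk_kernel p u) v))"

definition transition_graph :: "('s \<Rightarrow> 's pmf) \<Rightarrow> ('s, 's \<times> 's) pre_digraph"
  where "transition_graph P =
    \<lparr>verts = UNIV, arcs = {(u, v). pmf (P u) v \<noteq> 0}, tail = fst, head = snd\<rparr>"

definition scaled_path ::
    "(nat \<Rightarrow> real) \<Rightarrow> (nat \<Rightarrow> 'w \<Rightarrow> int^'d) \<Rightarrow> nat \<Rightarrow> 'w \<Rightarrow> real \<Rightarrow> real^'d"
  where "scaled_path B X n \<omega> =
    (\<lambda>t\<in>{0..1}. let k = nat \<lfloor>real n * t\<rfloor> in
       (1 / B n) *\<^sub>R (real_vec (X k \<omega>) +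
          (real n * t - real k) *\<^sub>R (real_vec (X (Suc k) \<omega>) - real_vec (X k \<omega>))))"

end

(*
  The perturbed walk X is coupled with an unperturbed walk Y that makes the same jumps as X away
  from the impurities and independent jumps on them, so that X - Y changes only when X is at an
  impurity. If the expected number of visits to A up to time n is O(n^g) for every g > 0, then
  Markov's inequality for the sum of the e-th powers of the jumps at A shows
  max_{k <= n} |X_k - Y_k| = o(B_n) in probability, because B_n >= sqrt n, and the invariance
  principle for X follows from the one for Y.

  The bound on the visits comes from an escape estimate. In dimension at least 2 the infinite
  second moment improves the local bound to P(Y_j = x) = o(1/j) uniformly in x. Hence a walk that
  starts at distance B_t from the origin has a vanishing probability of meeting A before time K t,
  whereas by that time it is at distance B_{K t} with a probability c independent of K. Iterating
  over the scales t, K t, K^2 t, ... shows that Y avoids A up to time n with probability at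
  least a constant times n^(-g), where g tends to 0 as K grows.

  Weak convergence in C[0,1] is reduced to bounded Lipschitz test functions and, by Ottaviani's
  maximal inequality, to the increments over a fixed partition.
*)
theory Submission
  imports Defs "HOL-Real_Asymp.Real_Asymp"
begin

text \<open>The local bound uses the characteristic function near 0 only. Averaging
  \<open>iexp\<close> over differences of two independent uniform points of a small square in a
  coordinate plane gives a nonnegative function of the lattice point with value 1 at the target, so
  it dominates the point probability. Near 0 the truncated second moments of the symmetrized jump
  are arbitrarily large in every direction, so |cf| is at most exp (- M |\<theta>|^2) for any
  prescribed M on a small enough disc; the plane integral of the j-th power is then at most pi / (j
  M), up to a geometric term. The scales \<open>B t\<close> and \<open>B (K * t)\<close> are never
  compared with each other: from any starting point, K t steps carry the walk beyond
  \<open>B (K * t)\<close> with probability c, by moving into the half-space on the side of its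
  start. The order of the jump moments at \<open>A\<close> is lowered to at most 1, which makes the
  power subadditive, so that the powers of the jumps can be summed along the visits.\<close>

lemma (in prob_space) bounded_convergence:
  fixes f :: "nat \<Rightarrow> 'a \<Rightarrow> 'b :: {banach, second_countable_topology}"
  assumes "\<And>n. f n \<in> borel_measurable M"
    and "\<And>n x. x \<in> space M \<Longrightarrow> norm (f n x) \<le> C"
    and "\<And>x. x \<in> space M \<Longrightarrow> (\<lambda>n. f n x) \<longlonglongrightarrow> g x"
  shows "(\<lambda>n. \<integral>x. f n x \<partial>M) \<longlonglongrightarrow> (\<integral>x. g x \<partial>M)"
proof (rule integral_dominated_convergence[where w="\<lambda>_. C"])
  show "g \<in> borel_measurable M"
    using assms(3) by (rule borel_measurable_LIMSEQ_metric[OF assms(1)])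
qed (use assms in auto)

lemma (in prob_space) integrable_bounded:
  fixes f :: "'a \<Rightarrow> 'b :: {banach, second_countable_topology}"
  assumes "f \<in> borel_measurable M" "\<And>x. x \<in> space M \<Longrightarrow> norm (f x) \<le> C"
  shows "integrable M f"
  using assms by (intro integrable_const_bound[where B=C]) auto

lemma tendsto_of_eventually_abs_le:
  fixes x :: "nat \<Rightarrow> real"
  assumes "\<And>e. e > 0 \<Longrightarrow> \<forall>\<^sub>F n in sequentially. \<bar>x n - l\<bar> \<le> e"
  shows "x \<longlonglongrightarrow> l"
proof (rule tendstoI)
  fix e :: real assume "e > 0"
  then show "\<forall>\<^sub>F n in sequentially. dist (x n) l < e"
    using assms[of "e/2"] by (auto simp: dist_real_def elim!: eventually_mono)
qed

section \<open>Weak convergence\<close>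

lemma space_borel_of [simp]: "space (borel_of T) = topspace T"
  by (simp add: borel_of_def space_measure_of_conv)

lemma borel_of_open: "openin T U \<Longrightarrow> U \<in> sets (borel_of T)"
  unfolding borel_of_def by (subst sets_measure_of) (use openin_subset in auto)

lemma measurable_borel_ofI:
  assumes "g \<in> space M \<rightarrow> topspace T" "\<And>U. openin T U \<Longrightarrow> g -` U \<inter> space M \<in> sets M"
  shows "g \<in> measurable M (borel_of T)"
  unfolding borel_of_def
  by (rule measurable_measure_of) (use assms in \<open>auto dest: openin_subset\<close>)

lemma borel_measurable_continuous_map:
  assumes "continuous_map T euclidean f"
  shows "f \<in> borel_measurable (borel_of T)"
proof (rule borel_measurableI)
  fix S :: "'b set" assume "open S"
  then have "openin T {x \<in> topspace T. f x \<in> S}"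
    using assms by (simp add: openin_continuous_map_preimage)
  moreover have "f -` S \<inter> space (borel_of T) = {x \<in> topspace T. f x \<in> S}"
    by auto
  ultimately show "f -` S \<inter> space (borel_of T) \<in> sets (borel_of T)"
    using borel_of_open by simp
qed

context Metric_space
begin

lemma continuous_map_lipschitz:
  fixes f :: "'a \<Rightarrow> real"
  assumes "\<And>x y. x \<in> M \<Longrightarrow> y \<in> M \<Longrightarrow> \<bar>f x - f y\<bar> \<le> L * d x y"
  shows "continuous_map mtopology euclideanreal f"
proof -
  have "\<exists>\<delta>>0. \<forall>y. y \<in> M \<and> d x y < \<delta> \<longrightarrow> dist (f x) (f y) < e" if "x \<in> M" "e > 0" for x e
  proof (intro exI[of _ "e / (\<bar>L\<bar> + 1)"] conjI allI impI)
    fix y assume y: "y \<in> M \<and> d x y < e / (\<bar>L\<bar> + 1)"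
    have "\<bar>f x - f y\<bar> \<le> L * d x y" using assms y that by simp
    also have "\<dots> \<le> (\<bar>L\<bar> + 1) * d x y" by (rule mult_right_mono) auto
    also have "\<dots> < e" using y by (simp add: field_simps)
    finally show "dist (f x) (f y) < e" by (simp add: dist_real_def)
  qed (use that in auto)
  then show ?thesis
    using metric_continuous_map[OF Met_TC.Metric_space_axioms, of f]
    unfolding mtopology_is_euclidean by simp
qed

text \<open>For bounded f this is the largest k-Lipschitz function below f: the inf-convolution of f
  with k times the distance.\<close>

definition lipschitz_minorant :: "('a \<Rightarrow> real) \<Rightarrow> nat \<Rightarrow> 'a \<Rightarrow> real"
  where "lipschitz_minorant f k x = (INF y\<in>M. f y + real k * d x y)"

context
  fixes f :: "'a \<Rightarrow> real" and C :: real
  assumes bounded_f: "\<And>x. x \<in> M \<Longrightarrow> \<bar>f x\<bar> \<le> C"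
begin

lemma lipschitz_minorant_bdd: "bdd_below ((\<lambda>y. f y + real k * d x y) ` M)"
  using bounded_f by (intro bdd_belowI2[of _ "- C"]) (smt (verit) mult_nonneg_nonneg nonneg of_nat_0_le_iff)

lemma lipschitz_minorant_le: "x \<in> M \<Longrightarrow> lipschitz_minorant f k x \<le> f x"
  unfolding lipschitz_minorant_def
  by (rule cINF_lower2[OF lipschitz_minorant_bdd, of x]) auto

lemma lipschitz_minorant_ge:
  "x \<in> M \<Longrightarrow> (\<And>y. y \<in> M \<Longrightarrow> c \<le> f y + real k * d x y) \<Longrightarrow> c \<le> lipschitz_minorant f k x"
  unfolding lipschitz_minorant_def by (rule cINF_greatest) auto

lemma lipschitz_minorant_bounded: "x \<in> M \<Longrightarrow> \<bar>lipschitz_minorant f k x\<bar> \<le> C"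
proof -
  assume x: "x \<in> M"
  have "- C \<le> lipschitz_minorant f k x"
    using bounded_f by (intro lipschitz_minorant_ge[OF x]) (smt (verit) mult_nonneg_nonneg nonneg of_nat_0_le_iff)
  then show ?thesis using lipschitz_minorant_le[OF x, of k] bounded_f[OF x] by linarith
qed

lemma lipschitz_minorant_lipschitz:
  assumes "x \<in> M" "y \<in> M"
  shows "\<bar>lipschitz_minorant f k x - lipschitz_minorant f k y\<bar> \<le> real k * d x y"
proof -
  have *: "lipschitz_minorant f k x - real k * d x y \<le> lipschitz_minorant f k y"
    if x: "x \<in> M" and y: "y \<in> M" for x y
  proof (rule lipschitz_minorant_ge[OF y])
    fix w assume w: "w \<in> M"
    have "lipschitz_minorant f k x \<le> f w + real k * d x w"
      unfolding lipschitz_minorant_def by (rule cINF_lower[OF lipschitz_minorant_bdd w])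
    also have "\<dots> \<le> f w + real k * (d x y + d y w)"
      using triangle[OF x y w] by (intro add_left_mono mult_left_mono) auto
    finally show "lipschitz_minorant f k x - real k * d x y \<le> f w + real k * d y w"
      by (simp add: algebra_simps)
  qed
  show ?thesis using *[OF assms] *[OF assms(2,1)] commute[of y x] by auto
qed

text \<open>A point at distance \<delta> or more pays k \<delta>, which exceeds the whole range 2 C
  of f once k is large; only points where continuity applies compete for the infimum.\<close>

lemma lipschitz_minorant_tendsto:
  assumes cont: "continuous_map mtopology euclideanreal f" and x: "x \<in> M"
  shows "(\<lambda>k. lipschitz_minorant f k x) \<longlonglongrightarrow> f x"
proof (rule tendsto_of_eventually_abs_le)
  fix e :: real assume e: "e > 0"
  obtain \<delta> where \<delta>: "\<delta> > 0" "\<And>y. y \<in> M \<Longrightarrow> d x y < \<delta> \<Longrightarrow> dist (f x) (f y) < e"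
    using cont[folded mtopology_is_euclidean, unfolded metric_continuous_map[OF Met_TC.Metric_space_axioms]] x e
    by meson
  have "f x - e \<le> lipschitz_minorant f k x" if k: "2 * C / \<delta> \<le> real k" for k
  proof (rule lipschitz_minorant_ge[OF x])
    fix y assume y: "y \<in> M"
    show "f x - e \<le> f y + real k * d x y"
    proof (cases "d x y < \<delta>")
      case True
      moreover have "0 \<le> real k * d x y" by simp
      ultimately show ?thesis using \<delta>(2)[OF y True] unfolding dist_real_def by linarith
    next
      case False
      have "2 * C \<le> real k * \<delta>" using k \<delta>(1) by (simp add: field_simps)
      also have "\<dots> \<le> real k * d x y" using False by (intro mult_left_mono) auto
      finally show ?thesis using bounded_f[OF x] bounded_f[OF y] e by auto
    qed
  qed
  moreover obtain K :: nat where "2 * C / \<delta> \<le> real K" using real_arch_simple by blast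
  ultimately have "\<forall>k\<ge>K. \<bar>lipschitz_minorant f k x - f x\<bar> \<le> e"
    using lipschitz_minorant_le[OF x] by (smt (verit) of_nat_mono)
  then show "\<forall>\<^sub>F k in sequentially. \<bar>lipschitz_minorant f k x - f x\<bar> \<le> e"
    using eventually_sequentially by blast
qed

end

text \<open>Each minorant is a Lipschitz test function below f, so the limit of its integrals bounds
  those of f from below, and bounded convergence under \<nu> alone closes the gap. The upper bound
  is the same estimate for - f.\<close>

lemma weakly_converges_if_lipschitz:
  assumes \<mu>: "\<And>n. prob_space (\<mu> n)" "\<And>n. sets (\<mu> n) = sets (borel_of mtopology)"
    and \<nu>: "prob_space \<nu>" "sets \<nu> = sets (borel_of mtopology)"
    and lip: "\<And>f C L. \<lbrakk>\<And>x. x \<in> M \<Longrightarrow> \<bar>f x\<bar> \<le> C;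
      \<And>x y. x \<in> M \<Longrightarrow> y \<in> M \<Longrightarrow> \<bar>f x - f y\<bar> \<le> L * d x y\<rbrakk>
      \<Longrightarrow> (\<lambda>n. \<integral>x. f x \<partial>\<mu> n) \<longlonglongrightarrow> (\<integral>x. f x \<partial>\<nu>)"
  shows "weakly_converges mtopology \<mu> \<nu>"
proof -
  interpret \<mu>: prob_space "\<mu> n" for n by (rule \<mu>)
  interpret \<nu>: prob_space \<nu> by (rule \<nu>)
  have sp [simp]: "space (\<mu> n) = M" "space \<nu> = M" for n
    using sets_eq_imp_space_eq[OF \<mu>(2)[of n]] sets_eq_imp_space_eq[OF \<nu>(2)] by auto
  have meas: "f \<in> borel_measurable (\<mu> n)" "f \<in> borel_measurable \<nu>"
    if "continuous_map mtopology euclideanreal f" for f n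
    using borel_measurable_continuous_map[OF that]
    by (auto simp: measurable_cong_sets[OF \<mu>(2) refl] measurable_cong_sets[OF \<nu>(2) refl])
  have lower: "\<forall>\<^sub>F n in sequentially. (\<integral>x. f x \<partial>\<nu>) - e \<le> (\<integral>x. f x \<partial>\<mu> n)"
    if f: "continuous_map mtopology euclideanreal f" and C: "\<And>x. x \<in> M \<Longrightarrow> \<bar>f x\<bar> \<le> C"
      and e: "e > 0" for f C e
  proof -
    define g where "g = lipschitz_minorant f"
    have g_lip: "x \<in> M \<Longrightarrow> y \<in> M \<Longrightarrow> \<bar>g k x - g k y\<bar> \<le> real k * d x y" for k x y
      unfolding g_def by (rule lipschitz_minorant_lipschitz[OF C])
    have g_bdd: "x \<in> M \<Longrightarrow> \<bar>g k x\<bar> \<le> C" for k x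
      unfolding g_def by (rule lipschitz_minorant_bounded[OF C])
    have g_cont: "continuous_map mtopology euclideanreal (g k)" for k
      by (rule continuous_map_lipschitz) (rule g_lip)
    have "(\<lambda>k. \<integral>x. g k x \<partial>\<nu>) \<longlonglongrightarrow> (\<integral>x. f x \<partial>\<nu>)"
      using meas(2)[OF g_cont] g_bdd lipschitz_minorant_tendsto[OF C f, folded g_def]
      by (intro \<nu>.bounded_convergence[where C=C]) auto
    then have "\<forall>\<^sub>F k in sequentially. dist (\<integral>x. g k x \<partial>\<nu>) (\<integral>x. f x \<partial>\<nu>) < e/2"
      using e by (intro tendstoD) auto
    then obtain k where k: "dist (\<integral>x. g k x \<partial>\<nu>) (\<integral>x. f x \<partial>\<nu>) < e/2"
      using eventually_sequentially by auto
    have "(\<lambda>n. \<integral>x. g k x \<partial>\<mu> n) \<longlonglongrightarrow> (\<integral>x. g k x \<partial>\<nu>)"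
      by (rule lip[of _ C "real k"]) (use g_bdd g_lip in auto)
    then have "\<forall>\<^sub>F n in sequentially. dist (\<integral>x. g k x \<partial>\<mu> n) (\<integral>x. g k x \<partial>\<nu>) < e/2"
      using e by (intro tendstoD) auto
    then show ?thesis
    proof eventually_elim
      case (elim n)
      have "(\<integral>x. g k x \<partial>\<mu> n) \<le> (\<integral>x. f x \<partial>\<mu> n)"
      proof (intro integral_mono \<mu>.integrable_bounded[where C=C])
        show "g k x \<le> f x" if "x \<in> space (\<mu> n)" for x
          unfolding g_def using that by (intro lipschitz_minorant_le[OF C]) auto
      qed (use meas(1)[OF g_cont] meas(1)[OF f] g_bdd C in auto)
      then show ?case using elim k unfolding dist_real_def by linarith
    qed
  qed
  have "(\<lambda>n. \<integral>x. f x \<partial>\<mu> n) \<longlonglongrightarrow> (\<integral>x. f x \<partial>\<nu>)"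
    if f: "continuous_map mtopology euclideanreal f" "bounded (f ` topspace mtopology)" for f
  proof -
    obtain C where C: "\<And>x. x \<in> M \<Longrightarrow> \<bar>f x\<bar> \<le> C"
      using f(2) by (auto simp: bounded_iff)
    show ?thesis
    proof (rule tendsto_of_eventually_abs_le)
      fix e :: real assume e: "e > 0"
      have "\<forall>\<^sub>F n in sequentially. (\<integral>x. - f x \<partial>\<nu>) - e \<le> (\<integral>x. - f x \<partial>\<mu> n)"
        using f C by (intro lower[OF _ _ e, of _ C]) auto
      moreover have "\<forall>\<^sub>F n in sequentially. (\<integral>x. f x \<partial>\<nu>) - e \<le> (\<integral>x. f x \<partial>\<mu> n)"
        using f(1) C e by (rule lower)
      ultimately show "\<forall>\<^sub>F n in sequentially. \<bar>(\<integral>x. f x \<partial>\<mu> n) - (\<integral>x. f x \<partial>\<nu>)\<bar> \<le> e"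
        by eventually_elim auto
    qed
  qed
  then show ?thesis unfolding weakly_converges_def using \<mu> \<nu> by auto
qed

end

section \<open>Linear interpolation\<close>

definition clamp01 :: "real \<Rightarrow> real"
  where "clamp01 s = max 0 (min 1 s)"

text \<open>A sum of increments weighted by ramps, rather than a case distinction on the interval
  containing n t: continuity in t and measurability then follow from closure properties.\<close>

definition lin_interp :: "nat \<Rightarrow> (nat \<Rightarrow> 'v::real_normed_vector) \<Rightarrow> real \<Rightarrow> 'v"
  where "lin_interp n x t =
    x 0 + (\<Sum>k<n. clamp01 (real n * t - real k) *\<^sub>R (x (Suc k) - x k))"

text \<open>At most one ramp lies strictly between 0 and 1. The alternative j = n, r = 0 is the
  right end point t = 1, where \<open>x (Suc n)\<close> appears with weight 0.\<close>

lemma lin_interp_between: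
  assumes t: "real n * t = real j + r" "0 \<le> r" "r \<le> 1" and j: "j < n \<or> j = n \<and> r = 0"
  shows "lin_interp n x t = x j + r *\<^sub>R (x (Suc j) - x j)"
proof -
  have c: "clamp01 (real n * t - real k) = (if k < j then 1 else if k = j then r else 0)" for k
    using t by (auto simp: clamp01_def)
  have "(\<Sum>k<n. clamp01 (real n * t - real k) *\<^sub>R (x (Suc k) - x k)) =
      (\<Sum>k<j. x (Suc k) - x k) + r *\<^sub>R (x (Suc j) - x j)"
  proof (cases "j < n")
    case True
    have "(\<Sum>k<n. clamp01 (real n * t - real k) *\<^sub>R (x (Suc k) - x k)) =
        (\<Sum>k<Suc j. clamp01 (real n * t - real k) *\<^sub>R (x (Suc k) - x k))"
      using True by (intro sum.mono_neutral_right) (auto simp: c)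
    then show ?thesis by (simp add: c)
  next
    case False
    then show ?thesis using j by (auto simp: c)
  qed
  then show ?thesis by (simp add: lin_interp_def sum_lessThan_telescope)
qed

lemma lin_interp_cases:
  fixes n :: nat and t :: real
  assumes "0 \<le> t" "t \<le> 1"
  defines "j \<equiv> nat \<lfloor>real n * t\<rfloor>"
  defines "r \<equiv> real n * t - real j"
  shows "real n * t = real j + r" "0 \<le> r" "r < 1" "j < n \<or> j = n \<and> r = 0"
    "lin_interp n x t = x j + r *\<^sub>R (x (Suc j) - x j)"
proof -
  have j: "real j = of_int \<lfloor>real n * t\<rfloor>" using assms(1) by (simp add: j_def)
  show eq: "real n * t = real j + r" by (simp add: r_def)
  show r: "0 \<le> r" "r < 1" unfolding r_def j by linarith+
  have le: "real n * t \<le> real n" using assms(2) by (simp add: mult_left_le)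
  show jn: "j < n \<or> j = n \<and> r = 0" using eq r le by linarith
  show "lin_interp n x t = x j + r *\<^sub>R (x (Suc j) - x j)"
    using lin_interp_between[OF eq _ _ jn] r by simp
qed

lemma norm_convex_le:
  fixes u v :: "'v::real_normed_vector"
  assumes "0 \<le> r" "r \<le> 1" "norm u \<le> c" "norm v \<le> c"
  shows "norm ((1 - r) *\<^sub>R u + r *\<^sub>R v) \<le> c"
proof -
  have "norm ((1 - r) *\<^sub>R u + r *\<^sub>R v) \<le> (1 - r) * norm u + r * norm v"
    using norm_triangle_ineq[of "(1 - r) *\<^sub>R u" "r *\<^sub>R v"] assms by simp
  also have "\<dots> \<le> (1 - r) * c + r * c"
    using assms by (intro add_mono mult_left_mono) auto
  finally show ?thesis by (simp add: algebra_simps)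
qed

lemma lin_interp_dist_le:
  assumes "\<And>k. k \<le> n \<Longrightarrow> norm (x k - y k) \<le> c" and t: "0 \<le> t" "t \<le> 1"
  shows "norm (lin_interp n x t - lin_interp n y t) \<le> c"
proof -
  define j where "j = nat \<lfloor>real n * t\<rfloor>"
  define r where "r = real n * t - real j"
  note * = lin_interp_cases[OF t, of n, folded j_def, folded r_def]
  show ?thesis
  proof (cases "j < n")
    case True
    have "norm ((1 - r) *\<^sub>R (x j - y j) + r *\<^sub>R (x (Suc j) - y (Suc j))) \<le> c"
      using * True by (intro norm_convex_le assms) auto
    then show ?thesis unfolding *(5) by (simp add: algebra_simps)
  next
    case False
    then show ?thesis unfolding *(5) using *(4) assms(1) by auto
  qed
qed

text \<open>Within block b both interpolations are convex combinations of values within c of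
  \<open>x (n * b div m)\<close>, so they differ by at most 2 c. The bound on j has an extra 1
  because the fine interpolation also reads the right neighbour of its index.\<close>

lemma lin_interp_coarse_le:
  assumes m: "m > 0" and t: "0 \<le> t" "t \<le> 1"
    and close: "\<And>b j. \<lbrakk>b < m; n * b div m \<le> j; j \<le> n * Suc b div m + 1; j \<le> n\<rbrakk>
      \<Longrightarrow> norm (x j - x (n * b div m)) \<le> c"
  shows "norm (lin_interp n x t - lin_interp m (\<lambda>b. x (n * b div m)) t) \<le> 2 * c"
proof -
  define j where "j = nat \<lfloor>real n * t\<rfloor>"
  define r where "r = real n * t - real j"
  define b where "b = nat \<lfloor>real m * t\<rfloor>"
  define q where "q = real m * t - real b"
  note J = lin_interp_cases[OF t, of n, folded j_def, folded r_def]
  note B = lin_interp_cases[OF t, of m, folded b_def, folded q_def]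
  have c: "0 \<le> c" using close[of 0 0] m by simp
  show ?thesis
  proof (cases "b < m")
    case False
    then have "b = m" "q = 0" using B(4) by auto
    then have "t = 1" using B(1) m by simp
    then have "j = n" "r = 0" using j_def r_def by auto
    then show ?thesis using \<open>b = m\<close> \<open>q = 0\<close> c m unfolding J(5) B(5) by simp
  next
    case True
    define s where "s = n * b div m"
    have t_eq: "t = (real b + q) / real m" using B(1) m by (simp add: field_simps)
    have nt: "real n * t = (real (n * b) + real n * q) / real m"
      unfolding t_eq by (simp add: field_simps)
    have "real s \<le> real (n * b) / real m"
      unfolding s_def by (rule of_nat_div_le_of_nat)
    also have "\<dots> \<le> real n * t" unfolding nt using B(2) by (intro divide_right_mono) auto
    finally have sj: "s \<le> j" using J(1,3) by linarith
    have "real n * q \<le> real n" using B(3) by (simp add: mult_left_le)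
    then have "real n * t \<le> real (n * Suc b) / real m"
      unfolding nt by (intro divide_right_mono) (auto simp: algebra_simps)
    then have "real j \<le> real (n * Suc b) / real m" using J(1,2) by linarith
    then have "real (j * m) \<le> real (n * Suc b)" using m by (simp add: field_simps)
    then have "j * m \<le> n * Suc b" by linarith
    then have js: "j \<le> n * Suc b div m" using m by (simp add: less_eq_div_iff_mult_less_eq)
    have le_n: "n * Suc b div m \<le> n"
      using True m by (metis Suc_leI div_le_mono div_mult_self_is_m mult_le_mono2)
    have 1: "norm (lin_interp n x t - x s) \<le> c"
    proof (cases "j < n")
      case True
      have "norm ((1 - r) *\<^sub>R (x j - x s) + r *\<^sub>R (x (Suc j) - x s)) \<le> c"
        unfolding s_def using J \<open>b < m\<close> sj js True
        by (intro norm_convex_le close) (auto simp: s_def)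
      then show ?thesis unfolding J(5) by (simp add: algebra_simps)
    next
      case False
      then show ?thesis unfolding J(5) s_def using J(4) close[OF \<open>b < m\<close>, of j] sj js
        by (auto simp: s_def)
    qed
    have "n * b div m \<le> n * Suc b div m" by (intro div_le_mono) auto
    then have "norm (x (n * Suc b div m) - x s) \<le> c"
      unfolding s_def using True le_n by (intro close) auto
    then have "norm ((1 - q) *\<^sub>R (x s - x s) + q *\<^sub>R (x (n * Suc b div m) - x s)) \<le> c"
      using B c by (intro norm_convex_le) auto
    then have 2: "norm (lin_interp m (\<lambda>b. x (n * b div m)) t - x s) \<le> c"
      unfolding B(5) s_def by (simp add: algebra_simps)
    show ?thesis using norm_triangle_ineq4[of "lin_interp n x t - x s"
        "lin_interp m (\<lambda>b. x (n * b div m)) t - x s"] 1 2 by simp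
  qed
qed

lemma continuous_on_lin_interp: "continuous_on A (lin_interp n x)"
  unfolding lin_interp_def clamp01_def by (intro continuous_intros)

definition path_of :: "nat \<Rightarrow> (nat \<Rightarrow> 'v::real_normed_vector) \<Rightarrow> real \<Rightarrow> 'v"
  where "path_of n x = (\<lambda>t\<in>{0..1}. lin_interp n x t)"

lemma path_of_C01: "path_of n x \<in> C01"
  unfolding C01_def path_of_def
  by (auto intro!: continuous_on_eq[OF continuous_on_lin_interp])

lemma restrict_C01: "continuous_on {0..1} w \<Longrightarrow> restrict w {0..1} \<in> C01"
  unfolding C01_def by (auto intro: continuous_on_eq)

lemma path_of_dist_le:
  assumes "\<And>k. k \<le> n \<Longrightarrow> norm (x k - y k) \<le> c"
  shows "C01_dist (path_of n x) (path_of n y) \<le> c"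
  using assms
  by (intro C01_dist_least path_of_C01) (auto simp: path_of_def dist_norm intro!: lin_interp_dist_le)

lemma path_of_cong:
  assumes "\<And>k. k \<le> n \<Longrightarrow> x k = y k"
  shows "path_of n x = path_of n y"
proof -
  have "lin_interp n x t = lin_interp n y t" for t
    unfolding lin_interp_def using assms by (auto intro!: arg_cong2[where f="(+)"] sum.cong)
  then show ?thesis by (simp add: path_of_def)
qed

lemma scaled_path_eq:
  "scaled_path B X n \<omega> = path_of n (\<lambda>k. (1 / B n) *\<^sub>R real_vec (X k \<omega>))"
proof -
  have "lin_interp n (\<lambda>k. (1 / B n) *\<^sub>R real_vec (X k \<omega>)) t =
    (1 / B n) *\<^sub>R (real_vec (X (nat \<lfloor>real n * t\<rfloor>) \<omega>) + (real n * t - real (nat \<lfloor>real n * t\<rfloor>)) *\<^sub>R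
      (real_vec (X (Suc (nat \<lfloor>real n * t\<rfloor>)) \<omega>) - real_vec (X (nat \<lfloor>real n * t\<rfloor>) \<omega>)))"
    if "0 \<le> t" "t \<le> 1" for t
    unfolding lin_interp_cases(5)[OF that] by (simp add: algebra_simps)
  then show ?thesis
    unfolding scaled_path_def path_of_def Let_def by (intro restrict_ext) auto
qed

lemma C01_dist_nonneg: "0 \<le> C01_dist f g"
  by (rule Metric_space.nonneg[OF Metric_space_C01])

lemma path_of_approx:
  fixes w :: "real \<Rightarrow> 'v::real_normed_vector"
  assumes w: "continuous_on {0..1} w"
  shows "(\<lambda>m. C01_dist (path_of m (\<lambda>k. w (real k / real m))) (restrict w {0..1})) \<longlonglongrightarrow> 0"
proof (rule tendsto_of_eventually_abs_le)
  fix e :: real assume e: "e > 0"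
  have "uniformly_continuous_on {0..1} w"
    using w by (rule compact_uniformly_continuous) simp
  then obtain \<delta> where \<delta>: "\<delta> > 0"
    "\<And>s t. s \<in> {0..1} \<Longrightarrow> t \<in> {0..1} \<Longrightarrow> dist s t < \<delta> \<Longrightarrow> dist (w s) (w t) < e"
    using e unfolding uniformly_continuous_on_def by metis
  obtain m0 :: nat where m0: "real m0 > 1 / \<delta>" using reals_Archimedean2 by blast
  have "C01_dist (path_of m (\<lambda>k. w (real k / real m))) (restrict w {0..1}) \<le> e" if m: "m \<ge> Suc m0" for m
  proof (rule C01_dist_least[OF path_of_C01 restrict_C01[OF w]])
    fix t :: real assume t: "t \<in> {0..1}"
    then have t': "0 \<le> t" "t \<le> 1" by auto
    define b where "b = nat \<lfloor>real m * t\<rfloor>"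
    define q where "q = real m * t - real b"
    note B = lin_interp_cases[OF t', of m, folded b_def, folded q_def]
    have "1 / \<delta> < real m" using m0 m by linarith
    then have md: "1 / real m < \<delta>" using \<delta>(1) m by (simp add: field_simps)
    have t_eq: "t = real b / real m + q / real m" using B(1) m by (simp add: field_simps)
    have near: "norm (w s - w t) \<le> e" if "s \<in> {0..1}" "\<bar>s - t\<bar> \<le> 1 / real m" for s
      using \<delta>(2)[OF that(1) t] that(2) md by (auto simp: dist_norm)
    have q: "q / real m \<le> 1 / real m" "0 \<le> q / real m" using B by (auto intro!: divide_right_mono)
    have "norm (lin_interp m (\<lambda>k. w (real k / real m)) t - w t) \<le> e"
    proof (cases "b < m")
      case True
      have "norm ((1 - q) *\<^sub>R (w (real b / real m) - w t) + q *\<^sub>R (w (real (Suc b) / real m) - w t)) \<le> e"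
      proof (intro norm_convex_le near)
        show "real b / real m \<in> {0..1}" "real (Suc b) / real m \<in> {0..1}" using True by auto
        show "\<bar>real b / real m - t\<bar> \<le> 1 / real m" using t_eq q by linarith
        have "real (Suc b) / real m = real b / real m + 1 / real m" by (simp add: add_divide_distrib)
        then show "\<bar>real (Suc b) / real m - t\<bar> \<le> 1 / real m" using t_eq q by linarith
      qed (use B in auto)
      then show ?thesis unfolding B(5) by (simp add: algebra_simps)
    next
      case False
      then have "q = 0" using B(4) by auto
      then have "lin_interp m (\<lambda>k. w (real k / real m)) t = w t" unfolding B(5) using t_eq by simp
      then show ?thesis using e by simp
    qed
    then show "dist (path_of m (\<lambda>k. w (real k / real m)) t) (restrict w {0..1} t) \<le> e"
      using t by (simp add: path_of_def dist_norm)
  qed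
  then have "\<forall>m\<ge>Suc m0. \<bar>C01_dist (path_of m (\<lambda>k. w (real k / real m))) (restrict w {0..1}) - 0\<bar> \<le> e"
    by (simp add: C01_dist_nonneg)
  then show "\<forall>\<^sub>F m in sequentially. \<bar>C01_dist (path_of m (\<lambda>k. w (real k / real m))) (restrict w {0..1}) - 0\<bar> \<le> e"
    using eventually_sequentially by blast
qed

section \<open>Measurability of continuous processes\<close>

text \<open>Gives Borel measurability of functionals that see a path only through m + 1 grid values:
  the bounding sum is continuous for the product topology and vanishes at x.\<close>

lemma continuous_on_product_lipschitz:
  fixes G :: "(nat \<Rightarrow> 'v::real_normed_vector) \<Rightarrow> real"
  assumes "\<And>x y. \<bar>G x - G y\<bar> \<le> L * (\<Sum>k\<le>m. norm (x k - y k))"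
  shows "continuous_on UNIV G"
proof (rule continuous_at_imp_continuous_on, intro ballI)
  fix x :: "nat \<Rightarrow> 'v"
  have "continuous_on UNIV (\<lambda>y :: nat \<Rightarrow> 'v. L * (\<Sum>k\<le>m. norm (y k - x k)))"
    by (intro continuous_intros continuous_on_product_coordinates)
  then have "isCont (\<lambda>y :: nat \<Rightarrow> 'v. L * (\<Sum>k\<le>m. norm (y k - x k))) x"
    by (simp add: continuous_on_eq_continuous_at)
  then have "((\<lambda>y :: nat \<Rightarrow> 'v. L * (\<Sum>k\<le>m. norm (y k - x k))) \<longlongrightarrow> 0) (at x)"
    by (simp add: isCont_def)
  then have "((\<lambda>y. G y - G x) \<longlongrightarrow> 0) (at x)"
    by (rule Lim_null_comparison[rotated]) (use assms in auto)
  then show "isCont G x" by (simp add: isCont_def LIM_zero_iff)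
qed

text \<open>The functional is the pointwise limit of its values at polygonal paths, and those are
  continuous functions of finitely many measurable coordinates.\<close>

lemma borel_measurable_lipschitz_of_path:
  fixes w :: "'b \<Rightarrow> real \<Rightarrow> 'v::{real_normed_vector, second_countable_topology}"
  assumes meas: "\<And>t. t \<in> {0..1} \<Longrightarrow> (\<lambda>\<omega>. w \<omega> t) \<in> borel_measurable N"
    and cont: "\<And>\<omega>. \<omega> \<in> space N \<Longrightarrow> continuous_on {0..1} (w \<omega>)"
    and lip: "\<And>f g. f \<in> C01 \<Longrightarrow> g \<in> C01 \<Longrightarrow> \<bar>h f - h g\<bar> \<le> L * C01_dist f g"
  shows "(\<lambda>\<omega>. h (restrict (w \<omega>) {0..1}) :: real) \<in> borel_measurable N"
proof (rule borel_measurable_LIMSEQ_metric)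
  fix m :: nat
  \<comment> \<open>Coordinates beyond m are replaced by 0, because the process is assumed
    measurable only at times in [0,1].\<close>
  define vec where "vec = (\<lambda>\<omega> k. if k \<le> m then w \<omega> (real k / real m) else 0)"
  have L: "0 \<le> L * C01_dist (f :: real \<Rightarrow> 'v) g" if "f \<in> C01" "g \<in> C01" for f g
    using lip[OF that] by linarith
  have "continuous_on UNIV (\<lambda>x. h (path_of m x))"
  proof (rule continuous_on_product_lipschitz)
    fix x y :: "nat \<Rightarrow> 'v"
    have "C01_dist (path_of m x) (path_of m y) \<le> (\<Sum>k\<le>m. norm (x k - y k))"
      by (rule path_of_dist_le) (auto intro!: member_le_sum)
    then have "\<bar>L\<bar> * C01_dist (path_of m x) (path_of m y) \<le> \<bar>L\<bar> * (\<Sum>k\<le>m. norm (x k - y k))"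
      by (intro mult_left_mono) auto
    moreover have "L * C01_dist (path_of m x) (path_of m y) \<le> \<bar>L\<bar> * C01_dist (path_of m x) (path_of m y)"
      by (intro mult_right_mono C01_dist_nonneg) auto
    ultimately show "\<bar>h (path_of m x) - h (path_of m y)\<bar> \<le> \<bar>L\<bar> * (\<Sum>k\<le>m. norm (x k - y k))"
      using lip[OF path_of_C01 path_of_C01, of m x m y] by linarith
  qed
  moreover have "vec \<in> borel_measurable N"
    unfolding vec_def
  proof (rule measurable_coordinatewise_then_product)
    fix k
    show "(\<lambda>\<omega>. if k \<le> m then w \<omega> (real k / real m) else 0) \<in> borel_measurable N"
      by (cases "k \<le> m") (auto intro!: meas simp: divide_le_eq_1)
  qed
  ultimately have "(\<lambda>\<omega>. h (path_of m (vec \<omega>))) \<in> borel_measurable N"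
    by (rule borel_measurable_continuous_on)
  moreover have "path_of m (vec \<omega>) = path_of m (\<lambda>k. w \<omega> (real k / real m))" for \<omega>
    unfolding vec_def by (rule path_of_cong) auto
  ultimately show "(\<lambda>\<omega>. h (path_of m (\<lambda>k. w \<omega> (real k / real m)))) \<in> borel_measurable N"
    by simp
next
  fix \<omega> assume \<omega>: "\<omega> \<in> space N"
  have "(\<lambda>m. L * C01_dist (path_of m (\<lambda>k. w \<omega> (real k / real m))) (restrict (w \<omega>) {0..1})) \<longlonglongrightarrow> 0"
    using tendsto_mult[OF tendsto_const path_of_approx[OF cont[OF \<omega>]], of L] by simp
  then have "(\<lambda>m. h (path_of m (\<lambda>k. w \<omega> (real k / real m))) - h (restrict (w \<omega>) {0..1})) \<longlonglongrightarrow> 0"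
    by (rule Lim_null_comparison[OF always_eventually, rotated])
      (use lip[OF path_of_C01 restrict_C01[OF cont[OF \<omega>]]] in simp)
  then show "(\<lambda>m. h (path_of m (\<lambda>k. w \<omega> (real k / real m)))) \<longlonglongrightarrow> h (restrict (w \<omega>) {0..1})"
    by (simp add: LIM_zero_iff)
qed

text \<open>The functional \<open>h\<close> below is the minimum of 1 and the distance to the
  complement of U. It is Lipschitz and positive exactly on the open set U, so the preimage of U
  becomes the preimage of a half-line under a measurable real function.\<close>

lemma measurable_path_C01:
  fixes w :: "'b \<Rightarrow> real \<Rightarrow> 'v::{real_normed_vector, second_countable_topology}"
  assumes meas: "\<And>t. t \<in> {0..1} \<Longrightarrow> (\<lambda>\<omega>. w \<omega> t) \<in> borel_measurable N"
    and cont: "\<And>\<omega>. \<omega> \<in> space N \<Longrightarrow> continuous_on {0..1} (w \<omega>)"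
  shows "(\<lambda>\<omega>. restrict (w \<omega>) {0..1}) \<in> measurable N (borel_of C01_topology)"
proof (rule measurable_borel_ofI)
  show "(\<lambda>\<omega>. restrict (w \<omega>) {0..1}) \<in> space N \<rightarrow> topspace C01_topology"
    using restrict_C01[OF cont] by (auto simp: topspace_C01_topology)
next
  interpret Metric_space "C01 :: (real \<Rightarrow> 'v) set" C01_dist by (rule Metric_space_C01)
  fix U :: "(real \<Rightarrow> 'v) set" assume U: "openin C01_topology U"
  define h where "h = lipschitz_minorant (indicator U :: _ \<Rightarrow> real) 1"
  have bdd: "\<bar>indicator U f\<bar> \<le> (1 :: real)" for f by (simp add: indicator_def)
  have "h f > 0 \<longleftrightarrow> f \<in> U" if f: "f \<in> C01" for f
  proof
    assume "f \<in> U"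
    then obtain r where r: "r > 0" "mball f r \<subseteq> U"
      using U unfolding C01_topology_def openin_mtopology by blast
    have "min 1 r \<le> h f" unfolding h_def
    proof (rule lipschitz_minorant_ge[OF bdd f])
      fix g :: "real \<Rightarrow> 'v" assume g: "g \<in> C01"
      show "min 1 r \<le> indicator U g + real 1 * C01_dist f g"
      proof (cases "g \<in> U")
        case False
        then have "r \<le> C01_dist f g" using r(2) f g by (auto simp: in_mball not_less)
        then show ?thesis by (simp add: min.coboundedI2 indicator_def)
      qed (use nonneg in \<open>auto simp: min.coboundedI1\<close>)
    qed
    then show "h f > 0" using r(1) by (auto simp: min_def split: if_splits)
  next
    assume "h f > 0"
    moreover have "h f \<le> indicator U f" unfolding h_def by (rule lipschitz_minorant_le[OF bdd f])
    ultimately show "f \<in> U" by (cases "f \<in> U") auto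
  qed
  then have "(\<lambda>\<omega>. restrict (w \<omega>) {0..1}) -` U \<inter> space N =
      (\<lambda>\<omega>. h (restrict (w \<omega>) {0..1})) -` {0<..} \<inter> space N"
    using restrict_C01[OF cont] by auto
  moreover have "(\<lambda>\<omega>. h (restrict (w \<omega>) {0..1})) \<in> borel_measurable N"
    by (rule borel_measurable_lipschitz_of_path[where L=1])
      (use meas cont lipschitz_minorant_lipschitz[OF bdd, where k=1] in \<open>auto simp: h_def\<close>)
  then have "(\<lambda>\<omega>. h (restrict (w \<omega>) {0..1})) -` {0<..} \<inter> space N \<in> sets N"
    by (rule measurable_sets) simp
  ultimately show "(\<lambda>\<omega>. restrict (w \<omega>) {0..1}) -` U \<inter> space N \<in> sets N" by simp
qed

section \<open>Convergence of finite-dimensional distributions\<close>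

text \<open>
  Multivariate weak convergence is obtained from the one-dimensional continuity theorem by
  treating the coordinates one at a time, the remaining ones entering through a bounded weight.
\<close>

lemma iexp_eq: "iexp x = complex_of_real (cos x) + \<i> * complex_of_real (sin x)"
  by (simp add: exp_Euler cos_of_real sin_of_real)

text \<open>Normalizing the weight T to a density turns a weighted integral of a function of X into
  an integral for a probability law on the line, to which one-dimensional theorems apply.\<close>

lemma (in prob_space) integral_tilted:
  fixes T X :: "'a \<Rightarrow> real" and g :: "real \<Rightarrow> 'b::{banach, second_countable_topology}"
  assumes [measurable]: "T \<in> borel_measurable M" "X \<in> borel_measurable M" "g \<in> borel_measurable borel"
    and T: "\<And>x. x \<in> space M \<Longrightarrow> 0 \<le> T x" "\<And>x. x \<in> space M \<Longrightarrow> T x \<le> C"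
    and a: "a = (\<integral>x. T x \<partial>M)" "a > 0"
  defines "P \<equiv> distr (density M (\<lambda>x. ennreal (T x / a))) borel X"
  shows "real_distribution P" "(\<integral>x. g x \<partial>P) = (1 / a) *\<^sub>R (\<integral>x. T x *\<^sub>R g (X x) \<partial>M)"
proof -
  have "integrable M T" using T by (intro integrable_bounded[where C=C]) auto
  then have "(\<integral>\<^sup>+x. ennreal (T x / a) \<partial>M) = ennreal (\<integral>x. T x / a \<partial>M)"
    using T a by (intro nn_integral_eq_integral AE_I2) auto
  also have "(\<integral>x. T x / a \<partial>M) = 1" using a by simp
  finally have "prob_space (density M (\<lambda>x. ennreal (T x / a)))"
    by (intro prob_spaceI) (simp add: emeasure_density cong: nn_integral_cong)
  then interpret D: prob_space "density M (\<lambda>x. ennreal (T x / a))" .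
  show "real_distribution P" unfolding P_def by (rule D.real_distribution_distr) simp
  have "(\<integral>x. g x \<partial>P) = (\<integral>x. g (X x) \<partial>density M (\<lambda>x. ennreal (T x / a)))"
    unfolding P_def by (rule integral_distr) auto
  also have "\<dots> = (\<integral>x. (T x / a) *\<^sub>R g (X x) \<partial>M)"
    using T a by (intro integral_density) auto
  also have "\<dots> = (\<integral>x. (1 / a) *\<^sub>R (T x *\<^sub>R g (X x)) \<partial>M)" by (simp add: divide_inverse mult.commute)
  also have "\<dots> = (1 / a) *\<^sub>R (\<integral>x. T x *\<^sub>R g (X x) \<partial>M)" by (rule integral_scaleR_right)
  finally show "(\<integral>x. g x \<partial>P) = (1 / a) *\<^sub>R (\<integral>x. T x *\<^sub>R g (X x) \<partial>M)" .
qed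

text \<open>The case \<theta> = 0 of the hypothesis is convergence of the masses. A vanishing limit
  mass kills both sides; otherwise the weights, normalized to densities, give laws on the line whose
  characteristic functions converge, and the one-dimensional continuity theorem yields the limit for
  h.\<close>

lemma weighted_levy:
  fixes T X :: "nat \<Rightarrow> 'a \<Rightarrow> real" and T' X' :: "'b \<Rightarrow> real" and h :: "real \<Rightarrow> real"
  assumes M: "\<And>n. prob_space (M n)" and N: "prob_space N"
    and meas: "\<And>n. T n \<in> borel_measurable (M n)" "\<And>n. X n \<in> borel_measurable (M n)"
      "T' \<in> borel_measurable N" "X' \<in> borel_measurable N"
    and T: "\<And>n x. x \<in> space (M n) \<Longrightarrow> 0 \<le> T n x" "\<And>n x. x \<in> space (M n) \<Longrightarrow> T n x \<le> C"
      "\<And>x. x \<in> space N \<Longrightarrow> 0 \<le> T' x" "\<And>x. x \<in> space N \<Longrightarrow> T' x \<le> C"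
    and conv: "\<And>\<theta>. (\<lambda>n. \<integral>x. T n x *\<^sub>R iexp (\<theta> * X n x) \<partial>M n) \<longlonglongrightarrow> (\<integral>x. T' x *\<^sub>R iexp (\<theta> * X' x) \<partial>N)"
    and h: "continuous_on UNIV h" "\<And>x. \<bar>h x\<bar> \<le> D"
  shows "(\<lambda>n. \<integral>x. T n x * h (X n x) \<partial>M n) \<longlonglongrightarrow> (\<integral>x. T' x * h (X' x) \<partial>N)"
proof -
  interpret M: prob_space "M n" for n by (rule M)
  interpret N: prob_space N by (rule N)
  define a where "a = (\<lambda>n. \<integral>x. T n x \<partial>M n)"
  define a' where "a' = (\<integral>x. T' x \<partial>N)"
  have hm [measurable]: "h \<in> borel_measurable borel"
    using h(1) by (rule borel_measurable_continuous_onI)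
  have of_real: "(\<lambda>n. complex_of_real (a n)) \<longlonglongrightarrow> complex_of_real a'"
    using conv[of 0] by (simp add: a_def a'_def scaleR_conv_of_real)
  then have a_lim: "a \<longlonglongrightarrow> a'" by (simp add: tendsto_of_real_iff)
  have D: "0 \<le> D" using h(2)[of 0] by linarith
  have Tint: "integrable (M n) (T n)" "integrable N T'" for n
    using T meas by (auto intro!: M.integrable_bounded[where C=C] N.integrable_bounded[where C=C])
  have a'0: "0 \<le> a'" unfolding a'_def using T by (intro Bochner_Integration.integral_nonneg) auto
  show ?thesis
  proof (cases "a' = 0")
    case True
    have "AE x in N. T' x = 0"
      using True integral_nonneg_eq_0_iff_AE[OF Tint(2)] T(3) unfolding a'_def by auto
    then have "(\<integral>x. T' x * h (X' x) \<partial>N) = 0"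
      by (intro integral_eq_zero_AE) auto
    moreover have "(\<lambda>n. \<integral>x. T n x * h (X n x) \<partial>M n) \<longlonglongrightarrow> 0"
    proof (rule Lim_null_comparison[OF always_eventually])
      show "(\<lambda>n. D * a n) \<longlonglongrightarrow> 0" using tendsto_mult[OF tendsto_const a_lim, of D] True by simp
      have "norm (\<integral>x. T n x * h (X n x) \<partial>M n) \<le> (\<integral>x. D * T n x \<partial>M n)" for n
      proof -
        have le: "norm (T n x * h (X n x)) \<le> D * T n x" if "x \<in> space (M n)" for x
          using T(1)[OF that] h(2)[of "X n x"] D
          by (simp add: abs_mult mult.commute[of D] mult_left_mono)
        have "norm (\<integral>x. T n x * h (X n x) \<partial>M n) \<le> (\<integral>x. norm (T n x * h (X n x)) \<partial>M n)"
          by (rule integral_norm_bound)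
        also have "\<dots> \<le> (\<integral>x. D * T n x \<partial>M n)"
        proof (rule Bochner_Integration.integral_mono)
          show "integrable (M n) (\<lambda>x. D * T n x)" using Tint by simp
          show "integrable (M n) (\<lambda>x. norm (T n x * h (X n x)))"
          proof (rule Bochner_Integration.integrable_bound[OF \<open>integrable (M n) (\<lambda>x. D * T n x)\<close>])
            show "AE x in M n. norm (norm (T n x * h (X n x))) \<le> norm (D * T n x)"
              using order_trans[OF le abs_ge_self] by (intro AE_I2) simp
          qed (use meas in simp)
        qed (rule le)
        finally show ?thesis .
      qed
      then show "\<forall>n. norm (\<integral>x. T n x * h (X n x) \<partial>M n) \<le> D * a n"
        by (simp add: a_def)
    qed
    ultimately show ?thesis by simp
  next
    case False
    with a'0 have a'_pos: "a' > 0" by simp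
    define \<nu> where "\<nu> = distr (density N (\<lambda>x. ennreal (T' x / a'))) borel X'"
    \<comment> \<open>The mass \<open>a n\<close> may be 0 for finitely many n; the limit law fills
      these places so that every \<open>\<mu> n\<close> is a probability law.\<close>
    define \<mu> where "\<mu> = (\<lambda>n. if a n > 0
      then distr (density (M n) (\<lambda>x. ennreal (T n x / a n))) borel (X n) else \<nu>)"
    note N_tilt = N.integral_tilted[OF meas(3,4) _ T(3,4) a'_def a'_pos, folded \<nu>_def]
    have a_eq: "a n = (\<integral>x. T n x \<partial>M n)" for n by (simp add: a_def)
    note M_tilt = M.integral_tilted[OF meas(1,2) _ T(1,2) a_eq]
    have \<nu>: "real_distribution \<nu>" using N_tilt(1)[OF hm] by simp
    have \<mu>: "real_distribution (\<mu> n)" for n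
      using M_tilt(1)[OF hm] \<nu> by (auto simp: \<mu>_def)
    have \<mu>_int_real: "(\<integral>x. g x \<partial>\<mu> n) = (1 / a n) *\<^sub>R (\<integral>x. T n x *\<^sub>R g (X n x) \<partial>M n)"
      if "g \<in> borel_measurable borel" "a n > 0" for g :: "real \<Rightarrow> real" and n
      unfolding \<mu>_def using that by (simp add: M_tilt(2))
    have \<mu>_int_complex: "(\<integral>x. g x \<partial>\<mu> n) = (1 / a n) *\<^sub>R (\<integral>x. T n x *\<^sub>R g (X n x) \<partial>M n)"
      if "g \<in> borel_measurable borel" "a n > 0" for g :: "real \<Rightarrow> complex" and n
      unfolding \<mu>_def using that by (simp add: M_tilt(2))
    have ev: "\<forall>\<^sub>F n in sequentially. a n > 0"
      using order_tendstoD(1)[OF a_lim a'_pos] .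
    have inv: "(\<lambda>n. 1 / a n) \<longlonglongrightarrow> 1 / a'" using a'_pos by (intro tendsto_intros a_lim) auto
    have "(\<lambda>n. char (\<mu> n) \<theta>) \<longlonglongrightarrow> char \<nu> \<theta>" for \<theta>
    proof -
      have "(\<lambda>n. (1 / a n) *\<^sub>R (\<integral>x. T n x *\<^sub>R iexp (\<theta> * X n x) \<partial>M n)) \<longlonglongrightarrow>
          (1 / a') *\<^sub>R (\<integral>x. T' x *\<^sub>R iexp (\<theta> * X' x) \<partial>N)"
        by (intro tendsto_scaleR inv conv)
      moreover have "char \<nu> \<theta> = (1 / a') *\<^sub>R (\<integral>x. T' x *\<^sub>R iexp (\<theta> * X' x) \<partial>N)"
        unfolding char_def by (rule N_tilt(2)) simp
      moreover have "\<forall>\<^sub>F n in sequentially. (1 / a n) *\<^sub>R (\<integral>x. T n x *\<^sub>R iexp (\<theta> * X n x) \<partial>M n) = char (\<mu> n) \<theta>"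
        using ev by eventually_elim (simp add: char_def \<mu>_int_complex)
      ultimately show ?thesis using Lim_transform_eventually by (simp only:)
    qed
    then have "weak_conv_m \<mu> \<nu>" by (rule levy_continuity[OF \<mu> \<nu>])
    then have "(\<lambda>n. \<integral>x. h x \<partial>\<mu> n) \<longlonglongrightarrow> (\<integral>x. h x \<partial>\<nu>)"
      using h by (intro weak_conv_imp_integral_bdd_continuous_conv[OF \<mu> \<nu>, where B=D])
        (auto simp: continuous_on_eq_continuous_at)
    then have "(\<lambda>n. a n * (\<integral>x. h x \<partial>\<mu> n)) \<longlonglongrightarrow> a' * (\<integral>x. h x \<partial>\<nu>)"
      by (intro tendsto_mult a_lim)
    moreover have "a' * (\<integral>x. h x \<partial>\<nu>) = (\<integral>x. T' x * h (X' x) \<partial>N)"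
      using N_tilt(2)[OF hm] a'_pos by simp
    moreover have "\<forall>\<^sub>F n in sequentially. a n * (\<integral>x. h x \<partial>\<mu> n) = (\<integral>x. T n x * h (X n x) \<partial>M n)"
      using ev by eventually_elim (simp add: \<mu>_int_real)
    ultimately show ?thesis using Lim_transform_eventually by (simp only:)
  qed
qed

text \<open>The weights in \<open>weighted_levy\<close> must be nonnegative, hence 1 + cos u and 1 +
  sin u rather than cos u and sin u. Euler's formula reduces both weighted integrals to plain
  exponentials at y, y + u and y - u.\<close>

lemma (in prob_space) weighted_trig_integrals:
  fixes P u y :: "'a \<Rightarrow> real"
  assumes [measurable]: "P \<in> borel_measurable M" "u \<in> borel_measurable M" "y \<in> borel_measurable M"
    and P: "\<And>x. x \<in> space M \<Longrightarrow> \<bar>P x\<bar> \<le> 1"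
  shows "(\<integral>x. (P x * (1 + cos (u x))) *\<^sub>R iexp (y x) \<partial>M) =
      (\<integral>x. P x *\<^sub>R iexp (y x) \<partial>M) + (1/2) * (\<integral>x. P x *\<^sub>R iexp (y x + u x) \<partial>M)
      + (1/2) * (\<integral>x. P x *\<^sub>R iexp (y x - u x) \<partial>M)" (is ?cos)
    and "(\<integral>x. (P x * (1 + sin (u x))) *\<^sub>R iexp (y x) \<partial>M) =
      (\<integral>x. P x *\<^sub>R iexp (y x) \<partial>M) - (\<i>/2) * (\<integral>x. P x *\<^sub>R iexp (y x + u x) \<partial>M)
      + (\<i>/2) * (\<integral>x. P x *\<^sub>R iexp (y x - u x) \<partial>M)" (is ?sin)
proof -
  have int: "integrable M (\<lambda>x. P x *\<^sub>R iexp (v x))" if "v \<in> borel_measurable M" for v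
    using that P by (intro integrable_bounded[where C=1]) auto
  have i: "integrable M (\<lambda>x. P x *\<^sub>R iexp (y x))" "integrable M (\<lambda>x. P x *\<^sub>R iexp (y x + u x))"
    "integrable M (\<lambda>x. P x *\<^sub>R iexp (y x - u x))"
    by (rule int; simp)+
  have lin: "(\<integral>x. f1 x + c * f2 x + d * f3 x \<partial>M) = (\<integral>x. f1 x \<partial>M) + c * (\<integral>x. f2 x \<partial>M) + d * (\<integral>x. f3 x \<partial>M)"
    if "integrable M f1" "integrable M f2" "integrable M f3" for f1 f2 f3 :: "'a \<Rightarrow> complex" and c d
    using that by simp
  have e: "(P x * (1 + cos (u x))) *\<^sub>R iexp (y x) = P x *\<^sub>R iexp (y x)
      + (1/2) * (P x *\<^sub>R iexp (y x + u x)) + (1/2) * (P x *\<^sub>R iexp (y x - u x))" for x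
    unfolding iexp_eq cos_add sin_add cos_diff sin_diff by (simp add: complex_eq_iff algebra_simps)
  show ?cos unfolding e by (rule lin[OF i])
  have e: "(P x * (1 + sin (u x))) *\<^sub>R iexp (y x) = P x *\<^sub>R iexp (y x)
      + (- (\<i>/2)) * (P x *\<^sub>R iexp (y x + u x)) + (\<i>/2) * (P x *\<^sub>R iexp (y x - u x))" for x
    unfolding iexp_eq cos_add sin_add cos_diff sin_diff by (simp add: complex_eq_iff algebra_simps)
  show ?sin unfolding e by (subst lin[OF i]) simp
qed

text \<open>The way back: the integral with \<open>iexp (u x)\<close> is recovered from the two
  nonnegative weights by subtracting the contribution of the constant 1 in each.\<close>

lemma (in prob_space) weighted_trig_recombine:
  fixes P u y :: "'a \<Rightarrow> real"
  assumes [measurable]: "P \<in> borel_measurable M" "u \<in> borel_measurable M" "y \<in> borel_measurable M"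
    and P: "\<And>x. x \<in> space M \<Longrightarrow> \<bar>P x\<bar> \<le> 1" "\<And>x. x \<in> space M \<Longrightarrow> \<bar>y x\<bar> \<le> 1"
  shows "(\<integral>x. (P x * y x) *\<^sub>R iexp (u x) \<partial>M) =
    complex_of_real ((\<integral>x. (P x * (1 + cos (u x))) * y x \<partial>M) - (\<integral>x. P x * y x \<partial>M))
    + \<i> * complex_of_real ((\<integral>x. (P x * (1 + sin (u x))) * y x \<partial>M) - (\<integral>x. P x * y x \<partial>M))"
proof -
  have Py: "\<bar>P x * y x\<bar> \<le> 1" if "x \<in> space M" for x
    using mult_mono[OF P[OF that]] by (simp add: abs_mult)
  have i: "integrable M (\<lambda>x. P x * y x)" 
    using Py by (intro integrable_bounded[where C=1]) auto
  have c: "integrable M (\<lambda>x. P x * y x * cos (u x))" "integrable M (\<lambda>x. P x * y x * sin (u x))"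
    by (rule Bochner_Integration.integrable_bound[OF i]; auto simp: abs_mult mult_left_le)+
  have "(\<integral>x. (P x * (1 + cos (u x))) * y x \<partial>M) = (\<integral>x. P x * y x + P x * y x * cos (u x) \<partial>M)"
    by (simp add: algebra_simps)
  also have "\<dots> = (\<integral>x. P x * y x \<partial>M) + (\<integral>x. P x * y x * cos (u x) \<partial>M)" using i c by simp
  finally have 1: "(\<integral>x. (P x * (1 + cos (u x))) * y x \<partial>M) - (\<integral>x. P x * y x \<partial>M) = (\<integral>x. P x * y x * cos (u x) \<partial>M)"
    by simp
  have "(\<integral>x. (P x * (1 + sin (u x))) * y x \<partial>M) = (\<integral>x. P x * y x + P x * y x * sin (u x) \<partial>M)"
    by (simp add: algebra_simps)
  also have "\<dots> = (\<integral>x. P x * y x \<partial>M) + (\<integral>x. P x * y x * sin (u x) \<partial>M)" using i c by simp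
  finally have 2: "(\<integral>x. (P x * (1 + sin (u x))) * y x \<partial>M) - (\<integral>x. P x * y x \<partial>M) = (\<integral>x. P x * y x * sin (u x) \<partial>M)"
    by simp
  have "(\<integral>x. (P x * y x) *\<^sub>R iexp (u x) \<partial>M) =
      (\<integral>x. complex_of_real (P x * y x * cos (u x)) + \<i> * complex_of_real (P x * y x * sin (u x)) \<partial>M)"
    by (intro Bochner_Integration.integral_cong) (auto simp: iexp_eq scaleR_conv_of_real algebra_simps)
  also have "\<dots> = complex_of_real (\<integral>x. P x * y x * cos (u x) \<partial>M) + \<i> * complex_of_real (\<integral>x. P x * y x * sin (u x) \<partial>M)"
    using c by (subst Bochner_Integration.integral_add) (auto simp del: of_real_mult)
  finally show ?thesis unfolding 1 2 .
qed

text \<open>Hat function with peak 1 at \<delta> k, vanishing at distance \<delta>; its translates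
  over all integers k form a partition of unity.\<close>

definition tent :: "real \<Rightarrow> int \<Rightarrow> real \<Rightarrow> real"
  where "tent \<delta> k x = max 0 (1 - \<bar>x / \<delta> - real_of_int k\<bar>)"

lemma tent_bounds: "0 \<le> tent \<delta> k x" "tent \<delta> k x \<le> 1"
  by (auto simp: tent_def)

lemma continuous_on_tent: "continuous_on A (tent \<delta> k)"
  unfolding tent_def divide_inverse by (intro continuous_intros)

lemma tent_pos_imp: "\<delta> > 0 \<Longrightarrow> tent \<delta> k x \<noteq> 0 \<Longrightarrow> \<bar>x - \<delta> * real_of_int k\<bar> \<le> \<delta>"
  by (auto simp: tent_def max_def abs_le_iff field_simps split: if_splits abs_split)

lemma sum_tent:
  shows "(\<Sum>k\<in>{-K..K}. tent \<delta> k x) \<le> 1"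
    and "\<bar>x / \<delta>\<bar> \<le> real_of_int K \<Longrightarrow> (\<Sum>k\<in>{-K..K}. tent \<delta> k x) = 1"
proof -
  define y where "y = x / \<delta>"
  define f where "f = \<lfloor>y\<rfloor>"
  have f: "of_int f \<le> y" "y < of_int f + 1" unfolding f_def by linarith+
  have t: "tent \<delta> k x = (if k = f then 1 - (y - of_int f) else if k = f + 1 then y - of_int f else 0)" for k
  proof -
    consider "k \<le> f - 1" | "k = f" | "k = f + 1" | "k \<ge> f + 2" by linarith
    then show ?thesis
    proof cases
      case 1
      then have "real_of_int k \<le> of_int f - 1" by linarith
      then show ?thesis using f 1 by (simp add: tent_def y_def[symmetric])
    next
      case 4
      then have "real_of_int k \<ge> of_int f + 2" by linarith
      then show ?thesis using f 4 by (simp add: tent_def y_def[symmetric])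
    qed (use f in \<open>auto simp: tent_def y_def[symmetric]\<close>)
  qed
  have e: "(\<Sum>k\<in>{-K..K}. tent \<delta> k x) =
      (if f \<in> {-K..K} then 1 - (y - of_int f) else 0) + (if f + 1 \<in> {-K..K} then y - of_int f else 0)"
  proof -
    have "(\<Sum>k\<in>{-K..K}. tent \<delta> k x) = (\<Sum>k\<in>{-K..K}. (if k = f then 1 - (y - of_int f) else 0)
        + (if k = f + 1 then y - of_int f else 0))"
      by (intro sum.cong) (auto simp: t)
    then show ?thesis by (simp add: sum.distrib)
  qed
  show "(\<Sum>k\<in>{-K..K}. tent \<delta> k x) \<le> 1" unfolding e using f by auto
  assume "\<bar>x / \<delta>\<bar> \<le> real_of_int K"
  \<comment> \<open>At the right edge f = K the hat with index K + 1 is missing from the sum, but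
    there y = f, so its weight is 0.\<close>
  then have "- K \<le> f" "f \<le> K" "f = K \<Longrightarrow> y = of_int f"
    unfolding y_def[symmetric] f_def by linarith+
  then show "(\<Sum>k\<in>{-K..K}. tent \<delta> k x) = 1" unfolding e by auto
qed

section \<open>Multivariate continuity theorem\<close>

locale char_convergence =
  fixes M :: "nat \<Rightarrow> 'a measure" and N :: "'b measure" and I :: "'j set"
    and Z :: "nat \<Rightarrow> 'a \<Rightarrow> 'j \<Rightarrow> real" and Z' :: "'b \<Rightarrow> 'j \<Rightarrow> real"
  assumes prob_M: "\<And>n. prob_space (M n)" and prob_N: "prob_space N" and finite_I: "finite I"
    and meas_Z: "\<And>n j. j \<in> I \<Longrightarrow> (\<lambda>x. Z n x j) \<in> borel_measurable (M n)"
    and meas_Z': "\<And>j. j \<in> I \<Longrightarrow> (\<lambda>x. Z' x j) \<in> borel_measurable N"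
    and conv: "\<And>v. (\<lambda>n. \<integral>x. iexp (\<Sum>j\<in>I. v j * Z n x j) \<partial>M n) \<longlonglongrightarrow> (\<integral>x. iexp (\<Sum>j\<in>I. v j * Z' x j) \<partial>N)"
begin

sublocale M: prob_space "M n" for n by (rule prob_M)
sublocale N: prob_space N by (rule prob_N)

text \<open>Induction on the set J of coordinates already tested by h, for all frequencies v at
  once. To add the coordinate a, the current exponential is moved into a nonnegative weight,
  \<open>weighted_levy\<close> tests coordinate a with \<open>h a\<close>, and the exponential is
  then recovered from the weight.\<close>

lemma conv_weighted:
  fixes h :: "'j \<Rightarrow> real \<Rightarrow> real"
  assumes "J \<subseteq> I" "\<And>j. j \<in> J \<Longrightarrow> continuous_on UNIV (h j)" "\<And>j x. j \<in> J \<Longrightarrow> 0 \<le> h j x \<and> h j x \<le> 1"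
  shows "(\<lambda>n. \<integral>x. (\<Prod>j\<in>J. h j (Z n x j)) *\<^sub>R iexp (\<Sum>j\<in>I. v j * Z n x j) \<partial>M n) \<longlonglongrightarrow>
    (\<integral>x. (\<Prod>j\<in>J. h j (Z' x j)) *\<^sub>R iexp (\<Sum>j\<in>I. v j * Z' x j) \<partial>N)"
  using finite_subset[OF assms(1) finite_I] assms
proof (induction J arbitrary: v rule: finite_induct)
  case empty
  then show ?case using conv[of v] by simp
next
  case (insert a J)
  have a: "a \<in> I" and J: "J \<subseteq> I" using insert.prems by auto
  define P where "P = (\<lambda>n x. \<Prod>j\<in>J. h j (Z n x j))"
  define P' where "P' = (\<lambda>x. \<Prod>j\<in>J. h j (Z' x j))"
  have IH: "(\<lambda>n. \<integral>x. P n x *\<^sub>R iexp (\<Sum>j\<in>I. w j * Z n x j) \<partial>M n) \<longlonglongrightarrow>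
    (\<integral>x. P' x *\<^sub>R iexp (\<Sum>j\<in>I. w j * Z' x j) \<partial>N)" for w
    unfolding P_def P'_def using insert.prems by (intro insert.IH) auto
  define u where "u = (\<lambda>n x. \<Sum>j\<in>I. v j * Z n x j)"
  define u' where "u' = (\<lambda>x. \<Sum>j\<in>I. v j * Z' x j)"
  \<comment> \<open>The induction hypothesis is needed at frequency \<theta> in coordinate a plus c
    times v, with c = 0, 1 and -1: these are the three exponentials in
    \<open>weighted_trig_integrals\<close>.\<close>
  have shift: "(\<Sum>j\<in>I. (c * v j + (if j = a then \<theta> else 0)) * z j) = \<theta> * z a + c * (\<Sum>j\<in>I. v j * z j)"
    for \<theta> c :: real and z
  proof -
    have "(\<Sum>j\<in>I. (c * v j + (if j = a then \<theta> else 0)) * z j) =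
        (\<Sum>j\<in>I. c * (v j * z j) + (if j = a then \<theta> * z j else 0))"
      by (intro sum.cong) (auto simp: algebra_simps)
    then show ?thesis using a finite_I by (simp add: sum.distrib sum_distrib_left)
  qed
  have hm: "h j \<in> borel_measurable borel" if "j \<in> insert a J" for j
    using insert.prems(2)[OF that] by (rule borel_measurable_continuous_onI)
  have ma [measurable]: "(\<lambda>x. Z n x a) \<in> borel_measurable (M n)" "(\<lambda>x. Z' x a) \<in> borel_measurable N" for n
    using meas_Z[OF a] meas_Z'[OF a] by auto
  have mh [measurable]: "(\<lambda>x. h a (Z n x a)) \<in> borel_measurable (M n)" "(\<lambda>x. h a (Z' x a)) \<in> borel_measurable N" for n
    using hm[of a] by simp_all
  have mP [measurable]: "P n \<in> borel_measurable (M n)" "P' \<in> borel_measurable N" for n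
    unfolding P_def P'_def using J insert.prems(2)
    by (auto intro!: borel_measurable_prod measurable_compose[OF _ hm] meas_Z meas_Z')
  have mu [measurable]: "u n \<in> borel_measurable (M n)" "u' \<in> borel_measurable N" for n
    unfolding u_def u'_def by (auto intro!: borel_measurable_sum borel_measurable_times meas_Z meas_Z')
  have P: "0 \<le> P n x \<and> P n x \<le> 1" "0 \<le> P' y \<and> P' y \<le> 1" for n x y
    unfolding P_def P'_def using insert.prems(3)
    by (auto intro!: prod_nonneg prod_le_1)
  have base: "(\<lambda>n. \<integral>x. P n x *\<^sub>R iexp (\<theta> * Z n x a) \<partial>M n) \<longlonglongrightarrow> (\<integral>x. P' x *\<^sub>R iexp (\<theta> * Z' x a) \<partial>N)"
    and plus: "(\<lambda>n. \<integral>x. P n x *\<^sub>R iexp (\<theta> * Z n x a + u n x) \<partial>M n) \<longlonglongrightarrow> (\<integral>x. P' x *\<^sub>R iexp (\<theta> * Z' x a + u' x) \<partial>N)"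
    and minus: "(\<lambda>n. \<integral>x. P n x *\<^sub>R iexp (\<theta> * Z n x a - u n x) \<partial>M n) \<longlonglongrightarrow> (\<integral>x. P' x *\<^sub>R iexp (\<theta> * Z' x a - u' x) \<partial>N)"
    for \<theta>
    using IH[of "\<lambda>j. 0 * v j + (if j = a then \<theta> else 0)"] IH[of "\<lambda>j. 1 * v j + (if j = a then \<theta> else 0)"]
      IH[of "\<lambda>j. (-1) * v j + (if j = a then \<theta> else 0)"]
    unfolding shift by (simp_all add: u_def u'_def)
  have h: "continuous_on UNIV (h a)" "\<And>x. \<bar>h a x\<bar> \<le> 1"
    using insert.prems(2,3)[of a] by (auto simp: abs_le_iff intro: order_trans[of _ 0])
  have Pabs: "\<And>n x. \<bar>P n x\<bar> \<le> 1" "\<And>x. \<bar>P' x\<bar> \<le> 1" using P by auto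
  have L1: "(\<lambda>n. \<integral>x. P n x * h a (Z n x a) \<partial>M n) \<longlonglongrightarrow> (\<integral>x. P' x * h a (Z' x a) \<partial>N)"
    by (rule weighted_levy[OF prob_M prob_N _ _ _ _ _ _ _ _ base h, where C=1]) (use P in auto)
  have W: "0 \<le> p * (1 + c)" "p * (1 + c) \<le> 2" if "0 \<le> p \<and> p \<le> 1" "\<bar>c\<bar> \<le> 1" for p c :: real
    using that mult_mono[of p 1 "1 + c" 2] by auto
  have mWc: "(\<lambda>x. P n x * (1 + cos (u n x))) \<in> borel_measurable (M n)" "(\<lambda>x. P' x * (1 + cos (u' x))) \<in> borel_measurable N"
    and mWs: "(\<lambda>x. P n x * (1 + sin (u n x))) \<in> borel_measurable (M n)" "(\<lambda>x. P' x * (1 + sin (u' x))) \<in> borel_measurable N" for n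
    by measurable
  note Wc = W(1)[OF P(1) abs_cos_le_one] W(2)[OF P(1) abs_cos_le_one] W(1)[OF P(2) abs_cos_le_one] W(2)[OF P(2) abs_cos_le_one]
  note Ws = W(1)[OF P(1) abs_sin_le_one] W(2)[OF P(1) abs_sin_le_one] W(1)[OF P(2) abs_sin_le_one] W(2)[OF P(2) abs_sin_le_one]
  have Lc: "(\<lambda>n. \<integral>x. P n x * (1 + cos (u n x)) * h a (Z n x a) \<partial>M n) \<longlonglongrightarrow>
      (\<integral>x. P' x * (1 + cos (u' x)) * h a (Z' x a) \<partial>N)"
  proof (rule weighted_levy[OF prob_M prob_N mWc(1) ma(1) mWc(2) ma(2) Wc _ h])
    show "(\<lambda>n. \<integral>x. (P n x * (1 + cos (u n x))) *\<^sub>R iexp (\<theta> * Z n x a) \<partial>M n) \<longlonglongrightarrow>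
      (\<integral>x. (P' x * (1 + cos (u' x))) *\<^sub>R iexp (\<theta> * Z' x a) \<partial>N)" for \<theta>
    proof -
      have m: "(\<lambda>x. \<theta> * Z n x a) \<in> borel_measurable (M n)" "(\<lambda>x. \<theta> * Z' x a) \<in> borel_measurable N" for n
        by simp_all
      show ?thesis
        unfolding M.weighted_trig_integrals(1)[OF mP(1) mu(1) m(1) Pabs(1)]
          N.weighted_trig_integrals(1)[OF mP(2) mu(2) m(2) Pabs(2)]
        by (intro tendsto_intros base plus minus)
    qed
  qed
  have Ls: "(\<lambda>n. \<integral>x. P n x * (1 + sin (u n x)) * h a (Z n x a) \<partial>M n) \<longlonglongrightarrow>
      (\<integral>x. P' x * (1 + sin (u' x)) * h a (Z' x a) \<partial>N)"
  proof (rule weighted_levy[OF prob_M prob_N mWs(1) ma(1) mWs(2) ma(2) Ws _ h])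
    show "(\<lambda>n. \<integral>x. (P n x * (1 + sin (u n x))) *\<^sub>R iexp (\<theta> * Z n x a) \<partial>M n) \<longlonglongrightarrow>
      (\<integral>x. (P' x * (1 + sin (u' x))) *\<^sub>R iexp (\<theta> * Z' x a) \<partial>N)" for \<theta>
    proof -
      have m: "(\<lambda>x. \<theta> * Z n x a) \<in> borel_measurable (M n)" "(\<lambda>x. \<theta> * Z' x a) \<in> borel_measurable N" for n
        by simp_all
      show ?thesis
        unfolding M.weighted_trig_integrals(2)[OF mP(1) mu(1) m(1) Pabs(1)]
          N.weighted_trig_integrals(2)[OF mP(2) mu(2) m(2) Pabs(2)]
        by (intro tendsto_intros base plus minus)
    qed
  qed
  have "(\<lambda>n. \<integral>x. (P n x * h a (Z n x a)) *\<^sub>R iexp (u n x) \<partial>M n) \<longlonglongrightarrow>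
      (\<integral>x. (P' x * h a (Z' x a)) *\<^sub>R iexp (u' x) \<partial>N)"
    unfolding M.weighted_trig_recombine[OF mP(1) mu(1) mh(1) Pabs(1) h(2)]
      N.weighted_trig_recombine[OF mP(2) mu(2) mh(2) Pabs(2) h(2)]
    by (intro tendsto_intros L1 Lc Ls)
  moreover have "(\<Prod>j\<in>insert a J. h j (z j)) = (\<Prod>j\<in>J. h j (z j)) * h a (z a)" for z
    using insert.hyps by simp
  ultimately show ?case unfolding P_def P'_def u_def u'_def by simp
qed

lemma conv_prod:
  fixes h :: "'j \<Rightarrow> real \<Rightarrow> real"
  assumes "\<And>j. j \<in> I \<Longrightarrow> continuous_on UNIV (h j)" "\<And>j x. j \<in> I \<Longrightarrow> 0 \<le> h j x \<and> h j x \<le> 1"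
  shows "(\<lambda>n. \<integral>x. (\<Prod>j\<in>I. h j (Z n x j)) \<partial>M n) \<longlonglongrightarrow> (\<integral>x. (\<Prod>j\<in>I. h j (Z' x j)) \<partial>N)"
proof -
  have *: "(\<Prod>j\<in>I. h j (z j)) *\<^sub>R iexp (\<Sum>j\<in>I. 0 * z j) = complex_of_real (\<Prod>j\<in>I. h j (z j))" for z
    by (simp only: mult_zero_left sum.neutral_const of_real_0 mult_zero_right exp_zero scaleR_conv_of_real mult_1_right)
  have "(\<lambda>n. complex_of_real (\<integral>x. (\<Prod>j\<in>I. h j (Z n x j)) \<partial>M n)) \<longlonglongrightarrow>
      complex_of_real (\<integral>x. (\<Prod>j\<in>I. h j (Z' x j)) \<partial>N)"
    using conv_weighted[where h=h and v="\<lambda>_. 0", OF order_refl assms]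
    unfolding * integral_complex_of_real .
  then show ?thesis by (simp only: tendsto_of_real_iff)
qed

text \<open>g is replaced by its multilinear interpolation G on the mesh \<delta>, a finite
  combination of products of hats. The mass outside the finite box is measured by 1 - S, which is
  built from the same products; its smallness under the limit law therefore passes to all large n,
  and tightness comes with it.\<close>

lemma conv_lipschitz:
  fixes g :: "('j \<Rightarrow> real) \<Rightarrow> real"
  assumes bdd: "\<And>x. \<bar>g x\<bar> \<le> C" and lip: "\<And>x y. \<bar>g x - g y\<bar> \<le> L * (\<Sum>j\<in>I. \<bar>x j - y j\<bar>)"
    and meas: "\<And>n. (\<lambda>x. g (Z n x)) \<in> borel_measurable (M n)" "(\<lambda>x. g (Z' x)) \<in> borel_measurable N"
  shows "(\<lambda>n. \<integral>x. g (Z n x) \<partial>M n) \<longlonglongrightarrow> (\<integral>x. g (Z' x) \<partial>N)"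
proof (rule tendsto_of_eventually_abs_le)
  fix e :: real assume e: "e > 0"
  \<comment> \<open>Moving every coordinate by at most \<delta> changes g by at most e/8; the
    summand 1 keeps the denominator positive.\<close>
  define \<delta> where "\<delta> = e / (8 * (\<bar>L\<bar> * real (card I) + 1))"
  have L_pos: "\<bar>L\<bar> * real (card I) + 1 > 0" by (simp add: add_nonneg_pos)
  have \<delta>0: "\<delta> > 0" unfolding \<delta>_def using e L_pos by (intro divide_pos_pos mult_pos_pos) auto
  have "(\<bar>L\<bar> * real (card I) + 1) * \<delta> = e / 8" unfolding \<delta>_def using L_pos by (simp add: field_simps)
  then have "\<bar>L\<bar> * real (card I) * \<delta> \<le> e / 8" using \<delta>0 by (simp add: distrib_right)
  note \<delta> = \<delta>0 this
  define S where "S = (\<lambda>K (x :: 'j \<Rightarrow> real). \<Prod>j\<in>I. \<Sum>k\<in>{-int K..int K}. tent \<delta> k (x j))"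
  define G where "G = (\<lambda>K (x :: 'j \<Rightarrow> real). \<Sum>\<kappa>\<in>Pi\<^sub>E I (\<lambda>_. {-int K..int K}).
    g (\<lambda>j. \<delta> * real_of_int (\<kappa> j)) * (\<Prod>j\<in>I. tent \<delta> (\<kappa> j) (x j)))"
  have S_eq: "S K x = (\<Sum>\<kappa>\<in>Pi\<^sub>E I (\<lambda>_. {-int K..int K}). \<Prod>j\<in>I. tent \<delta> (\<kappa> j) (x j))" for K x
    unfolding S_def by (rule prod_sum_PiE) (use finite_I in auto)
  have S_bounds: "0 \<le> S K x" "S K x \<le> 1" for K x
    unfolding S_def using tent_bounds sum_tent(1)
    by (auto intro!: prod_nonneg prod_le_1 sum_nonneg)
  have C: "0 \<le> C" using bdd[of undefined] by linarith
  have approx: "\<bar>g x - G K x\<bar> \<le> e / 8 + C * (1 - S K x)" for K x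
  proof -
    define t where "t = (\<lambda>\<kappa>. \<Prod>j\<in>I. tent \<delta> (\<kappa> j) (x j))"
    have t0: "0 \<le> t \<kappa>" for \<kappa> unfolding t_def using tent_bounds by (intro prod_nonneg) auto
    have near: "\<bar>g x - g (\<lambda>j. \<delta> * real_of_int (\<kappa> j))\<bar> * t \<kappa> \<le> e / 8 * t \<kappa>" for \<kappa>
    proof (cases "t \<kappa> = 0")
      case False
      then have "tent \<delta> (\<kappa> j) (x j) \<noteq> 0" if "j \<in> I" for j
        using that finite_I by (auto simp: t_def prod_zero_iff)
      then have "(\<Sum>j\<in>I. \<bar>x j - \<delta> * real_of_int (\<kappa> j)\<bar>) \<le> (\<Sum>j\<in>I. \<delta>)"
        using tent_pos_imp[OF \<delta>(1)] by (intro sum_mono) auto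
      then have "\<bar>L\<bar> * (\<Sum>j\<in>I. \<bar>x j - \<delta> * real_of_int (\<kappa> j)\<bar>) \<le> \<bar>L\<bar> * (real (card I) * \<delta>)"
        by (intro mult_left_mono) auto
      moreover have "L * (\<Sum>j\<in>I. \<bar>x j - \<delta> * real_of_int (\<kappa> j)\<bar>) \<le> \<bar>L\<bar> * (\<Sum>j\<in>I. \<bar>x j - \<delta> * real_of_int (\<kappa> j)\<bar>)"
        by (intro mult_right_mono sum_nonneg) auto
      ultimately have "\<bar>g x - g (\<lambda>j. \<delta> * real_of_int (\<kappa> j))\<bar> \<le> e / 8"
        using lip[of x "\<lambda>j. \<delta> * real_of_int (\<kappa> j)"] \<delta>(2) by (simp add: mult.assoc)
      then show ?thesis using t0 by (intro mult_right_mono) auto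
    qed simp
    have "g x * S K x - G K x = (\<Sum>\<kappa>\<in>Pi\<^sub>E I (\<lambda>_. {-int K..int K}). (g x - g (\<lambda>j. \<delta> * real_of_int (\<kappa> j))) * t \<kappa>)"
      unfolding S_eq G_def t_def by (simp add: sum_distrib_left sum_subtractf left_diff_distrib)
    also have "\<bar>\<dots>\<bar> \<le> (\<Sum>\<kappa>\<in>Pi\<^sub>E I (\<lambda>_. {-int K..int K}). \<bar>(g x - g (\<lambda>j. \<delta> * real_of_int (\<kappa> j))) * t \<kappa>\<bar>)"
      by (rule sum_abs)
    also have "\<dots> \<le> (\<Sum>\<kappa>\<in>Pi\<^sub>E I (\<lambda>_. {-int K..int K}). e / 8 * t \<kappa>)"
      using near t0 by (intro sum_mono) (simp add: abs_mult)
    also have "\<dots> = e / 8 * S K x" unfolding S_eq t_def by (simp add: sum_distrib_left)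
    also have "\<dots> \<le> e / 8" using S_bounds e by (simp add: mult_left_le)
    finally have 1: "\<bar>g x * S K x - G K x\<bar> \<le> e / 8" .
    have "\<bar>g x * (1 - S K x)\<bar> \<le> C * (1 - S K x)"
      unfolding abs_mult using bdd[of x] S_bounds by (intro mult_mono) auto
    moreover have "g x * (1 - S K x) = g x - g x * S K x" by (simp add: algebra_simps)
    ultimately show ?thesis using 1 by linarith
  qed
  have S_meas: "(\<lambda>x. S K (Z n x)) \<in> borel_measurable (M n)" "(\<lambda>x. S K (Z' x)) \<in> borel_measurable N" for K n
    unfolding S_def
    by (auto intro!: borel_measurable_prod borel_measurable_sum meas_Z meas_Z'
        borel_measurable_continuous_on[OF continuous_on_tent])
  have prod_meas: "(\<lambda>x. \<Prod>j\<in>I. tent \<delta> (\<kappa> j) (Z n x j)) \<in> borel_measurable (M n)"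
    "(\<lambda>x. \<Prod>j\<in>I. tent \<delta> (\<kappa> j) (Z' x j)) \<in> borel_measurable N" for \<kappa> n
    by (auto intro!: borel_measurable_prod meas_Z meas_Z'
        borel_measurable_continuous_on[OF continuous_on_tent])
  have prod_bdd: "norm (\<Prod>j\<in>I. tent \<delta> (\<kappa> j) (x j)) \<le> 1" for \<kappa> and x :: "'j \<Rightarrow> real"
    using tent_bounds by (auto simp: abs_prod intro!: prod_le_1)
  have prod_int: "integrable (M n) (\<lambda>x. \<Prod>j\<in>I. tent \<delta> (\<kappa> j) (Z n x j))"
    "integrable N (\<lambda>x. \<Prod>j\<in>I. tent \<delta> (\<kappa> j) (Z' x j))" for \<kappa> n
    by (rule M.integrable_bounded[OF prod_meas(1) prod_bdd] N.integrable_bounded[OF prod_meas(2) prod_bdd])+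
  have tents_conv: "(\<lambda>n. \<integral>x. (\<Prod>j\<in>I. tent \<delta> (\<kappa> j) (Z n x j)) \<partial>M n) \<longlonglongrightarrow> (\<integral>x. (\<Prod>j\<in>I. tent \<delta> (\<kappa> j) (Z' x j)) \<partial>N)" for \<kappa>
    by (rule conv_prod) (use continuous_on_tent tent_bounds in auto)
  have G_conv: "(\<lambda>n. \<integral>x. G K (Z n x) \<partial>M n) \<longlonglongrightarrow> (\<integral>x. G K (Z' x) \<partial>N)" for K
    unfolding G_def using prod_int by (simp add: tendsto_sum tendsto_mult tents_conv)
  have S_conv: "(\<lambda>n. \<integral>x. S K (Z n x) \<partial>M n) \<longlonglongrightarrow> (\<integral>x. S K (Z' x) \<partial>N)" for K
    unfolding S_eq using prod_int by (simp add: tendsto_sum tents_conv)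
  have G_int: "integrable (M n) (\<lambda>x. G K (Z n x))" "integrable N (\<lambda>x. G K (Z' x))" for K n
    unfolding G_def using prod_int by auto
  have S_int: "integrable (M n) (\<lambda>x. S K (Z n x))" "integrable N (\<lambda>x. S K (Z' x))" for K n
    unfolding S_eq using prod_int by auto
  have g_int: "integrable (M n) (\<lambda>x. g (Z n x))" "integrable N (\<lambda>x. g (Z' x))" for n
    using meas bdd by (auto intro!: M.integrable_bounded[where C=C] N.integrable_bounded[where C=C])
  have "(\<lambda>K. \<integral>x. S K (Z' x) \<partial>N) \<longlonglongrightarrow> (\<integral>x. 1 \<partial>N)"
  proof (rule N.bounded_convergence[OF S_meas(2), where C=1])
    fix x
    have "\<exists>K0. \<forall>j\<in>I. \<bar>Z' x j / \<delta>\<bar> \<le> real K0"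
    proof -
      obtain K0 :: nat where "(\<Sum>j\<in>I. \<bar>Z' x j / \<delta>\<bar>) \<le> real K0" using real_arch_simple by blast
      then show ?thesis using finite_I
        by (intro exI[of _ K0] ballI order_trans[OF member_le_sum[where f="\<lambda>j. \<bar>Z' x j / \<delta>\<bar>"]]) auto
    qed
    then obtain K0 where K0: "\<And>j. j \<in> I \<Longrightarrow> \<bar>Z' x j / \<delta>\<bar> \<le> real K0" by blast
    have "S K (Z' x) = 1" if "K \<ge> K0" for K
      unfolding S_def
    proof (rule prod.neutral, intro ballI sum_tent(2))
      fix j assume "j \<in> I"
      show "\<bar>Z' x j / \<delta>\<bar> \<le> real_of_int (int K)" using K0[OF \<open>j \<in> I\<close>] that by simp
    qed
    then show "(\<lambda>K. S K (Z' x)) \<longlonglongrightarrow> 1"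
      by (intro tendsto_eventually) (auto simp: eventually_sequentially)
  qed (use S_bounds in auto)
  then have "(\<lambda>K. C * (1 - (\<integral>x. S K (Z' x) \<partial>N))) \<longlonglongrightarrow> C * (1 - 1)"
    by (intro tendsto_intros) (simp add: N.prob_space)
  then have "\<forall>\<^sub>F K in sequentially. C * (1 - (\<integral>x. S K (Z' x) \<partial>N)) < e / 8"
    using e by (intro order_tendstoD(2)) auto
  then obtain K where K: "C * (1 - (\<integral>x. S K (Z' x) \<partial>N)) < e / 8"
    by (auto simp: eventually_sequentially)
  have diff: "\<bar>(\<integral>x. g (Y x) \<partial>R) - (\<integral>x. G K (Y x) \<partial>R)\<bar> \<le> e / 8 + C * (1 - (\<integral>x. S K (Y x) \<partial>R))"
    if R: "prob_space R" and i: "integrable R (\<lambda>x. g (Y x))" "integrable R (\<lambda>x. G K (Y x))" "integrable R (\<lambda>x. S K (Y x))"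
    for R :: "'r measure" and Y
  proof -
    interpret R: prob_space R by (rule R)
    have "\<bar>(\<integral>x. g (Y x) \<partial>R) - (\<integral>x. G K (Y x) \<partial>R)\<bar> = \<bar>\<integral>x. g (Y x) - G K (Y x) \<partial>R\<bar>" using i by simp
    also have "\<dots> \<le> (\<integral>x. \<bar>g (Y x) - G K (Y x)\<bar> \<partial>R)" by (rule integral_abs_bound)
    also have "\<dots> \<le> (\<integral>x. e / 8 + C * (1 - S K (Y x)) \<partial>R)"
      using i by (intro integral_mono approx) auto
    also have "\<dots> = e / 8 + C * (1 - (\<integral>x. S K (Y x) \<partial>R))" using i by (simp add: R.prob_space)
    finally show ?thesis .
  qed
  have "\<forall>\<^sub>F n in sequentially. dist (\<integral>x. G K (Z n x) \<partial>M n) (\<integral>x. G K (Z' x) \<partial>N) < e / 8"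
    by (rule tendstoD[OF G_conv]) (use e in auto)
  moreover have "(\<lambda>n. C * (1 - (\<integral>x. S K (Z n x) \<partial>M n))) \<longlonglongrightarrow> C * (1 - (\<integral>x. S K (Z' x) \<partial>N))"
    by (intro tendsto_intros S_conv)
  then have "\<forall>\<^sub>F n in sequentially. C * (1 - (\<integral>x. S K (Z n x) \<partial>M n)) < e / 8"
    using K by (rule order_tendstoD(2))
  ultimately show "\<forall>\<^sub>F n in sequentially. \<bar>(\<integral>x. g (Z n x) \<partial>M n) - (\<integral>x. g (Z' x) \<partial>N)\<bar> \<le> e"
  proof eventually_elim
    case (elim n)
    show ?case
      using diff[OF prob_M g_int(1) G_int(1) S_int(1), of n] diff[OF prob_N g_int(2) G_int(2) S_int(2)] elim K
      unfolding dist_real_def by linarith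
  qed
qed

end

section \<open>Characteristic functions along a norming sequence\<close>

text \<open>By Skorohod's representation the laws belong to variables that converge pointwise, and
  |iexp a - iexp b| \<le> min 2 |a - b| gives a bound independent of t in [-1,1].\<close>

lemma uniform_char_convergence:
  fixes \<mu> :: "nat \<Rightarrow> real measure"
  assumes \<mu>: "\<And>n. real_distribution (\<mu> n)" and \<nu>: "real_distribution \<nu>"
    and conv: "\<And>t. (\<lambda>n. char (\<mu> n) t) \<longlonglongrightarrow> char \<nu> t" and e: "e > 0"
  shows "\<forall>\<^sub>F n in sequentially. \<forall>t. \<bar>t\<bar> \<le> 1 \<longrightarrow> norm (char (\<mu> n) t - char \<nu> t) \<le> e"
proof -
  have "weak_conv_m \<mu> \<nu>" by (rule levy_continuity[OF \<mu> \<nu> conv])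
  from Skorohod[OF \<mu> \<nu> this] obtain \<Omega> Y Y' where
    \<Omega>: "prob_space (\<Omega> :: real measure)" and Y [measurable]: "\<And>n. Y n \<in> measurable \<Omega> borel"
    and dY: "\<And>n. distr \<Omega> borel (Y n) = \<mu> n" and Y'l: "Y' \<in> measurable \<Omega> lborel"
    and dY': "distr \<Omega> borel Y' = \<nu>" and lim: "\<And>x. x \<in> space \<Omega> \<Longrightarrow> (\<lambda>n. Y n x) \<longlonglongrightarrow> Y' x"
    by blast
  interpret \<Omega>: prob_space \<Omega> by fact
  have Y' [measurable]: "Y' \<in> borel_measurable \<Omega>" using Y'l by simp
  have "(\<lambda>n. \<integral>x. min 2 \<bar>Y n x - Y' x\<bar> \<partial>\<Omega>) \<longlonglongrightarrow> (\<integral>x. 0 \<partial>\<Omega>)"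
  proof (rule \<Omega>.bounded_convergence[where C=2])
    fix x assume "x \<in> space \<Omega>"
    from lim[OF this] have "(\<lambda>n. min 2 \<bar>Y n x - Y' x\<bar>) \<longlonglongrightarrow> min 2 \<bar>Y' x - Y' x\<bar>"
      by (intro tendsto_intros)
    then show "(\<lambda>n. min 2 \<bar>Y n x - Y' x\<bar>) \<longlonglongrightarrow> 0" by simp
  qed auto
  then have "\<forall>\<^sub>F n in sequentially. (\<integral>x. min 2 \<bar>Y n x - Y' x\<bar> \<partial>\<Omega>) < e"
    using e by (intro order_tendstoD(2)) auto
  then show ?thesis
  proof eventually_elim
    case (elim n)
    show ?case
    proof (intro allI impI)
      fix t :: real assume t: "\<bar>t\<bar> \<le> 1"
      have i: "integrable \<Omega> (\<lambda>x. iexp (t * Y n x))" "integrable \<Omega> (\<lambda>x. iexp (t * Y' x))"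
        by (intro \<Omega>.integrable_bounded[where C=1]; simp)+
      have "char (\<mu> n) t - char \<nu> t = (\<integral>x. iexp (t * Y n x) \<partial>\<Omega>) - (\<integral>x. iexp (t * Y' x) \<partial>\<Omega>)"
        unfolding char_def dY[symmetric] dY'[symmetric] by (simp add: integral_distr)
      also have "\<dots> = (\<integral>x. iexp (t * Y n x) - iexp (t * Y' x) \<partial>\<Omega>)" using i by simp
      also have "norm \<dots> \<le> (\<integral>x. norm (iexp (t * Y n x) - iexp (t * Y' x)) \<partial>\<Omega>)"
        by (rule integral_norm_bound)
      also have "\<dots> \<le> (\<integral>x. min 2 \<bar>Y n x - Y' x\<bar> \<partial>\<Omega>)"
      proof (rule integral_mono)
        show "integrable \<Omega> (\<lambda>x. norm (iexp (t * Y n x) - iexp (t * Y' x)))" using i by auto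
        show "integrable \<Omega> (\<lambda>x. min 2 \<bar>Y n x - Y' x\<bar>)"
          by (intro \<Omega>.integrable_bounded[where C=2]) auto
        fix x
        define a where "a = t * Y n x"
        define b where "b = t * Y' x"
        have "iexp a - iexp b = iexp b * (iexp (a - b) - 1)"
          by (simp add: algebra_simps flip: exp_add)
        then have "norm (iexp a - iexp b) = norm (iexp (a - b) - 1)"
          by (simp add: norm_mult)
        also have "\<dots> \<le> \<bar>a - b\<bar>" using iexp_approx1[of "a - b" 0] by simp
        also have "\<dots> = \<bar>t\<bar> * \<bar>Y n x - Y' x\<bar>"
          unfolding a_def b_def by (simp add: abs_mult flip: right_diff_distrib)
        also have "\<dots> \<le> 1 * \<bar>Y n x - Y' x\<bar>" using t by (intro mult_right_mono) auto
        finally have 1: "norm (iexp a - iexp b) \<le> \<bar>Y n x - Y' x\<bar>" by simp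
        have "norm (iexp a - iexp b) \<le> norm (iexp a) + norm (iexp b)" by (rule norm_triangle_ineq4)
        then have "norm (iexp a - iexp b) \<le> 2" by simp
        with 1 show "norm (iexp (t * Y n x) - iexp (t * Y' x)) \<le> min 2 \<bar>Y n x - Y' x\<bar>"
          unfolding a_def b_def by simp
      qed
      finally show "norm (char (\<mu> n) t - char \<nu> t) \<le> e" using elim by simp
    qed
  qed
qed

text \<open>Modulus 1 is equality in the triangle inequality for the integral:
  \<open>iexp (t * x)\<close> has variance 0, so it is almost surely the constant w, and its square
  is the constant w^2.\<close>

lemma (in real_distribution) norm_char_double:
  assumes "norm (char M t) = 1"
  shows "norm (char M (2 * t)) = 1"
proof -
  define w where "w = char M t"
  have i: "integrable M (\<lambda>x. iexp (t * x))" by (intro integrable_iexp) auto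
  have ns: "(norm (iexp (t * x) - w))\<^sup>2 = 2 - 2 * Re (cnj w * iexp (t * x))" for x
  proof -
    have "(norm (iexp (t * x) - w))\<^sup>2 = (norm (iexp (t * x)))\<^sup>2 + (norm w)\<^sup>2 - 2 * Re (cnj w * iexp (t * x))"
      unfolding cmod_power2 by (simp add: power2_eq_square algebra_simps)
    then show ?thesis using assms w_def by simp
  qed
  have i2: "integrable M (\<lambda>x. cnj w * iexp (t * x))" using i by simp
  have "(\<integral>x. (norm (iexp (t * x) - w))\<^sup>2 \<partial>M) = 2 - 2 * Re (cnj w * (\<integral>x. iexp (t * x) \<partial>M))"
  proof -
    have "(\<integral>x. 2 - 2 * Re (f x) \<partial>M) = 2 - 2 * Re (\<integral>x. f x \<partial>M)" if "integrable M f" for f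
      using that prob_space by simp
    from this[OF i2] show ?thesis unfolding ns by simp
  qed
  also have "\<dots> = 2 - 2 * Re (cnj w * w)" unfolding w_def char_def ..
  also have "cnj w * w = of_real ((norm w)\<^sup>2)" by (metis complex_norm_square mult.commute)
  finally have "(\<integral>x. (norm (iexp (t * x) - w))\<^sup>2 \<partial>M) = 0" using assms w_def by simp
  moreover have "integrable M (\<lambda>x. (norm (iexp (t * x) - w))\<^sup>2)" unfolding ns
    by (intro Bochner_Integration.integrable_diff integrable_mult_right integrable_Re i2) simp
  ultimately have "AE x in M. (norm (iexp (t * x) - w))\<^sup>2 = 0"
    by (subst (asm) integral_nonneg_eq_0_iff_AE) auto
  then have "AE x in M. iexp (2 * t * x) = w\<^sup>2"
  proof eventually_elim
    case (elim x)
    then have "w = iexp (t * x)" by simp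
    then show ?case unfolding power2_eq_square by (simp add: algebra_simps flip: exp_add)
  qed
  then have "char M (2 * t) = (\<integral>x. w\<^sup>2 \<partial>M)"
    unfolding char_def by (intro integral_cong_AE) (auto simp: mult.assoc)
  then show ?thesis using assms w_def prob_space by (simp add: norm_power)
qed

text \<open>If \<open>B n\<close> < Z for infinitely many n, then with b = max Z 1 every \<tau> in
  [-1/b, 1/b] is t / B n with |t| \<le> 1 for these n; the n-th powers at \<tau> then cannot tend to
  0, so the modulus is 1 there. Doubling spreads modulus 1 over the line, which contradicts the
  limit exp (- c / 2) < 1 at t = 1.\<close>

lemma norming_at_top:
  fixes B :: "nat \<Rightarrow> real"
  assumes \<mu>: "real_distribution \<mu>" and B: "\<And>n. n \<ge> 1 \<Longrightarrow> B n > 0" and c: "c > 0"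
    and unif: "\<And>e. e > 0 \<Longrightarrow> \<forall>\<^sub>F n in sequentially. \<forall>t. \<bar>t\<bar> \<le> 1 \<longrightarrow>
      norm (char \<mu> (t / B n) ^ n - of_real (exp (- c * t\<^sup>2 / 2))) \<le> e"
  shows "filterlim B at_top sequentially"
proof (rule ccontr)
  interpret real_distribution \<mu> by (rule \<mu>)
  \<comment> \<open>Half the least value of exp (- c t^2 / 2) on [-1,1]; it serves both as the
    tolerance of the uniform convergence and as the threshold for the power.\<close>
  define \<kappa> where "\<kappa> = exp (- c / 2) / 2"
  have \<kappa>: "\<kappa> > 0" by (simp add: \<kappa>_def)
  assume "\<not> filterlim B at_top sequentially"
  then obtain Z where Z: "\<exists>\<^sub>F n in sequentially. B n < Z"
    by (auto simp: filterlim_at_top not_eventually not_le)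
  define b where "b = max Z 1"
  have b: "b > 0" by (simp add: b_def)
  have small: "norm (char \<mu> \<tau>) = 1" if \<tau>: "\<bar>\<tau>\<bar> \<le> 1 / b" for \<tau>
  proof (rule ccontr)
    assume "norm (char \<mu> \<tau>) \<noteq> 1"
    then have "norm (char \<mu> \<tau>) < 1" using cmod_char_le_1[of \<tau>] by simp
    then have "(\<lambda>n. norm (char \<mu> \<tau>) ^ n) \<longlonglongrightarrow> 0" by (intro LIMSEQ_realpow_zero) auto
    then have "\<forall>\<^sub>F n in sequentially. norm (char \<mu> \<tau>) ^ n < \<kappa>" using \<kappa> by (rule order_tendstoD(2))
    with unif[OF \<kappa>] eventually_ge_at_top[of 1]
    have "\<forall>\<^sub>F n in sequentially. \<not> B n < Z"
    proof eventually_elim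
      case (elim n)
      show ?case
      proof
        assume "B n < Z"
        then have Bn: "0 < B n" "B n \<le> b" using B[OF elim(2)] by (auto simp: b_def)
        have "\<bar>\<tau> * B n\<bar> \<le> 1 / b * b"
          unfolding abs_mult using \<tau> Bn b by (intro mult_mono) auto
        then have t: "\<bar>\<tau> * B n\<bar> \<le> 1" using b by simp
        then have "norm (char \<mu> (\<tau> * B n / B n) ^ n - of_real (exp (- c * (\<tau> * B n)\<^sup>2 / 2))) \<le> \<kappa>"
          using elim(1) by blast
        then have "norm (char \<mu> \<tau> ^ n - of_real (exp (- c * (\<tau> * B n)\<^sup>2 / 2))) \<le> \<kappa>"
          using Bn by simp
        moreover have "norm (of_real (exp (- c * (\<tau> * B n)\<^sup>2 / 2)) :: complex) - norm (char \<mu> \<tau> ^ n)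
            \<le> norm (of_real (exp (- c * (\<tau> * B n)\<^sup>2 / 2)) - char \<mu> \<tau> ^ n)"
          by (rule norm_triangle_ineq2)
        ultimately have 1: "exp (- c * (\<tau> * B n)\<^sup>2 / 2) - norm (char \<mu> \<tau>) ^ n \<le> \<kappa>"
          by (simp add: norm_power norm_minus_commute)
        have "(\<tau> * B n)\<^sup>2 \<le> 1" using t by (simp add: abs_square_le_1)
        then have "c * (\<tau> * B n)\<^sup>2 \<le> c * 1" using c by (intro mult_left_mono) auto
        then have "exp (- c / 2) \<le> exp (- c * (\<tau> * B n)\<^sup>2 / 2)" by simp
        then show False using 1 elim(3) unfolding \<kappa>_def by linarith
      qed
    qed
    then show False using Z by (simp add: frequently_def)
  qed
  have big: "norm (char \<mu> \<tau>) = 1" if "\<bar>\<tau>\<bar> \<le> 2 ^ k / b" for k \<tau>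
    using that
  proof (induction k arbitrary: \<tau>)
    case (Suc k)
    then have "norm (char \<mu> (\<tau> / 2)) = 1" by (intro Suc.IH) (simp add: field_simps)
    from norm_char_double[OF this] show ?case by simp
  qed (use small in auto)
  have one: "norm (char \<mu> \<tau>) = 1" for \<tau>
  proof -
    obtain k where "\<bar>\<tau>\<bar> * b < 2 ^ k" using real_arch_pow[of 2 "\<bar>\<tau>\<bar> * b"] by auto
    then show ?thesis using b by (intro big[of _ k]) (simp add: field_simps)
  qed
  define e where "e = (1 - exp (- c / 2)) / 2"
  have e: "e > 0" using c by (simp add: e_def)
  obtain n where n: "\<forall>t. \<bar>t\<bar> \<le> 1 \<longrightarrow> norm (char \<mu> (t / B n) ^ n - of_real (exp (- c * t\<^sup>2 / 2))) \<le> e"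
    using unif[OF e] by (auto simp: eventually_sequentially)
  have "norm (char \<mu> (1 / B n) ^ n - of_real (exp (- c / 2))) \<le> e"
    using spec[OF n, of 1] by simp
  moreover have "norm (char \<mu> (1 / B n) ^ n) - norm (of_real (exp (- c / 2)) :: complex)
      \<le> norm (char \<mu> (1 / B n) ^ n - of_real (exp (- c / 2)))"
    by (rule norm_triangle_ineq2)
  ultimately have "1 - exp (- c / 2) \<le> e" by (simp add: norm_power one)
  then show False using e by (simp add: e_def)
qed

text \<open>
  The powers determine the logarithm only up to multiples of \<open>2 \<pi> i\<close>; uniform convergence near
  the origin fixes the branch by continuity.
\<close>

lemma norming_derivative:
  fixes B :: "nat \<Rightarrow> real"
  assumes \<mu>: "real_distribution \<mu>" and B: "filterlim B at_top sequentially"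
    and unif: "\<And>e. e > 0 \<Longrightarrow> \<forall>\<^sub>F n in sequentially. \<forall>t. \<bar>t\<bar> \<le> 1 \<longrightarrow>
      norm (char \<mu> (t / B n) ^ n - of_real (exp (- c * t\<^sup>2 / 2))) \<le> e"
    and c: "c > 0"
  shows "(\<lambda>n. of_nat n * (char \<mu> (1 / B n) - 1)) \<longlonglongrightarrow> of_real (- c / 2)"
proof -
  interpret real_distribution \<mu> by (rule \<mu>)
  define z where "z = (\<lambda>n t. char \<mu> (t / B n))"
  define b where "b = (\<lambda>n t. of_nat n * Ln (z n t))"
  have "isCont (char \<mu>) 0" by (rule isCont_char)
  \<comment> \<open>Once 1 / B n < \<delta>, all values used lie in the disc of radius 1 about 1,
    hence in the right half-plane, where \<open>Ln\<close> is continuous.\<close>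
  then obtain \<delta> where \<delta>: "\<delta> > 0" "\<And>s. \<bar>s\<bar> < \<delta> \<Longrightarrow> norm (char \<mu> s - 1) < 1"
    unfolding continuous_at_eps_delta by (metis char_zero diff_zero dist_norm real_norm_def zero_less_one)
  have "\<forall>\<^sub>F n in sequentially. B n > max 1 (1 / \<delta>)"
    using B by (simp only: filterlim_at_top_dense)
  then have near: "\<forall>\<^sub>F n in sequentially. \<forall>t. \<bar>t\<bar> \<le> 1 \<longrightarrow> norm (z n t - 1) < 1"
  proof eventually_elim
    case (elim n)
    show ?case
    proof (intro allI impI)
      fix t :: real assume t: "\<bar>t\<bar> \<le> 1"
      have "\<bar>t / B n\<bar> \<le> 1 / B n" using t elim by (simp add: divide_right_mono)
      also have "\<dots> < \<delta>" using elim \<delta>(1) by (simp add: field_simps)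
      finally show "norm (z n t - 1) < 1" unfolding z_def by (rule \<delta>(2))
    qed
  qed
  have e: "exp (- c / 2) / 2 > 0" by simp
  have Ln_b: "\<forall>\<^sub>F n in sequentially. b n 1 = Ln (z n 1 ^ n)"
    using near unif[OF e]
  proof eventually_elim
    case (elim n)
    have Rez: "Re (z n t) > 0" if "\<bar>t\<bar> \<le> 1" for t
    proof -
      have "\<bar>Re (z n t - 1)\<bar> < 1" using elim(1) that abs_Re_le_cmod[of "z n t - 1"] by (meson le_less_trans)
      then show ?thesis by simp
    qed
    have z0: "z n t \<noteq> 0" if "\<bar>t\<bar> \<le> 1" for t using Rez[OF that] by auto
    have exp_b: "exp (b n t) = z n t ^ n" if "\<bar>t\<bar> \<le> 1" for t
      unfolding b_def using z0[OF that] by (simp add: exp_of_nat_mult)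
    have Rep: "Re (z n t ^ n) > 0" if "\<bar>t\<bar> \<le> 1" for t
    proof -
      have "\<bar>Re (z n t ^ n - of_real (exp (- c * t\<^sup>2 / 2)))\<bar> \<le> exp (- c / 2) / 2"
        using elim(2) that abs_Re_le_cmod[of "z n t ^ n - of_real (exp (- c * t\<^sup>2 / 2))"]
        unfolding z_def by (meson order_trans)
      then have 1: "\<bar>Re (z n t ^ n) - exp (- c * t\<^sup>2 / 2)\<bar> \<le> exp (- c / 2) / 2" by simp
      have "t\<^sup>2 \<le> 1" using that by (simp add: abs_square_le_1)
      then have "c * t\<^sup>2 \<le> c * 1" using c by (intro mult_left_mono) auto
      then have "exp (- c / 2) \<le> exp (- c * t\<^sup>2 / 2)" by simp
      then show ?thesis using 1 e by linarith
    qed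
    have cont: "continuous_on {0..1} (\<lambda>t. Im (b n t))"
    proof -
      have "continuous_on UNIV (char \<mu>)" by (simp add: continuous_at_imp_continuous_on isCont_char)
      then have "continuous_on {0..1} (z n)" unfolding z_def divide_inverse
        by (rule continuous_on_compose2) (auto intro!: continuous_intros)
      moreover have "z n t \<notin> \<real>\<^sub>\<le>\<^sub>0" if "t \<in> {0..1}" for t
        using Rez[of t] that by (auto simp: complex_nonpos_Reals_iff)
      ultimately show ?thesis unfolding b_def by (intro continuous_intros) auto
    qed
    \<comment> \<open>The real part of the power is positive along the whole path, while an
      imaginary part pi/2 or - pi/2 of b would make it 0. Starting from 0, the imaginary part of b
      therefore stays between these values, and b at t = 1 is the principal logarithm of the
      power.\<close>
    have no: "\<bar>Im (b n t)\<bar> \<noteq> pi / 2" if t: "\<bar>t\<bar> \<le> 1" for t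
    proof
      assume h: "\<bar>Im (b n t)\<bar> = pi / 2"
      have "cos (Im (b n t)) = cos \<bar>Im (b n t)\<bar>" by simp
      also have "\<dots> = 0" unfolding h by simp
      finally have "Re (exp (b n t)) = 0" by (simp add: Re_exp)
      then show False using exp_b[OF t] Rep[OF t] by simp
    qed
    have b0: "b n 0 = 0" by (simp add: b_def z_def char_zero)
    have "\<bar>Im (b n 1)\<bar> < pi / 2"
    proof (rule ccontr)
      assume "\<not> \<bar>Im (b n 1)\<bar> < pi / 2"
      moreover have "continuous_on {0..1} (\<lambda>t. \<bar>Im (b n t)\<bar>)" by (rule continuous_on_rabs[OF cont])
      ultimately have "\<exists>t\<ge>0. t \<le> 1 \<and> \<bar>Im (b n t)\<bar> = pi / 2"
        using b0 pi_gt_zero by (intro IVT') auto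
      then show False using no by auto
    qed
    then have "- pi < Im (b n 1)" "Im (b n 1) \<le> pi" using pi_gt_zero by linarith+
    then have "Ln (exp (b n 1)) = b n 1" by simp
    then show ?case using exp_b[of 1] by simp
  qed
  have "(\<lambda>n. z n 1 ^ n) \<longlonglongrightarrow> of_real (exp (- c / 2))"
  proof (rule tendstoI)
    fix e :: real assume "e > 0"
    then have "e / 2 > 0" by simp
    from unif[OF this] show "\<forall>\<^sub>F n in sequentially. dist (z n 1 ^ n) (of_real (exp (- c / 2))) < e"
    proof eventually_elim
      case (elim n)
      then have "dist (z n 1 ^ n) (of_real (exp (- c / 2))) \<le> e / 2"
        unfolding z_def dist_norm using spec[OF elim, of 1] by simp
      then show ?case using \<open>e > 0\<close> by simp
    qed
  qed
  then have "(\<lambda>n. Ln (z n 1 ^ n)) \<longlonglongrightarrow> Ln (of_real (exp (- c / 2)))"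
    by (intro tendsto_Ln) (auto simp: complex_nonpos_Reals_iff)
  then have "(\<lambda>n. Ln (z n 1 ^ n)) \<longlonglongrightarrow> of_real (- c / 2)"
    by (subst (asm) Ln_of_real) auto
  then have b_lim: "(\<lambda>n. b n 1) \<longlonglongrightarrow> of_real (- c / 2)"
    by (rule Lim_transform_eventually) (use Ln_b in eventually_elim, simp)
  \<comment> \<open>The difference quotient of exp at 0, extended continuously: n (exp (b / n) - 1)
    = b g (b / n). It passes from the logarithm of the characteristic function to its deviation from
    1.\<close>
  define g where "g = (\<lambda>w :: complex. if w = 0 then 1 else (exp w - 1) / w)"
  have "((\<lambda>w :: complex. (exp w - 1) / w) \<longlongrightarrow> 1) (at 0)"
    using DERIV_exp[of "0 :: complex"] by (simp add: has_field_derivative_iff)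
  then have "(g \<longlongrightarrow> 1) (at 0)"
    by (rule Lim_transform_eventually) (auto simp: g_def eventually_at_filter)
  then have g_cont: "isCont g 0" by (simp add: isCont_def g_def)
  have "(\<lambda>n. inverse (of_nat n :: complex) * b n 1) \<longlonglongrightarrow> 0 * of_real (- c / 2)"
    by (intro tendsto_mult b_lim lim_inverse_n)
  then have "(\<lambda>n. g (inverse (of_nat n) * b n 1)) \<longlonglongrightarrow> g 0"
    by (intro isCont_tendsto_compose[OF g_cont]) simp
  then have "(\<lambda>n. b n 1 * g (inverse (of_nat n) * b n 1)) \<longlonglongrightarrow> of_real (- c / 2) * 1"
    by (intro tendsto_mult b_lim) (simp add: g_def)
  moreover have "\<forall>\<^sub>F n in sequentially. b n 1 * g (inverse (of_nat n) * b n 1) = of_nat n * (char \<mu> (1 / B n) - 1)"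
    using near eventually_gt_at_top[of 0]
  proof eventually_elim
    case (elim n)
    have "z n 1 \<noteq> 0" using elim(1) by (auto dest!: spec[of _ 1])
    then have "exp (inverse (of_nat n) * b n 1) = z n 1" using elim(2) by (simp add: b_def mult.assoc[symmetric])
    then show ?case using elim(2) by (auto simp: g_def z_def divide_inverse mult.commute)
  qed
  ultimately have "(\<lambda>n. of_nat n * (char \<mu> (1 / B n) - 1)) \<longlonglongrightarrow> of_real (- c / 2) * 1"
    by (rule Lim_transform_eventually)
  then show ?thesis by simp
qed

lemma weakly_convergesD:
  assumes "weakly_converges T \<mu> \<nu>"
  shows "prob_space (\<mu> n)" "sets (\<mu> n) = sets (borel_of T)" "prob_space \<nu>" "sets \<nu> = sets (borel_of T)"
    "continuous_map T euclideanreal f \<Longrightarrow> bounded (f ` topspace T) \<Longrightarrow> (\<lambda>n. \<integral>x. f x \<partial>\<mu> n) \<longlonglongrightarrow> (\<integral>x. f x \<partial>\<nu>)"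
  using assms unfolding weakly_converges_def by simp_all

section \<open>Jump distributions of B-type\<close>

definition cf :: "(int^'d) pmf \<Rightarrow> real^'d \<Rightarrow> complex"
  where "cf p v = (\<integral>y. iexp (v \<bullet> real_vec y) \<partial>measure_pmf p)"

lemma norm_cf_le_1: "norm (cf p v) \<le> 1"
proof -
  have "norm (cf p v) \<le> (\<integral>y. norm (iexp (v \<bullet> real_vec y)) \<partial>measure_pmf p)"
    unfolding cf_def by (rule integral_norm_bound)
  then show ?thesis by simp
qed

lemma cf_0 [simp]: "cf p 0 = 1"
  by (simp add: cf_def)

lemma cf_eq_char: "cf p (t *\<^sub>R v) = char (distr (measure_pmf p) borel (\<lambda>y. v \<bullet> real_vec y)) t"
  unfolding cf_def char_def by (subst integral_distr) auto

lemma sum_real_vec_measurable: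
  "(\<lambda>\<xi>. (1 / B n) *\<^sub>R (\<Sum>k\<in>{1..n}. real_vec (\<xi> k))) \<in> borel_measurable (\<Pi>\<^sub>M k\<in>(UNIV::nat set). measure_pmf p)"
proof -
  have "(\<lambda>\<xi>. real_vec (\<xi> k)) \<in> borel_measurable (\<Pi>\<^sub>M k\<in>(UNIV::nat set). measure_pmf p)" for k
    by (rule measurable_compose[OF measurable_component_singleton]) auto
  then show ?thesis by (intro borel_measurable_scaleR borel_measurable_sum) auto
qed

lemma sets_scaled_sum_law [simp]: "sets (scaled_sum_law p B n) = sets borel"
  by (simp add: scaled_sum_law_def)

lemma integral_scaled_sum_law:
  "(\<integral>x. iexp (v \<bullet> x) \<partial>scaled_sum_law p B n) = cf p ((1 / B n) *\<^sub>R v) ^ n"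
proof -
  let ?\<Omega> = "\<Pi>\<^sub>M k\<in>(UNIV::nat set). measure_pmf p"
  interpret product_prob_space "\<lambda>_::nat. measure_pmf p" UNIV
    by (rule product_prob_spaceI) (rule prob_space_measure_pmf)
  define f where "f = (\<lambda>y. iexp (((1 / B n) *\<^sub>R v) \<bullet> real_vec y))"
  have m: "(\<lambda>\<xi>. \<Prod>k\<in>{1..n}. f (\<xi> k)) \<in> borel_measurable (\<Pi>\<^sub>M k\<in>{1..n}. measure_pmf p)"
    by (intro borel_measurable_prod measurable_compose[OF measurable_component_singleton]) auto
  have "(\<integral>x. iexp (v \<bullet> x) \<partial>scaled_sum_law p B n) =
      (\<integral>\<xi>. iexp (v \<bullet> ((1 / B n) *\<^sub>R (\<Sum>k\<in>{1..n}. real_vec (\<xi> k)))) \<partial>?\<Omega>)"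
    unfolding scaled_sum_law_def by (rule integral_distr[OF sum_real_vec_measurable]) auto
  also have "\<dots> = (\<integral>\<xi>. (\<Prod>k\<in>{1..n}. f (restrict \<xi> {1..n} k)) \<partial>?\<Omega>)"
    by (intro Bochner_Integration.integral_cong refl)
      (simp add: f_def inner_sum_right sum_distrib_left flip: exp_sum)
  also have "\<dots> = (\<integral>\<xi>. (\<Prod>k\<in>{1..n}. f (\<xi> k)) \<partial>distr ?\<Omega> (\<Pi>\<^sub>M k\<in>{1..n}. measure_pmf p) (\<lambda>\<xi>. restrict \<xi> {1..n}))"
    by (rule integral_distr[symmetric, OF measurable_restrict_subset m]) auto
  also have "\<dots> = (\<integral>\<xi>. (\<Prod>k\<in>{1..n}. f (\<xi> k)) \<partial>(\<Pi>\<^sub>M k\<in>{1..n}. measure_pmf p))"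
    by (subst distr_PiM_restrict_finite) auto
  also have "\<dots> = (\<Prod>k\<in>{1..n}. \<integral>y. f y \<partial>measure_pmf p)"
    by (rule product_integral_prod)
      (auto intro!: measure_pmf.integrable_bounded[where C=1] simp: f_def)
  also have "\<dots> = cf p ((1 / B n) *\<^sub>R v) ^ n"
    by (simp add: f_def cf_def)
  finally show ?thesis .
qed

lemma char_normal:
  assumes "prob_space \<nu>" "distributed \<nu> lborel X (normal_density 0 \<sigma>)" "\<sigma> > 0"
  shows "(\<integral>x. iexp (X x) \<partial>\<nu>) = of_real (exp (- \<sigma>\<^sup>2 / 2))"
proof -
  interpret prob_space \<nu> by fact
  have d: "distributed \<nu> lborel (\<lambda>x. X x / \<sigma>) std_normal_density"
    using assms(2) normal_standard_normal_convert[OF assms(3), of X 0] by simp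
  then have eq: "distr \<nu> lborel (\<lambda>x. X x / \<sigma>) = std_normal_distribution"
    by (rule distributed_distr_eq_density)
  have m: "(\<lambda>x. X x / \<sigma>) \<in> measurable \<nu> lborel"
    using distributed_measurable[OF d] .
  have "char std_normal_distribution \<sigma> = (\<integral>x. iexp (\<sigma> * (X x / \<sigma>)) \<partial>\<nu>)"
    unfolding char_def eq[symmetric] by (rule integral_distr[OF m]) auto
  then show ?thesis using assms(3) by (simp add: char_std_normal_distribution)
qed

lemma centered_normal_law_char:
  assumes "centered_normal_law S \<nu>"
  shows "(\<integral>x. iexp (v \<bullet> x) \<partial>\<nu>) = of_real (exp (- (v \<bullet> (S *v v)) / 2))"
proof (cases "v = 0")
  case True
  have "prob_space \<nu>" using assms by (simp add: centered_normal_law_def)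
  then show ?thesis using True by (simp add: prob_space.prob_space)
next
  case False
  then have "v \<bullet> (S *v v) > 0" using assms by (auto simp: centered_normal_law_def pos_def_matrix_def)
  then show ?thesis
    using char_normal[of \<nu> "\<lambda>x. v \<bullet> x" "sqrt (v \<bullet> (S *v v))"] assms False
    by (auto simp: centered_normal_law_def)
qed

lemma quadratic_form_scaleR: "(t *\<^sub>R v) \<bullet> (S *v (t *\<^sub>R v)) = t\<^sup>2 * (v \<bullet> (S *v v))" for S :: "real^'d^'d"
  by (simp add: matrix_vector_mult_scaleR power2_eq_square)

context
  fixes p :: "(int^'d) pmf" and B :: "nat \<Rightarrow> real" and S :: "real^'d^'d"
  assumes B_type: "B_type p B S"
begin

lemma B_pos: "n \<ge> 1 \<Longrightarrow> B n > 0"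
  using B_type by (simp add: B_type_def)

lemma S_pos: "v \<noteq> 0 \<Longrightarrow> v \<bullet> (S *v v) > 0"
  using B_type by (auto simp: B_type_def centered_normal_law_def pos_def_matrix_def)

lemma S_nonneg: "v \<bullet> (S *v v) \<ge> 0"
  using S_pos[of v] by (cases "v = 0") auto

lemma cf_power_tendsto: "(\<lambda>n. cf p ((1 / B n) *\<^sub>R v) ^ n) \<longlonglongrightarrow> of_real (exp (- (v \<bullet> (S *v v)) / 2))"
proof -
  obtain \<nu> where \<nu>: "centered_normal_law S \<nu>" "weakly_converges euclidean (scaled_sum_law p B) \<nu>"
    using B_type by (auto simp: B_type_def)
  from \<nu>(2) have conv: "(\<lambda>n. \<integral>x. f x \<partial>scaled_sum_law p B n) \<longlonglongrightarrow> (\<integral>x. f x \<partial>\<nu>)"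
    if "continuous_on UNIV f" "bounded (range f)" for f :: "_ \<Rightarrow> real"
    using that weakly_convergesD(5)[OF \<nu>(2), of f] by simp
  have prob: "prob_space (scaled_sum_law p B n)" "prob_space \<nu>" "sets \<nu> = sets borel" for n
    using weakly_convergesD(1,3,4)[OF \<nu>(2)] by (auto simp: borel_of_euclidean)
  \<comment> \<open>Weak convergence is stated for real test functions, so the exponential is split
    into cosine and sine.\<close>
  have split: "(\<integral>x. iexp (v \<bullet> x) \<partial>\<mu>) = of_real (\<integral>x. cos (v \<bullet> x) \<partial>\<mu>) + \<i> * of_real (\<integral>x. sin (v \<bullet> x) \<partial>\<mu>)"
    if "prob_space \<mu>" "sets \<mu> = sets borel" for \<mu> :: "(real^'d) measure"
  proof -
    interpret prob_space \<mu> by fact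
    have [measurable_cong]: "sets \<mu> = sets borel" by fact
    have "integrable \<mu> (\<lambda>x. cos (v \<bullet> x))" "integrable \<mu> (\<lambda>x. sin (v \<bullet> x))"
      by (intro integrable_bounded[where C=1]; simp)+
    then show ?thesis unfolding iexp_eq by (subst Bochner_Integration.integral_add) auto
  qed
  have "(\<lambda>n. \<integral>x. iexp (v \<bullet> x) \<partial>scaled_sum_law p B n) \<longlonglongrightarrow> (\<integral>x. iexp (v \<bullet> x) \<partial>\<nu>)"
    unfolding split[OF prob(1) sets_scaled_sum_law] split[OF prob(2,3)]
    by (intro tendsto_intros conv continuous_intros) (auto simp: bounded_iff intro!: exI[of _ 1])
  then show ?thesis by (simp add: integral_scaled_sum_law centered_normal_law_char[OF \<nu>(1)])
qed

text \<open>Uniformity in t is the point: it allows \<open>norming_at_top\<close> to evaluate at t =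
  \<tau> B n, which varies with n, and \<open>norming_derivative\<close> to follow the logarithm
  along t in [0,1].\<close>

lemma uniform_cf_power:
  assumes e: "e > 0"
  shows "\<forall>\<^sub>F n in sequentially. \<forall>t. \<bar>t\<bar> \<le> 1 \<longrightarrow>
    norm (cf p ((t / B n) *\<^sub>R v) ^ n - of_real (exp (- (v \<bullet> (S *v v)) * t\<^sup>2 / 2))) \<le> e"
proof -
  obtain \<nu> where \<nu>: "centered_normal_law S \<nu>" "weakly_converges euclidean (scaled_sum_law p B) \<nu>"
    using B_type by (auto simp: B_type_def)
  have prob: "prob_space (scaled_sum_law p B n)" "prob_space \<nu>" "sets \<nu> = sets borel" for n
    using weakly_convergesD(1,3,4)[OF \<nu>(2)] by (auto simp: borel_of_euclidean)
  define \<mu> where "\<mu> = (\<lambda>n. distr (scaled_sum_law p B n) borel (\<lambda>x. v \<bullet> x))"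
  define \<mu>' where "\<mu>' = distr \<nu> borel (\<lambda>x. v \<bullet> x)"
  have m: "(\<lambda>x. v \<bullet> x) \<in> borel_measurable (scaled_sum_law p B n)" "(\<lambda>x. v \<bullet> x) \<in> borel_measurable \<nu>" for n
    by (simp_all add: measurable_cong_sets[OF prob(3) refl] measurable_cong_sets[OF sets_scaled_sum_law refl])
  have rd: "real_distribution (\<mu> n)" "real_distribution \<mu>'" for n
    unfolding \<mu>_def \<mu>'_def using m
    by (auto intro!: prob_space.real_distribution_distr prob)
  have c: "char (\<mu> n) t = cf p ((t / B n) *\<^sub>R v) ^ n" for n t
  proof -
    have "char (\<mu> n) t = (\<integral>x. iexp (t * (v \<bullet> x)) \<partial>scaled_sum_law p B n)"
      unfolding \<mu>_def char_def by (rule integral_distr[OF m(1)]) auto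
    also have "\<dots> = (\<integral>x. iexp ((t *\<^sub>R v) \<bullet> x) \<partial>scaled_sum_law p B n)" by simp
    also have "\<dots> = cf p ((1 / B n) *\<^sub>R (t *\<^sub>R v)) ^ n" by (rule integral_scaled_sum_law)
    finally show ?thesis by simp
  qed
  have c': "char \<mu>' t = of_real (exp (- (v \<bullet> (S *v v)) * t\<^sup>2 / 2))" for t
  proof -
    have "char \<mu>' t = (\<integral>x. iexp (t * (v \<bullet> x)) \<partial>\<nu>)"
      unfolding \<mu>'_def char_def by (rule integral_distr[OF m(2)]) auto
    also have "\<dots> = (\<integral>x. iexp ((t *\<^sub>R v) \<bullet> x) \<partial>\<nu>)" by simp
    also have "\<dots> = of_real (exp (- ((t *\<^sub>R v) \<bullet> (S *v (t *\<^sub>R v))) / 2))"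
      by (rule centered_normal_law_char[OF \<nu>(1)])
    finally show ?thesis unfolding quadratic_form_scaleR by (simp add: mult.commute)
  qed
  have "(\<lambda>n. char (\<mu> n) t) \<longlonglongrightarrow> char \<mu>' t" for t
    using cf_power_tendsto[of "t *\<^sub>R v"] unfolding c c' quadratic_form_scaleR
    by (simp add: mult.commute)
  from uniform_char_convergence[OF rd this e] show ?thesis unfolding c c' .
qed

lemma B_at_top: "filterlim B at_top sequentially"
proof -
  obtain v :: "real^'d" where v: "v \<noteq> 0" using nonzero_Basis nonempty_Basis by blast
  show ?thesis
  proof (rule norming_at_top)
    show "real_distribution (distr (measure_pmf p) borel (\<lambda>y. v \<bullet> real_vec y))"
      by (rule prob_space.real_distribution_distr[OF prob_space_measure_pmf]) auto
    show "v \<bullet> (S *v v) > 0" by (rule S_pos[OF v])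
  qed (use B_pos uniform_cf_power in \<open>auto simp flip: cf_eq_char\<close>)
qed

lemma cf_derivative:
  "(\<lambda>n. of_nat n * (cf p ((1 / B n) *\<^sub>R v) - 1)) \<longlonglongrightarrow> of_real (- (v \<bullet> (S *v v)) / 2)"
proof (cases "v = 0")
  case False
  have "(\<lambda>n. of_nat n * (char (distr (measure_pmf p) borel (\<lambda>y. v \<bullet> real_vec y)) (1 / B n) - 1))
      \<longlonglongrightarrow> of_real (- (v \<bullet> (S *v v)) / 2)"
  proof (rule norming_derivative[OF _ B_at_top])
    show "real_distribution (distr (measure_pmf p) borel (\<lambda>y. v \<bullet> real_vec y))"
      by (rule prob_space.real_distribution_distr[OF prob_space_measure_pmf]) auto
    show "v \<bullet> (S *v v) > 0" by (rule S_pos[OF False])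
  qed (use uniform_cf_power in \<open>auto simp flip: cf_eq_char\<close>)
  then show ?thesis by (simp add: cf_eq_char)
qed simp

text \<open>Comparison with w n = exp (- q / n), for which n (w n - 1) has the same limit - q. The
  k-th powers differ by at most k |cf - w|, which vanishes because k n / n converges and n |cf - w|
  tends to 0. Thus about t n steps are treated with the norming \<open>B n\<close> itself.\<close>

lemma cf_power_tendsto_fraction:
  assumes k: "(\<lambda>n. real (k n) / real n) \<longlonglongrightarrow> t"
  shows "(\<lambda>n. cf p ((1 / B n) *\<^sub>R v) ^ k n) \<longlonglongrightarrow> of_real (exp (- t * (v \<bullet> (S *v v)) / 2))"
proof -
  define q where "q = v \<bullet> (S *v v) / 2"
  have q: "q \<ge> 0" unfolding q_def using S_nonneg by simp
  define w where "w = (\<lambda>n. of_real (exp (- q / real n)) :: complex)"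
  have "(\<lambda>n. real n * (exp (- q / real n) - 1)) \<longlonglongrightarrow> - q" by real_asymp
  then have "(\<lambda>n. of_real (real n * (exp (- q / real n) - 1)) :: complex) \<longlonglongrightarrow> of_real (- q)"
    by (rule tendsto_of_real)
  then have "(\<lambda>n. of_nat n * (w n - 1)) \<longlonglongrightarrow> of_real (- q)" by (simp add: w_def)
  then have "(\<lambda>n. of_nat n * (cf p ((1 / B n) *\<^sub>R v) - 1) - of_nat n * (w n - 1)) \<longlonglongrightarrow>
      of_real (- (v \<bullet> (S *v v)) / 2) - of_real (- q)"
    by (intro tendsto_diff cf_derivative)
  then have "(\<lambda>n. of_nat n * (cf p ((1 / B n) *\<^sub>R v) - w n)) \<longlonglongrightarrow> 0"
    by (simp add: q_def algebra_simps)
  then have "(\<lambda>n. real (k n) / real n * norm (of_nat n * (cf p ((1 / B n) *\<^sub>R v) - w n))) \<longlonglongrightarrow> t * 0"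
    by (intro tendsto_mult k tendsto_norm_zero)
  then have lim0: "(\<lambda>n. real (k n) / real n * norm (of_nat n * (cf p ((1 / B n) *\<^sub>R v) - w n))) \<longlonglongrightarrow> 0"
    by simp
  have "(\<lambda>n. cf p ((1 / B n) *\<^sub>R v) ^ k n - w n ^ k n) \<longlonglongrightarrow> 0"
  proof (rule Lim_null_comparison[OF _ lim0])
    show "\<forall>\<^sub>F n in sequentially. norm (cf p ((1 / B n) *\<^sub>R v) ^ k n - w n ^ k n)
      \<le> real (k n) / real n * norm (of_nat n * (cf p ((1 / B n) *\<^sub>R v) - w n))"
      using eventually_gt_at_top[of 0]
    proof eventually_elim
      case (elim n)
      have "norm (w n) \<le> 1" using q by (simp add: w_def)
      then have "norm (cf p ((1 / B n) *\<^sub>R v) ^ k n - w n ^ k n) \<le> real (k n) * norm (cf p ((1 / B n) *\<^sub>R v) - w n)"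
        by (intro norm_power_diff norm_cf_le_1)
      then show ?case using elim by (simp add: norm_mult)
    qed
  qed
  moreover have "(\<lambda>n. w n ^ k n) \<longlonglongrightarrow> of_real (exp (- t * (v \<bullet> (S *v v)) / 2))"
  proof -
    have "w n ^ k n = of_real (exp (- q * (real (k n) / real n)))" for n
      unfolding w_def by (simp add: mult.commute flip: exp_of_nat_mult of_real_power)
    moreover have "(\<lambda>n. exp (- q * (real (k n) / real n))) \<longlonglongrightarrow> exp (- q * t)"
      by (intro tendsto_intros k)
    then have "(\<lambda>n. of_real (exp (- q * (real (k n) / real n))) :: complex) \<longlonglongrightarrow> of_real (exp (- q * t))"
      by (rule tendsto_of_real)
    ultimately show ?thesis by (simp add: q_def mult.commute)
  qed
  ultimately have "(\<lambda>n. (cf p ((1 / B n) *\<^sub>R v) ^ k n - w n ^ k n) + w n ^ k n) \<longlonglongrightarrow>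
      0 + of_real (exp (- t * (v \<bullet> (S *v v)) / 2))" by (rule tendsto_add)
  then show ?thesis by simp
qed

end

section \<open>Truncated second moments\<close>

text \<open>Taylor's formula gives the lower bound u^2/2 - |u|^3/6, at least u^2/3 on [-1,1]; 1/4 is
  a convenient weaker constant.\<close>

lemma one_minus_cos_ge: "\<bar>u\<bar> \<le> 1 \<Longrightarrow> 1 - cos u \<ge> u\<^sup>2 / 4" for u :: real
proof -
  assume u: "\<bar>u\<bar> \<le> 1"
  have "norm (iexp u - (\<Sum>k\<le>2. (\<i> * u) ^ k / fact k)) \<le> \<bar>u\<bar> ^ 3 / 6"
    using iexp_approx1[of u 2] by (simp add: eval_nat_numeral)
  then have "\<bar>Re (iexp u - (\<Sum>k\<le>2. (\<i> * u) ^ k / fact k))\<bar> \<le> \<bar>u\<bar> ^ 3 / 6"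
    using abs_Re_le_cmod order_trans by blast
  moreover have "Re (iexp u - (\<Sum>k\<le>2. (\<i> * u) ^ k / fact k)) = cos u - (1 - u\<^sup>2 / 2)"
    by (simp add: iexp_eq eval_nat_numeral power2_eq_square)
  moreover have "\<bar>u\<bar> ^ 3 = u\<^sup>2 * \<bar>u\<bar>" by (simp add: eval_nat_numeral)
  moreover have "u\<^sup>2 * \<bar>u\<bar> \<le> u\<^sup>2" using u by (simp add: mult_left_le)
  moreover have "0 \<le> u\<^sup>2" by simp
  ultimately show ?thesis by linarith
qed

lemma one_minus_cos_le: "1 - cos u \<le> u\<^sup>2 / 2" for u :: real
proof -
  have "1 - cos u = 2 * (sin (u / 2))\<^sup>2" using cos_double_sin[of "u / 2"] by simp
  also have "(sin (u / 2))\<^sup>2 \<le> (u / 2)\<^sup>2"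
    using abs_sin_x_le_abs_x[of "u / 2"] by (rule abs_le_square_iff[THEN iffD1])
  finally show ?thesis by (simp add: power2_eq_square)
qed

text \<open>X is the linear form under study and Y the size by which it is truncated. They are kept
  apart because later Y is a norm common to all directions, so that the truncated moments of all
  directions form one quadratic form.\<close>

lemma trunc_integrable:
  fixes q :: "'s pmf" and X Y :: "'s \<Rightarrow> real"
  assumes XY: "\<And>y. \<bar>X y\<bar> \<le> c * Y y" and Y: "\<And>y. 0 \<le> Y y"
  shows "integrable (measure_pmf q) (\<lambda>y. (X y)\<^sup>2 * indicator {y. Y y \<le> K} y)"
proof (rule measure_pmf.integrable_bounded)
  fix y
  show "norm ((X y)\<^sup>2 * indicator {y. Y y \<le> K} y) \<le> (\<bar>c\<bar> * \<bar>K\<bar>)\<^sup>2"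
  proof (cases "Y y \<le> K")
    case True
    have "\<bar>X y\<bar> \<le> \<bar>c\<bar> * Y y" using XY[of y] Y[of y] by (meson abs_ge_self mult_right_mono order_trans)
    also have "\<dots> \<le> \<bar>c\<bar> * \<bar>K\<bar>" using True by (intro mult_left_mono) auto
    finally have "\<bar>X y\<bar> \<le> \<bar>\<bar>c\<bar> * \<bar>K\<bar>\<bar>" by simp
    then have "(X y)\<^sup>2 \<le> (\<bar>c\<bar> * \<bar>K\<bar>)\<^sup>2" by (rule abs_le_square_iff[THEN iffD1])
    then show ?thesis using True by simp
  qed simp
qed simp

lemma trunc_second_moment:
  fixes q :: "'s pmf" and X Y :: "'s \<Rightarrow> real"
  assumes inf: "(\<integral>\<^sup>+y. ennreal ((X y)\<^sup>2) \<partial>measure_pmf q) = \<infinity>"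
    and XY: "\<And>y. \<bar>X y\<bar> \<le> c * Y y" and Y: "\<And>y. 0 \<le> Y y"
  shows "\<exists>K::nat. R < (\<integral>y. (X y)\<^sup>2 * indicator {y. Y y \<le> real K} y \<partial>measure_pmf q)"
proof -
  define f where "f = (\<lambda>(K::nat) y. ennreal ((X y)\<^sup>2 * indicator {y. Y y \<le> real K} y))"
  have "(SUP K. f K y) = ennreal ((X y)\<^sup>2)" for y
  proof (rule antisym)
    show "(SUP K. f K y) \<le> ennreal ((X y)\<^sup>2)"
      by (rule SUP_least) (auto simp: f_def indicator_def)
    obtain K :: nat where "Y y \<le> real K" using real_arch_simple by blast
    then have "f K y = ennreal ((X y)\<^sup>2)" by (simp add: f_def)
    then show "ennreal ((X y)\<^sup>2) \<le> (SUP K. f K y)" by (metis SUP_upper UNIV_I)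
  qed
  then have "(\<integral>\<^sup>+y. (SUP K. f K y) \<partial>measure_pmf q) = \<infinity>" using inf by simp
  moreover have "(\<integral>\<^sup>+y. (SUP K. f K y) \<partial>measure_pmf q) = (SUP K. \<integral>\<^sup>+y. f K y \<partial>measure_pmf q)"
    by (rule nn_integral_monotone_convergence_SUP)
      (auto simp: f_def incseq_def le_fun_def indicator_def intro!: ennreal_leI)
  ultimately have top: "(SUP K. \<integral>\<^sup>+y. f K y \<partial>measure_pmf q) = \<infinity>" by (simp only:)
  have "ennreal (max R 0) < (SUP K. \<integral>\<^sup>+y. f K y \<partial>measure_pmf q)" unfolding top by simp
  then obtain K where "ennreal (max R 0) < (\<integral>\<^sup>+y. f K y \<partial>measure_pmf q)"
    unfolding less_SUP_iff by blast
  also have "\<dots> = ennreal (\<integral>y. (X y)\<^sup>2 * indicator {y. Y y \<le> real K} y \<partial>measure_pmf q)"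
    unfolding f_def by (intro nn_integral_eq_integral trunc_integrable[OF XY Y]) auto
  finally have "max R 0 < (\<integral>y. (X y)\<^sup>2 * indicator {y. Y y \<le> real K} y \<partial>measure_pmf q)"
    by (subst (asm) ennreal_less_iff) simp_all
  then show ?thesis by (intro exI[of _ K]) simp
qed

text \<open>Inside the truncation |s X| \<le> 1 and the quadratic lower bound holds; outside, the
  integrand on the right is still nonnegative.\<close>

lemma one_minus_cos_integral_ge:
  fixes q :: "'s pmf" and X Y :: "'s \<Rightarrow> real"
  assumes XY: "\<And>y. \<bar>X y\<bar> \<le> c * Y y" and Y: "\<And>y. 0 \<le> Y y" and s: "\<bar>s\<bar> * \<bar>c\<bar> * K \<le> 1"
  shows "s\<^sup>2 / 4 * (\<integral>y. (X y)\<^sup>2 * indicator {y. Y y \<le> K} y \<partial>measure_pmf q) \<le> (\<integral>y. 1 - cos (s * X y) \<partial>measure_pmf q)"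
proof -
  have "s\<^sup>2 / 4 * (\<integral>y. (X y)\<^sup>2 * indicator {y. Y y \<le> K} y \<partial>measure_pmf q) =
      (\<integral>y. s\<^sup>2 / 4 * ((X y)\<^sup>2 * indicator {y. Y y \<le> K} y) \<partial>measure_pmf q)" by simp
  also have "\<dots> \<le> (\<integral>y. 1 - cos (s * X y) \<partial>measure_pmf q)"
  proof (rule integral_mono)
    show "integrable (measure_pmf q) (\<lambda>y. s\<^sup>2 / 4 * ((X y)\<^sup>2 * indicator {y. Y y \<le> K} y))"
      by (intro integrable_mult_right trunc_integrable[OF XY Y])
    show "integrable (measure_pmf q) (\<lambda>y. 1 - cos (s * X y))"
      by (rule measure_pmf.integrable_bounded[where C=2]) (auto simp: abs_le_iff intro: order_trans[OF diff_left_mono[OF cos_ge_minus_one]])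
    fix y
    show "s\<^sup>2 / 4 * ((X y)\<^sup>2 * indicator {y. Y y \<le> K} y) \<le> 1 - cos (s * X y)"
    proof (cases "Y y \<le> K")
      case True
      have "\<bar>X y\<bar> \<le> \<bar>c\<bar> * Y y" using XY[of y] Y[of y] by (meson abs_ge_self mult_right_mono order_trans)
      also have "\<dots> \<le> \<bar>c\<bar> * K" using True by (intro mult_left_mono) auto
      finally have "\<bar>s\<bar> * \<bar>X y\<bar> \<le> \<bar>s\<bar> * (\<bar>c\<bar> * K)" by (intro mult_left_mono) auto
      then have "\<bar>s * X y\<bar> \<le> 1" using s by (simp add: abs_mult mult.assoc)
      from one_minus_cos_ge[OF this] show ?thesis using True by (simp add: power_mult_distrib)
    qed simp
  qed
  finally show ?thesis .
qed

context
  fixes p :: "(int^'d) pmf" and B :: "nat \<Rightarrow> real" and S :: "real^'d^'d"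
  assumes B_type: "B_type p B S"
begin

lemma one_minus_cos_tendsto:
  "(\<lambda>n. real n * (\<integral>y. 1 - cos ((1 / B n) * (v \<bullet> real_vec y)) \<partial>measure_pmf p)) \<longlonglongrightarrow> v \<bullet> (S *v v) / 2"
proof -
  have re: "Re (cf p w) = (\<integral>y. cos (w \<bullet> real_vec y) \<partial>measure_pmf p)" for w
  proof -
    have "integrable (measure_pmf p) (\<lambda>y. iexp (w \<bullet> real_vec y))"
      by (rule measure_pmf.integrable_bounded[where C=1]) auto
    then show ?thesis unfolding cf_def by (subst integral_Re[symmetric]) (simp_all add: iexp_eq)
  qed
  have "(\<lambda>n. - Re (of_nat n * (cf p ((1 / B n) *\<^sub>R v) - 1))) \<longlonglongrightarrow> - Re (of_real (- (v \<bullet> (S *v v)) / 2))"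
    by (intro tendsto_minus tendsto_Re cf_derivative[OF B_type])
  moreover have "- Re (of_nat n * (cf p ((1 / B n) *\<^sub>R v) - 1)) =
      real n * (\<integral>y. 1 - cos ((1 / B n) * (v \<bullet> real_vec y)) \<partial>measure_pmf p)" for n
  proof -
    have "integrable (measure_pmf p) (\<lambda>y. cos ((1 / B n) * (v \<bullet> real_vec y)))"
      by (rule measure_pmf.integrable_bounded[where C=1]) auto
    then have I: "(\<integral>y. 1 - cos ((1 / B n) * (v \<bullet> real_vec y)) \<partial>measure_pmf p) = 1 - Re (cf p ((1 / B n) *\<^sub>R v))"
      unfolding re by simp
    show ?thesis unfolding I by (simp add: algebra_simps)
  qed
  ultimately show ?thesis by simp
qed

text \<open>The quantity n (1 - Re cf) at 1 / B n converges, yet it is at least n / (4 (B n)^2)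
  times any given truncated second moment once \<open>B n\<close> exceeds the truncation level.
  Since the truncated moments are unbounded, n / (B n)^2 must vanish.\<close>

lemma n_over_B_square_tendsto_of_direction:
  assumes inf: "(\<integral>\<^sup>+y. ennreal ((v \<bullet> real_vec y)\<^sup>2) \<partial>measure_pmf p) = \<infinity>"
  shows "(\<lambda>n. real n / (B n)\<^sup>2) \<longlonglongrightarrow> 0"
proof (rule tendsto_of_eventually_abs_le)
  fix e :: real assume e: "e > 0"
  define q where "q = v \<bullet> (S *v v) / 2"
  have q: "q \<ge> 0" unfolding q_def using S_nonneg[OF B_type] by simp
  define R where "R = 4 * (q + 1) / e"
  obtain K :: nat where K: "R < (\<integral>y. (v \<bullet> real_vec y)\<^sup>2 * indicator {y. \<bar>v \<bullet> real_vec y\<bar> \<le> real K} y \<partial>measure_pmf p)"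
    using trunc_second_moment[OF inf, of 1 "\<lambda>y. \<bar>v \<bullet> real_vec y\<bar>" R] by auto
  have "\<forall>\<^sub>F n in sequentially. B n \<ge> max 1 (real K)"
    using B_at_top[OF B_type] by (simp only: filterlim_at_top)
  moreover have "\<forall>\<^sub>F n in sequentially. real n * (\<integral>y. 1 - cos ((1 / B n) * (v \<bullet> real_vec y)) \<partial>measure_pmf p) < q + 1"
    using one_minus_cos_tendsto[of v] by (rule order_tendstoD(2)) (simp add: q_def)
  ultimately show "\<forall>\<^sub>F n in sequentially. \<bar>real n / (B n)\<^sup>2 - 0\<bar> \<le> e"
  proof eventually_elim
    case (elim n)
    have Bn: "B n > 0" "real K \<le> B n" using elim(1) by auto
    have "(1 / B n)\<^sup>2 / 4 * R \<le> (1 / B n)\<^sup>2 / 4 *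
        (\<integral>y. (v \<bullet> real_vec y)\<^sup>2 * indicator {y. \<bar>v \<bullet> real_vec y\<bar> \<le> real K} y \<partial>measure_pmf p)"
      using K by (intro mult_left_mono) auto
    also have "\<dots> \<le> (\<integral>y. 1 - cos ((1 / B n) * (v \<bullet> real_vec y)) \<partial>measure_pmf p)"
      using Bn by (intro one_minus_cos_integral_ge[where c=1]) (auto simp: field_simps)
    finally have "real n * ((1 / B n)\<^sup>2 / 4 * R) \<le> real n * (\<integral>y. 1 - cos ((1 / B n) * (v \<bullet> real_vec y)) \<partial>measure_pmf p)"
      by (intro mult_left_mono) auto
    also have "\<dots> < q + 1" by (rule elim(2))
    finally have "real n / (B n)\<^sup>2 * (q + 1) \<le> e * (q + 1)"
      using e Bn by (simp add: R_def power_divide field_simps)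
    then have "real n / (B n)\<^sup>2 \<le> e" by (rule mult_right_le_imp_le) (use q in simp)
    then show ?case by simp
  qed
qed

lemma infinite_variance_coordinate:
  "\<exists>v. (\<integral>\<^sup>+y. ennreal ((v \<bullet> real_vec y)\<^sup>2) \<partial>measure_pmf p) = \<infinity>"
proof (rule ccontr)
  assume "\<not> ?thesis"
  then have fin: "(\<integral>\<^sup>+y. ennreal ((axis i 1 \<bullet> real_vec y)\<^sup>2) \<partial>measure_pmf p) < \<infinity>" for i
    by (simp add: less_top)
  have "(\<integral>\<^sup>+y. ennreal ((infnorm (real_vec y :: real^'d))\<^sup>2) \<partial>measure_pmf p)
      \<le> (\<integral>\<^sup>+y. (\<Sum>i\<in>UNIV. ennreal ((axis i 1 \<bullet> real_vec y)\<^sup>2)) \<partial>measure_pmf p)"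
  proof (rule nn_integral_mono)
    fix y :: "int^'d"
    have "(infnorm (real_vec y))\<^sup>2 \<le> (norm (real_vec y))\<^sup>2"
      by (intro power_mono infnorm_le_norm infnorm_pos_le)
    also have "\<dots> = (\<Sum>i\<in>UNIV. (axis i 1 \<bullet> real_vec y)\<^sup>2)"
    proof -
      have a: "axis i 1 \<bullet> (real_vec y :: real^'d) = real_vec y $ i" for i by (simp add: inner_axis')
      show ?thesis unfolding power2_norm_eq_inner a by (simp add: inner_vec_def power2_eq_square)
    qed
    finally have "ennreal ((infnorm (real_vec y))\<^sup>2) \<le> ennreal (\<Sum>i\<in>UNIV. (axis i 1 \<bullet> real_vec y)\<^sup>2)"
      by (rule ennreal_leI)
    then show "ennreal ((infnorm (real_vec y))\<^sup>2) \<le> (\<Sum>i\<in>UNIV. ennreal ((axis i 1 \<bullet> real_vec y)\<^sup>2))"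
      by (subst (asm) sum_ennreal[symmetric]) auto
  qed
  also have "\<dots> = (\<Sum>i\<in>UNIV. \<integral>\<^sup>+y. ennreal ((axis i 1 \<bullet> real_vec y)\<^sup>2) \<partial>measure_pmf p)"
    by (rule nn_integral_sum) auto
  also have "\<dots> < \<infinity>" using fin by simp
  finally show False using B_type by (simp add: B_type_def)
qed

lemma n_over_B_square_tendsto: "(\<lambda>n. real n / (B n)\<^sup>2) \<longlonglongrightarrow> 0"
  using infinite_variance_coordinate n_over_B_square_tendsto_of_direction by blast

text \<open>A finite variance s in direction v would give n (1 - Re cf) \<le> n s / (2 (B n)^2),
  which tends to 0, although the limit is half the positive form of \<open>S\<close> at v.
  Nondegeneracy thus spreads the infinite variance from one direction to all, as the local bound
  requires it throughout a plane.\<close>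

lemma infinite_variance:
  assumes v: "v \<noteq> 0"
  shows "(\<integral>\<^sup>+y. ennreal ((v \<bullet> real_vec y)\<^sup>2) \<partial>measure_pmf p) = \<infinity>"
proof (rule ccontr)
  assume "\<not> ?thesis"
  then have i: "integrable (measure_pmf p) (\<lambda>y. (v \<bullet> real_vec y)\<^sup>2)"
    by (intro integrableI_bounded) (auto simp: less_top)
  define s where "s = (\<integral>y. (v \<bullet> real_vec y)\<^sup>2 \<partial>measure_pmf p)"
  have "(\<lambda>n. real n / (B n)\<^sup>2 * (s / 2)) \<longlonglongrightarrow> 0 * (s / 2)"
    by (intro tendsto_mult n_over_B_square_tendsto tendsto_const)
  then have lim: "(\<lambda>n. real n / (B n)\<^sup>2 * (s / 2)) \<longlonglongrightarrow> 0" by simp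
  have "v \<bullet> (S *v v) / 2 \<le> 0"
  proof (rule LIMSEQ_le[OF one_minus_cos_tendsto lim], intro exI allI impI)
    fix n :: nat
    have "(\<integral>y. 1 - cos ((1 / B n) * (v \<bullet> real_vec y)) \<partial>measure_pmf p) \<le>
        (\<integral>y. (1 / B n)\<^sup>2 / 2 * (v \<bullet> real_vec y)\<^sup>2 \<partial>measure_pmf p)"
    proof (rule integral_mono)
      show "integrable (measure_pmf p) (\<lambda>y. 1 - cos ((1 / B n) * (v \<bullet> real_vec y)))"
        by (rule measure_pmf.integrable_bounded[where C=2]) (auto simp: abs_le_iff intro: order_trans[OF diff_left_mono[OF cos_ge_minus_one]])
      show "integrable (measure_pmf p) (\<lambda>y. (1 / B n)\<^sup>2 / 2 * (v \<bullet> real_vec y)\<^sup>2)" using i by simp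
      show "1 - cos ((1 / B n) * (v \<bullet> real_vec y)) \<le> (1 / B n)\<^sup>2 / 2 * (v \<bullet> real_vec y)\<^sup>2" for y
        using one_minus_cos_le[of "(1 / B n) * (v \<bullet> real_vec y)"] by (simp add: power_mult_distrib power_divide)
    qed
    also have "\<dots> = (1 / B n)\<^sup>2 / 2 * s" by (simp add: s_def)
    finally have "real n * (\<integral>y. 1 - cos ((1 / B n) * (v \<bullet> real_vec y)) \<partial>measure_pmf p) \<le> real n * ((1 / B n)\<^sup>2 / 2 * s)"
      by (intro mult_left_mono) auto
    then show "real n * (\<integral>y. 1 - cos ((1 / B n) * (v \<bullet> real_vec y)) \<partial>measure_pmf p) \<le> real n / (B n)\<^sup>2 * (s / 2)"
      by (simp add: power_divide mult.commute)
  qed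
  then show False using S_pos[OF B_type v] by simp
qed

end

section \<open>Discrete Markov chains\<close>

lemma integral_bind_pmf_real:
  fixes f :: "'b \<Rightarrow> real"
  assumes "\<And>x. \<bar>f x\<bar> \<le> C"
  shows "(\<integral>x. f x \<partial>measure_pmf (bind_pmf p q)) = (\<integral>x. \<integral>y. f y \<partial>measure_pmf (q x) \<partial>measure_pmf p)"
  unfolding measure_pmf_bind
proof (rule integral_bind[where K="count_space UNIV" and B=C and B'=1])
  show "finite_measure (measure_pmf p)" by unfold_locales
  show "AE x in measure_pmf p. emeasure (measure_pmf (q x)) (space (measure_pmf (q x))) \<le> ennreal 1"
    using measure_pmf.emeasure_space_1 by simp
  show "(\<lambda>x. measure_pmf (q x)) \<in> measure_pmf p \<rightarrow>\<^sub>M subprob_algebra (count_space UNIV)"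
    using measurable_measure_pmf[of q] by simp
qed (use assms in auto)

lemma integral_bind_pmf_complex:
  fixes f :: "'b \<Rightarrow> complex"
  assumes f: "\<And>x. norm (f x) \<le> C"
  shows "(\<integral>x. f x \<partial>measure_pmf (bind_pmf p q)) = (\<integral>x. \<integral>y. f y \<partial>measure_pmf (q x) \<partial>measure_pmf p)"
proof -
  have i: "integrable (measure_pmf r) f" for r
    using f by (intro measure_pmf.integrable_bounded[where C=C]) auto
  have ii: "integrable (measure_pmf p) (\<lambda>x. \<integral>y. f y \<partial>measure_pmf (q x))"
  proof (rule measure_pmf.integrable_bounded[where C=C])
    fix x
    have "norm (\<integral>y. f y \<partial>measure_pmf (q x)) \<le> (\<integral>y. norm (f y) \<partial>measure_pmf (q x))" by (rule integral_norm_bound)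
    also have "\<dots> \<le> (\<integral>y. C \<partial>measure_pmf (q x))" using f i by (intro integral_mono) auto
    finally show "norm (\<integral>y. f y \<partial>measure_pmf (q x)) \<le> C" by simp
  qed simp
  have b: "\<bar>Re (f x)\<bar> \<le> C" "\<bar>Im (f x)\<bar> \<le> C" for x
    using f[of x] abs_Re_le_cmod[of "f x"] abs_Im_le_cmod[of "f x"] by linarith+
  show ?thesis
  proof (rule complex_eqI)
    show "Re (\<integral>x. f x \<partial>measure_pmf (bind_pmf p q)) = Re (\<integral>x. \<integral>y. f y \<partial>measure_pmf (q x) \<partial>measure_pmf p)"
      using integral_bind_pmf_real[of "\<lambda>x. Re (f x)" C p q, OF b(1)] i ii by simp
    show "Im (\<integral>x. f x \<partial>measure_pmf (bind_pmf p q)) = Im (\<integral>x. \<integral>y. f y \<partial>measure_pmf (q x) \<partial>measure_pmf p)"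
      using integral_bind_pmf_real[of "\<lambda>x. Im (f x)" C p q, OF b(2)] i ii by simp
  qed
qed

lemma measure_bind_pmf_eq:
  "measure (measure_pmf (bind_pmf p q)) D = (\<integral>x. measure (measure_pmf (q x)) D \<partial>measure_pmf p)"
proof -
  have "\<bar>indicator D x\<bar> \<le> (1 :: real)" for x by (simp add: indicator_def)
  then have "(\<integral>x. indicat_real D x \<partial>measure_pmf (bind_pmf p q)) =
      (\<integral>x. \<integral>y. indicat_real D y \<partial>measure_pmf (q x) \<partial>measure_pmf p)"
    by (rule integral_bind_pmf_real)
  then show ?thesis by simp
qed

lemma integrable_pmf_bounded:
  fixes f :: "'b \<Rightarrow> real"
  assumes "\<And>x. \<bar>f x\<bar> \<le> C"
  shows "integrable (measure_pmf p) f"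
  using assms by (intro measure_pmf.integrable_bounded[where C=C]) auto

lemma nstep_Suc_first: "nstep K (Suc n) x = bind_pmf (K x) (nstep K n)"
proof (induction n)
  case 0
  show ?case by (simp add: bind_return_pmf bind_return_pmf')
next
  case (Suc n)
  have "nstep K (Suc (Suc n)) x = bind_pmf (bind_pmf (K x) (nstep K n)) K"
    by (subst Suc.IH[symmetric]) (rule nstep.simps)
  also have "\<dots> = bind_pmf (K x) (\<lambda>y. bind_pmf (nstep K n y) K)" by (rule bind_assoc_pmf)
  also have "\<dots> = bind_pmf (K x) (nstep K (Suc n))"
    by (rule arg_cong[where f="bind_pmf (K x)"]) (rule ext, simp)
  finally show ?case .
qed

text \<open>The law of the states at times 0 to n, as a list of length n + 1. The first-step
  recursion has the same shape as \<open>nstep_Suc_first\<close> and \<open>killed\<close>, so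
  inductions run in parallel.\<close>

primrec chain_path :: "('s \<Rightarrow> 's pmf) \<Rightarrow> nat \<Rightarrow> 's \<Rightarrow> 's list pmf"
  where
    "chain_path K 0 x = return_pmf [x]"
  | "chain_path K (Suc n) x = bind_pmf (K x) (\<lambda>y. map_pmf ((#) x) (chain_path K n y))"

lemma length_chain_path: "l \<in> set_pmf (chain_path K n x) \<Longrightarrow> length l = Suc n"
  by (induction n arbitrary: x l) auto

lemma hd_chain_path: "l \<in> set_pmf (chain_path K n x) \<Longrightarrow> l ! 0 = x"
  by (cases n) auto

text \<open>If h turns the transitions of one chain into those of another, it does the same with
  path laws; this extracts the two marginals of a coupled chain.\<close>

lemma chain_path_map:
  assumes "\<And>s. map_pmf h (K s) = K' (h s)"
  shows "map_pmf (map h) (chain_path K n s) = chain_path K' n (h s)"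
proof (induction n arbitrary: s)
  case (Suc n)
  have "map_pmf (map h) (chain_path K (Suc n) s) = bind_pmf (K s) (\<lambda>y. map_pmf ((#) (h s)) (map_pmf (map h) (chain_path K n y)))"
    by (simp add: map_bind_pmf pmf.map_comp o_def)
  also have "\<dots> = bind_pmf (map_pmf h (K s)) (\<lambda>y. map_pmf ((#) (h s)) (chain_path K' n y))"
    by (simp add: Suc.IH bind_map_pmf)
  finally show ?case by (simp add: assms)
qed simp

text \<open>The Markov property at time s.\<close>

lemma chain_path_drop:
  "s \<le> n \<Longrightarrow> map_pmf (drop s) (chain_path K n x) = bind_pmf (nstep K s x) (chain_path K (n - s))"
proof (induction s arbitrary: n x)
  case (Suc s)
  then obtain m where n: "n = Suc m" by (cases n) auto
  have "map_pmf (drop (Suc s)) (chain_path K n x) = bind_pmf (K x) (\<lambda>y. map_pmf (drop s) (chain_path K m y))"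
    by (simp add: n map_bind_pmf pmf.map_comp o_def)
  also have "\<dots> = bind_pmf (K x) (\<lambda>y. bind_pmf (nstep K s y) (chain_path K (m - s)))"
    using Suc.prems n by (intro bind_pmf_cong refl Suc.IH) auto
  finally show ?case by (simp add: n nstep_Suc_first bind_assoc_pmf del: nstep.simps)
qed (simp add: bind_return_pmf)

text \<open>The last-step form of the recursion, which fits \<open>markov_chain\<close>, where the
  transition after a given past is prescribed.\<close>

lemma chain_path_snoc:
  "chain_path K (Suc n) x = bind_pmf (chain_path K n x) (\<lambda>l. map_pmf (\<lambda>y. l @ [y]) (K (last l)))"
proof (induction n arbitrary: x)
  case 0
  show ?case by (simp add: bind_return_pmf map_pmf_def)
next
  case (Suc n)
  have "chain_path K (Suc (Suc n)) x = bind_pmf (K x) (\<lambda>y. map_pmf ((#) x) (chain_path K (Suc n) y))"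
    by (rule chain_path.simps)
  also have "\<dots> = bind_pmf (K x) (\<lambda>y. bind_pmf (chain_path K n y) (\<lambda>l. map_pmf (\<lambda>v. x # l @ [v]) (K (last l))))"
    unfolding Suc.IH by (simp add: map_bind_pmf pmf.map_comp o_def)
  also have "\<dots> = bind_pmf (K x) (\<lambda>y. bind_pmf (chain_path K n y) (\<lambda>l. map_pmf (\<lambda>v. (x # l) @ [v]) (K (last (x # l)))))"
  proof (intro bind_pmf_cong refl)
    fix y l assume "l \<in> set_pmf (chain_path K n y)"
    then have "l \<noteq> []" using length_chain_path by fastforce
    then show "map_pmf (\<lambda>v. x # l @ [v]) (K (last l)) = map_pmf (\<lambda>v. (x # l) @ [v]) (K (last (x # l)))"
      by simp
  qed
  also have "\<dots> = bind_pmf (chain_path K (Suc n) x) (\<lambda>l. map_pmf (\<lambda>v. l @ [v]) (K (last l)))"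
    by (simp add: bind_assoc_pmf bind_map_pmf)
  finally show ?case .
qed

subsection \<open>Killing on a set\<close>

text \<open>The expectation of f at time n on the event that the chain avoids C at all times 0 to n,
  both ends included; \<open>avoid\<close> is the probability of that event. The recursion expresses
  it without a path space.\<close>

primrec killed :: "('s \<Rightarrow> 's pmf) \<Rightarrow> 's set \<Rightarrow> nat \<Rightarrow> ('s \<Rightarrow> real) \<Rightarrow> 's \<Rightarrow> real"
  where
    "killed K C 0 f x = (if x \<in> C then 0 else f x)"
  | "killed K C (Suc n) f x = (if x \<in> C then 0 else \<integral>y. killed K C n f y \<partial>measure_pmf (K x))"

abbreviation avoid :: "('s \<Rightarrow> 's pmf) \<Rightarrow> 's set \<Rightarrow> nat \<Rightarrow> 's \<Rightarrow> real"
  where "avoid K C n \<equiv> killed K C n (\<lambda>_. 1)"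

lemma killed_bounds:
  assumes "\<And>x. 0 \<le> f x" "\<And>x. f x \<le> c" "0 \<le> c"
  shows "0 \<le> killed K C n f x" "killed K C n f x \<le> c"
proof -
  have "0 \<le> killed K C n f x \<and> killed K C n f x \<le> c"
  proof (induction n arbitrary: x)
    case (Suc n)
    have "(\<integral>y. killed K C n f y \<partial>measure_pmf (K x)) \<le> (\<integral>y. c \<partial>measure_pmf (K x))"
      using Suc assms by (intro integral_mono integrable_pmf_bounded[where C=c]) auto
    then show ?case using Suc assms by (auto intro!: Bochner_Integration.integral_nonneg)
  qed (use assms in auto)
  then show "0 \<le> killed K C n f x" "killed K C n f x \<le> c" by auto
qed

lemma killed_mono:
  assumes f: "\<And>x. 0 \<le> f x" "\<And>x. f x \<le> g x" "\<And>x. g x \<le> c"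
  shows "killed K C n f x \<le> killed K C n g x"
proof (induction n arbitrary: x)
  case (Suc n)
  have c: "0 \<le> c" using f(1)[of x] f(2)[of x] f(3)[of x] by linarith
  have g0: "0 \<le> g x" for x using f(1)[of x] f(2)[of x] by linarith
  have fc: "f x \<le> c" for x using f(2)[of x] f(3)[of x] by linarith
  have "(\<integral>y. killed K C n f y \<partial>measure_pmf (K x)) \<le> (\<integral>y. killed K C n g y \<partial>measure_pmf (K x))"
    using killed_bounds[of f c] killed_bounds[of g c] f g0 fc c
    by (intro integral_mono integrable_pmf_bounded[where C=c] Suc.IH) (auto simp: abs_le_iff intro: order_trans[of _ 0])
  then show ?case by simp
qed (use f in auto)

lemma killed_scale: "killed K C n (\<lambda>x. c * f x) x = c * killed K C n f x"
  by (induction n arbitrary: x) auto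

lemma killed_add: "killed K C (n + m) f x = killed K C n (killed K C m f) x"
proof (induction n arbitrary: x)
  case 0
  show ?case by (cases m) auto
next
  case (Suc n)
  have "killed K C (n + m) f = killed K C n (killed K C m f)" by (rule ext) (rule Suc.IH)
  then show ?case by simp
qed

lemma avoid_antimono: "m \<le> n \<Longrightarrow> avoid K C n x \<le> avoid K C m x"
proof -
  assume "m \<le> n"
  then obtain k where n: "n = m + k" by (metis le_Suc_ex)
  have "avoid K C n x = killed K C m (avoid K C k) x" unfolding n by (rule killed_add)
  also have "\<dots> \<le> avoid K C m x"
    using killed_bounds[of "\<lambda>_. 1" 1 K C k] by (intro killed_mono[where c=1]) auto
  finally show ?thesis .
qed

text \<open>The kernel is evaluated only outside C, so up to its first impurity the perturbed chain
  behaves as the unperturbed walk.\<close>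

lemma killed_cong_kernel:
  assumes "\<And>x. x \<notin> C \<Longrightarrow> K x = K' x"
  shows "killed K C n f x = killed K' C n f x"
proof (induction n arbitrary: x)
  case (Suc n)
  have "killed K C n f = killed K' C n f" by (rule ext) (rule Suc.IH)
  then show ?case using assms by simp
qed simp

text \<open>Condition on the first visit to C: from there the chain ends in D with probability at
  least 1 - \<rho>, whatever time remains. Induction on the first step replaces the stopping
  time.\<close>

lemma ottaviani:
  assumes "\<And>x m. x \<in> C \<Longrightarrow> m \<le> n \<Longrightarrow> 1 - \<rho> \<le> measure (measure_pmf (nstep K m x)) D" and \<rho>: "\<rho> \<le> 1"
  shows "(1 - \<rho>) * (1 - avoid K C n x) \<le> measure (measure_pmf (nstep K n x)) D"
  using assms(1)
proof (induction n arbitrary: x)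
  case 0
  then show ?case using \<rho> 0[of x 0] by auto
next
  case (Suc n)
  show ?case
  proof (cases "x \<in> C")
    case True
    then show ?thesis using Suc.prems[of x "Suc n"] by simp
  next
    case False
    have b: "0 \<le> avoid K C n y" "avoid K C n y \<le> 1" for y using killed_bounds[of "\<lambda>_. 1" 1] by auto
    have "(1 - \<rho>) * (1 - avoid K C (Suc n) x) = (\<integral>y. (1 - \<rho>) * (1 - avoid K C n y) \<partial>measure_pmf (K x))"
      using False b by (simp add: integrable_pmf_bounded[where C=1])
    also have "\<dots> \<le> (\<integral>y. measure (measure_pmf (nstep K n y)) D \<partial>measure_pmf (K x))"
      using b Suc.prems \<rho>
      by (intro integral_mono integrable_mult_right integrable_pmf_bounded[where C=1] Suc.IH) auto
    also have "\<dots> = measure (measure_pmf (nstep K (Suc n) x)) D"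
      unfolding nstep_Suc_first measure_bind_pmf_eq ..
    finally show ?thesis .
  qed
qed

subsection \<open>Expected number of visits\<close>

text \<open>The expected number of times i \<le> n at which the chain is in A, the start
  included.\<close>

primrec visits :: "('s \<Rightarrow> 's pmf) \<Rightarrow> 's set \<Rightarrow> nat \<Rightarrow> 's \<Rightarrow> real"
  where
    "visits K A 0 x = indicator A x"
  | "visits K A (Suc n) x = indicator A x + (\<integral>y. visits K A n y \<partial>measure_pmf (K x))"

lemma visits_bounds: "0 \<le> visits K A n x" "visits K A n x \<le> real (Suc n)"
proof -
  have "0 \<le> visits K A n x \<and> visits K A n x \<le> real (Suc n)"
  proof (induction n arbitrary: x)
    case (Suc n)
    have "(\<integral>y. visits K A n y \<partial>measure_pmf (K x)) \<le> (\<integral>y. real (Suc n) \<partial>measure_pmf (K x))"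
      using Suc by (intro integral_mono integrable_pmf_bounded[where C="real (Suc n)"]) auto
    moreover have "0 \<le> (\<integral>y. visits K A n y \<partial>measure_pmf (K x))"
      using Suc by (intro Bochner_Integration.integral_nonneg) auto
    ultimately show ?case by (auto simp: indicator_def)
  qed (auto simp: indicator_def)
  then show "0 \<le> visits K A n x" "visits K A n x \<le> real (Suc n)" by auto
qed

lemma abs_visits_le: "\<bar>visits K A n x\<bar> \<le> real (Suc n)"
  unfolding abs_of_nonneg[OF visits_bounds(1)] by (rule visits_bounds(2))

lemma integrable_visits: "integrable (measure_pmf p) (visits K A n)"
  by (rule integrable_pmf_bounded) (rule abs_visits_le)

lemma visits_mono: "m \<le> n \<Longrightarrow> visits K A m x \<le> visits K A n x"
proof (rule lift_Suc_mono_le[of "\<lambda>n. visits K A n x"])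
  fix n
  show "visits K A n x \<le> visits K A (Suc n) x"
  proof (induction n arbitrary: x)
    case 0
    show ?case using visits_bounds(1)[of K A 0] by (simp del: visits.simps(1) add: visits.simps(1)[of K A x])
  next
    case (Suc n)
    have "(\<integral>y. visits K A n y \<partial>measure_pmf (K x)) \<le> (\<integral>y. visits K A (Suc n) y \<partial>measure_pmf (K x))"
      by (intro integral_mono integrable_visits Suc.IH)
    then show ?case by simp
  qed
qed

text \<open>No visit is counted before A is hit, and from the first point of A on at most V are
  expected.\<close>

lemma visits_first_hit:
  assumes Q: "\<And>x y. x \<in> Q \<Longrightarrow> y \<in> set_pmf (K x) \<Longrightarrow> y \<in> Q"
    and V: "\<And>u. u \<in> A \<inter> Q \<Longrightarrow> visits K A n u \<le> V" and "0 \<le> V" and "x \<in> Q" and "m \<le> n"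
  shows "visits K A m x \<le> (1 - avoid K A m x) * V"
  using assms(4,5)
proof (induction m arbitrary: x)
  case 0
  then show ?case using V[of x] visits_mono[of 0 n K A x] \<open>0 \<le> V\<close> by (auto simp: indicator_def)
next
  case (Suc m)
  show ?case
  proof (cases "x \<in> A")
    case True
    then show ?thesis using V[of x] Suc.prems visits_mono[of "Suc m" n K A x] by auto
  next
    case False
    have b: "0 \<le> avoid K A m y" "avoid K A m y \<le> 1" for y using killed_bounds[of "\<lambda>_. 1" 1] by auto
    have "visits K A (Suc m) x = (\<integral>y. visits K A m y \<partial>measure_pmf (K x))" using False by simp
    also have "\<dots> \<le> (\<integral>y. (1 - avoid K A m y) * V \<partial>measure_pmf (K x))"
      using Suc Q b
      by (intro integral_mono_AE integrable_visits integrable_mult_left integrable_pmf_bounded[where C=1] AE_pmfI) auto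
    also have "\<dots> = (1 - avoid K A (Suc m) x) * V"
      using False b by (simp add: integrable_pmf_bounded[where C=1])
    finally show ?thesis .
  qed
qed

text \<open>Each of the first j steps contributes at most one visit; by monotonicity in n the full
  horizon can be kept for the rest.\<close>

lemma visits_after:
  "visits K A n x \<le> real j + (\<integral>y. visits K A n y \<partial>measure_pmf (nstep K j x))"
proof (induction j arbitrary: x)
  case 0
  show ?case by simp
next
  case (Suc j)
  have i: "integrable (measure_pmf (K x)) (\<lambda>y. \<integral>w. visits K A n w \<partial>measure_pmf (nstep K j y))"
  proof (rule integrable_pmf_bounded)
    fix y
    have "(\<integral>w. visits K A n w \<partial>measure_pmf (nstep K j y)) \<le> (\<integral>w. real (Suc n) \<partial>measure_pmf (nstep K j y))"
      using visits_bounds by (intro integral_mono integrable_visits) auto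
    moreover have "0 \<le> (\<integral>w. visits K A n w \<partial>measure_pmf (nstep K j y))"
      using visits_bounds by (intro Bochner_Integration.integral_nonneg) auto
    ultimately show "\<bar>\<integral>w. visits K A n w \<partial>measure_pmf (nstep K j y)\<bar> \<le> real (Suc n)" by simp
  qed
  have "visits K A n x \<le> visits K A (Suc n) x" by (rule visits_mono) simp
  also have "\<dots> \<le> 1 + (\<integral>y. visits K A n y \<partial>measure_pmf (K x))" by (simp add: indicator_def)
  also have "(\<integral>y. visits K A n y \<partial>measure_pmf (K x)) \<le>
      (\<integral>y. real j + (\<integral>w. visits K A n w \<partial>measure_pmf (nstep K j y)) \<partial>measure_pmf (K x))"
    by (intro integral_mono integrable_visits Suc.IH Bochner_Integration.integrable_add i) simp
  also have "\<dots> = real j + (\<integral>y. \<integral>w. visits K A n w \<partial>measure_pmf (nstep K j y) \<partial>measure_pmf (K x))"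
    by (subst Bochner_Integration.integral_add[OF _ i]) auto
  also have "(\<integral>y. \<integral>w. visits K A n w \<partial>measure_pmf (nstep K j y) \<partial>measure_pmf (K x)) =
      (\<integral>w. visits K A n w \<partial>measure_pmf (nstep K (Suc j) x))"
    unfolding nstep_Suc_first
    by (rule integral_bind_pmf_real[symmetric]) (rule abs_visits_le)
  finally show ?case by simp
qed

text \<open>
  If from every visited point of \<open>A\<close> the chain can reach a point from which it avoids \<open>A\<close> with
  probability \<open>a\<close>, the number of visits is dominated by a geometric variable.
\<close>

lemma visits_le:
  assumes Q: "\<And>x y. x \<in> Q \<Longrightarrow> y \<in> set_pmf (K x) \<Longrightarrow> y \<in> Q" and A: "finite A"
    and reach: "\<And>u. u \<in> A \<inter> Q \<Longrightarrow> \<exists>j\<le>J. \<exists>w. pmf (nstep K j u) w \<ge> r \<and> avoid K A n w \<ge> a"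
    and r: "0 < r" and a: "0 < a" and z: "z \<in> Q"
  shows "visits K A n z \<le> real J / (r * a)"
proof (cases "A \<inter> Q = {}")
  case True
  have "visits K A n z \<le> (1 - avoid K A n z) * 0"
    by (rule visits_first_hit[where Q=Q and n=n]) (use Q True z in auto)
  then show ?thesis using r a by (simp add: order_trans[OF _ divide_nonneg_nonneg])
next
  case False
  define V where "V = Max (visits K A n ` (A \<inter> Q))"
  have fin: "finite (visits K A n ` (A \<inter> Q))" using A by simp
  have V: "visits K A n u \<le> V" if "u \<in> A \<inter> Q" for u
    unfolding V_def using fin that by (intro Max_ge) auto
  have V0: "0 \<le> V" using V visits_bounds(1) False by (metis ex_in_conv order_trans)
  have Qn: "y \<in> Q" if "x \<in> Q" "y \<in> set_pmf (nstep K j x)" for x y j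
    using that by (induction j arbitrary: y) (use Q in auto)
  \<comment> \<open>The maximum V is attained at some u, so bounding the visits from u in terms of V
    gives the self-consistent inequality V \<le> J + (1 - r a) V, which is solved for V.\<close>
  have "V \<in> visits K A n ` (A \<inter> Q)" unfolding V_def using fin False by (intro Max_in) auto
  then obtain u where u: "u \<in> A \<inter> Q" "V = visits K A n u" by auto
  from reach[OF u(1)] obtain j w where j: "j \<le> J" and w: "pmf (nstep K j u) w \<ge> r" "avoid K A n w \<ge> a" by blast
  have b: "0 \<le> avoid K A n y" "avoid K A n y \<le> 1" for y using killed_bounds[of "\<lambda>_. 1" 1] by auto
  have fh: "visits K A n y \<le> (1 - avoid K A n y) * V" if "y \<in> Q" for y
    by (rule visits_first_hit[where Q=Q and n=n]) (use Q V V0 that in auto)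
  have "V \<le> real j + (\<integral>y. visits K A n y \<partial>measure_pmf (nstep K j u))" unfolding u(2) by (rule visits_after)
  also have "(\<integral>y. visits K A n y \<partial>measure_pmf (nstep K j u)) \<le> (\<integral>y. (1 - avoid K A n y) * V \<partial>measure_pmf (nstep K j u))"
    using fh Qn u(1) b
    by (intro integral_mono_AE integrable_visits integrable_mult_left integrable_pmf_bounded[where C=1] AE_pmfI) auto
  also have "\<dots> = (1 - (\<integral>y. avoid K A n y \<partial>measure_pmf (nstep K j u))) * V"
    using b by (simp add: integrable_pmf_bounded[where C=1])
  also have "\<dots> \<le> (1 - r * a) * V"
  proof (rule mult_right_mono)
    have "r * a \<le> pmf (nstep K j u) w * avoid K A n w" using w r a by (intro mult_mono) auto
    also have "\<dots> = (\<integral>y. avoid K A n w * indicator {w} y \<partial>measure_pmf (nstep K j u))"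
      by (simp add: measure_pmf_single)
    also have "\<dots> \<le> (\<integral>y. avoid K A n y \<partial>measure_pmf (nstep K j u))"
      using b by (intro integral_mono integrable_pmf_bounded[where C=1]) (auto simp: indicator_def)
    finally show "1 - (\<integral>y. avoid K A n y \<partial>measure_pmf (nstep K j u)) \<le> 1 - r * a" by simp
  qed (rule V0)
  finally have "r * a * V \<le> real J" using j by (simp add: algebra_simps)
  then have VJ: "V \<le> real J / (r * a)" using r a by (simp add: pos_le_divide_eq mult.commute)
  have "visits K A n z \<le> (1 - avoid K A n z) * V"
    by (rule fh[OF z])
  also have "\<dots> \<le> 1 * V" using b V0 by (intro mult_right_mono) auto
  finally show ?thesis using VJ by simp
qed

section \<open>Random walks with B-type jumps\<close>

lemma real_vec_add: "real_vec (x + y) = real_vec x + real_vec y"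
  and real_vec_diff: "real_vec (x - y) = real_vec x - real_vec y"
  and real_vec_0 [simp]: "real_vec 0 = 0"
  by (simp_all add: real_vec_def vec_eq_iff)

lemma nstep_walk: "nstep (walk_kernel p) n x = map_pmf (\<lambda>y. x + y) (nstep (walk_kernel p) n 0)"
proof (induction n)
  case (Suc n)
  have "nstep (walk_kernel p) (Suc n) x = bind_pmf (nstep (walk_kernel p) n 0) (\<lambda>y. walk_kernel p (x + y))"
    by (simp add: Suc.IH bind_map_pmf)
  also have "\<dots> = map_pmf (\<lambda>y. x + y) (nstep (walk_kernel p) (Suc n) 0)"
    by (simp add: map_bind_pmf walk_kernel_def pmf.map_comp o_def add.assoc)
  finally show ?case .
qed simp

lemma cf_nstep: "(\<integral>y. iexp (v \<bullet> real_vec y) \<partial>measure_pmf (nstep (walk_kernel p) n 0)) = cf p v ^ n"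
proof (induction n)
  case (Suc n)
  have step: "(\<integral>w. iexp (v \<bullet> real_vec w) \<partial>measure_pmf (walk_kernel p y)) = iexp (v \<bullet> real_vec y) * cf p v" for y
  proof -
    have "(\<integral>w. iexp (v \<bullet> real_vec w) \<partial>measure_pmf (walk_kernel p y)) =
        (\<integral>w. iexp (v \<bullet> real_vec y) * iexp (v \<bullet> real_vec w) \<partial>measure_pmf p)"
      unfolding walk_kernel_def by (simp add: real_vec_add inner_add_right distrib_left exp_add)
    then show ?thesis by (simp add: cf_def)
  qed
  have "(\<integral>y. iexp (v \<bullet> real_vec y) \<partial>measure_pmf (nstep (walk_kernel p) (Suc n) 0)) =
      (\<integral>y. \<integral>w. iexp (v \<bullet> real_vec w) \<partial>measure_pmf (walk_kernel p y) \<partial>measure_pmf (nstep (walk_kernel p) n 0))"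
    unfolding nstep.simps by (rule integral_bind_pmf_complex[where C=1]) simp
  also have "\<dots> = (\<integral>y. iexp (v \<bullet> real_vec y) \<partial>measure_pmf (nstep (walk_kernel p) n 0)) * cf p v"
    unfolding step by simp
  finally show ?case unfolding Suc.IH by (simp add: mult.commute)
qed simp

text \<open>Independence of the increments in the form needed for the limit: the joint
  characteristic function is a product. The frequency may change with the step, which later allows
  one frequency per block.\<close>

lemma cf_walk_increments:
  fixes p :: "(int^'d) pmf"
  shows "(\<integral>l. iexp (\<Sum>k<n. w k \<bullet> real_vec (l ! Suc k - l ! k)) \<partial>measure_pmf (chain_path (walk_kernel p) n x)) = (\<Prod>k<n. cf p (w k))"
proof (induction n arbitrary: x w)
  case (Suc n)
  define F where "F = (\<lambda>l :: (int^'d) list. iexp (\<Sum>k<Suc n. w k \<bullet> real_vec (l ! Suc k - l ! k)))"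
  have step: "(\<integral>l. F (x # l) \<partial>measure_pmf (chain_path (walk_kernel p) n y)) =
      iexp (w 0 \<bullet> real_vec (y - x)) * (\<Prod>k<n. cf p (w (Suc k)))" for y
  proof -
    have "(\<integral>l. F (x # l) \<partial>measure_pmf (chain_path (walk_kernel p) n y)) =
        (\<integral>l. iexp (w 0 \<bullet> real_vec (y - x)) * iexp (\<Sum>k<n. w (Suc k) \<bullet> real_vec (l ! Suc k - l ! k))
          \<partial>measure_pmf (chain_path (walk_kernel p) n y))"
    proof (rule integral_cong_AE)
      show "AE l in measure_pmf (chain_path (walk_kernel p) n y). F (x # l) =
          iexp (w 0 \<bullet> real_vec (y - x)) * iexp (\<Sum>k<n. w (Suc k) \<bullet> real_vec (l ! Suc k - l ! k))"
      proof (rule AE_pmfI)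
        fix l assume "l \<in> set_pmf (chain_path (walk_kernel p) n y)"
        then have "l ! 0 = y" by (rule hd_chain_path)
        then show "F (x # l) = iexp (w 0 \<bullet> real_vec (y - x)) * iexp (\<Sum>k<n. w (Suc k) \<bullet> real_vec (l ! Suc k - l ! k))"
          unfolding F_def sum.lessThan_Suc_shift by (simp add: distrib_left exp_add)
      qed
    qed auto
    also have "\<dots> = iexp (w 0 \<bullet> real_vec (y - x)) *
        (\<integral>l. iexp (\<Sum>k<n. w (Suc k) \<bullet> real_vec (l ! Suc k - l ! k)) \<partial>measure_pmf (chain_path (walk_kernel p) n y))"
      by (rule integral_mult_right_zero)
    finally show ?thesis unfolding Suc.IH[where w="\<lambda>k. w (Suc k)"] .
  qed
  have "(\<integral>l. F l \<partial>measure_pmf (chain_path (walk_kernel p) (Suc n) x)) =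
      (\<integral>y. \<integral>l. F (x # l) \<partial>measure_pmf (chain_path (walk_kernel p) n y) \<partial>measure_pmf (walk_kernel p x))"
    unfolding chain_path.simps
    by (subst integral_bind_pmf_complex[where C=1]) (simp_all only: F_def norm_exp_i_times order_refl integral_map_pmf)
  also have "\<dots> = (\<integral>y. iexp (w 0 \<bullet> real_vec (y - x)) \<partial>measure_pmf (walk_kernel p x)) * (\<Prod>k<n. cf p (w (Suc k)))"
    unfolding step by simp
  also have "(\<integral>y. iexp (w 0 \<bullet> real_vec (y - x)) \<partial>measure_pmf (walk_kernel p x)) = cf p (w 0)"
    by (simp add: walk_kernel_def cf_def)
  finally show ?case unfolding F_def prod.lessThan_Suc_shift .
qed simp

lemma std_normal_fourth_moment: "(\<integral>x. x ^ 4 \<partial>std_normal_distribution) = 3"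
  using std_normal_distribution_even_moments(1)[of 2] by (simp add: eval_nat_numeral)

section \<open>Limit theorem, small-time tails and maximal inequality for the walk\<close>

context
  fixes p :: "(int^'d) pmf" and B :: "nat \<Rightarrow> real" and S :: "real^'d^'d"
  assumes B_type: "B_type p B S"
begin

lemma walk_weak_limit:
  fixes h :: "real \<Rightarrow> real"
  assumes conv: "\<And>\<theta>. (\<lambda>r. cf p ((1 / B (m r)) *\<^sub>R (\<theta> *\<^sub>R v)) ^ k r) \<longlonglongrightarrow> of_real (exp (- (\<theta> * s)\<^sup>2 / 2))"
    and h: "continuous_on UNIV h" "\<And>x. \<bar>h x\<bar> \<le> D"
  shows "(\<lambda>r. \<integral>y. h ((v \<bullet> real_vec y) / B (m r)) \<partial>measure_pmf (nstep (walk_kernel p) (k r) 0)) \<longlonglongrightarrow>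
    (\<integral>x. h (s * x) \<partial>std_normal_distribution)"
proof -
  interpret N: real_distribution std_normal_distribution by (rule real_dist_normal_dist)
  have "(\<lambda>r. \<integral>y. 1 * h ((v \<bullet> real_vec y) / B (m r)) \<partial>measure_pmf (nstep (walk_kernel p) (k r) 0)) \<longlonglongrightarrow>
    (\<integral>x. 1 * h (s * x) \<partial>std_normal_distribution)"
  proof (rule weighted_levy[where C=1 and D=D and T="\<lambda>_ _. 1" and T'="\<lambda>_. 1"
        and X="\<lambda>r y. (v \<bullet> real_vec y) / B (m r)" and X'="\<lambda>x. s * x" and h=h])
    fix \<theta> :: real
    have "(\<integral>y. 1 *\<^sub>R iexp (\<theta> * (v \<bullet> real_vec y / B (m r))) \<partial>measure_pmf (nstep (walk_kernel p) (k r) 0)) =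
        cf p ((1 / B (m r)) *\<^sub>R (\<theta> *\<^sub>R v)) ^ k r" for r
      unfolding cf_nstep[symmetric] by (simp add: mult.commute)
    moreover have "(\<integral>x. 1 *\<^sub>R iexp (\<theta> * (s * x)) \<partial>std_normal_distribution) = of_real (exp (- (\<theta> * s)\<^sup>2 / 2))"
      using fun_cong[OF char_std_normal_distribution, of "\<theta> * s"] by (simp add: char_def mult.assoc)
    ultimately show "(\<lambda>r. \<integral>y. 1 *\<^sub>R iexp (\<theta> * (v \<bullet> real_vec y / B (m r))) \<partial>measure_pmf (nstep (walk_kernel p) (k r) 0)) \<longlonglongrightarrow>
        (\<integral>x. 1 *\<^sub>R iexp (\<theta> * (s * x)) \<partial>std_normal_distribution)"
      using conv[of \<theta>] by (simp only:)
  qed (use h in \<open>auto intro: prob_space_measure_pmf N.prob_space_axioms\<close>)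
  then show ?thesis by simp
qed

lemma walk_clt:
  fixes h :: "real \<Rightarrow> real"
  assumes k: "(\<lambda>n. real (k n) / real n) \<longlonglongrightarrow> t" and t: "t \<ge> 0"
    and h: "continuous_on UNIV h" "\<And>x. \<bar>h x\<bar> \<le> D"
  shows "(\<lambda>n. \<integral>y. h ((v \<bullet> real_vec y) / B n) \<partial>measure_pmf (nstep (walk_kernel p) (k n) 0)) \<longlonglongrightarrow>
    (\<integral>x. h (sqrt (t * (v \<bullet> (S *v v))) * x) \<partial>std_normal_distribution)"
proof (rule walk_weak_limit[OF _ h])
  fix \<theta>
  have "(sqrt (t * (v \<bullet> (S *v v))))\<^sup>2 = t * (v \<bullet> (S *v v))"
    using t S_nonneg[OF B_type, of v] by simp
  then have "- t * ((\<theta> *\<^sub>R v) \<bullet> (S *v (\<theta> *\<^sub>R v))) / 2 = - (\<theta> * sqrt (t * (v \<bullet> (S *v v))))\<^sup>2 / 2"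
    unfolding quadratic_form_scaleR power_mult_distrib by (simp add: mult.commute mult.left_commute)
  then show "(\<lambda>n. cf p ((1 / B n) *\<^sub>R (\<theta> *\<^sub>R v)) ^ k n) \<longlonglongrightarrow> of_real (exp (- (\<theta> * sqrt (t * (v \<bullet> (S *v v))))\<^sup>2 / 2))"
    using cf_power_tendsto_fraction[OF B_type k, of "\<theta> *\<^sub>R v"] by (simp only:)
qed

lemma prob_le_integral:
  fixes h :: "'s \<Rightarrow> real"
  assumes "\<And>y. y \<in> E \<Longrightarrow> 1 \<le> h y" "\<And>y. 0 \<le> h y" "\<And>y. h y \<le> C"
  shows "measure (measure_pmf q) E \<le> (\<integral>y. h y \<partial>measure_pmf q)"
proof -
  have "(\<integral>y. indicator E y \<partial>measure_pmf q) \<le> (\<integral>y. h y \<partial>measure_pmf q)"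
    using assms
    by (intro integral_mono integrable_pmf_bounded[where C="max 1 C"])
      (auto simp: indicator_def abs_le_iff le_max_iff_disj intro: order_trans[of _ 0])
  then show ?thesis by simp
qed

text \<open>Otherwise there are m r tending to infinity and k r \<le> m r / (r + 1) whose tails
  exceed \<rho>. Since n |cf - 1| converges at the scale \<open>B n\<close>, the powers with
  exponent k r tend to 1, so the normed walk tends to 0 in probability, a contradiction.\<close>

lemma coordinate_tail_small:
  assumes \<delta>: "\<delta> > 0" and \<rho>: "\<rho> > 0"
  shows "\<exists>\<eta>>0. \<forall>\<^sub>F n in sequentially. \<forall>j. real j \<le> \<eta> * real n \<longrightarrow>
    measure (measure_pmf (nstep (walk_kernel p) j 0)) {y. \<delta> * B n \<le> \<bar>v \<bullet> real_vec y\<bar>} \<le> \<rho>"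
proof (rule ccontr)
  define bad where "bad = (\<lambda>n j. \<rho> < measure (measure_pmf (nstep (walk_kernel p) j 0)) {y. \<delta> * B n \<le> \<bar>v \<bullet> real_vec y\<bar>})"
  assume contr: "\<not> ?thesis"
  have "\<exists>n j. n \<ge> Suc r \<and> real j \<le> 1 / real (Suc r) * real n \<and> bad n j" for r
  proof (rule ccontr)
    assume "\<not> ?thesis"
    then have "\<forall>n\<ge>Suc r. \<forall>j. real j \<le> 1 / real (Suc r) * real n \<longrightarrow>
        measure (measure_pmf (nstep (walk_kernel p) j 0)) {y. \<delta> * B n \<le> \<bar>v \<bullet> real_vec y\<bar>} \<le> \<rho>"
      by (auto simp: bad_def not_less)
    then have "\<forall>\<^sub>F n in sequentially. \<forall>j. real j \<le> 1 / real (Suc r) * real n \<longrightarrow>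
        measure (measure_pmf (nstep (walk_kernel p) j 0)) {y. \<delta> * B n \<le> \<bar>v \<bullet> real_vec y\<bar>} \<le> \<rho>"
      using eventually_sequentially by blast
    moreover have "1 / real (Suc r) > 0" by simp
    ultimately show False using contr by blast
  qed
  then obtain m k where mk: "\<And>r. m r \<ge> Suc r" "\<And>r. real (k r) \<le> 1 / real (Suc r) * real (m r)" "\<And>r. bad (m r) (k r)"
    by metis
  have m_lim: "filterlim m at_top sequentially"
    using mk(1) by (intro filterlim_at_top_mono[OF filterlim_ident]) (auto intro: order_trans[of _ "Suc _"] eventuallyI Suc_leD)
  have conv: "(\<lambda>r. cf p ((1 / B (m r)) *\<^sub>R (\<theta> *\<^sub>R v)) ^ k r) \<longlonglongrightarrow> of_real (exp (- (\<theta> * 0)\<^sup>2 / 2))" for \<theta>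
  proof -
    define d where "d = (\<lambda>n. norm (of_nat n * (cf p ((1 / B n) *\<^sub>R (\<theta> *\<^sub>R v)) - 1)))"
    obtain l where "d \<longlonglongrightarrow> l" unfolding d_def using tendsto_norm[OF cf_derivative[OF B_type]] by blast
    then have "(\<lambda>r. d (m r)) \<longlonglongrightarrow> l" using m_lim by (rule filterlim_compose)
    then have "(\<lambda>r. inverse (real (Suc r)) * d (m r)) \<longlonglongrightarrow> 0 * l"
      by (intro tendsto_mult LIMSEQ_inverse_real_of_nat)
    then have lim0: "(\<lambda>r. inverse (real (Suc r)) * d (m r)) \<longlonglongrightarrow> 0" by simp
    have "(\<lambda>r. cf p ((1 / B (m r)) *\<^sub>R (\<theta> *\<^sub>R v)) ^ k r - 1) \<longlonglongrightarrow> 0"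
    proof (rule Lim_null_comparison[OF always_eventually lim0], rule allI)
      fix r
      define z where "z = cf p ((1 / B (m r)) *\<^sub>R (\<theta> *\<^sub>R v))"
      have "norm (z ^ k r - 1 ^ k r) \<le> real (k r) * norm (z - 1)"
        unfolding z_def by (intro norm_power_diff norm_cf_le_1) auto
      also have "\<dots> \<le> (1 / real (Suc r) * real (m r)) * norm (z - 1)"
        by (intro mult_right_mono mk) auto
      also have "\<dots> = inverse (real (Suc r)) * d (m r)"
        unfolding d_def z_def norm_mult by (simp add: divide_inverse mult.assoc)
      finally show "norm (cf p ((1 / B (m r)) *\<^sub>R (\<theta> *\<^sub>R v)) ^ k r - 1) \<le> inverse (real (Suc r)) * d (m r)"
        by (simp add: z_def)
    qed
    then show ?thesis by (simp add: LIM_zero_iff)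
  qed
  define h where "h = (\<lambda>x :: real. min 1 (\<bar>x\<bar> / \<delta>))"
  have "(\<lambda>r. \<integral>y. h ((v \<bullet> real_vec y) / B (m r)) \<partial>measure_pmf (nstep (walk_kernel p) (k r) 0)) \<longlonglongrightarrow>
    (\<integral>x. h (0 * x) \<partial>std_normal_distribution)"
    using \<delta> by (intro walk_weak_limit[OF conv, where D=1])
      (auto simp: h_def divide_inverse abs_le_iff intro!: continuous_intros intro: order_trans[of _ 0])
  then have "(\<lambda>r. \<integral>y. h ((v \<bullet> real_vec y) / B (m r)) \<partial>measure_pmf (nstep (walk_kernel p) (k r) 0)) \<longlonglongrightarrow> 0"
    by (simp add: h_def)
  then have "\<forall>\<^sub>F r in sequentially. (\<integral>y. h ((v \<bullet> real_vec y) / B (m r)) \<partial>measure_pmf (nstep (walk_kernel p) (k r) 0)) < \<rho>"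
    using \<rho> by (rule order_tendstoD(2))
  then obtain r where r: "(\<integral>y. h ((v \<bullet> real_vec y) / B (m r)) \<partial>measure_pmf (nstep (walk_kernel p) (k r) 0)) < \<rho>"
    by (auto simp: eventually_sequentially)
  have Bm: "B (m r) > 0" using mk(1)[of r] by (intro B_pos[OF B_type]) simp
  have "measure (measure_pmf (nstep (walk_kernel p) (k r) 0)) {y. \<delta> * B (m r) \<le> \<bar>v \<bullet> real_vec y\<bar>} \<le>
      (\<integral>y. h ((v \<bullet> real_vec y) / B (m r)) \<partial>measure_pmf (nstep (walk_kernel p) (k r) 0))"
    using \<delta> Bm by (intro prob_le_integral[where C=1]) (auto simp: h_def abs_mult field_simps)
  then show False using mk(3)[of r] r by (simp add: bad_def)
qed

lemma norm_tail_le_coordinates: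
  assumes "a > 0"
  shows "measure (measure_pmf q) {y :: int^'d. a \<le> norm (real_vec y)} \<le>
    (\<Sum>i\<in>UNIV. measure (measure_pmf q) {y. a / real CARD('d) \<le> \<bar>axis i 1 \<bullet> real_vec y\<bar>})"
proof -
  have "\<exists>i. a / real CARD('d) \<le> \<bar>axis i 1 \<bullet> real_vec y\<bar>" if "a \<le> norm (real_vec y)" for y :: "int^'d"
  proof (rule ccontr)
    assume "\<not> ?thesis"
    then have "\<bar>real_vec y $ i\<bar> < a / real CARD('d)" for i by (simp add: inner_axis' not_le)
    then have "(\<Sum>i\<in>UNIV. \<bar>real_vec y $ i\<bar>) < (\<Sum>i\<in>(UNIV :: 'd set). a / real CARD('d))"
      by (intro sum_strict_mono) auto
    then show False using norm_le_l1_cart[of "real_vec y"] that by simp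
  qed
  then have "{y :: int^'d. a \<le> norm (real_vec y)} \<subseteq> (\<Union>i\<in>UNIV. {y. a / real CARD('d) \<le> \<bar>axis i 1 \<bullet> real_vec y\<bar>})"
    by auto
  then have "measure (measure_pmf q) {y :: int^'d. a \<le> norm (real_vec y)} \<le>
      measure (measure_pmf q) (\<Union>i\<in>UNIV. {y. a / real CARD('d) \<le> \<bar>axis i 1 \<bullet> real_vec y\<bar>})"
    by (intro measure_pmf.finite_measure_mono) auto
  also have "\<dots> \<le> (\<Sum>i\<in>UNIV. measure (measure_pmf q) {y. a / real CARD('d) \<le> \<bar>axis i 1 \<bullet> real_vec y\<bar>})"
    by (intro measure_pmf.finite_measure_subadditive_finite) auto
  finally show ?thesis .
qed

lemma tail_small:
  assumes \<delta>: "\<delta> > 0" and \<rho>: "\<rho> > 0"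
  shows "\<exists>\<eta>>0. \<forall>\<^sub>F n in sequentially. \<forall>j. real j \<le> \<eta> * real n \<longrightarrow>
    measure (measure_pmf (nstep (walk_kernel p) j 0)) {y. \<delta> * B n \<le> norm (real_vec y)} \<le> \<rho>"
proof -
  have d: "real CARD('d) > 0" by simp
  have "\<forall>i. \<exists>\<eta>. \<eta> > 0 \<and> (\<forall>\<^sub>F n in sequentially. \<forall>j. real j \<le> \<eta> * real n \<longrightarrow>
    measure (measure_pmf (nstep (walk_kernel p) j 0)) {y. \<delta> / real CARD('d) * B n \<le> \<bar>axis i 1 \<bullet> real_vec y\<bar>} \<le> \<rho> / real CARD('d))"
    using \<delta> \<rho> d by (intro allI coordinate_tail_small) auto
  from choice[OF this] obtain \<eta> where "\<forall>i. \<eta> i > 0 \<and> (\<forall>\<^sub>F n in sequentially. \<forall>j. real j \<le> \<eta> i * real n \<longrightarrow>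
    measure (measure_pmf (nstep (walk_kernel p) j 0)) {y. \<delta> / real CARD('d) * B n \<le> \<bar>axis i 1 \<bullet> real_vec y\<bar>} \<le> \<rho> / real CARD('d))"
    by blast
  then have \<eta>: "\<And>i. \<eta> i > 0" "\<And>i. \<forall>\<^sub>F n in sequentially. \<forall>j. real j \<le> \<eta> i * real n \<longrightarrow>
    measure (measure_pmf (nstep (walk_kernel p) j 0)) {y. \<delta> / real CARD('d) * B n \<le> \<bar>axis i 1 \<bullet> real_vec y\<bar>} \<le> \<rho> / real CARD('d)"
    by blast+
  have "\<forall>\<^sub>F n in sequentially. \<forall>i\<in>UNIV. \<forall>j. real j \<le> \<eta> i * real n \<longrightarrow>
    measure (measure_pmf (nstep (walk_kernel p) j 0)) {y. \<delta> / real CARD('d) * B n \<le> \<bar>axis i 1 \<bullet> real_vec y\<bar>} \<le> \<rho> / real CARD('d)"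
    by (intro eventually_ball_finite ballI \<eta>(2) finite)
  then have "\<forall>\<^sub>F n in sequentially. \<forall>j. real j \<le> Min (range \<eta>) * real n \<longrightarrow>
    measure (measure_pmf (nstep (walk_kernel p) j 0)) {y. \<delta> * B n \<le> norm (real_vec y)} \<le> \<rho>"
    using eventually_ge_at_top[of 1]
  proof eventually_elim
    case (elim n)
    show ?case
    proof (intro allI impI)
      fix j assume j: "real j \<le> Min (range \<eta>) * real n"
      have "Min (range \<eta>) * real n \<le> \<eta> i * real n" for i by (intro mult_right_mono) auto
      then have ji: "real j \<le> \<eta> i * real n" for i using j order_trans by blast
      have "measure (measure_pmf (nstep (walk_kernel p) j 0)) {y. \<delta> * B n \<le> norm (real_vec y)} \<le>
          (\<Sum>i\<in>UNIV. measure (measure_pmf (nstep (walk_kernel p) j 0)) {y. \<delta> * B n / real CARD('d) \<le> \<bar>axis i 1 \<bullet> real_vec y\<bar>})"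
        using \<delta> B_pos[OF B_type elim(2)] by (intro norm_tail_le_coordinates) auto
      also have "\<dots> \<le> (\<Sum>i\<in>(UNIV :: 'd set). \<rho> / real CARD('d))"
        using elim(1) ji by (intro sum_mono) simp
      also have "\<dots> = \<rho>" by simp
      finally show "measure (measure_pmf (nstep (walk_kernel p) j 0)) {y. \<delta> * B n \<le> norm (real_vec y)} \<le> \<rho>" .
    qed
  qed
  moreover have "Min (range \<eta>) > 0" using \<eta>(1) by (subst Min_gr_iff) auto
  ultimately show ?thesis by blast
qed

text \<open>Once the walk is at distance 2 a from x, a further displacement below a leaves it at
  distance at least a.\<close>

lemma walk_ottaviani:
  assumes "\<And>m. m \<le> n \<Longrightarrow> measure (measure_pmf (nstep (walk_kernel p) m 0)) {y. a \<le> norm (real_vec y)} \<le> \<rho>" and \<rho>: "\<rho> \<le> 1"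
  shows "(1 - \<rho>) * (1 - avoid (walk_kernel p) {y. 2 * a \<le> norm (real_vec (y - x))} n x) \<le>
    measure (measure_pmf (nstep (walk_kernel p) n 0)) {y. a \<le> norm (real_vec y)}"
proof -
  define D where "D = {y. a \<le> norm (real_vec (y - x))}"
  have "(1 - \<rho>) * (1 - avoid (walk_kernel p) {y. 2 * a \<le> norm (real_vec (y - x))} n x) \<le> measure (measure_pmf (nstep (walk_kernel p) n x)) D"
  proof (rule ottaviani[OF _ \<rho>])
    fix c m assume c: "c \<in> {y. 2 * a \<le> norm (real_vec (y - x))}" and m: "m \<le> n"
    have "1 - measure (measure_pmf (nstep (walk_kernel p) m 0)) {y. a \<le> norm (real_vec y)} =
        measure (measure_pmf (nstep (walk_kernel p) m 0)) (- {y. a \<le> norm (real_vec y)})"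
      using measure_pmf.prob_compl[of "{y. a \<le> norm (real_vec y)}" "nstep (walk_kernel p) m 0"] by (simp add: Compl_eq_Diff_UNIV)
    also have "\<dots> \<le> measure (measure_pmf (nstep (walk_kernel p) m 0)) ((\<lambda>y. c + y) -` D)"
    proof (rule measure_pmf.finite_measure_mono)
      show "- {y. a \<le> norm (real_vec y)} \<subseteq> (\<lambda>y. c + y) -` D"
      proof
        fix y :: "int^'d" assume "y \<in> - {y. a \<le> norm (real_vec y)}"
        then have y: "norm (real_vec y) < a" by simp
        have "real_vec (c - x) = real_vec (c + y - x) - real_vec y" by (simp add: real_vec_add real_vec_diff)
        then have "norm (real_vec (c - x)) \<le> norm (real_vec (c + y - x)) + norm (real_vec y)"
          using norm_triangle_ineq4 by metis
        then show "y \<in> (\<lambda>y. c + y) -` D" using c y by (simp add: D_def)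
      qed
    qed simp
    also have "\<dots> = measure (measure_pmf (nstep (walk_kernel p) m c)) D"
      by (subst nstep_walk) (simp add: measure_map_pmf)
    finally show "1 - \<rho> \<le> measure (measure_pmf (nstep (walk_kernel p) m c)) D" using assms(1)[OF m] by linarith
  qed
  also have "measure (measure_pmf (nstep (walk_kernel p) n x)) D = measure (measure_pmf (nstep (walk_kernel p) n 0)) {y. a \<le> norm (real_vec y)}"
    by (subst nstep_walk) (simp add: measure_map_pmf D_def)
  finally show ?thesis .
qed

lemma maximal_small:
  assumes \<delta>: "\<delta> > 0" and e: "e > 0"
  shows "\<exists>\<eta>>0. \<forall>\<^sub>F n in sequentially. \<forall>j x. real j \<le> \<eta> * real n \<longrightarrow>
    1 - avoid (walk_kernel p) {y. \<delta> * B n \<le> norm (real_vec (y - x))} j x \<le> e"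
proof -
  \<comment> \<open>The maximal inequality divides the tail by 1 - \<rho>, which is at least 1/2; so
    a tail of e/2 is small enough.\<close>
  define \<rho> where "\<rho> = min (1/2) (e / 2)"
  have \<rho>: "\<rho> > 0" "\<rho> \<le> 1/2" "\<rho> \<le> e / 2" using e by (auto simp: \<rho>_def)
  obtain \<eta> where \<eta>: "\<eta> > 0" "\<forall>\<^sub>F n in sequentially. \<forall>j. real j \<le> \<eta> * real n \<longrightarrow>
    measure (measure_pmf (nstep (walk_kernel p) j 0)) {y. \<delta> / 2 * B n \<le> norm (real_vec y)} \<le> \<rho>"
    using tail_small[of "\<delta> / 2" \<rho>] \<delta> \<rho> by auto
  from \<eta>(2) have "\<forall>\<^sub>F n in sequentially. \<forall>j x. real j \<le> \<eta> * real n \<longrightarrow>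
    1 - avoid (walk_kernel p) {y. \<delta> * B n \<le> norm (real_vec (y - x))} j x \<le> e"
  proof eventually_elim
    case (elim n)
    show ?case
    proof (intro allI impI)
      fix j x assume j: "real j \<le> \<eta> * real n"
      define q where "q = 1 - avoid (walk_kernel p) {y. \<delta> * B n \<le> norm (real_vec (y - x))} j x"
      have q0: "0 \<le> q" unfolding q_def using killed_bounds(2)[of "\<lambda>_. 1" 1] by simp
      have "(1 - \<rho>) * (1 - avoid (walk_kernel p) {y. 2 * (\<delta> / 2 * B n) \<le> norm (real_vec (y - x))} j x) \<le>
        measure (measure_pmf (nstep (walk_kernel p) j 0)) {y. \<delta> / 2 * B n \<le> norm (real_vec y)}"
      proof (rule walk_ottaviani)
        fix m assume "m \<le> j"
        then have "real m \<le> \<eta> * real n" using j by (meson of_nat_le_iff order_trans)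
        then show "measure (measure_pmf (nstep (walk_kernel p) m 0)) {y. \<delta> / 2 * B n \<le> norm (real_vec y)} \<le> \<rho>"
          using elim by blast
      qed (use \<rho> in auto)
      also have "\<dots> \<le> \<rho>" using elim j by blast
      finally have "(1 - \<rho>) * q \<le> \<rho>" by (simp add: q_def)
      moreover have "1 / 2 * q \<le> (1 - \<rho>) * q" using \<rho> q0 by (intro mult_right_mono) auto
      ultimately have "q \<le> e" using \<rho> by linarith
      then show "1 - avoid (walk_kernel p) {y. \<delta> * B n \<le> norm (real_vec (y - x))} j x \<le> e" by (simp add: q_def)
    qed
  qed
  then show ?thesis using \<eta>(1) by blast
qed

end

lemma avoid_nonneg: "0 \<le> avoid K C n x"
  by (rule killed_bounds) auto

lemma avoid_le_1: "avoid K C n x \<le> 1"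
  by (rule killed_bounds) auto

section \<open>Oscillation over short blocks, and spread of the walk at the scale of the
  norming\<close>

context
  fixes p :: "(int^'d) pmf" and B :: "nat \<Rightarrow> real" and S :: "real^'d^'d"
  assumes B_type: "B_type p B S"
begin

text \<open>The exponent 4 matters: for t = 1/m the bound is of order 1/m^2, so a sum over m blocks
  still vanishes, whereas a second moment would give only order 1/m per block. The fourth moment is
  that of the normal limit; the test function is capped at 1 so that the limit theorem applies to
  it.\<close>

lemma coordinate_quartic_tail:
  assumes k: "(\<lambda>n. real (k n) / real n) \<longlonglongrightarrow> t" and t: "t \<ge> 0" and a: "a > 0" and e: "e > 0"
  shows "\<forall>\<^sub>F n in sequentially. measure (measure_pmf (nstep (walk_kernel p) (k n) 0)) {y. a * B n \<le> \<bar>v \<bullet> real_vec y\<bar>}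
    \<le> 3 * (t * (v \<bullet> (S *v v)))\<^sup>2 / a ^ 4 + e"
proof -
  interpret N: real_distribution std_normal_distribution by (rule real_dist_normal_dist)
  define h where "h = (\<lambda>x :: real. min 1 ((x / a) ^ 4))"
  define s where "s = sqrt (t * (v \<bullet> (S *v v)))"
  have s2: "s\<^sup>2 = t * (v \<bullet> (S *v v))" unfolding s_def using t S_nonneg[OF B_type, of v] by simp
  have h_cont: "continuous_on UNIV h" unfolding h_def divide_inverse by (intro continuous_intros)
  have h0: "0 \<le> h x" "h x \<le> 1" for x unfolding h_def by auto
  have hm: "h \<in> borel_measurable borel" using h_cont by (rule borel_measurable_continuous_onI)
  have "(\<lambda>n. \<integral>y. h ((v \<bullet> real_vec y) / B n) \<partial>measure_pmf (nstep (walk_kernel p) (k n) 0)) \<longlonglongrightarrow>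
    (\<integral>x. h (s * x) \<partial>std_normal_distribution)"
    unfolding s_def by (rule walk_clt[OF B_type k t h_cont, where D=1]) (use h0 in \<open>simp add: abs_le_iff order_trans[of _ 0]\<close>)
  moreover have "(\<integral>x. h (s * x) \<partial>std_normal_distribution) \<le> (\<integral>x. (s / a) ^ 4 * x ^ 4 \<partial>std_normal_distribution)"
  proof (rule integral_mono)
    show "integrable std_normal_distribution (\<lambda>x. h (s * x))"
      using h0 hm by (intro N.integrable_bounded[where C=1]) auto
    show "integrable std_normal_distribution (\<lambda>x. (s / a) ^ 4 * x ^ 4)"
      by (intro integrable_mult_right integrable_std_normal_distribution_moment)
    show "h (s * x) \<le> (s / a) ^ 4 * x ^ 4" for x
      unfolding h_def by (simp add: power_mult_distrib power_divide)
  qed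
  moreover have "(\<integral>x. (s / a) ^ 4 * x ^ 4 \<partial>std_normal_distribution) = (s / a) ^ 4 * 3"
    using std_normal_fourth_moment by simp
  moreover have "(s / a) ^ 4 * 3 = 3 * (t * (v \<bullet> (S *v v)))\<^sup>2 / a ^ 4"
    unfolding s2[symmetric] by (simp add: power_divide flip: power_mult)
  ultimately have "\<forall>\<^sub>F n in sequentially. (\<integral>y. h ((v \<bullet> real_vec y) / B n) \<partial>measure_pmf (nstep (walk_kernel p) (k n) 0))
      < 3 * (t * (v \<bullet> (S *v v)))\<^sup>2 / a ^ 4 + e"
    using e by (intro order_tendstoD(2)) auto
  then show ?thesis using eventually_ge_at_top[of 1]
  proof eventually_elim
    case (elim n)
    have Bn: "B n > 0" using B_pos[OF B_type elim(2)] .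
    have "measure (measure_pmf (nstep (walk_kernel p) (k n) 0)) {y. a * B n \<le> \<bar>v \<bullet> real_vec y\<bar>} \<le>
        (\<integral>y. h ((v \<bullet> real_vec y) / B n) \<partial>measure_pmf (nstep (walk_kernel p) (k n) 0))"
    proof (rule prob_le_integral[OF B_type, where C=1])
      fix y assume "y \<in> {y. a * B n \<le> \<bar>v \<bullet> real_vec y\<bar>}"
      then have "1 \<le> \<bar>v \<bullet> real_vec y\<bar> / B n / a" using Bn a by (simp add: field_simps)
      then have "1 \<le> \<bar>v \<bullet> real_vec y / B n / a\<bar>" using Bn a by simp
      then have "1 \<le> \<bar>v \<bullet> real_vec y / B n / a\<bar> ^ 4" by (rule one_le_power)
      then have "1 \<le> (v \<bullet> real_vec y / B n / a) ^ 4" by (subst (asm) power_even_abs) auto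
      then show "1 \<le> h ((v \<bullet> real_vec y) / B n)" by (simp add: h_def)
    qed (use h0 in auto)
    then show ?case using elim(1) by linarith
  qed
qed

lemma norm_quartic_tail:
  "\<exists>C\<ge>0. \<forall>k t a e. (\<lambda>n. real (k n) / real n) \<longlonglongrightarrow> t \<longrightarrow> t \<ge> 0 \<longrightarrow> a > 0 \<longrightarrow> e > 0 \<longrightarrow>
    (\<forall>\<^sub>F n in sequentially. measure (measure_pmf (nstep (walk_kernel p) (k n) 0)) {y. a * B n \<le> norm (real_vec y)}
      \<le> C * t\<^sup>2 / a ^ 4 + e)"
proof -
  define d where "d = real CARD('d)"
  have d: "d > 0" by (simp add: d_def)
  define q where "q = (\<lambda>i. axis i 1 \<bullet> (S *v axis i (1 :: real)))"
  define C where "C = (\<Sum>i\<in>UNIV. 3 * (q i)\<^sup>2) * d ^ 4"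
  have "C \<ge> 0" unfolding C_def using d by (intro mult_nonneg_nonneg sum_nonneg) auto
  moreover have "\<forall>\<^sub>F n in sequentially. measure (measure_pmf (nstep (walk_kernel p) (k n) 0)) {y. a * B n \<le> norm (real_vec y)}
      \<le> C * t\<^sup>2 / a ^ 4 + e"
    if k: "(\<lambda>n. real (k n) / real n) \<longlonglongrightarrow> t" and t: "t \<ge> 0" and a: "a > 0" and e: "e > 0" for k t a e
  proof -
    have "\<forall>\<^sub>F n in sequentially. \<forall>i\<in>UNIV. measure (measure_pmf (nstep (walk_kernel p) (k n) 0))
        {y. a / d * B n \<le> \<bar>axis i 1 \<bullet> real_vec y\<bar>} \<le> 3 * (t * q i)\<^sup>2 / (a / d) ^ 4 + e / d"
      unfolding q_def using a d e
      by (intro eventually_ball_finite ballI finite coordinate_quartic_tail[OF k t]) auto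
    then show ?thesis using eventually_ge_at_top[of 1]
    proof eventually_elim
      case (elim n)
      have "measure (measure_pmf (nstep (walk_kernel p) (k n) 0)) {y. a * B n \<le> norm (real_vec y)} \<le>
          (\<Sum>i\<in>UNIV. measure (measure_pmf (nstep (walk_kernel p) (k n) 0)) {y. a * B n / d \<le> \<bar>axis i 1 \<bullet> real_vec y\<bar>})"
        unfolding d_def using a B_pos[OF B_type elim(2)] by (intro norm_tail_le_coordinates[OF B_type]) auto
      also have "\<dots> \<le> (\<Sum>i\<in>(UNIV :: 'd set). 3 * (t * q i)\<^sup>2 / (a / d) ^ 4 + e / d)"
        using elim(1) by (intro sum_mono) simp
      also have "\<dots> = (\<Sum>i\<in>(UNIV :: 'd set). 3 * (q i)\<^sup>2) * (t\<^sup>2 * d ^ 4 / a ^ 4) + e"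
      proof -
        have "3 * (t * q i)\<^sup>2 / (a / d) ^ 4 = 3 * (q i)\<^sup>2 * (t\<^sup>2 * d ^ 4 / a ^ 4)" for i
          by (simp add: power_divide power_mult_distrib)
        then show ?thesis unfolding sum.distrib sum_distrib_right using d by (simp add: d_def)
      qed
      finally show ?case by (simp add: C_def field_simps)
    qed
  qed
  ultimately show ?thesis by blast
qed

lemma div_over_tendsto: "m > 0 \<Longrightarrow> (\<lambda>n. real (n div m + 2) / real n) \<longlonglongrightarrow> 1 / real m"
proof -
  assume m: "m > 0"
  have "(\<lambda>n. real (n div m + 2) / real n - 1 / real m) \<longlonglongrightarrow> 0"
  proof (rule Lim_null_comparison)
    show "(\<lambda>n. 2 / real n) \<longlonglongrightarrow> 0" by real_asymp
    show "\<forall>\<^sub>F n in sequentially. norm (real (n div m + 2) / real n - 1 / real m) \<le> 2 / real n"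
      using eventually_gt_at_top[of 0]
    proof eventually_elim
      case (elim n)
      have "real n / real m = real (n div m) + real (n mod m) / real m"
      proof -
        have "real n = real (m * (n div m) + n mod m)" by simp
        then have "real n = real m * real (n div m) + real (n mod m)"
          by (simp only: of_nat_add of_nat_mult)
        then show ?thesis using m by (simp add: field_simps)
      qed
      moreover have "0 \<le> real (n mod m) / real m" "real (n mod m) / real m \<le> 1"
        using m by (auto simp: less_imp_le)
      ultimately have "\<bar>real (n div m + 2) - real n / real m\<bar> \<le> 2" by simp
      moreover have "real (n div m + 2) / real n - 1 / real m = (real (n div m + 2) - real n / real m) / real n"
        using elim m by (simp add: field_simps)
      ultimately show ?case using elim by (simp add: abs_divide divide_right_mono)
    qed
  qed
  then show ?thesis by (simp add: LIM_zero_iff)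
qed

text \<open>A union bound over m blocks in disguise: by Ottaviani a block leaves its neighbourhood
  with probability at most twice the tail at half the distance, and m times the quartic tail at t =
  1/m tends to 0. The length n div m + 2 absorbs the rounding of the block ends and the right
  neighbour read by the interpolation.\<close>

lemma maximal_block:
  assumes \<delta>: "\<delta> > 0" and e: "e > 0"
  shows "\<exists>m0. \<forall>m\<ge>m0. \<forall>\<^sub>F n in sequentially. \<forall>x.
    real m * (1 - avoid (walk_kernel p) {y. \<delta> * B n \<le> norm (real_vec (y - x))} (n div m + 2) x) \<le> e"
proof -
  define a where "a = \<delta> / 2"
  have a: "a > 0" using \<delta> by (simp add: a_def)
  obtain \<eta> where \<eta>: "\<eta> > 0" "\<forall>\<^sub>F n in sequentially. \<forall>j. real j \<le> \<eta> * real n \<longrightarrow>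
    measure (measure_pmf (nstep (walk_kernel p) j 0)) {y. a * B n \<le> norm (real_vec y)} \<le> 1 / 2"
    using tail_small[OF B_type a, of "1/2"] by auto
  obtain C where C: "C \<ge> 0" "\<And>k t a e. (\<lambda>n. real (k n) / real n) \<longlonglongrightarrow> t \<Longrightarrow> t \<ge> 0 \<Longrightarrow> a > 0 \<Longrightarrow> e > 0 \<Longrightarrow>
    (\<forall>\<^sub>F n in sequentially. measure (measure_pmf (nstep (walk_kernel p) (k n) 0)) {y. a * B n \<le> norm (real_vec y)}
      \<le> C * t\<^sup>2 / a ^ 4 + e)"
    using norm_quartic_tail by blast
  \<comment> \<open>2 / \<eta> makes a block shorter than \<eta> n, where the tail is at most 1/2; 4
    C / (a^4 e) makes the resulting term 2 C / (a^4 m) at most e/2.\<close>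
  obtain m0 :: nat where m0: "real m0 > max (max 1 (2 / \<eta>)) (4 * C / (a ^ 4 * e))"
    using reals_Archimedean2 by blast
  have "\<forall>\<^sub>F n in sequentially. \<forall>x.
    real m * (1 - avoid (walk_kernel p) {y. \<delta> * B n \<le> norm (real_vec (y - x))} (n div m + 2) x) \<le> e" if m: "m \<ge> m0" for m
  proof -
    have "real m0 \<le> real m" using m by simp
    then have mr: "real m > 1" "real m > 2 / \<eta>" "real m > 4 * C / (a ^ 4 * e)" using m0 by linarith+
    have "\<forall>\<^sub>F n in sequentially. real (n div m + 2) / real n < 2 / real m"
      using mr by (intro order_tendstoD(2)[OF div_over_tendsto]) (auto simp: divide_strict_right_mono)
    moreover have "\<forall>\<^sub>F n in sequentially. measure (measure_pmf (nstep (walk_kernel p) (n div m + 2) 0)) {y. a * B n \<le> norm (real_vec y)}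
      \<le> C * (1 / real m)\<^sup>2 / a ^ 4 + e / (4 * real m)"
      using mr a e by (intro C(2) div_over_tendsto) auto
    ultimately show ?thesis using \<eta>(2) eventually_ge_at_top[of 1]
    proof eventually_elim
      case (elim n)
      show ?case
      proof
        fix x
        define q where "q = 1 - avoid (walk_kernel p) {y. \<delta> * B n \<le> norm (real_vec (y - x))} (n div m + 2) x"
        have "real (n div m + 2) \<le> 2 / real m * real n" using elim(1,4) mr by (simp add: field_simps)
        also have "\<dots> \<le> \<eta> * real n"
          using mr \<eta>(1) by (intro mult_right_mono) (auto simp: field_simps)
        finally have small: "real (n div m + 2) \<le> \<eta> * real n" .
        have "(1 - 1 / 2) * (1 - avoid (walk_kernel p) {y. 2 * (a * B n) \<le> norm (real_vec (y - x))} (n div m + 2) x) \<le>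
          measure (measure_pmf (nstep (walk_kernel p) (n div m + 2) 0)) {y. a * B n \<le> norm (real_vec y)}"
        proof (rule walk_ottaviani[OF B_type])
          fix j assume "j \<le> n div m + 2"
          then have "real j \<le> \<eta> * real n" using small by (meson of_nat_le_iff order_trans)
          then show "measure (measure_pmf (nstep (walk_kernel p) j 0)) {y. a * B n \<le> norm (real_vec y)} \<le> 1 / 2"
            using elim(3) by blast
        qed simp
        then have "1 / 2 * q \<le> C * (1 / real m)\<^sup>2 / a ^ 4 + e / (4 * real m)"
          using elim(2) by (simp add: q_def a_def)
        then have "real m * q \<le> real m * (2 * (C * (1 / real m)\<^sup>2 / a ^ 4 + e / (4 * real m)))"
          using mr by (intro mult_left_mono) auto
        also have "\<dots> = 2 * C / (a ^ 4 * real m) + e / 2"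
          using mr a by (simp add: field_simps power2_eq_square)
        also have "2 * C / (a ^ 4 * real m) \<le> e / 2"
        proof -
          have "4 * C < real m * (a ^ 4 * e)" using mr(3) a e by (simp add: pos_divide_less_eq)
          then show ?thesis using mr a by (simp add: field_simps)
        qed
        finally show "real m * (1 - avoid (walk_kernel p) {y. \<delta> * B n \<le> norm (real_vec (y - x))} (n div m + 2) x) \<le> e"
          by (simp add: q_def)
      qed
    qed
  qed
  then show ?thesis by blast
qed

text \<open>Uniformity in x comes from choosing, of the directions v and - v, the one in which x has
  a nonnegative component: a displacement by \<open>B n\<close> in that direction ends at distance
  at least \<open>B n\<close>, wherever x is.\<close>

lemma far_probability:
  "\<exists>c>0. \<forall>\<^sub>F n in sequentially. \<forall>x. c \<le> measure (measure_pmf (nstep (walk_kernel p) n x)) {y. B n \<le> norm (real_vec y)}"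
proof -
  interpret N: real_distribution std_normal_distribution by (rule real_dist_normal_dist)
  obtain i :: 'd where True by blast
  define v where "v = axis i (1 :: real)"
  have v: "norm v = 1" "v \<noteq> 0" by (auto simp: v_def norm_axis_1)
  define s where "s = sqrt (1 * (v \<bullet> (S *v v)))"
  have s: "s > 0" unfolding s_def using S_pos[OF B_type v(2)] by simp
  \<comment> \<open>Continuous, 0 up to 1 and positive beyond, hence below the indicator of [1,
    \<infinity>) and still with a positive normal integral.\<close>
  define h where "h = (\<lambda>x :: real. clamp01 (x - 1))"
  have h_cont: "continuous_on UNIV h" unfolding h_def clamp01_def by (intro continuous_intros)
  have h0: "0 \<le> h x" "h x \<le> 1" for x unfolding h_def clamp01_def by auto
  have hm: "h \<in> borel_measurable borel" using h_cont by (rule borel_measurable_continuous_onI)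
  define L where "L = (\<integral>x. h (s * x) \<partial>std_normal_distribution)"
  have hi: "integrable std_normal_distribution (\<lambda>x. h (s * x))"
    using h0 hm by (intro N.integrable_bounded[where C=1]) auto
  have "L \<noteq> 0"
  proof
    assume "L = 0"
    then have "AE x in std_normal_distribution. h (s * x) = 0"
      using integral_nonneg_eq_0_iff_AE[OF hi] h0 unfolding L_def by simp
    then have "AE x in lborel. 0 < ennreal (std_normal_density x) \<longrightarrow> h (s * x) = 0"
      by (subst (asm) AE_density) auto
    then have "AE x in lborel. x \<notin> {1 / s<..<2 / s}"
    proof eventually_elim
      case (elim x)
      have "h (s * x) = 0" using elim by (simp add: normal_density_pos)
      then have "s * x \<le> 1" by (simp add: h_def clamp01_def split: if_splits)
      then have "x \<le> 1 / s" using s by (simp add: field_simps)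
      then show ?case by simp
    qed
    then have "emeasure lborel {1 / s<..<2 / s} = 0"
      by (subst (asm) AE_iff_measurable[of "{1 / s<..<2 / s}"]) auto
    then show False using s by (simp add: divide_right_mono less_imp_le)
  qed
  moreover have "L \<ge> 0" unfolding L_def using h0 by (intro Bochner_Integration.integral_nonneg) auto
  ultimately have L: "L > 0" by simp
  have k: "(\<lambda>n. real n / real n) \<longlonglongrightarrow> 1"
    by (rule tendsto_eventually) (auto intro: eventually_mono[OF eventually_gt_at_top[of 0]])
  have hD: "\<bar>h x\<bar> \<le> 1" for x using h0[of x] by simp
  have lim1: "(\<lambda>n. \<integral>y. h ((v \<bullet> real_vec y) / B n) \<partial>measure_pmf (nstep (walk_kernel p) n 0)) \<longlonglongrightarrow> L"
    unfolding L_def s_def by (rule walk_clt[OF B_type k _ h_cont hD]) simp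
  have "(\<lambda>n. \<integral>y. h ((- v \<bullet> real_vec y) / B n) \<partial>measure_pmf (nstep (walk_kernel p) n 0)) \<longlonglongrightarrow>
      (\<integral>x. h (sqrt (1 * (- v \<bullet> (S *v (- v)))) * x) \<partial>std_normal_distribution)"
    by (rule walk_clt[OF B_type k _ h_cont hD]) simp
  moreover have "- v \<bullet> (S *v (- v)) = v \<bullet> (S *v v)"
    using quadratic_form_scaleR[of "-1" v S] by simp
  ultimately have lim2: "(\<lambda>n. \<integral>y. h ((- v \<bullet> real_vec y) / B n) \<partial>measure_pmf (nstep (walk_kernel p) n 0)) \<longlonglongrightarrow> L"
    unfolding L_def s_def by simp
  have "L / 2 < L" using L by simp
  note order_tendstoD(1)[OF lim1 this] order_tendstoD(1)[OF lim2 this]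
  then have "\<forall>\<^sub>F n in sequentially. \<forall>x. L / 2 \<le> measure (measure_pmf (nstep (walk_kernel p) n x)) {y. B n \<le> norm (real_vec y)}"
    using eventually_ge_at_top[of 1]
  proof eventually_elim
    case (elim n)
    have Bn: "B n > 0" using B_pos[OF B_type elim(3)] .
    have half: "(\<integral>y. h ((w \<bullet> real_vec y) / B n) \<partial>measure_pmf (nstep (walk_kernel p) n 0)) \<le>
        measure (measure_pmf (nstep (walk_kernel p) n x)) {y. B n \<le> norm (real_vec y)}"
      if w: "norm w = 1" and wx: "0 \<le> w \<bullet> real_vec x" for w x
    proof -
      have "(\<integral>y. h ((w \<bullet> real_vec y) / B n) \<partial>measure_pmf (nstep (walk_kernel p) n 0)) \<le>
          (\<integral>y. indicator {y. B n \<le> w \<bullet> real_vec y} y \<partial>measure_pmf (nstep (walk_kernel p) n 0))"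
      proof (intro integral_mono integrable_pmf_bounded[where C=1])
        fix y
        show "h ((w \<bullet> real_vec y) / B n) \<le> indicator {y. B n \<le> w \<bullet> real_vec y} y"
          using Bn h0 by (auto simp: h_def clamp01_def indicator_def field_simps)
      qed (use hD in \<open>auto simp: indicator_def\<close>)
      also have "\<dots> = measure (measure_pmf (nstep (walk_kernel p) n 0)) {y. B n \<le> w \<bullet> real_vec y}" by simp
      also have "\<dots> \<le> measure (measure_pmf (nstep (walk_kernel p) n 0)) ((\<lambda>y. x + y) -` {y. B n \<le> norm (real_vec y)})"
      proof (rule measure_pmf.finite_measure_mono)
        show "{y. B n \<le> w \<bullet> real_vec y} \<subseteq> (\<lambda>y. x + y) -` {y. B n \<le> norm (real_vec y)}"
        proof
          fix y assume "y \<in> {y. B n \<le> w \<bullet> real_vec y}"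
          then have "B n \<le> w \<bullet> real_vec (x + y)" using wx by (simp add: real_vec_add inner_add_right)
          also have "\<dots> \<le> norm (real_vec (x + y))" using norm_cauchy_schwarz[of w "real_vec (x + y)"] w by simp
          finally show "y \<in> (\<lambda>y. x + y) -` {y. B n \<le> norm (real_vec y)}" by simp
        qed
      qed simp
      also have "\<dots> = measure (measure_pmf (nstep (walk_kernel p) n x)) {y. B n \<le> norm (real_vec y)}"
        by (subst (2) nstep_walk) (simp add: measure_map_pmf)
      finally show ?thesis .
    qed
    show ?case
    proof
      fix x
      show "L / 2 \<le> measure (measure_pmf (nstep (walk_kernel p) n x)) {y. B n \<le> norm (real_vec y)}"
      proof (cases "0 \<le> v \<bullet> real_vec x")
        case True
        then show ?thesis using half[of v x] elim(1) v by simp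
      next
        case False
        then show ?thesis using half[of "- v" x] elim(2) v by simp
      qed
    qed
  qed
  then show ?thesis using L by (intro exI[of _ "L / 2"]) auto
qed

end

subsection \<open>Local bound for the transition probabilities\<close>

text \<open>Embeds R^2 along the axes a and b, isometrically when a and b differ. Frequencies from
  one coordinate plane already give decay of order 1/j.\<close>

definition plane :: "'d \<Rightarrow> 'd \<Rightarrow> real \<times> real \<Rightarrow> real^'d"
  where "plane a b \<theta> = fst \<theta> *\<^sub>R axis a 1 + snd \<theta> *\<^sub>R axis b 1"

lemma plane_inner: "plane a b \<theta> \<bullet> w = fst \<theta> * w $ a + snd \<theta> * w $ b"
  by (simp add: plane_def inner_add_left inner_axis')

lemma plane_diff: "plane a b (\<theta> - \<theta>') = plane a b \<theta> - plane a b \<theta>'"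
  by (simp add: plane_def algebra_simps)

lemma plane_scaleR: "plane a b (r *\<^sub>R \<theta>) = r *\<^sub>R plane a b \<theta>"
  by (simp add: plane_def algebra_simps)

lemma norm_plane:
  assumes "a \<noteq> b"
  shows "norm (plane a b \<theta>) = norm \<theta>"
proof -
  have "plane a b \<theta> \<bullet> plane a b \<theta> = \<theta> \<bullet> \<theta>"
    unfolding plane_inner using assms
    by (cases \<theta>) (simp add: plane_def axis_def)
  then show ?thesis by (simp add: norm_eq_sqrt_inner)
qed

lemma plane_measurable [measurable]: "plane a b \<in> borel_measurable borel"
  unfolding plane_def by (intro borel_measurable_continuous_onI continuous_intros)

lemma continuous_cf: "continuous_on UNIV (cf p)"
proof (rule continuous_at_imp_continuous_on, intro ballI)
  fix v
  have "(cf p \<circ> x) \<longlonglongrightarrow> cf p v" if x: "x \<longlonglongrightarrow> v" for x :: "nat \<Rightarrow> real^'a"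
    unfolding cf_def o_def
    by (rule measure_pmf.bounded_convergence[where C=1]) (auto intro!: tendsto_intros x)
  then show "isCont (cf p) v" unfolding continuous_at_sequentially by blast
qed

text \<open>The squared modulus is the characteristic function of the difference of two independent
  jumps, which is symmetric; hence an integral of cosines.\<close>

lemma cf_norm_square:
  "(norm (cf p w))\<^sup>2 = (\<integral>y. cos (w \<bullet> real_vec (fst y - snd y)) \<partial>measure_pmf (pair_pmf p p))"
proof -
  have i: "integrable (measure_pmf q) (\<lambda>y. iexp (g y))" for q :: "'b pmf" and g :: "'b \<Rightarrow> real"
    by (rule measure_pmf.integrable_bounded[where C=1]) auto
  have "(\<integral>y. iexp (w \<bullet> real_vec (fst y - snd y)) \<partial>measure_pmf (pair_pmf p p)) =
      (\<integral>y. \<integral>y'. iexp (w \<bullet> real_vec (y - y')) \<partial>measure_pmf p \<partial>measure_pmf p)"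
    unfolding pair_pmf_def by (simp add: integral_bind_pmf_complex[where C=1])
  also have "\<dots> = (\<integral>y. \<integral>y'. iexp (w \<bullet> real_vec y) * cnj (iexp (w \<bullet> real_vec y')) \<partial>measure_pmf p \<partial>measure_pmf p)"
  proof -
    have "iexp (w \<bullet> real_vec (y - y')) = iexp (w \<bullet> real_vec y) * cnj (iexp (w \<bullet> real_vec y'))" for y y'
      by (simp add: real_vec_diff inner_diff_right exp_cnj algebra_simps flip: exp_add)
    then show ?thesis by (simp only:)
  qed
  also have "\<dots> = cf p w * cnj (cf p w)"
    unfolding cf_def by (simp del: complex_cnj_mult exp_cnj)
  also have "\<dots> = of_real ((norm (cf p w))\<^sup>2)" by (rule complex_norm_square[symmetric])
  finally have "(norm (cf p w))\<^sup>2 = Re (\<integral>y. iexp (w \<bullet> real_vec (fst y - snd y)) \<partial>measure_pmf (pair_pmf p p))"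
    by (metis Re_complex_of_real)
  also have "\<dots> = (\<integral>y. Re (iexp (w \<bullet> real_vec (fst y - snd y))) \<partial>measure_pmf (pair_pmf p p))"
    by (rule integral_Re[symmetric]) (rule i)
  finally show ?thesis by (simp add: iexp_eq)
qed

lemma nn_integral_gauss_1:
  assumes a: "a > 0"
  shows "(\<integral>\<^sup>+x. ennreal (exp (- a * (x - \<mu>)\<^sup>2)) \<partial>lborel) = ennreal (sqrt (pi / a))"
proof -
  define \<sigma> where "\<sigma> = 1 / sqrt (2 * a)"
  have \<sigma>: "\<sigma> > 0" "\<sigma>\<^sup>2 = 1 / (2 * a)" using a by (auto simp: \<sigma>_def power_divide)
  have "exp (- a * (x - \<mu>)\<^sup>2) = sqrt (pi / a) * normal_density \<mu> \<sigma> x" for x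
    using a unfolding normal_density_def \<sigma>(2) by (simp add: field_simps)
  then have "(\<integral>\<^sup>+x. ennreal (exp (- a * (x - \<mu>)\<^sup>2)) \<partial>lborel) = (\<integral>\<^sup>+x. ennreal (sqrt (pi / a)) * ennreal (normal_density \<mu> \<sigma> x) \<partial>lborel)"
    using a by (simp add: ennreal_mult' normal_density_nonneg)
  also have "\<dots> = ennreal (sqrt (pi / a)) * (\<integral>\<^sup>+x. ennreal (normal_density \<mu> \<sigma> x) \<partial>lborel)"
    by (rule nn_integral_cmult) simp
  also have "(\<integral>\<^sup>+x. ennreal (normal_density \<mu> \<sigma> x) \<partial>lborel) = ennreal (\<integral>x. normal_density \<mu> \<sigma> x \<partial>lborel)"
    using \<sigma> by (intro nn_integral_eq_integral) (auto simp: normal_density_nonneg)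
  finally show ?thesis using \<sigma> by simp
qed

lemma nn_integral_gauss_2:
  fixes c :: "real \<times> real"
  assumes a: "a > 0"
  shows "(\<integral>\<^sup>+\<theta>. ennreal (exp (- a * (norm (\<theta> - c))\<^sup>2)) \<partial>lborel) = ennreal (pi / a)"
proof -
  have e: "ennreal (exp (- a * (norm ((s, t) - c))\<^sup>2)) =
      ennreal (exp (- a * (s - fst c)\<^sup>2)) * ennreal (exp (- a * (t - snd c)\<^sup>2))" for s t
    by (cases c) (simp add: norm_Pair ennreal_mult'[symmetric] algebra_simps flip: exp_add)
  have "(\<integral>\<^sup>+\<theta>. ennreal (exp (- a * (norm (\<theta> - c))\<^sup>2)) \<partial>lborel) =
      (\<integral>\<^sup>+\<theta>. ennreal (exp (- a * (norm (\<theta> - c))\<^sup>2)) \<partial>(lborel \<Otimes>\<^sub>M lborel))"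
    by (simp add: lborel_prod)
  also have "\<dots> = (\<integral>\<^sup>+s. \<integral>\<^sup>+t. ennreal (exp (- a * (norm ((s, t) - c))\<^sup>2)) \<partial>lborel \<partial>lborel)"
    by (rule lborel.nn_integral_fst[symmetric]) (simp add: lborel_prod)
  also have "\<dots> = ennreal (sqrt (pi / a)) * ennreal (sqrt (pi / a))"
    unfolding e by (simp add: nn_integral_cmult nn_integral_multc nn_integral_gauss_1[OF a, unfolded mult_minus_left])
  also have "\<dots> = ennreal (pi / a)" using a by (simp flip: ennreal_mult')
  finally show ?thesis .
qed

section \<open>Gaussian decay of the characteristic function near 0, and the local bound\<close>

context
  fixes p :: "(int^'d) pmf" and B :: "nat \<Rightarrow> real" and S :: "real^'d^'d"
  assumes B_type: "B_type p B S"
begin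

text \<open>For each fixed value of the first jump, s^2 \<le> 2 (t - s)^2 + 2 t^2 transfers the
  infinite second moment to the difference.\<close>

lemma symmetrized_infinite_variance:
  assumes "w \<noteq> 0"
  shows "(\<integral>\<^sup>+y. ennreal ((w \<bullet> real_vec (fst y - snd y))\<^sup>2) \<partial>measure_pmf (pair_pmf p p)) = \<infinity>"
proof -
  have inner: "(\<integral>\<^sup>+y'. ennreal ((w \<bullet> real_vec (y - y'))\<^sup>2) \<partial>measure_pmf p) = \<infinity>" for y
  proof (rule ccontr)
    assume neq: "\<not> ?thesis"
    have "(\<integral>\<^sup>+y'. ennreal ((w \<bullet> real_vec y')\<^sup>2) \<partial>measure_pmf p) \<le>
        (\<integral>\<^sup>+y'. 2 * ennreal ((w \<bullet> real_vec (y - y'))\<^sup>2) + ennreal (2 * (w \<bullet> real_vec y)\<^sup>2) \<partial>measure_pmf p)"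
    proof (rule nn_integral_mono)
      fix y'
      define s where "s = w \<bullet> real_vec y'"
      define t where "t = w \<bullet> real_vec y"
      have "s\<^sup>2 \<le> 2 * (t - s)\<^sup>2 + 2 * t\<^sup>2"
        using sum_squares_ge_zero[of "s - 2 * t" 0] by (simp add: power2_eq_square algebra_simps)
      then have "ennreal (s\<^sup>2) \<le> ennreal (2 * (t - s)\<^sup>2 + 2 * t\<^sup>2)" by (rule ennreal_leI)
      also have "\<dots> = 2 * ennreal ((t - s)\<^sup>2) + ennreal (2 * t\<^sup>2)"
        by (simp add: ennreal_plus ennreal_mult')
      finally show "ennreal ((w \<bullet> real_vec y')\<^sup>2) \<le> 2 * ennreal ((w \<bullet> real_vec (y - y'))\<^sup>2) + ennreal (2 * (w \<bullet> real_vec y)\<^sup>2)"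
        by (simp add: s_def t_def real_vec_diff inner_diff_right)
    qed
    also have "\<dots> = 2 * (\<integral>\<^sup>+y'. ennreal ((w \<bullet> real_vec (y - y'))\<^sup>2) \<partial>measure_pmf p) + ennreal (2 * (w \<bullet> real_vec y)\<^sup>2)"
      by (subst nn_integral_add) (auto simp: nn_integral_cmult measure_pmf.emeasure_space_1[simplified])
    also have "\<dots> < \<infinity>" using neq by (simp add: less_top[symmetric] ennreal_mult_eq_top_iff)
    finally show False using infinite_variance[OF B_type assms] by simp
  qed
  show ?thesis unfolding pair_pmf_def by (simp add: inner del: ennreal_eq_zero_iff)
qed

context
  fixes a b :: 'd
  assumes ab: "a \<noteq> b"
begin

text \<open>The truncation does not depend on \<theta>, so this is a quadratic form in \<theta>, in
  particular continuous; it increases with K.\<close>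

definition truncated_form :: "real \<Rightarrow> real \<times> real \<Rightarrow> real"
  where "truncated_form K \<theta> = (\<integral>y. (plane a b \<theta> \<bullet> real_vec (fst y - snd y))\<^sup>2 *
    indicator {y. norm (real_vec (fst y - snd y)) \<le> K} y \<partial>measure_pmf (pair_pmf p p))"

lemma plane_bound: "\<bar>plane a b \<theta> \<bullet> w\<bar> \<le> norm \<theta> * norm w"
  using Cauchy_Schwarz_ineq2[of "plane a b \<theta>" w] norm_plane[OF ab] by simp

lemma truncated_form_integrable: "integrable (measure_pmf (pair_pmf p p))
  (\<lambda>y. (plane a b \<theta> \<bullet> real_vec (fst y - snd y))\<^sup>2 * indicator {y. norm (real_vec (fst y - snd y)) \<le> K} y)"
  by (rule trunc_integrable[where c="norm \<theta>"]) (use plane_bound in auto)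

lemma truncated_form_mono: "K \<le> K' \<Longrightarrow> truncated_form K \<theta> \<le> truncated_form K' \<theta>"
  unfolding truncated_form_def
  by (intro integral_mono truncated_form_integrable) (auto simp: indicator_def)

lemma continuous_truncated_form: "continuous_on UNIV (truncated_form K)"
proof -
  define D where "D = (\<lambda>y. real_vec (fst y - snd y) :: real^'d)"
  define I where "I = (indicator {y. norm (D y) \<le> K} :: _ \<Rightarrow> real)"
  define q where "q = measure_pmf (pair_pmf p p)"
  have i: "integrable q (\<lambda>y. D y $ i * D y $ j * I y)" for i j
    unfolding q_def
  proof (rule integrable_pmf_bounded)
    fix y
    show "\<bar>D y $ i * D y $ j * I y\<bar> \<le> K\<^sup>2"
    proof (cases "norm (D y) \<le> K")
      case True
      have "\<bar>D y $ i\<bar> \<le> K" "\<bar>D y $ j\<bar> \<le> K"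
        using True component_le_norm_cart[of "D y"] order_trans by blast+
      then have "\<bar>D y $ i\<bar> * \<bar>D y $ j\<bar> \<le> K * K" by (intro mult_mono) auto
      then show ?thesis using True by (simp add: I_def abs_mult power2_eq_square)
    qed (simp add: I_def)
  qed
  have "truncated_form K \<theta> = (fst \<theta>)\<^sup>2 * (\<integral>y. D y $ a * D y $ a * I y \<partial>q) +
      2 * fst \<theta> * snd \<theta> * (\<integral>y. D y $ a * D y $ b * I y \<partial>q) + (snd \<theta>)\<^sup>2 * (\<integral>y. D y $ b * D y $ b * I y \<partial>q)" for \<theta>
  proof -
    have "truncated_form K \<theta> = (\<integral>y. (fst \<theta>)\<^sup>2 * (D y $ a * D y $ a * I y) +
      2 * fst \<theta> * snd \<theta> * (D y $ a * D y $ b * I y) + (snd \<theta>)\<^sup>2 * (D y $ b * D y $ b * I y) \<partial>q)"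
      unfolding truncated_form_def plane_inner D_def I_def q_def
      by (intro Bochner_Integration.integral_cong refl) (simp add: power2_eq_square algebra_simps)
    also have "\<dots> = (fst \<theta>)\<^sup>2 * (\<integral>y. D y $ a * D y $ a * I y \<partial>q) +
      2 * fst \<theta> * snd \<theta> * (\<integral>y. D y $ a * D y $ b * I y \<partial>q) + (snd \<theta>)\<^sup>2 * (\<integral>y. D y $ b * D y $ b * I y \<partial>q)"
      using i by simp
    finally show ?thesis .
  qed
  then have "truncated_form K = (\<lambda>\<theta>. (fst \<theta>)\<^sup>2 * (\<integral>y. D y $ a * D y $ a * I y \<partial>q) +
      2 * fst \<theta> * snd \<theta> * (\<integral>y. D y $ a * D y $ b * I y \<partial>q) + (snd \<theta>)\<^sup>2 * (\<integral>y. D y $ b * D y $ b * I y \<partial>q))"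
    by (rule ext)
  then show ?thesis by (simp only:) (intro continuous_intros)
qed

text \<open>Divergence in each direction becomes uniform by compactness of the unit circle: bad
  directions for growing K accumulate at some l, and for each fixed K continuity and monotonicity
  carry the bound R over to l.\<close>

lemma truncated_form_large: "\<exists>K\<ge>1. \<forall>\<theta>. norm \<theta> = 1 \<longrightarrow> R < truncated_form K \<theta>"
proof (rule ccontr)
  assume contr: "\<not> ?thesis"
  have "\<forall>n. \<exists>\<theta>. norm \<theta> = 1 \<and> truncated_form (real (Suc n)) \<theta> \<le> R"
  proof
    fix n
    have "real (Suc n) \<ge> 1" by simp
    then show "\<exists>\<theta>. norm \<theta> = 1 \<and> truncated_form (real (Suc n)) \<theta> \<le> R"
      using contr by (meson not_le)
  qed
  from choice[OF this] obtain \<theta> where \<theta>: "\<forall>n. norm (\<theta> n) = 1 \<and> truncated_form (real (Suc n)) (\<theta> n) \<le> R" by blast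
  have "seq_compact (sphere (0 :: real \<times> real) 1)" by (intro compact_imp_seq_compact compact_sphere)
  moreover have "\<forall>n. \<theta> n \<in> sphere 0 1" using \<theta> by simp
  ultimately obtain l r where l: "l \<in> sphere 0 1" and r: "strict_mono r" "(\<theta> \<circ> r) \<longlonglongrightarrow> l"
    unfolding seq_compact_def by blast
  have nl: "norm l = 1" using l by simp
  have "plane a b l \<noteq> 0" using norm_plane[OF ab, of l] nl by auto
  then obtain K :: nat where K: "R < truncated_form (real K) l"
    using trunc_second_moment[OF symmetrized_infinite_variance, of "plane a b l" 1 "\<lambda>y. norm (real_vec (fst y - snd y))" R]
      plane_bound[of l] nl unfolding truncated_form_def by auto
  have lim: "(\<lambda>n. truncated_form (real K) ((\<theta> \<circ> r) n)) \<longlonglongrightarrow> truncated_form (real K) l"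
    using continuous_on_tendsto_compose[OF continuous_truncated_form r(2)] by simp
  have le: "truncated_form (real K) ((\<theta> \<circ> r) n) \<le> R" if "n \<ge> K" for n
  proof -
    have "real K \<le> real (Suc (r n))" using that seq_suble[OF r(1), of n] by simp
    moreover have "truncated_form (real (Suc (r n))) (\<theta> (r n)) \<le> R" using \<theta> by blast
    ultimately show ?thesis unfolding o_def by (rule order_trans[OF truncated_form_mono])
  qed
  have "truncated_form (real K) l \<le> R"
  proof (rule LIMSEQ_le_const2[OF lim], rule exI[of _ K], intro allI impI)
    fix n assume "K \<le> n"
    then show "truncated_form (real K) ((\<theta> \<circ> r) n) \<le> R" by (rule le)
  qed
  with K show False by linarith
qed

text \<open>Here M is arbitrary and only the radius depends on it; this is the gain over a finite
  variance, which would limit M.\<close>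

lemma cf_gauss_bound:
  "\<exists>\<delta>>0. \<forall>\<theta>. norm \<theta> \<le> \<delta> \<longrightarrow> norm (cf p (plane a b \<theta>)) \<le> exp (- M * (norm \<theta>)\<^sup>2)"
proof -
  \<comment> \<open>The factor 8 gives |cf|^2 \<le> 1 - 2 M r^2 \<le> exp (- 2 M r^2), and the
    square root leaves M.\<close>
  obtain K where K: "K \<ge> 1" "\<And>\<theta>. norm \<theta> = 1 \<Longrightarrow> 8 * M < truncated_form K \<theta>"
    using truncated_form_large[of "8 * M"] by blast
  have "norm (cf p (plane a b \<theta>)) \<le> exp (- M * (norm \<theta>)\<^sup>2)" if \<theta>: "norm \<theta> \<le> 1 / K" for \<theta>
  proof (cases "\<theta> = 0")
    case True
    then show ?thesis using norm_cf_le_1 by simp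
  next
    case False
    define r where "r = norm \<theta>"
    define e where "e = (1 / r) *\<^sub>R \<theta>"
    have r: "r > 0" using False by (simp add: r_def)
    have e: "norm e = 1" "\<theta> = r *\<^sub>R e" using r by (auto simp: e_def r_def)
    have "r\<^sup>2 / 4 * truncated_form K e \<le>
        (\<integral>y. 1 - cos (r * (plane a b e \<bullet> real_vec (fst y - snd y))) \<partial>measure_pmf (pair_pmf p p))"
      unfolding truncated_form_def
      using plane_bound[of e] e(1) \<theta> K(1) r
      by (intro one_minus_cos_integral_ge[where c=1]) (auto simp: r_def[symmetric] field_simps)
    also have "\<dots> = 1 - (\<integral>y. cos (r * (plane a b e \<bullet> real_vec (fst y - snd y))) \<partial>measure_pmf (pair_pmf p p))"
      by (subst Bochner_Integration.integral_diff) (auto intro!: integrable_pmf_bounded[where C=1])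
    also have "(\<integral>y. cos (r * (plane a b e \<bullet> real_vec (fst y - snd y))) \<partial>measure_pmf (pair_pmf p p)) = (norm (cf p (plane a b \<theta>)))\<^sup>2"
      unfolding cf_norm_square e(2) plane_scaleR by simp
    finally have "(norm (cf p (plane a b \<theta>)))\<^sup>2 \<le> 1 - r\<^sup>2 / 4 * truncated_form K e" by simp
    moreover have "r\<^sup>2 / 4 * (8 * M) \<le> r\<^sup>2 / 4 * truncated_form K e"
      using K(2)[OF e(1)] by (intro mult_left_mono) auto
    ultimately have "(norm (cf p (plane a b \<theta>)))\<^sup>2 \<le> 1 + (- 2 * M * r\<^sup>2)" by simp
    also have "\<dots> \<le> exp (- 2 * M * r\<^sup>2)" by (rule exp_ge_add_one_self)
    also have "\<dots> = (exp (- M * r\<^sup>2))\<^sup>2" by (simp add: power2_eq_square flip: exp_add)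
    finally show ?thesis unfolding r_def by (rule power2_le_imp_le) simp
  qed
  then show ?thesis using K(1) by (intro exI[of _ "1 / K"]) auto
qed

text \<open>Averaging \<open>iexp\<close> over the difference of two independent points with law U
  gives the squared modulus of one average: nonnegative at every y and equal to 1 at y = x, so it
  dominates the indicator of x. Fubini then turns the expectation over the walk into a power of
  \<open>cf\<close>.\<close>

lemma pmf_le_integral:
  fixes U :: "(real \<times> real) measure"
  assumes U: "prob_space U" "sets U = sets borel"
  shows "pmf (nstep (walk_kernel p) j 0) x \<le> (\<integral>z. norm (cf p (plane a b (fst z - snd z))) ^ j \<partial>(U \<Otimes>\<^sub>M U))"
proof -
  interpret U: prob_space U by fact
  interpret UU: pair_prob_space U U ..
  have [measurable_cong]: "sets U = sets borel" by fact
  define q where "q = nstep (walk_kernel p) j 0"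
  interpret Q: pair_prob_space "measure_pmf q" "U \<Otimes>\<^sub>M U" ..
  define f where "f = (\<lambda>y z. iexp (plane a b (fst z - snd z) \<bullet> real_vec (y - x)))"
  have f_meas: "case_prod f \<in> borel_measurable (measure_pmf q \<Otimes>\<^sub>M (U \<Otimes>\<^sub>M U))"
  proof -
    have [measurable]: "(\<lambda>y. real_vec (y - x)) \<in> borel_measurable (measure_pmf q)" by simp
    show ?thesis unfolding f_def by measurable
  qed
  have f_int: "integrable (measure_pmf q \<Otimes>\<^sub>M (U \<Otimes>\<^sub>M U)) (case_prod f)"
    using f_meas by (rule Q.P.integrable_bounded[where C=1]) (auto simp: f_def)
  have fz_meas: "f y \<in> borel_measurable (U \<Otimes>\<^sub>M U)" for y unfolding f_def by measurable
  have fz_int: "integrable (U \<Otimes>\<^sub>M U) (f y)" for y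
    using fz_meas by (rule UU.P.integrable_bounded[where C=1]) (auto simp: f_def)
  have product: "(\<integral>z. f y z \<partial>(U \<Otimes>\<^sub>M U)) = of_real ((norm (\<integral>\<theta>. iexp (plane a b \<theta> \<bullet> real_vec (y - x)) \<partial>U))\<^sup>2)" for y
  proof -
    have e: "f y (\<theta>, \<theta>') = iexp (plane a b \<theta> \<bullet> real_vec (y - x)) * cnj (iexp (plane a b \<theta>' \<bullet> real_vec (y - x)))" for \<theta> \<theta>'
      by (simp add: f_def plane_diff inner_diff_left exp_cnj algebra_simps flip: exp_add)
    have "(\<integral>z. f y z \<partial>(U \<Otimes>\<^sub>M U)) = (\<integral>\<theta>. \<integral>\<theta>'. f y (\<theta>, \<theta>') \<partial>U \<partial>U)"
      by (rule UU.integral_fst'[symmetric]) (rule fz_int)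
    also have "\<dots> = (\<integral>\<theta>. iexp (plane a b \<theta> \<bullet> real_vec (y - x)) \<partial>U) * cnj (\<integral>\<theta>. iexp (plane a b \<theta> \<bullet> real_vec (y - x)) \<partial>U)"
      unfolding e by (simp del: exp_cnj)
    finally show ?thesis by (simp add: complex_norm_square del: of_real_power)
  qed
  have "pmf q x = (\<integral>y. indicator {x} y \<partial>measure_pmf q)" by (simp add: measure_pmf_single)
  also have "\<dots> \<le> (\<integral>y. Re (\<integral>z. f y z \<partial>(U \<Otimes>\<^sub>M U)) \<partial>measure_pmf q)"
  proof (rule integral_mono)
    have n1: "norm (\<integral>z. f y z \<partial>(U \<Otimes>\<^sub>M U)) \<le> 1" for y
    proof -
      have "norm (\<integral>z. f y z \<partial>(U \<Otimes>\<^sub>M U)) \<le> (\<integral>z. norm (f y z) \<partial>(U \<Otimes>\<^sub>M U))" by (rule integral_norm_bound)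
      then show ?thesis by (simp add: f_def UU.P.prob_space)
    qed
    show "integrable (measure_pmf q) (\<lambda>y. Re (\<integral>z. f y z \<partial>(U \<Otimes>\<^sub>M U)))"
      by (rule integrable_pmf_bounded[where C=1]) (rule order_trans[OF abs_Re_le_cmod n1])
    show "indicator {x} y \<le> Re (\<integral>z. f y z \<partial>(U \<Otimes>\<^sub>M U))" for y
    proof (cases "y = x")
      case True
      then have "f y z = 1" for z by (simp add: f_def)
      then show ?thesis using True by (simp add: UU.P.prob_space)
    qed (simp add: product)
  qed (simp add: integrable_pmf_bounded[where C=1])
  also have "\<dots> = Re (\<integral>y. \<integral>z. f y z \<partial>(U \<Otimes>\<^sub>M U) \<partial>measure_pmf q)"
    by (rule integral_Re) (rule Q.integrable_fst[OF f_int])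
  also have "\<dots> = Re (\<integral>z. \<integral>y. f y z \<partial>measure_pmf q \<partial>(U \<Otimes>\<^sub>M U))"
    by (subst Q.Fubini_integral[OF f_int]) simp
  also have "\<dots> \<le> norm (\<integral>z. \<integral>y. f y z \<partial>measure_pmf q \<partial>(U \<Otimes>\<^sub>M U))" by (rule complex_Re_le_cmod)
  also have "\<dots> \<le> (\<integral>z. norm (\<integral>y. f y z \<partial>measure_pmf q) \<partial>(U \<Otimes>\<^sub>M U))" by (rule integral_norm_bound)
  also have "\<dots> = (\<integral>z. norm (cf p (plane a b (fst z - snd z))) ^ j \<partial>(U \<Otimes>\<^sub>M U))"
  proof (intro Bochner_Integration.integral_cong refl)
    fix z
    define w where "w = plane a b (fst z - snd z)"
    have "f y z = iexp (- (w \<bullet> real_vec x)) * iexp (w \<bullet> real_vec y)" for y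
      by (simp add: f_def w_def real_vec_diff inner_diff_right algebra_simps flip: exp_add)
    then have "(\<integral>y. f y z \<partial>measure_pmf q) = iexp (- (w \<bullet> real_vec x)) * cf p w ^ j"
      unfolding q_def cf_nstep[symmetric] by simp
    then show "norm (\<integral>y. f y z \<partial>measure_pmf q) = norm (cf p (plane a b (fst z - snd z))) ^ j"
      by (simp only: norm_mult norm_exp_i_times norm_power w_def mult_1_left)
  qed
  finally show ?thesis by (simp add: q_def)
qed

lemma local_bound:
  assumes e: "e > 0"
  shows "\<forall>\<^sub>F j in sequentially. \<forall>x. real j * pmf (nstep (walk_kernel p) j 0) x \<le> e"
proof -
  obtain \<delta> where \<delta>: "\<delta> > 0" "\<And>\<theta>. norm \<theta> \<le> \<delta> \<Longrightarrow> norm (cf p (plane a b \<theta>)) \<le> exp (- 1 * (norm \<theta>)\<^sup>2)"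
    using cf_gauss_bound[of 1] by auto
  \<comment> \<open>Differences of two points of the square have norm at most 4 r = \<delta>, within
    the range of the first Gaussian bound. The square and its area c are fixed before M, so M may
    depend on c.\<close>
  define r where "r = \<delta> / 4"
  define A where "A = cbox (- r, - r) (r, r)"
  have r: "r > 0" using \<delta> by (simp add: r_def)
  define c where "c = measure lborel A"
  have A_fin: "emeasure lborel A < \<infinity>" unfolding A_def by (rule emeasure_lborel_cbox_finite)
  have em: "emeasure lborel A = ennreal c"
    unfolding c_def using A_fin by (simp add: emeasure_eq_ennreal_measure)
  have "c > 0" unfolding c_def A_def using r by (subst content_pos_lt_eq) (auto simp: Basis_prod_def)
  define U where "U = uniform_measure lborel A"
  have A_meas: "A \<in> sets lborel" unfolding A_def by simp
  have U: "prob_space U" "sets U = sets borel"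
    unfolding U_def using em \<open>c > 0\<close> by (auto intro!: prob_space_uniform_measure)
  interpret U: prob_space U by (rule U)
  interpret UU: pair_prob_space U U ..
  have [measurable_cong]: "sets U = sets borel" by (rule U)
  \<comment> \<open>With this M the main term j pi / (j M c) equals e/2.\<close>
  define M where "M = 2 * pi / (c * e)"
  have M: "M > 0" using \<open>c > 0\<close> e by (simp add: M_def)
  obtain \<delta>' where \<delta>': "\<delta>' > 0" "\<And>\<theta>. norm \<theta> \<le> \<delta>' \<Longrightarrow> norm (cf p (plane a b \<theta>)) \<le> exp (- M * (norm \<theta>)\<^sup>2)"
    using cf_gauss_bound[of M] by auto
  \<comment> \<open>Between \<delta>' and \<delta> only the bound with rate 1 is available; it
    contributes the geometric term \<kappa>^j, negligible against 1/j.\<close>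
  define \<kappa> where "\<kappa> = exp (- (\<delta>'\<^sup>2))"
  have \<kappa>: "0 < \<kappa>" "\<kappa> < 1" using \<delta>' by (auto simp: \<kappa>_def)
  have bound: "norm (cf p (plane a b (\<theta> - \<theta>'))) ^ j \<le> exp (- (real j * M) * (norm (\<theta>' - \<theta>))\<^sup>2) + \<kappa> ^ j"
    if "\<theta> \<in> A" "\<theta>' \<in> A" for \<theta> \<theta>' j
  proof -
    have "norm (\<theta> - \<theta>') \<le> norm (fst (\<theta> - \<theta>')) + norm (snd (\<theta> - \<theta>'))" 
      using norm_Pair_le[of "fst (\<theta> - \<theta>')" "snd (\<theta> - \<theta>')"] by (simp only: prod.collapse)
    also have "\<dots> \<le> 2 * r + 2 * r"
      using that by (cases \<theta>; cases \<theta>') (auto simp: A_def cbox_Pair_eq)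
    finally have n\<delta>: "norm (\<theta> - \<theta>') \<le> \<delta>" by (simp add: r_def)
    show ?thesis
    proof (cases "norm (\<theta> - \<theta>') \<le> \<delta>'")
      case True
      have "norm (cf p (plane a b (\<theta> - \<theta>'))) ^ j \<le> exp (- M * (norm (\<theta> - \<theta>'))\<^sup>2) ^ j"
        by (intro power_mono \<delta>'(2) True) auto
      also have "\<dots> = exp (- (real j * M) * (norm (\<theta>' - \<theta>))\<^sup>2)"
        by (simp add: norm_minus_commute mult.assoc flip: exp_of_nat_mult)
      finally show ?thesis using \<kappa> by (simp add: add_increasing2)
    next
      case False
      then have "\<delta>'\<^sup>2 \<le> (norm (\<theta> - \<theta>'))\<^sup>2" using \<delta>' by (intro power_mono) auto
      then have "exp (- 1 * (norm (\<theta> - \<theta>'))\<^sup>2) \<le> \<kappa>" by (simp add: \<kappa>_def)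
      then have "norm (cf p (plane a b (\<theta> - \<theta>'))) ^ j \<le> \<kappa> ^ j"
        using \<delta>(2)[OF n\<delta>] by (intro power_mono) auto
      then show ?thesis by (simp add: add_increasing)
    qed
  qed
  have U_nn: "(\<integral>\<^sup>+\<theta>. g \<theta> \<partial>U) = (\<integral>\<^sup>+\<theta>. g \<theta> * indicator A \<theta> \<partial>lborel) / ennreal c"
    if "g \<in> borel_measurable borel" for g
    unfolding U_def em[symmetric] using that A_meas by (intro nn_integral_uniform_measure) auto
  have cf_meas: "(\<lambda>z. norm (cf p (plane a b (fst z - snd z))) ^ j) \<in> borel_measurable (U \<Otimes>\<^sub>M U)" for j
  proof -
    have [measurable]: "cf p \<in> borel_measurable borel"
      using continuous_cf by (rule borel_measurable_continuous_onI)
    show ?thesis by measurable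
  qed
  have AE_A: "AE \<theta> in U. \<theta> \<in> A" unfolding U_def using A_meas by (intro AE_uniform_measureI) auto
  have main: "pmf (nstep (walk_kernel p) j 0) x \<le> pi / (real j * M * c) + \<kappa> ^ j" if j: "j \<ge> 1" for j x
  proof -
    define \<phi> where "\<phi> = (\<lambda>z. norm (cf p (plane a b (fst z - snd z))) ^ j)"
    have jM: "real j * M > 0" using j M by simp
    have \<phi>_meas [measurable]: "\<phi> \<in> borel_measurable (U \<Otimes>\<^sub>M U)" unfolding \<phi>_def by (rule cf_meas)
    have \<phi>_int: "integrable (U \<Otimes>\<^sub>M U) \<phi>"
      using \<phi>_meas by (rule UU.P.integrable_bounded[where C=1]) (auto simp: \<phi>_def norm_cf_le_1 power_le_one)
    have gauss_U: "(\<integral>\<^sup>+\<theta>'. ennreal (exp (- (real j * M) * (norm (\<theta>' - \<theta>))\<^sup>2)) \<partial>U) \<le> ennreal (pi / (real j * M * c))" for \<theta>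
    proof -
      have "(\<integral>\<^sup>+\<theta>'. ennreal (exp (- (real j * M) * (norm (\<theta>' - \<theta>))\<^sup>2)) \<partial>U) =
          (\<integral>\<^sup>+\<theta>'. ennreal (exp (- (real j * M) * (norm (\<theta>' - \<theta>))\<^sup>2)) * indicator A \<theta>' \<partial>lborel) / ennreal c"
        by (rule U_nn) measurable
      also have "\<dots> \<le> (\<integral>\<^sup>+\<theta>'. ennreal (exp (- (real j * M) * (norm (\<theta>' - \<theta>))\<^sup>2)) \<partial>lborel) / ennreal c"
        by (intro divide_right_mono_ennreal nn_integral_mono) (auto simp: indicator_def)
      also have "\<dots> = ennreal (pi / (real j * M)) / ennreal c" by (subst nn_integral_gauss_2[OF jM]) simp
      also have "\<dots> = ennreal (pi / (real j * M * c))"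
        using jM \<open>c > 0\<close> by (subst divide_ennreal) (auto simp: divide_simps)
      finally show ?thesis .
    qed
    have inner: "(\<integral>\<^sup>+\<theta>'. ennreal (\<phi> (\<theta>, \<theta>')) \<partial>U) \<le> ennreal (pi / (real j * M * c)) + ennreal (\<kappa> ^ j)" if \<theta>: "\<theta> \<in> A" for \<theta>
    proof -
      have "(\<integral>\<^sup>+\<theta>'. ennreal (\<phi> (\<theta>, \<theta>')) \<partial>U) \<le>
          (\<integral>\<^sup>+\<theta>'. ennreal (exp (- (real j * M) * (norm (\<theta>' - \<theta>))\<^sup>2)) + ennreal (\<kappa> ^ j) \<partial>U)"
      proof (rule nn_integral_mono_AE, use AE_A in eventually_elim)
        case (elim \<theta>')
        have "ennreal (\<phi> (\<theta>, \<theta>')) \<le> ennreal (exp (- (real j * M) * (norm (\<theta>' - \<theta>))\<^sup>2) + \<kappa> ^ j)"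
          unfolding \<phi>_def fst_conv snd_conv by (rule ennreal_leI) (rule bound[OF \<theta> elim])
        then show ?case using \<kappa> by (simp add: ennreal_plus)
      qed
      also have "\<dots> = (\<integral>\<^sup>+\<theta>'. ennreal (exp (- (real j * M) * (norm (\<theta>' - \<theta>))\<^sup>2)) \<partial>U) + (\<integral>\<^sup>+\<theta>'. ennreal (\<kappa> ^ j) \<partial>U)"
        by (rule nn_integral_add) measurable
      also have "(\<integral>\<^sup>+\<theta>'. ennreal (\<kappa> ^ j) \<partial>U) = ennreal (\<kappa> ^ j)" by (simp add: U.emeasure_space_1)
      finally show ?thesis using gauss_U[of \<theta>] by (meson add_right_mono order_trans)
    qed
    have "ennreal (pmf (nstep (walk_kernel p) j 0) x) \<le> ennreal (\<integral>z. \<phi> z \<partial>(U \<Otimes>\<^sub>M U))"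
      unfolding \<phi>_def by (rule ennreal_leI) (rule pmf_le_integral[OF U])
    also have "\<dots> = (\<integral>\<^sup>+z. ennreal (\<phi> z) \<partial>(U \<Otimes>\<^sub>M U))"
      using \<phi>_int by (intro nn_integral_eq_integral[symmetric]) (auto simp: \<phi>_def)
    also have "\<dots> = (\<integral>\<^sup>+\<theta>. \<integral>\<^sup>+\<theta>'. ennreal (\<phi> (\<theta>, \<theta>')) \<partial>U \<partial>U)"
      by (rule U.nn_integral_fst[symmetric]) measurable
    also have "\<dots> \<le> (\<integral>\<^sup>+\<theta>. ennreal (pi / (real j * M * c)) + ennreal (\<kappa> ^ j) \<partial>U)"
      by (rule nn_integral_mono_AE, use AE_A in eventually_elim) (rule inner)
    also have "\<dots> = ennreal (pi / (real j * M * c)) + ennreal (\<kappa> ^ j)" by (simp add: U.emeasure_space_1)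
    also have "\<dots> = ennreal (pi / (real j * M * c) + \<kappa> ^ j)"
      using jM \<open>c > 0\<close> \<kappa> by (intro ennreal_plus[symmetric]) auto
    finally show ?thesis using jM \<open>c > 0\<close> \<kappa> by (subst (asm) ennreal_le_iff) auto
  qed
  have "(\<lambda>j. real j * \<kappa> ^ j) \<longlonglongrightarrow> 0" using \<kappa> powser_times_n_limit_0[of \<kappa>] by simp
  then have "\<forall>\<^sub>F j in sequentially. real j * \<kappa> ^ j < e / 2" using e by (intro order_tendstoD(2)) auto
  then show ?thesis using eventually_ge_at_top[of 1]
  proof eventually_elim
    case (elim j)
    show ?case
    proof
      fix x
      have "real j * pmf (nstep (walk_kernel p) j 0) x \<le> real j * (pi / (real j * M * c) + \<kappa> ^ j)"
        by (intro mult_left_mono main elim) auto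
      also have "\<dots> = e / 2 + real j * \<kappa> ^ j"
        using elim(2) \<open>c > 0\<close> e by (simp add: M_def field_simps)
      finally show "real j * pmf (nstep (walk_kernel p) j 0) x \<le> e" using elim(1) by linarith
    qed
  qed
qed

end

end

subsection \<open>Escaping from a finite set\<close>

lemma integrable_avoid: "integrable (measure_pmf q) (avoid K A n)"
  using avoid_nonneg[of K A n] avoid_le_1[of K A n]
  by (intro integrable_pmf_bounded[where C=1]) (simp only: abs_of_nonneg)

text \<open>A chain that avoids A up to time n but not up to n + 1 is in A at time n + 1.\<close>

lemma avoid_Suc_ge: "avoid K A n x - measure (measure_pmf (nstep K (Suc n) x)) A \<le> avoid K A (Suc n) x"
proof (induction n arbitrary: x)
  case 0
  show ?case
  proof (cases "x \<in> A")
    case False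
    have "(\<integral>y. avoid K A 0 y \<partial>measure_pmf (K x)) = (\<integral>y. 1 - indicator A y \<partial>measure_pmf (K x))"
      by (intro Bochner_Integration.integral_cong) (auto simp: indicator_def)
    also have "\<dots> = 1 - measure (measure_pmf (K x)) A"
      by (subst Bochner_Integration.integral_diff) (auto intro!: integrable_pmf_bounded[where C=1])
    finally show ?thesis using False by (simp add: bind_return_pmf del: killed.simps(1) add: killed.simps(1)[of K A _ x])
  qed simp
next
  case (Suc n)
  show ?case
  proof (cases "x \<in> A")
    case False
    have "(\<integral>y. avoid K A n y \<partial>measure_pmf (K x)) - (\<integral>y. measure (measure_pmf (nstep K (Suc n) y)) A \<partial>measure_pmf (K x)) =
        (\<integral>y. avoid K A n y - measure (measure_pmf (nstep K (Suc n) y)) A \<partial>measure_pmf (K x))"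
      using avoid_nonneg[of K A n] avoid_le_1[of K A n]
      by (subst Bochner_Integration.integral_diff) (auto intro!: integrable_pmf_bounded[where C=1])
    also have "\<dots> \<le> (\<integral>y. avoid K A (Suc n) y \<partial>measure_pmf (K x))"
    proof (rule integral_mono[OF _ _ Suc.IH])
      show "integrable (measure_pmf (K x)) (\<lambda>y. avoid K A n y - measure (measure_pmf (nstep K (Suc n) y)) A)"
        by (rule Bochner_Integration.integrable_diff[OF integrable_avoid integrable_pmf_bounded[where C=1]]) simp
      show "integrable (measure_pmf (K x)) (avoid K A (Suc n))" by (rule integrable_avoid)
    qed
    finally have *: "(\<integral>y. avoid K A n y \<partial>measure_pmf (K x)) - (\<integral>y. measure (measure_pmf (nstep K (Suc n) y)) A \<partial>measure_pmf (K x))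
      \<le> (\<integral>y. avoid K A (Suc n) y \<partial>measure_pmf (K x))" .
    have e: "avoid K A (Suc m) x = (\<integral>y. avoid K A m y \<partial>measure_pmf (K x))" for m
      using False by (simp only: killed.simps(2) if_False)
    show ?thesis using * unfolding e nstep_Suc_first[of K "Suc n"] measure_bind_pmf_eq .
  qed simp
qed

lemma avoid_union_bound:
  "avoid K A s x - (\<Sum>j<m. measure (measure_pmf (nstep K (Suc (s + j)) x)) A) \<le> avoid K A (s + m) x"
proof (induction m)
  case (Suc m)
  then show ?case using avoid_Suc_ge[of K A "s + m" x] by (simp del: nstep.simps killed.simps)
qed simp

lemma avoid_subset:
  assumes "A \<subseteq> C"
  shows "avoid K C n x \<le> avoid K A n x"
proof (induction n arbitrary: x)
  case (Suc n)
  have "(\<integral>y. avoid K C n y \<partial>measure_pmf (K x)) \<le> (\<integral>y. avoid K A n y \<partial>measure_pmf (K x))"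
    by (intro integral_mono integrable_avoid Suc.IH)
  moreover have "0 \<le> (\<integral>y. avoid K A n y \<partial>measure_pmf (K x))"
    using avoid_nonneg by (intro Bochner_Integration.integral_nonneg) auto
  ultimately show ?case using assms by auto
qed (use assms in auto)

text \<open>The probability of ending in F, minus the probability of having met A.\<close>

lemma killed_indicator_ge:
  "measure (measure_pmf (nstep K n x)) F - (1 - avoid K A n x) \<le> killed K A n (indicator F) x"
proof (induction n arbitrary: x)
  case 0
  show ?case by (auto simp: indicator_def)
next
  case (Suc n)
  have b: "0 \<le> killed K A n (indicator F) y" "killed K A n (indicator F) y \<le> 1" for y
    using killed_bounds[of "indicator F" 1] by auto
  show ?case
  proof (cases "x \<in> A")
    case True
    then show ?thesis by simp
  next
    case False
    have "(\<integral>y. measure (measure_pmf (nstep K n y)) F \<partial>measure_pmf (K x)) - (1 - (\<integral>y. avoid K A n y \<partial>measure_pmf (K x))) =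
        (\<integral>y. measure (measure_pmf (nstep K n y)) F - (1 - avoid K A n y) \<partial>measure_pmf (K x))"
    proof -
      have "(\<integral>y. 1 - avoid K A n y \<partial>measure_pmf (K x)) = 1 - (\<integral>y. avoid K A n y \<partial>measure_pmf (K x))"
        by (subst Bochner_Integration.integral_diff[OF integrable_pmf_bounded[where C=1] integrable_avoid]) auto
      then show ?thesis
        by (subst Bochner_Integration.integral_diff[OF integrable_pmf_bounded[where C=1]
              Bochner_Integration.integrable_diff[OF integrable_pmf_bounded[where C=1] integrable_avoid]]) auto
    qed
    also have "\<dots> \<le> (\<integral>y. killed K A n (indicator F) y \<partial>measure_pmf (K x))"
    proof (rule integral_mono[OF _ _ Suc.IH])
      show "integrable (measure_pmf (K x)) (\<lambda>y. measure (measure_pmf (nstep K n y)) F - (1 - avoid K A n y))"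
        by (rule Bochner_Integration.integrable_diff[OF integrable_pmf_bounded[where C=1]
              Bochner_Integration.integrable_diff[OF integrable_pmf_bounded[where C=1] integrable_avoid]]) auto
      show "integrable (measure_pmf (K x)) (killed K A n (indicator F))"
        using b by (intro integrable_pmf_bounded[where C=1]) auto
    qed
    finally show ?thesis using False unfolding nstep_Suc_first measure_bind_pmf_eq by simp
  qed
qed

context
  fixes p :: "(int^'d) pmf" and B :: "nat \<Rightarrow> real" and S :: "real^'d^'d"
  assumes B_type: "B_type p B S" and dim: "CARD('d) \<ge> 2"
begin

lemma nstep_set_le:
  assumes A: "finite A" and bound: "\<And>y. pmf (nstep (walk_kernel p) j 0) y \<le> e"
  shows "measure (measure_pmf (nstep (walk_kernel p) j x)) A \<le> real (card A) * e"
proof -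
  have shift: "pmf (nstep (walk_kernel p) j x) u = pmf (nstep (walk_kernel p) j 0) (u - x)" for u
    using pmf_map_inj'[of "\<lambda>y. x + y" "nstep (walk_kernel p) j 0" "u - x"]
    by (subst nstep_walk) (simp add: inj_def)
  have "measure (measure_pmf (nstep (walk_kernel p) j x)) A = (\<Sum>u\<in>A. pmf (nstep (walk_kernel p) j x) u)"
    using A by (rule measure_measure_pmf_finite)
  also have "\<dots> \<le> (\<Sum>u\<in>A. e)" unfolding shift by (intro sum_mono bound)
  finally show ?thesis by simp
qed

text \<open>
  Since \<open>j P(Y\<^sub>j = x) \<rightarrow> 0\<close>, a walk at distance \<open>B t\<close> has vanishing probability of hitting \<open>A\<close>
  before time \<open>K t\<close>, while it reaches distance \<open>B (K t)\<close> with a probability \<open>c\<close> that does not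
  depend on \<open>K\<close>.
\<close>

lemma one_scale:
  "\<exists>c>0. c \<le> 1 \<and> (\<forall>A K. finite A \<longrightarrow> 1 \<le> K \<longrightarrow> (\<forall>\<^sub>F t in sequentially. \<forall>x. B t \<le> norm (real_vec x) \<longrightarrow>
    c \<le> killed (walk_kernel p) A (K * t) (indicator {y. B (K * t) \<le> norm (real_vec y)}) x))"
proof -
  obtain a b :: 'd where ab: "a \<noteq> b"
  proof -
    have "\<not> CARD('d) \<le> Suc 0" using dim by simp
    then show ?thesis using that card_le_Suc0_iff_eq[of "UNIV :: 'd set"] by auto
  qed
  obtain c where c: "c > 0" "\<forall>\<^sub>F n in sequentially. \<forall>x. c \<le> measure (measure_pmf (nstep (walk_kernel p) n x)) {y. B n \<le> norm (real_vec y)}"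
    using far_probability[OF B_type] by blast
  obtain \<eta> where \<eta>: "\<eta> > 0" "\<forall>\<^sub>F n in sequentially. \<forall>j x. real j \<le> \<eta> * real n \<longrightarrow>
    1 - avoid (walk_kernel p) {y. 1 / 2 * B n \<le> norm (real_vec (y - x))} j x \<le> c / 4"
    using maximal_small[OF B_type, of "1/2" "c / 4"] c by auto
  have c1: "c \<le> 1"
  proof -
    obtain n where "\<forall>x. c \<le> measure (measure_pmf (nstep (walk_kernel p) n x)) {y. B n \<le> norm (real_vec y)}"
      using c(2) by (auto simp: eventually_sequentially)
    then show ?thesis using measure_pmf.prob_le_1 order_trans by blast
  qed
  have "\<forall>\<^sub>F t in sequentially. \<forall>x. B t \<le> norm (real_vec x) \<longrightarrow>
    c / 2 \<le> killed (walk_kernel p) A (K * t) (indicator {y. B (K * t) \<le> norm (real_vec y)}) x"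
    if A: "finite A" and K: "1 \<le> K" for A K
  proof -
    define R where "R = (\<Sum>u\<in>A. norm (real_vec u))"
    have R: "norm (real_vec u) \<le> R" if "u \<in> A" for u
      unfolding R_def using A that by (intro member_le_sum) auto
    \<comment> \<open>Chosen so that at most K t hitting probabilities, each at most card A times e
      / (\<eta> t), sum to at most c/8.\<close>
    define e where "e = c * \<eta> / (8 * real K * (real (card A) + 1))"
    have e: "e > 0" unfolding e_def using c \<eta> K by (intro divide_pos_pos mult_pos_pos) auto
    obtain J where J: "\<And>j x. j \<ge> J \<Longrightarrow> real j * pmf (nstep (walk_kernel p) j 0) x \<le> e"
      using local_bound[OF B_type ab e] by (auto simp: eventually_sequentially)
    have Kt: "filterlim (\<lambda>t. K * t) at_top sequentially"
      using K by (intro filterlim_at_top_mono[OF filterlim_ident]) auto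
    have "\<forall>\<^sub>F t in sequentially. \<forall>x. c \<le> measure (measure_pmf (nstep (walk_kernel p) (K * t) x)) {y. B (K * t) \<le> norm (real_vec y)}"
      using c(2) Kt by (rule eventually_compose_filterlim)
    moreover have "\<forall>\<^sub>F t in sequentially. B t \<ge> 2 * R"
      using B_at_top[OF B_type] by (simp only: filterlim_at_top)
    moreover have "\<forall>\<^sub>F t in sequentially. \<eta> * real t \<ge> real J + 1"
    proof -
      have "filterlim (\<lambda>t. \<eta> * real t) at_top sequentially"
        using \<eta>(1) by (intro filterlim_tendsto_pos_mult_at_top[OF tendsto_const] filterlim_real_sequentially) auto
      then show ?thesis by (simp only: filterlim_at_top)
    qed
    ultimately show ?thesis using \<eta>(2) eventually_ge_at_top[of 1]
    proof eventually_elim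
      case (elim t)
      show ?case
      proof (intro allI impI)
        fix x :: "int^'d" assume x: "B t \<le> norm (real_vec x)"
        \<comment> \<open>Up to time s the walk stays within B t / 2 of x with probability at least
          1 - c/4, and then it cannot reach A, which lies within R \<le> B t / 2 of the origin.
          After s the local bound takes over. The minimum covers large \<eta>, where the second
          period is empty.\<close>
        define s where "s = min (nat \<lfloor>\<eta> * real t\<rfloor>) (K * t)"
        define C where "C = {y :: int^'d. 1 / 2 * B t \<le> norm (real_vec (y - x))}"
        have t: "real t > 0" using elim(5) by simp
        have \<eta>t: "\<eta> * real t > 0" using \<eta>(1) t by simp
        have "real s \<le> \<eta> * real t"
        proof -
          have "real s \<le> real (nat \<lfloor>\<eta> * real t\<rfloor>)" by (simp add: s_def)
          also have "\<dots> \<le> \<eta> * real t" using \<eta>t by (intro of_nat_floor) simp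
          finally show ?thesis .
        qed
        then have 1: "1 - avoid (walk_kernel p) C s x \<le> c / 4" using elim(4) unfolding C_def by blast
        have "A \<subseteq> C"
        proof
          fix u assume u: "u \<in> A"
          have "norm (real_vec x) \<le> norm (real_vec (u - x)) + norm (real_vec u)"
            unfolding real_vec_diff by (metis add.commute norm_minus_commute norm_triangle_sub)
          then show "u \<in> C" using x R[OF u] elim(2) by (simp add: C_def)
        qed
        from avoid_subset[OF this, of "walk_kernel p" s x] 1
        have 2: "1 - c / 4 \<le> avoid (walk_kernel p) A s x" by linarith
        define m where "m = K * t - s"
        have sm: "s + m = K * t" by (simp add: m_def s_def)
        have hit: "measure (measure_pmf (nstep (walk_kernel p) (Suc (s + j)) x)) A \<le> real (card A) * (e / (\<eta> * real t))"
          if "j < m" for j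
        proof (rule nstep_set_le[OF A])
          fix y
          have "s < K * t" using that by (simp add: m_def)
          then have "s = nat \<lfloor>\<eta> * real t\<rfloor>" by (auto simp: s_def)
          then have "\<eta> * real t < real s + 1" using \<eta>t by linarith
          then have big: "\<eta> * real t \<le> real (Suc (s + j))" by simp
          then have "J \<le> Suc (s + j)" using elim(3) by linarith
          from J[OF this, of y] have "real (Suc (s + j)) * pmf (nstep (walk_kernel p) (Suc (s + j)) 0) y \<le> e" .
          moreover have "\<eta> * real t * pmf (nstep (walk_kernel p) (Suc (s + j)) 0) y \<le>
              real (Suc (s + j)) * pmf (nstep (walk_kernel p) (Suc (s + j)) 0) y"
            by (intro mult_right_mono big pmf_nonneg)
          ultimately show "pmf (nstep (walk_kernel p) (Suc (s + j)) 0) y \<le> e / (\<eta> * real t)"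
            using \<eta>t by (simp add: pos_le_divide_eq mult.commute del: nstep.simps)
        qed
        have "(\<Sum>j<m. measure (measure_pmf (nstep (walk_kernel p) (Suc (s + j)) x)) A) \<le> (\<Sum>j<m. real (card A) * (e / (\<eta> * real t)))"
          by (intro sum_mono hit) auto
        also have "\<dots> = real m * (real (card A) * (e / (\<eta> * real t)))" by simp
        also have "\<dots> \<le> real (K * t) * ((real (card A) + 1) * (e / (\<eta> * real t)))"
        proof (intro mult_mono of_nat_mono)
          show "m \<le> K * t" by (simp add: m_def)
        qed (use e \<eta>t in auto)
        also have "\<dots> = c / 8"
        proof -
          define r where "r = real (card A) + 1"
          have "r > 0" by (simp add: r_def)
          then show ?thesis unfolding e_def r_def[symmetric] using \<eta>(1) t K by (simp add: field_simps)
        qed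
        finally have "1 - c / 4 - c / 8 \<le> avoid (walk_kernel p) A (s + m) x"
          using avoid_union_bound[of "walk_kernel p" A s x m] 2 by linarith
        then have "1 - avoid (walk_kernel p) A (K * t) x \<le> c / 4 + c / 8" unfolding sm by linarith
        moreover have "c \<le> measure (measure_pmf (nstep (walk_kernel p) (K * t) x)) {y. B (K * t) \<le> norm (real_vec y)}"
          using elim(1) by blast
        ultimately show "c / 2 \<le> killed (walk_kernel p) A (K * t) (indicator {y. B (K * t) \<le> norm (real_vec y)}) x"
          using killed_indicator_ge[of "walk_kernel p" "K * t" x "{y. B (K * t) \<le> norm (real_vec y)}" A] c(1)
          by linarith
      qed
    qed
  qed
  then show ?thesis using c c1 by (intro exI[of _ "c / 2"]) auto
qed

text \<open>Multiplying the time by K costs a factor c in probability. As c is independent of K, K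
  can be taken so large that K powr (- \<gamma>) \<le> c, and each such factor is paid for by the
  decay n powr (- \<gamma>).\<close>

lemma escape:
  assumes A: "finite A" and \<gamma>: "\<gamma> > 0"
  shows "\<exists>\<kappa>>0. \<exists>R. \<forall>n\<ge>1. \<forall>x. R \<le> norm (real_vec x) \<longrightarrow> \<kappa> * real n powr (- \<gamma>) \<le> avoid (walk_kernel p) A n x"
proof -
  obtain c where c: "0 < c" "c \<le> 1" and step: "\<And>K. 1 \<le> K \<Longrightarrow> (\<forall>\<^sub>F t in sequentially. \<forall>x. B t \<le> norm (real_vec x) \<longrightarrow>
    c \<le> killed (walk_kernel p) A (K * t) (indicator {y. B (K * t) \<le> norm (real_vec y)}) x)"
    using one_scale A by blast
  obtain K0 :: nat where K0: "(1 / c) powr (1 / \<gamma>) \<le> real K0" using real_arch_simple by blast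
  define K where "K = max 2 K0"
  have K: "K \<ge> 2" "(1 / c) powr (1 / \<gamma>) \<le> real K" using K0 by (auto simp: K_def)
  have cK: "real K powr (- \<gamma>) \<le> c"
  proof -
    have "((1 / c) powr (1 / \<gamma>)) powr \<gamma> \<le> real K powr \<gamma>" using K \<gamma> by (intro powr_mono2) auto
    then have "1 / c \<le> real K powr \<gamma>" using \<gamma> c by (simp add: powr_powr)
    then show ?thesis using c K by (simp add: powr_minus field_simps)
  qed
  have "1 \<le> K" using K by simp
  from step[OF this] obtain t0 where t0: "\<And>t x. t \<ge> t0 \<Longrightarrow> B t \<le> norm (real_vec x) \<Longrightarrow>
    c \<le> killed (walk_kernel p) A (K * t) (indicator {y. B (K * t) \<le> norm (real_vec y)}) x"
    by (auto simp: eventually_sequentially)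
  \<comment> \<open>The induction keeps only the mass that is beyond \<open>B (K * t)\<close> at
    time K t, which is exactly the starting condition of the next scale.\<close>
  have chain: "c ^ Suc i \<le> avoid (walk_kernel p) A (t * K ^ i) x" if "t \<ge> t0" "B t \<le> norm (real_vec x)" for i t x
    using that
  proof (induction i arbitrary: t x)
    case 0
    have "c \<le> killed (walk_kernel p) A (K * t) (indicator {y. B (K * t) \<le> norm (real_vec y)}) x" using 0 by (rule t0)
    also have "\<dots> \<le> avoid (walk_kernel p) A (K * t) x"
      by (rule killed_mono[where c=1]) (auto simp: indicator_def)
    also have "\<dots> \<le> avoid (walk_kernel p) A t x" using K by (intro avoid_antimono) auto
    finally show ?case by simp
  next
    case (Suc i)
    define F where "F = {y :: int^'d. B (K * t) \<le> norm (real_vec y)}"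
    have "t \<le> K * t" using K by simp
    then have Kt: "t0 \<le> K * t" using Suc.prems(1) by linarith
    have IH: "c ^ Suc i * indicator F y \<le> avoid (walk_kernel p) A (K * t * K ^ i) y" for y
    proof (cases "y \<in> F")
      case True
      then show ?thesis using Suc.IH[OF Kt, of y] by (simp add: F_def)
    qed (simp add: avoid_nonneg)
    have "c ^ Suc (Suc i) \<le> c ^ Suc i * killed (walk_kernel p) A (K * t) (indicator F) x"
      using t0[OF Suc.prems] c by (simp add: F_def mult.commute mult_left_mono)
    also have "\<dots> = killed (walk_kernel p) A (K * t) (\<lambda>y. c ^ Suc i * indicator F y) x"
      by (rule killed_scale[symmetric])
    also have "\<dots> \<le> killed (walk_kernel p) A (K * t) (avoid (walk_kernel p) A (K * t * K ^ i)) x"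
      using c by (intro killed_mono[where c=1] IH avoid_le_1) auto
    also have "\<dots> = avoid (walk_kernel p) A (K * t + K * t * K ^ i) x" by (rule killed_add[symmetric])
    also have "\<dots> \<le> avoid (walk_kernel p) A (t * K ^ Suc i) x" by (intro avoid_antimono) (simp add: mult.commute mult.left_commute)
    finally show ?case .
  qed
  define t1 where "t1 = max t0 1"
  \<comment> \<open>For K^j \<le> n < K^(j + 1) the scale j + 1 is needed, which costs c^(j + 2);
    the two surplus factors form the constant in front.\<close>
  have "real K powr (- \<gamma>) * real K powr (- \<gamma>) * real n powr (- \<gamma>) \<le> avoid (walk_kernel p) A n x"
    if n: "n \<ge> 1" and x: "B t1 \<le> norm (real_vec x)" for n x
  proof -
    obtain j where j: "K ^ j \<le> n" "n < K ^ (j + 1)" using ex_power_ivl1[OF K(1) n] by blast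
    have "real K powr (- \<gamma>) * real K powr (- \<gamma>) * real n powr (- \<gamma>) \<le>
        real K powr (- \<gamma>) * real K powr (- \<gamma>) * real (K ^ j) powr (- \<gamma>)"
      using j K \<gamma> by (intro mult_left_mono powr_mono2') (auto simp flip: of_nat_power)
    also have "\<dots> = (real K powr (- \<gamma>)) ^ Suc (Suc j)"
    proof -
      have "real (K ^ j) powr (- \<gamma>) = (real K powr (- \<gamma>)) ^ j"
        using K by (simp add: powr_realpow[symmetric] powr_powr mult.commute)
      then show ?thesis by simp
    qed
    also have "\<dots> \<le> c ^ Suc (Suc j)" by (intro power_mono cK) auto
    also have "\<dots> \<le> avoid (walk_kernel p) A (t1 * K ^ Suc j) x"
      using x by (intro chain) (auto simp: t1_def)
    also have "\<dots> \<le> avoid (walk_kernel p) A n x"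
    proof (rule avoid_antimono)
      have "n \<le> 1 * K ^ Suc j" using j(2) by simp
      also have "\<dots> \<le> t1 * K ^ Suc j" by (intro mult_right_mono) (auto simp: t1_def)
      finally show "n \<le> t1 * K ^ Suc j" .
    qed
    finally show ?thesis .
  qed
  moreover have "real K powr (- \<gamma>) * real K powr (- \<gamma>) > 0" using K by simp
  ultimately show ?thesis by blast
qed

end

section \<open>The invariance principle for the unperturbed walk\<close>

lemma pmf_measure_mono_support:
  assumes "\<And>x. x \<in> set_pmf q \<Longrightarrow> x \<in> E \<Longrightarrow> x \<in> F"
  shows "measure (measure_pmf q) E \<le> measure (measure_pmf q) F"
  using assms by (intro measure_pmf.finite_measure_mono_AE) (auto simp: AE_measure_pmf_iff)

lemma chain_path_avoid:
  "k \<le> n \<Longrightarrow> measure (measure_pmf (chain_path K n x)) {l. \<forall>i\<le>k. l ! i \<notin> C} = avoid K C k x"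
proof (induction n arbitrary: k x)
  case 0
  then show ?case by (auto simp: indicator_def)
next
  case (Suc n)
  have split: "measure (measure_pmf (chain_path K (Suc n) x)) E =
      (\<integral>y. measure (measure_pmf (chain_path K n y)) {l. x # l \<in> E} \<partial>measure_pmf (K x))" for E
    by (simp add: measure_bind_pmf_eq measure_map_pmf vimage_def)
  show ?case
  proof (cases k)
    case 0
    then show ?thesis unfolding split by simp
  next
    case (Suc j)
    have "{l. x # l \<in> {l. \<forall>i\<le>k. l ! i \<notin> C}} = (if x \<in> C then {} else {l. \<forall>i\<le>j. l ! i \<notin> C})"
    proof -
      have "(\<forall>i\<le>k. (x # l) ! i \<notin> C) \<longleftrightarrow> x \<notin> C \<and> (\<forall>i\<le>j. l ! i \<notin> C)" for l
      proof -
        have "{..k} = insert 0 (Suc ` {..j})" unfolding Suc by (rule atMost_Suc_eq_insert_0)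
        then have "(\<forall>i\<in>{..k}. (x # l) ! i \<notin> C) \<longleftrightarrow> x \<notin> C \<and> (\<forall>i\<in>{..j}. l ! i \<notin> C)" by auto
        then show ?thesis by (simp only: Ball_def atMost_iff)
      qed
      then show ?thesis by auto
    qed
    moreover have "j \<le> n" using Suc Suc.prems by simp
    ultimately show ?thesis unfolding split Suc by (simp add: Suc.IH)
  qed
qed

text \<open>The Markov property at the block start s. The set to be avoided consists of the points
  related to the state y at time s, so it varies with y.\<close>

lemma block_oscillation:
  assumes s: "s \<le> n"
  shows "measure (measure_pmf (chain_path K n x)) {l. \<exists>j. s \<le> j \<and> j \<le> s + k \<and> j \<le> n \<and> R (l ! s) (l ! j)}
    \<le> (\<integral>y. 1 - avoid K {w. R y w} k y \<partial>measure_pmf (nstep K s x))"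
proof -
  \<comment> \<open>The list ends at time n, so the window is cut there; avoiding over the longer
    window k is less likely, which is the direction needed.\<close>
  define r where "r = min k (n - s)"
  define E where "E = {l. \<exists>i\<le>r. R (l ! 0) (l ! i)}"
  have "measure (measure_pmf (chain_path K n x)) {l. \<exists>j. s \<le> j \<and> j \<le> s + k \<and> j \<le> n \<and> R (l ! s) (l ! j)} \<le>
      measure (measure_pmf (chain_path K n x)) (drop s -` E)"
  proof (rule pmf_measure_mono_support)
    fix l assume l: "l \<in> set_pmf (chain_path K n x)" and "l \<in> {l. \<exists>j. s \<le> j \<and> j \<le> s + k \<and> j \<le> n \<and> R (l ! s) (l ! j)}"
    then obtain j where j: "s \<le> j" "j \<le> s + k" "j \<le> n" "R (l ! s) (l ! j)" by blast
    have len: "length l = Suc n" using l by (rule length_chain_path)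
    have "R (drop s l ! 0) (drop s l ! (j - s))" using j len s by simp
    moreover have "j - s \<le> r" using j by (auto simp: r_def)
    ultimately show "l \<in> drop s -` E" unfolding E_def by auto
  qed
  also have "\<dots> = measure (measure_pmf (map_pmf (drop s) (chain_path K n x))) E"
    by (simp add: measure_map_pmf)
  also have "\<dots> = (\<integral>y. measure (measure_pmf (chain_path K (n - s) y)) E \<partial>measure_pmf (nstep K s x))"
    unfolding chain_path_drop[OF s] by (rule measure_bind_pmf_eq)
  also have "\<dots> \<le> (\<integral>y. 1 - avoid K {w. R y w} k y \<partial>measure_pmf (nstep K s x))"
  proof (rule integral_mono)
    show "integrable (measure_pmf (nstep K s x)) (\<lambda>y. measure (measure_pmf (chain_path K (n - s) y)) E)"
      by (rule integrable_pmf_bounded[where C=1]) auto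
    show "integrable (measure_pmf (nstep K s x)) (\<lambda>y. 1 - avoid K {w. R y w} k y)"
      using avoid_nonneg[of K _ k] avoid_le_1[of K _ k] by (intro integrable_pmf_bounded[where C=1]) (auto simp: abs_le_iff intro: add_increasing)
    fix y
    have "measure (measure_pmf (chain_path K (n - s) y)) E \<le>
        measure (measure_pmf (chain_path K (n - s) y)) (- {l. \<forall>i\<le>r. l ! i \<notin> {w. R y w}})"
      by (rule pmf_measure_mono_support) (auto simp: E_def dest: hd_chain_path)
    also have "\<dots> = 1 - measure (measure_pmf (chain_path K (n - s) y)) {l. \<forall>i\<le>r. l ! i \<notin> {w. R y w}}"
      using measure_pmf.prob_compl[of "{l. \<forall>i\<le>r. l ! i \<notin> {w. R y w}}" "chain_path K (n - s) y"]
      by (simp add: Compl_eq_Diff_UNIV)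
    also have "\<dots> = 1 - avoid K {w. R y w} r y" by (subst chain_path_avoid) (auto simp: r_def)
    also have "\<dots> \<le> 1 - avoid K {w. R y w} k y" using avoid_antimono[of r k K "{w. R y w}" y] by (simp add: r_def)
    finally show "measure (measure_pmf (chain_path K (n - s) y)) E \<le> 1 - avoid K {w. R y w} k y" .
  qed
  finally show ?thesis .
qed

lemma prod_blocks:
  fixes s :: "nat \<Rightarrow> nat" and g :: "nat \<Rightarrow> 'c::comm_monoid_mult"
  assumes s: "mono s" "s 0 = 0"
  shows "(\<Prod>k<s m. g k) = (\<Prod>b<m. \<Prod>k\<in>{s b..<s (Suc b)}. g k)"
proof (induction m)
  case (Suc m)
  have "prod g {0..<s m} * prod g {s m..<s (Suc m)} = prod g {0..<s (Suc m)}"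
    using monoD[OF s(1), of m "Suc m"] by (intro prod.atLeastLessThan_concat) auto
  then show ?case using Suc by (simp add: atLeast0LessThan)
qed (simp add: s)

lemma sum_blocks:
  fixes s :: "nat \<Rightarrow> nat" and g :: "nat \<Rightarrow> 'c::comm_monoid_add"
  assumes s: "mono s" "s 0 = 0"
  shows "(\<Sum>k<s m. g k) = (\<Sum>b<m. \<Sum>k\<in>{s b..<s (Suc b)}. g k)"
proof (induction m)
  case (Suc m)
  have "sum g {0..<s m} + sum g {s m..<s (Suc m)} = sum g {0..<s (Suc m)}"
    using monoD[OF s(1), of m "Suc m"] by (intro sum.atLeastLessThan_concat) auto
  then show ?case using Suc by (simp add: atLeast0LessThan)
qed (simp add: s)

text \<open>A frequency that is constant on each block makes the single increments telescope to the
  block increment, so the product formula for single steps applies.\<close>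

lemma cf_walk_blocks:
  fixes p :: "(int^'d) pmf" and u :: "nat \<Rightarrow> real^'d"
  assumes s: "mono s" "s 0 = 0"
  shows "(\<integral>l. iexp (\<Sum>b<m. u b \<bullet> real_vec (l ! s (Suc b) - l ! s b)) \<partial>measure_pmf (chain_path (walk_kernel p) (s m) x)) =
    (\<Prod>b<m. cf p (u b) ^ (s (Suc b) - s b))"
proof -
  \<comment> \<open>The index of the block containing k; taking the least candidate makes it well
    defined even with empty blocks.\<close>
  define \<beta> where "\<beta> = (\<lambda>k. LEAST b. k < s (Suc b))"
  have \<beta>: "\<beta> k = b" if "k \<in> {s b..<s (Suc b)}" for k b
    unfolding \<beta>_def
  proof (rule Least_equality)
    fix c assume "k < s (Suc c)"
    then have "s b < s (Suc c)" using that by simp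
    then show "b \<le> c" using monoD[OF s(1), of "Suc c" b] by (metis not_less not_less_eq_eq)
  qed (use that in simp)
  have tele: "(\<Sum>k\<in>{s b..<s (Suc b)}. u (\<beta> k) \<bullet> real_vec (l ! Suc k - l ! k)) = u b \<bullet> real_vec (l ! s (Suc b) - l ! s b)" for b and l :: "(int^'d) list"
  proof -
    have "(\<Sum>k\<in>{s b..<s (Suc b)}. u (\<beta> k) \<bullet> real_vec (l ! Suc k - l ! k)) = (\<Sum>k\<in>{s b..<s (Suc b)}. u b \<bullet> real_vec (l ! Suc k) - u b \<bullet> real_vec (l ! k))"
      by (intro sum.cong refl) (simp add: \<beta> real_vec_diff inner_diff_right)
    also have "\<dots> = u b \<bullet> real_vec (l ! s (Suc b)) - u b \<bullet> real_vec (l ! s b)"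
      using monoD[OF s(1), of b "Suc b"] by (intro sum_Suc_diff') simp
    finally show ?thesis by (simp add: real_vec_diff inner_diff_right)
  qed
  have "(\<integral>l. iexp (\<Sum>b<m. u b \<bullet> real_vec (l ! s (Suc b) - l ! s b)) \<partial>measure_pmf (chain_path (walk_kernel p) (s m) x)) =
      (\<integral>l. iexp (\<Sum>k<s m. u (\<beta> k) \<bullet> real_vec (l ! Suc k - l ! k)) \<partial>measure_pmf (chain_path (walk_kernel p) (s m) x))"
    unfolding sum_blocks[OF s] tele ..
  also have "\<dots> = (\<Prod>b<m. \<Prod>k\<in>{s b..<s (Suc b)}. cf p (u (\<beta> k)))"
    unfolding cf_walk_increments prod_blocks[OF s] ..
  also have "\<dots> = (\<Prod>b<m. cf p (u b) ^ (s (Suc b) - s b))"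
    by (intro prod.cong refl) (simp add: \<beta>)
  finally show ?thesis .
qed

lemma wiener_increment_char:
  assumes W: "wiener_process N S W" and st: "0 \<le> s" "s < t" "t \<le> 1"
  shows "(\<integral>\<omega>. iexp (v \<bullet> (W t \<omega> - W s \<omega>)) \<partial>N) = of_real (exp (- (t - s) * (v \<bullet> (S *v v)) / 2))"
proof -
  have m: "(\<lambda>\<omega>. W t \<omega> - W s \<omega>) \<in> borel_measurable N"
    using W st by (auto simp: wiener_process_def intro!: borel_measurable_diff)
  have law: "centered_normal_law ((t - s) *\<^sub>R S) (distr N borel (\<lambda>\<omega>. W t \<omega> - W s \<omega>))"
    using W st by (simp add: wiener_process_def)
  have "(\<integral>\<omega>. iexp (v \<bullet> (W t \<omega> - W s \<omega>)) \<partial>N) = (\<integral>x. iexp (v \<bullet> x) \<partial>distr N borel (\<lambda>\<omega>. W t \<omega> - W s \<omega>))"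
    by (rule integral_distr[symmetric, OF m]) simp
  also have "\<dots> = of_real (exp (- (v \<bullet> (((t - s) *\<^sub>R S) *v v)) / 2))"
    by (rule centered_normal_law_char[OF law])
  also have "v \<bullet> (((t - s) *\<^sub>R S) *v v) = (t - s) * (v \<bullet> (S *v v))"
    by (simp add: scaleR_matrix_vector_assoc[symmetric])
  finally show ?thesis by (simp only: mult_minus_left)
qed

lemma wiener_increments_char:
  assumes W: "wiener_process N S W" and m: "m > 0"
  shows "(\<integral>\<omega>. iexp (\<Sum>b<m. u b \<bullet> (W (real (Suc b) / real m) \<omega> - W (real b / real m) \<omega>)) \<partial>N) =
    (\<Prod>b<m. of_real (exp (- (1 / real m) * (u b \<bullet> (S *v u b)) / 2)))"
proof -
  interpret prob_space N using W by (simp add: wiener_process_def)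
  define D where "D = (\<lambda>b \<omega>. W (real (Suc b) / real m) \<omega> - W (real b / real m) \<omega>)"
  have grid: "\<forall>i<m. real i / real m < real (Suc i) / real m" using m by (simp add: divide_strict_right_mono)
  have ind: "indep_vars (\<lambda>_. borel) D {..<m}"
  proof -
    have "\<forall>k (t :: nat \<Rightarrow> real). 0 \<le> t 0 \<and> (\<forall>i<k. t i < t (Suc i)) \<and> t k \<le> 1 \<longrightarrow>
       indep_vars (\<lambda>_. borel) (\<lambda>i \<omega>. W (t (Suc i)) \<omega> - W (t i) \<omega>) {..<k}"
      using W unfolding wiener_process_def by blast
    from this[rule_format, of "\<lambda>i. real i / real m" m] show ?thesis
      unfolding D_def using grid m by simp
  qed
  have D_meas: "D b \<in> borel_measurable N" if "b < m" for b
  proof -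
    have "real (Suc b) / real m \<le> 1" "real b / real m \<le> 1" using that m by auto
    then show ?thesis unfolding D_def
      using W by (auto simp: wiener_process_def intro!: borel_measurable_diff)
  qed
  have "indep_vars (\<lambda>_. borel) (\<lambda>b \<omega>. (\<lambda>x. iexp (u b \<bullet> x)) (D b \<omega>)) {..<m}"
    by (rule indep_vars_compose2[OF ind]) simp
  then have "(\<integral>\<omega>. (\<Prod>b<m. iexp (u b \<bullet> D b \<omega>)) \<partial>N) = (\<Prod>b<m. \<integral>\<omega>. iexp (u b \<bullet> D b \<omega>) \<partial>N)"
    using D_meas by (intro indep_vars_lebesgue_integral) (auto intro!: integrable_bounded[where C=1] measurable_compose[OF D_meas])
  also have "\<dots> = (\<Prod>b<m. of_real (exp (- (1 / real m) * (u b \<bullet> (S *v u b)) / 2)))"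
  proof (rule prod.cong[OF refl])
    fix b assume b: "b \<in> {..<m}"
    have "real (Suc b) / real m \<le> 1" using b m by auto
    then have "(\<integral>\<omega>. iexp (u b \<bullet> D b \<omega>) \<partial>N) =
        of_real (exp (- (real (Suc b) / real m - real b / real m) * (u b \<bullet> (S *v u b)) / 2))"
      unfolding D_def using grid b by (intro wiener_increment_char[OF W]) auto
    also have "real (Suc b) / real m - real b / real m = 1 / real m" by (simp add: diff_divide_distrib[symmetric])
    finally show "(\<integral>\<omega>. iexp (u b \<bullet> D b \<omega>) \<partial>N) = of_real (exp (- (1 / real m) * (u b \<bullet> (S *v u b)) / 2))" .
  qed
  finally show ?thesis unfolding D_def by (simp add: sum_distrib_left exp_sum)
qed

lemma div_fraction_tendsto:
  assumes "m > 0"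
  shows "(\<lambda>n. real (n * b div m) / real n) \<longlonglongrightarrow> real b / real m"
proof -
  have "(\<lambda>n. real (n * b div m) / real n - real b / real m) \<longlonglongrightarrow> 0"
  proof (rule Lim_null_comparison)
    show "(\<lambda>n. 1 / real n) \<longlonglongrightarrow> 0" by real_asymp
    show "\<forall>\<^sub>F n in sequentially. norm (real (n * b div m) / real n - real b / real m) \<le> 1 / real n"
      using eventually_gt_at_top[of 0]
    proof eventually_elim
      case (elim n)
      have "real (n * b) = real (m * (n * b div m) + n * b mod m)" by simp
      then have "real (n * b) = real m * real (n * b div m) + real (n * b mod m)"
        by (simp only: of_nat_add of_nat_mult)
      then have "real (n * b) / real m = real (n * b div m) + real (n * b mod m) / real m"
        using assms by (simp add: field_simps)
      moreover have "0 \<le> real (n * b mod m) / real m" "real (n * b mod m) / real m \<le> 1"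
        using assms by (auto simp: less_imp_le)
      ultimately have "\<bar>real (n * b div m) - real (n * b) / real m\<bar> \<le> 1" by simp
      moreover have "real (n * b div m) / real n - real b / real m = (real (n * b div m) - real (n * b) / real m) / real n"
        using elim assms by (simp add: field_simps)
      ultimately show ?case using elim by (simp add: abs_divide divide_right_mono)
    qed
  qed
  then show ?thesis by (simp add: LIM_zero_iff)
qed

section \<open>Path functionals of the unperturbed walk: limit on a coarse grid, and the error of
  passing to it\<close>

context
  fixes p :: "(int^'d) pmf" and B :: "nat \<Rightarrow> real" and S :: "real^'d^'d"
    and N :: "'b measure" and W :: "real \<Rightarrow> 'b \<Rightarrow> real^'d"
    and f :: "(real \<Rightarrow> real^'d) \<Rightarrow> real" and C L :: real
  assumes B_type: "B_type p B S" and W: "wiener_process N S W"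
    and f_bdd: "\<And>x. x \<in> C01 \<Longrightarrow> \<bar>f x\<bar> \<le> C"
    and f_lip: "\<And>x y. x \<in> C01 \<Longrightarrow> y \<in> C01 \<Longrightarrow> \<bar>f x - f y\<bar> \<le> L * C01_dist x y"
begin

interpretation N: prob_space N
  using W by (simp add: wiener_process_def)

lemma f_lip_abs: "x \<in> C01 \<Longrightarrow> y \<in> C01 \<Longrightarrow> C01_dist x y \<le> c \<Longrightarrow> \<bar>f x - f y\<bar> \<le> \<bar>L\<bar> * c"
proof -
  assume x: "x \<in> C01" and y: "y \<in> C01" and c: "C01_dist x y \<le> c"
  have "L * C01_dist x y \<le> \<bar>L\<bar> * C01_dist x y" by (intro mult_right_mono C01_dist_nonneg) simp
  also have "\<dots> \<le> \<bar>L\<bar> * c" using c by (intro mult_left_mono) auto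
  finally show ?thesis using f_lip[OF x y] by linarith
qed

lemma C_nonneg: "0 \<le> C"
  using f_bdd[OF path_of_C01[of 0 "\<lambda>_. 0"]] by linarith

text \<open>On the grid the path is a partial sum of block increments, indexed by pairs of block and
  coordinate. Their joint characteristic functions are products of powers of \<open>cf\<close> with
  exponents about n / m, which converge to those of the independent Wiener increments.\<close>

lemma coarse_grid_limit:
  assumes m: "m > 0"
  shows "(\<lambda>n. \<integral>l. f (path_of m (\<lambda>b. (1 / B n) *\<^sub>R real_vec (l ! (n * b div m)))) \<partial>measure_pmf (chain_path (walk_kernel p) n 0))
    \<longlonglongrightarrow> (\<integral>\<omega>. f (path_of m (\<lambda>b. W (real b / real m) \<omega>)) \<partial>N)"
proof -
  define s where "s = (\<lambda>n b. n * b div m)"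
  have s: "mono (s n)" "s n 0 = 0" "s n m = n" for n
    using m by (auto simp: s_def mono_def intro!: div_le_mono)
  define Z where "Z = (\<lambda>n l (j :: nat \<times> 'd). (1 / B n) * (real_vec (l ! s n (Suc (fst j)) - l ! s n (fst j)) $ snd j))"
  define Z' where "Z' = (\<lambda>\<omega> (j :: nat \<times> 'd). (W (real (Suc (fst j)) / real m) \<omega> - W (real (fst j) / real m) \<omega>) $ snd j)"
  define I where "I = {..<m} \<times> (UNIV :: 'd set)"
  define vec where "vec = (\<lambda>(D :: nat \<times> 'd \<Rightarrow> real) b. (\<chi> i. D (b, i)) :: real^'d)"
  define G where "G = (\<lambda>D. f (path_of m (\<lambda>k. \<Sum>b<k. vec D b)))"
  have inner: "(\<Sum>j\<in>I. v j * D j) = (\<Sum>b<m. vec v b \<bullet> vec D b)" for v D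
    unfolding I_def vec_def by (simp add: sum.cartesian_product inner_vec_def)
  have vec_Z: "vec (Z n l) b = (1 / B n) *\<^sub>R real_vec (l ! s n (Suc b) - l ! s n b)" for n l b
    by (simp add: vec_def Z_def vec_eq_iff)
  have vec_Z': "vec (Z' \<omega>) b = W (real (Suc b) / real m) \<omega> - W (real b / real m) \<omega>" for \<omega> b
    by (simp add: vec_def Z'_def vec_eq_iff)
  have W_meas: "W (real b / real m) \<in> borel_measurable N" if "b \<le> m" for b
    using W that m by (auto simp: wiener_process_def)
  have W0: "W 0 \<omega> = 0" if "\<omega> \<in> space N" for \<omega>
    using W that by (simp add: wiener_process_def)
  have G_Z': "G (Z' \<omega>) = f (path_of m (\<lambda>b. W (real b / real m) \<omega>))" if "\<omega> \<in> space N" for \<omega>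
  proof -
    have "(\<Sum>b<k. vec (Z' \<omega>) b) = W (real k / real m) \<omega>" for k
      unfolding vec_Z' sum_lessThan_telescope[of "\<lambda>b. W (real b / real m) \<omega>"] using W0[OF that] by simp
    then show ?thesis by (simp add: G_def)
  qed
  have G_Z: "G (Z n l) = f (path_of m (\<lambda>b. (1 / B n) *\<^sub>R real_vec (l ! (n * b div m))))"
    if "l \<in> set_pmf (chain_path (walk_kernel p) n 0)" for n l
  proof -
    have "(\<Sum>b<k. vec (Z n l) b) = (1 / B n) *\<^sub>R real_vec (l ! (n * k div m))" for k
    proof -
      have "(\<Sum>b<k. vec (Z n l) b) = (1 / B n) *\<^sub>R (\<Sum>b<k. real_vec (l ! s n (Suc b)) - real_vec (l ! s n b))"
        unfolding vec_Z by (simp add: real_vec_diff scaleR_sum_right)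
      also have "(\<Sum>b<k. real_vec (l ! s n (Suc b)) - real_vec (l ! s n b)) = real_vec (l ! s n k) - real_vec (l ! s n 0)"
        by (rule sum_lessThan_telescope)
      finally show ?thesis using hd_chain_path[OF that] by (simp add: s_def)
    qed
    then show ?thesis by (simp add: G_def)
  qed
  interpret char_convergence "\<lambda>n. measure_pmf (chain_path (walk_kernel p) n 0)" N I Z Z'
  proof
    show "finite I" by (simp add: I_def)
    show "(\<lambda>\<omega>. Z' \<omega> j) \<in> borel_measurable N" if "j \<in> I" for j
    proof -
      have "Suc (fst j) \<le> m" "fst j \<le> m" using that by (auto simp: I_def)
      then have "(\<lambda>\<omega>. W (real (Suc (fst j)) / real m) \<omega> - W (real (fst j) / real m) \<omega>) \<in> borel_measurable N"
        by (intro borel_measurable_diff W_meas)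
      moreover have "(\<lambda>x :: real^'d. x $ snd j) \<in> borel_measurable borel"
        by (intro borel_measurable_continuous_onI continuous_intros)
      ultimately show ?thesis unfolding Z'_def by (rule measurable_compose)
    qed
    fix v :: "nat \<times> 'd \<Rightarrow> real"
    define u where "u = vec v"
    have lhs: "(\<integral>l. iexp (\<Sum>j\<in>I. v j * Z n l j) \<partial>measure_pmf (chain_path (walk_kernel p) n 0)) =
        (\<Prod>b<m. cf p ((1 / B n) *\<^sub>R u b) ^ (s n (Suc b) - s n b))" for n
      using cf_walk_blocks[OF s(1,2)[of n], where m=m and u="\<lambda>b. (1 / B n) *\<^sub>R u b" and p=p and x=0]
      unfolding inner vec_Z s(3) u_def by simp
    have rhs: "(\<integral>\<omega>. iexp (\<Sum>j\<in>I. v j * Z' \<omega> j) \<partial>N) = (\<Prod>b<m. of_real (exp (- (1 / real m) * (u b \<bullet> (S *v u b)) / 2)))"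
      unfolding inner vec_Z' u_def[symmetric] by (rule wiener_increments_char[OF W m])
    have "(\<lambda>n. real (s n (Suc b) - s n b) / real n) \<longlonglongrightarrow> 1 / real m" for b
    proof -
      have "(\<lambda>n. real (s n (Suc b)) / real n - real (s n b) / real n) \<longlonglongrightarrow> real (Suc b) / real m - real b / real m"
        unfolding s_def by (intro tendsto_diff div_fraction_tendsto m)
      moreover have "real (s n (Suc b)) / real n - real (s n b) / real n = real (s n (Suc b) - s n b) / real n" for n
        using monoD[OF s(1), of b "Suc b" n] by (simp add: of_nat_diff diff_divide_distrib)
      moreover have "real (Suc b) / real m - real b / real m = 1 / real m" by (simp add: diff_divide_distrib[symmetric])
      ultimately show ?thesis by simp
    qed
    then show "(\<lambda>n. \<integral>l. iexp (\<Sum>j\<in>I. v j * Z n l j) \<partial>measure_pmf (chain_path (walk_kernel p) n 0)) \<longlonglongrightarrow>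
        (\<integral>\<omega>. iexp (\<Sum>j\<in>I. v j * Z' \<omega> j) \<partial>N)"
      unfolding lhs rhs by (intro tendsto_prod cf_power_tendsto_fraction[OF B_type])
  qed (auto intro: prob_space_measure_pmf N.prob_space_axioms)
  have "(\<lambda>n. \<integral>l. G (Z n l) \<partial>measure_pmf (chain_path (walk_kernel p) n 0)) \<longlonglongrightarrow> (\<integral>\<omega>. G (Z' \<omega>) \<partial>N)"
  proof (rule conv_lipschitz)
    show "\<bar>G D\<bar> \<le> C" for D unfolding G_def by (intro f_bdd path_of_C01)
    fix D D' :: "nat \<times> 'd \<Rightarrow> real"
    have "C01_dist (path_of m (\<lambda>k. \<Sum>b<k. vec D b)) (path_of m (\<lambda>k. \<Sum>b<k. vec D' b)) \<le> (\<Sum>j\<in>I. \<bar>D j - D' j\<bar>)"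
    proof (rule path_of_dist_le)
      fix k assume k: "k \<le> m"
      have "norm ((\<Sum>b<k. vec D b) - (\<Sum>b<k. vec D' b)) \<le> (\<Sum>b<k. norm (vec D b - vec D' b))"
        unfolding sum_subtractf[symmetric] by (rule norm_sum)
      also have "\<dots> \<le> (\<Sum>b<m. norm (vec D b - vec D' b))" using k by (intro sum_mono2) auto
      also have "\<dots> \<le> (\<Sum>b<m. \<Sum>i\<in>UNIV. \<bar>D (b, i) - D' (b, i)\<bar>)"
        by (intro sum_mono order_trans[OF norm_le_l1_cart]) (simp add: vec_def)
      also have "\<dots> = (\<Sum>j\<in>I. \<bar>D j - D' j\<bar>)" unfolding I_def by (simp add: sum.cartesian_product)
      finally show "norm ((\<Sum>b<k. vec D b) - (\<Sum>b<k. vec D' b)) \<le> (\<Sum>j\<in>I. \<bar>D j - D' j\<bar>)" .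
    qed
    then show "\<bar>G D - G D'\<bar> \<le> \<bar>L\<bar> * (\<Sum>j\<in>I. \<bar>D j - D' j\<bar>)"
      unfolding G_def by (intro f_lip_abs path_of_C01)
  next
    have "(\<lambda>\<omega>. f (restrict (lin_interp m (\<lambda>b. W (real b / real m) \<omega>)) {0..1})) \<in> borel_measurable N"
    proof (rule borel_measurable_lipschitz_of_path[where h=f and L=L])
      show "(\<lambda>\<omega>. lin_interp m (\<lambda>b. W (real b / real m) \<omega>) t) \<in> borel_measurable N" for t
        unfolding lin_interp_def
        by (intro borel_measurable_add borel_measurable_sum borel_measurable_scaleR borel_measurable_const borel_measurable_diff W_meas) auto
    qed (auto intro: continuous_on_lin_interp f_lip)
    then have "(\<lambda>\<omega>. f (path_of m (\<lambda>b. W (real b / real m) \<omega>))) \<in> borel_measurable N"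
      by (simp add: path_of_def)
    then show "(\<lambda>\<omega>. G (Z' \<omega>)) \<in> borel_measurable N"
      by (subst measurable_cong[OF G_Z'])
  qed simp
  moreover have "(\<integral>l. G (Z n l) \<partial>measure_pmf (chain_path (walk_kernel p) n 0)) =
      (\<integral>l. f (path_of m (\<lambda>b. (1 / B n) *\<^sub>R real_vec (l ! (n * b div m)))) \<partial>measure_pmf (chain_path (walk_kernel p) n 0))" for n
    by (rule integral_cong_AE) (auto intro!: AE_pmfI G_Z)
  moreover have "(\<integral>\<omega>. G (Z' \<omega>) \<partial>N) = (\<integral>\<omega>. f (path_of m (\<lambda>b. W (real b / real m) \<omega>)) \<partial>N)"
    by (intro Bochner_Integration.integral_cong refl G_Z')
  ultimately show ?thesis by simp
qed

text \<open>Outside the event \<open>Bad\<close> the normed walk moves by less than \<delta> from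
  each block start, so the two interpolations differ by at most 2 \<delta>; on \<open>Bad\<close>
  only the trivial bound 2 C is available.\<close>

lemma coarse_grid_error:
  assumes m: "m > 0" and n: "n \<ge> 1" and \<delta>: "\<delta> > 0"
    and small: "\<And>x. real m * (1 - avoid (walk_kernel p) {y. \<delta> * B n \<le> norm (real_vec (y - x))} (n div m + 2) x) \<le> e"
  shows "\<bar>(\<integral>l. f (path_of n (\<lambda>k. (1 / B n) *\<^sub>R real_vec (l ! k))) \<partial>measure_pmf (chain_path (walk_kernel p) n 0)) -
      (\<integral>l. f (path_of m (\<lambda>b. (1 / B n) *\<^sub>R real_vec (l ! (n * b div m)))) \<partial>measure_pmf (chain_path (walk_kernel p) n 0))\<bar>
    \<le> \<bar>L\<bar> * (2 * \<delta>) + 2 * C * e"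
proof -
  define q where "q = measure_pmf (chain_path (walk_kernel p) n 0)"
  define F where "F = (\<lambda>l. f (path_of n (\<lambda>k. (1 / B n) *\<^sub>R real_vec (l ! k :: int^'d))))"
  define F' where "F' = (\<lambda>l. f (path_of m (\<lambda>b. (1 / B n) *\<^sub>R real_vec (l ! (n * b div m) :: int^'d))))"
  define R where "R = (\<lambda>y w :: int^'d. \<delta> * B n \<le> norm (real_vec (w - y)))"
  define bad where "bad = (\<lambda>b. {l. \<exists>j. n * b div m \<le> j \<and> j \<le> n * b div m + (n div m + 2) \<and> j \<le> n \<and> R (l ! (n * b div m)) (l ! j)})"
  have Bn: "B n > 0" using B_pos[OF B_type n] .
  have block: "measure q (bad b) \<le> e / real m" if "b < m" for b
  proof -
    have sn: "n * b div m \<le> n"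
      using that m by (metis div_le_mono div_mult_self_is_m less_imp_le_nat mult_le_mono2)
    have "measure q (bad b) \<le> (\<integral>y. 1 - avoid (walk_kernel p) {w. R y w} (n div m + 2) y \<partial>measure_pmf (nstep (walk_kernel p) (n * b div m) 0))"
      unfolding q_def bad_def by (rule block_oscillation[OF sn])
    also have "\<dots> \<le> (\<integral>y. e / real m \<partial>measure_pmf (nstep (walk_kernel p) (n * b div m) 0))"
    proof (rule integral_mono)
      show "integrable (measure_pmf (nstep (walk_kernel p) (n * b div m) 0)) (\<lambda>y. 1 - avoid (walk_kernel p) {w. R y w} (n div m + 2) y)"
        using avoid_nonneg[of "walk_kernel p" _ "n div m + 2"] avoid_le_1[of "walk_kernel p" _ "n div m + 2"]
        by (intro integrable_pmf_bounded[where C=1]) (simp only: abs_of_nonneg diff_ge_0_iff_ge, smt (verit))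
      show "1 - avoid (walk_kernel p) {w. R y w} (n div m + 2) y \<le> e / real m" for y
        using small[of y] m unfolding R_def by (simp only: pos_le_divide_eq of_nat_0_less_iff mult.commute)
    qed simp
    finally show ?thesis by simp
  qed
  define Bad where "Bad = (\<Union>b<m. bad b)"
  have "measure q Bad \<le> (\<Sum>b<m. measure q (bad b))"
    unfolding Bad_def q_def by (intro measure_pmf.finite_measure_subadditive_finite) auto
  also have "\<dots> \<le> (\<Sum>b<m. e / real m)" by (intro sum_mono block) auto
  also have "\<dots> = e" using m by simp
  finally have Bad: "measure q Bad \<le> e" .
  have pointwise: "\<bar>F l - F' l\<bar> \<le> \<bar>L\<bar> * (2 * \<delta>) + 2 * C * indicator Bad l" for l
  proof (cases "l \<in> Bad")
    case True
    have "\<bar>F l\<bar> \<le> C" "\<bar>F' l\<bar> \<le> C" unfolding F_def F'_def by (intro f_bdd path_of_C01)+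
    then show ?thesis using True \<delta> by (simp add: abs_le_iff add_increasing)
  next
    case False
    define x where "x = (\<lambda>k. (1 / B n) *\<^sub>R real_vec (l ! k))"
    have "C01_dist (path_of n x) (path_of m (\<lambda>b. x (n * b div m))) \<le> 2 * \<delta>"
    proof (rule C01_dist_least[OF path_of_C01 path_of_C01])
      fix t :: real assume t: "t \<in> {0..1}"
      have "norm (lin_interp n x t - lin_interp m (\<lambda>b. x (n * b div m)) t) \<le> 2 * \<delta>"
      proof (rule lin_interp_coarse_le[OF m])
        fix b j assume b: "b < m" and j: "n * b div m \<le> j" "j \<le> n * Suc b div m + 1" "j \<le> n"
        \<comment> \<open>Rounding may lengthen a block by 1; together with the right neighbour read
          by the interpolation this is the 2 in the block length.\<close>
        have "n * Suc b div m \<le> n * b div m + n div m + 1"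
        proof -
          have "n * Suc b div m = (n * b + n) div m" by (simp add: algebra_simps)
          also have "\<dots> = n * b div m + n div m + (n * b mod m + n mod m) div m" by (rule div_add1_eq)
          also have "(n * b mod m + n mod m) div m \<le> 1"
          proof -
            have "n * b mod m < m" "n mod m < m" using m by auto
            then have "n * b mod m + n mod m < 2 * m" by linarith
            then have "(n * b mod m + n mod m) div m < 2" using m by (simp add: less_mult_imp_div_less)
            then show ?thesis by simp
          qed
          finally show ?thesis by simp
        qed
        then have "\<not> R (l ! (n * b div m)) (l ! j)" using False b j by (fastforce simp: Bad_def bad_def)
        then have "norm (real_vec (l ! j - l ! (n * b div m))) < \<delta> * B n" by (simp add: R_def)
        moreover have "x j - x (n * b div m) = (1 / B n) *\<^sub>R real_vec (l ! j - l ! (n * b div m))"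
          by (simp add: x_def real_vec_diff scaleR_diff_right)
        ultimately show "norm (x j - x (n * b div m)) \<le> \<delta>" using Bn by (simp add: field_simps)
      qed (use t in auto)
      then show "dist (path_of n x t) (path_of m (\<lambda>b. x (n * b div m)) t) \<le> 2 * \<delta>"
        using t by (simp add: path_of_def dist_norm)
    qed
    then show ?thesis using False f_lip_abs[OF path_of_C01 path_of_C01] by (simp add: F_def F'_def x_def)
  qed
  have FC: "\<bar>F l\<bar> \<le> C" "\<bar>F' l\<bar> \<le> C" for l unfolding F_def F'_def by (intro f_bdd path_of_C01)+
  have i: "integrable q F" "integrable q F'"
    unfolding q_def by (rule integrable_pmf_bounded, rule FC)+
  have "\<bar>(\<integral>l. F l \<partial>q) - (\<integral>l. F' l \<partial>q)\<bar> = \<bar>\<integral>l. F l - F' l \<partial>q\<bar>" using i by simp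
  also have "\<dots> \<le> (\<integral>l. \<bar>F l - F' l\<bar> \<partial>q)" by (rule integral_abs_bound)
  also have "\<dots> \<le> (\<integral>l. \<bar>L\<bar> * (2 * \<delta>) + 2 * C * indicator Bad l \<partial>q)"
  proof (rule integral_mono)
    have "integrable q (indicat_real Bad)" unfolding q_def by (rule integrable_pmf_bounded[where C=1]) auto
    then show "integrable q (\<lambda>l. \<bar>L\<bar> * (2 * \<delta>) + 2 * C * indicator Bad l)"
      unfolding q_def by (intro Bochner_Integration.integrable_add integrable_mult_right) auto
    show "integrable q (\<lambda>l. \<bar>F l - F' l\<bar>)" using i by auto
  qed (rule pointwise)
  also have "\<dots> = \<bar>L\<bar> * (2 * \<delta>) + 2 * C * measure q Bad"
    unfolding q_def
    by (subst Bochner_Integration.integral_add) (auto intro!: integrable_mult_right integrable_pmf_bounded[where C=1])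
  also have "\<dots> \<le> \<bar>L\<bar> * (2 * \<delta>) + 2 * C * e" using Bad C_nonneg by (simp add: mult_left_mono)
  finally show ?thesis unfolding F_def F'_def q_def .
qed

lemma wiener_grid_limit:
  "(\<lambda>m. \<integral>\<omega>. f (path_of m (\<lambda>b. W (real b / real m) \<omega>)) \<partial>N) \<longlonglongrightarrow> (\<integral>\<omega>. f (\<lambda>t\<in>{0..1}. W t \<omega>) \<partial>N)"
proof (rule N.bounded_convergence[where C=C])
  fix m
  show "(\<lambda>\<omega>. f (path_of m (\<lambda>b. W (real b / real m) \<omega>))) \<in> borel_measurable N"
  proof -
    have W_meas: "W (real b / real m) \<in> borel_measurable N" if "b \<le> m" for b
      using W that by (cases "m = 0") (auto simp: wiener_process_def)
    have "(\<lambda>\<omega>. f (restrict (lin_interp m (\<lambda>b. W (real b / real m) \<omega>)) {0..1})) \<in> borel_measurable N"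
    proof (rule borel_measurable_lipschitz_of_path[where h=f and L=L])
      show "(\<lambda>\<omega>. lin_interp m (\<lambda>b. W (real b / real m) \<omega>) t) \<in> borel_measurable N" for t
        unfolding lin_interp_def
        by (intro borel_measurable_add borel_measurable_sum borel_measurable_scaleR borel_measurable_const borel_measurable_diff W_meas) auto
    qed (auto intro: continuous_on_lin_interp f_lip)
    then show ?thesis by (simp add: path_of_def)
  qed
next
  fix m \<omega>
  show "norm (f (path_of m (\<lambda>b. W (real b / real m) \<omega>))) \<le> C" using f_bdd[OF path_of_C01] by simp
next
  fix \<omega> assume "\<omega> \<in> space N"
  then have cont: "continuous_on {0..1} (\<lambda>t. W t \<omega>)" using W by (simp add: wiener_process_def)
  have "(\<lambda>m. \<bar>L\<bar> * C01_dist (path_of m (\<lambda>k. W (real k / real m) \<omega>)) (\<lambda>t\<in>{0..1}. W t \<omega>)) \<longlonglongrightarrow> \<bar>L\<bar> * 0"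
    by (intro tendsto_mult tendsto_const path_of_approx[OF cont])
  then have lim0: "(\<lambda>m. \<bar>L\<bar> * C01_dist (path_of m (\<lambda>k. W (real k / real m) \<omega>)) (\<lambda>t\<in>{0..1}. W t \<omega>)) \<longlonglongrightarrow> 0"
    by simp
  have "(\<lambda>m. f (path_of m (\<lambda>b. W (real b / real m) \<omega>)) - f (\<lambda>t\<in>{0..1}. W t \<omega>)) \<longlonglongrightarrow> 0"
  proof (rule Lim_null_comparison[OF always_eventually lim0], rule allI)
    fix m
    show "norm (f (path_of m (\<lambda>b. W (real b / real m) \<omega>)) - f (\<lambda>t\<in>{0..1}. W t \<omega>))
        \<le> \<bar>L\<bar> * C01_dist (path_of m (\<lambda>k. W (real k / real m) \<omega>)) (\<lambda>t\<in>{0..1}. W t \<omega>)"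
      unfolding real_norm_def by (intro f_lip_abs path_of_C01 restrict_C01 cont order_refl)
  qed
  then show "(\<lambda>m. f (path_of m (\<lambda>b. W (real b / real m) \<omega>))) \<longlonglongrightarrow> f (\<lambda>t\<in>{0..1}. W t \<omega>)"
    by (simp only: LIM_zero_iff)
qed

lemma walk_invariance_principle:
  "(\<lambda>n. \<integral>l. f (path_of n (\<lambda>k. (1 / B n) *\<^sub>R real_vec (l ! k))) \<partial>measure_pmf (chain_path (walk_kernel p) n 0))
    \<longlonglongrightarrow> (\<integral>\<omega>. f (\<lambda>t\<in>{0..1}. W t \<omega>) \<partial>N)"
proof (rule tendsto_of_eventually_abs_le)
  fix e :: real assume e: "e > 0"
  define \<delta> where "\<delta> = e / (8 * (\<bar>L\<bar> + 1))"
  have \<delta>: "\<delta> > 0" unfolding \<delta>_def using e by (intro divide_pos_pos) auto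
  have L\<delta>: "\<bar>L\<bar> * (2 * \<delta>) \<le> e / 4"
  proof -
    have "(\<bar>L\<bar> + 1) * \<delta> = e / 8" unfolding \<delta>_def by (simp add: field_simps)
    then show ?thesis using \<delta> by (simp add: algebra_simps)
  qed
  define e' where "e' = e / (8 * (C + 1))"
  have e': "e' > 0" unfolding e'_def using e C_nonneg by (intro divide_pos_pos) auto
  have Ce': "2 * C * e' \<le> e / 4"
  proof -
    have "(C + 1) * e' = e / 8" unfolding e'_def using C_nonneg by (simp add: field_simps)
    then show ?thesis using e' by (simp add: algebra_simps)
  qed
  obtain m0 where m0: "\<And>m. m \<ge> m0 \<Longrightarrow> \<forall>\<^sub>F n in sequentially. \<forall>x.
    real m * (1 - avoid (walk_kernel p) {y. \<delta> * B n \<le> norm (real_vec (y - x))} (n div m + 2) x) \<le> e'"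
    using maximal_block[OF B_type \<delta> e'] by blast
  have "\<forall>\<^sub>F m in sequentially. dist (\<integral>\<omega>. f (path_of m (\<lambda>b. W (real b / real m) \<omega>)) \<partial>N) (\<integral>\<omega>. f (\<lambda>t\<in>{0..1}. W t \<omega>) \<partial>N) < e / 4"
    by (rule tendstoD[OF wiener_grid_limit]) (use e in simp)
  then obtain m1 where m1: "\<And>m. m \<ge> m1 \<Longrightarrow> dist (\<integral>\<omega>. f (path_of m (\<lambda>b. W (real b / real m) \<omega>)) \<partial>N) (\<integral>\<omega>. f (\<lambda>t\<in>{0..1}. W t \<omega>) \<partial>N) < e / 4"
    by (auto simp: eventually_sequentially)
  \<comment> \<open>One m meets both requirements, small oscillation in the blocks and a good
    approximation of the Wiener path; only then does n tend to infinity. Each of the four errors is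
    at most e/4.\<close>
  define m where "m = Suc (m0 + m1)"
  have m: "m > 0" "m \<ge> m0" "m \<ge> m1" by (auto simp: m_def)
  have "\<forall>\<^sub>F n in sequentially. dist (\<integral>l. f (path_of m (\<lambda>b. (1 / B n) *\<^sub>R real_vec (l ! (n * b div m)))) \<partial>measure_pmf (chain_path (walk_kernel p) n 0))
      (\<integral>\<omega>. f (path_of m (\<lambda>b. W (real b / real m) \<omega>)) \<partial>N) < e / 4"
    by (rule tendstoD[OF coarse_grid_limit[OF m(1)]]) (use e in simp)
  with m0[OF m(2)] eventually_ge_at_top[of 1]
  show "\<forall>\<^sub>F n in sequentially. \<bar>(\<integral>l. f (path_of n (\<lambda>k. (1 / B n) *\<^sub>R real_vec (l ! k))) \<partial>measure_pmf (chain_path (walk_kernel p) n 0)) -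
      (\<integral>\<omega>. f (\<lambda>t\<in>{0..1}. W t \<omega>) \<partial>N)\<bar> \<le> e"
  proof eventually_elim
    case (elim n)
    have "\<bar>(\<integral>l. f (path_of n (\<lambda>k. (1 / B n) *\<^sub>R real_vec (l ! k))) \<partial>measure_pmf (chain_path (walk_kernel p) n 0)) -
      (\<integral>l. f (path_of m (\<lambda>b. (1 / B n) *\<^sub>R real_vec (l ! (n * b div m)))) \<partial>measure_pmf (chain_path (walk_kernel p) n 0))\<bar>
      \<le> \<bar>L\<bar> * (2 * \<delta>) + 2 * C * e'"
      using elim(1) by (intro coarse_grid_error m \<delta> elim(2)) blast
    then show ?case using elim(3) m1[OF m(3)] L\<delta> Ce' unfolding dist_real_def by linarith
  qed
qed

end

section \<open>Local impurities\<close>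

subsection \<open>Visits to the impurities\<close>

text \<open>A path inside the component uses only arcs of the transition graph, and each of these is
  a step of positive probability.\<close>

lemma set_pmf_nstep_reachable:
  assumes Q: "Q \<in> verts ` pre_digraph.sccs (transition_graph P)" and u: "u \<in> Q" and w: "w \<in> Q"
  shows "\<exists>j. w \<in> set_pmf (nstep P j u)"
proof -
  obtain H where H: "H \<in> pre_digraph.sccs (transition_graph P)" "Q = verts H" using Q by blast
  then have ind: "induced_subgraph H (transition_graph P)" and con: "strongly_connected H"
    by (auto simp: pre_digraph.sccs_def)
  have sub: "subgraph H (transition_graph P)" using ind by (simp add: induced_subgraph_def)
  have ends: "arcs_ends H \<subseteq> {(u, v). v \<in> set_pmf (P u)}"
    using sub by (auto simp: arcs_ends_def arc_to_ends_def transition_graph_def subgraph_def compatible_def set_pmf_iff)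
  have "u \<rightarrow>\<^sup>*\<^bsub>H\<^esub> w"
    using con u w H(2) by (auto simp: strongly_connected_def)
  then have "(u, w) \<in> rtrancl_on (verts H) (arcs_ends H)" by (simp add: reachable_def)
  then show ?thesis
  proof (induction rule: rtrancl_on_induct)
    case base
    show ?case by (intro exI[of _ 0]) simp
  next
    case (step v w)
    then obtain j where "v \<in> set_pmf (nstep P j u)" by blast
    moreover have "w \<in> set_pmf (P v)" using step ends by auto
    ultimately show ?case by (intro exI[of _ "Suc j"]) auto
  qed
qed

lemma finite_lattice_ball: "finite {w :: int^'d. norm (real_vec w) < R}"
proof (rule finite_subset)
  define K where "K = \<lceil>\<bar>R\<bar>\<rceil>"
  show "{w :: int^'d. norm (real_vec w) < R} \<subseteq> vec_lambda ` (Pi\<^sub>E UNIV (\<lambda>_. {- K..K}))"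
  proof
    fix w :: "int^'d" assume w: "w \<in> {w. norm (real_vec w) < R}"
    have "w $ i \<in> {- K..K}" for i
    proof -
      have "\<bar>real_vec w $ i\<bar> \<le> norm (real_vec w)" by (rule component_le_norm_cart)
      then have "\<bar>real_of_int (w $ i)\<bar> \<le> \<bar>R\<bar>" using w by (simp add: real_vec_def)
      then have "\<bar>w $ i\<bar> \<le> K" unfolding K_def by linarith
      then show ?thesis by auto
    qed
    then show "w \<in> vec_lambda ` (Pi\<^sub>E UNIV (\<lambda>_. {- K..K}))"
      by (intro image_eqI[of _ _ "\<lambda>i. w $ i"]) auto
  qed
  show "finite (vec_lambda ` (Pi\<^sub>E (UNIV :: 'd set) (\<lambda>_. {- K..K})))"
    by (intro finite_imageI finite_PiE) auto
qed

lemma impurity_kernel: "impurity_set P p A \<Longrightarrow> u \<notin> A \<Longrightarrow> P u = walk_kernel p u"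
  by (intro pmf_eqI) (simp add: impurity_set_def)

text \<open>One point w of Q outside the ball of radius R is fixed; it exists because lattice balls
  are finite. From every impurity in Q it is reached with positive probability in boundedly many
  steps, and from w the chain avoids A exactly as the unperturbed walk does. So
  \<open>visits_le\<close> applies with a of order n powr (- \<gamma>).\<close>

lemma visits_polynomial:
  fixes p :: "(int^'d) pmf"
  assumes B_type: "B_type p B S" and dim: "CARD('d) \<ge> 2" and imp: "impurity_set P p A"
    and Q: "Q \<in> verts ` pre_digraph.sccs (transition_graph P)" "infinite Q"
    and closed: "\<forall>u\<in>Q. \<forall>v. pmf (P u) v \<noteq> 0 \<longrightarrow> v \<in> Q" and z: "z \<in> Q" and \<gamma>: "\<gamma> > 0"
  shows "\<exists>D\<ge>0. \<forall>n\<ge>1. visits P A n z \<le> D * real n powr \<gamma>"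
proof -
  have A: "finite A" using imp by (simp add: impurity_set_def)
  obtain \<kappa> R where \<kappa>: "\<kappa> > 0" "\<And>n x. n \<ge> 1 \<Longrightarrow> R \<le> norm (real_vec x) \<Longrightarrow> \<kappa> * real n powr (- \<gamma>) \<le> avoid (walk_kernel p) A n x"
    using escape[OF B_type dim A \<gamma>] by blast
  have "\<not> Q \<subseteq> {w. norm (real_vec w) < R}" using Q(2) finite_subset[OF _ finite_lattice_ball] by blast
  then obtain w where w': "w \<in> Q" "\<not> norm (real_vec w) < R" by blast
  then have w: "w \<in> Q" "R \<le> norm (real_vec w)" by simp_all
  have "\<forall>u. \<exists>j. u \<in> Q \<longrightarrow> w \<in> set_pmf (nstep P j u)"
    using set_pmf_nstep_reachable[OF Q(1) _ w(1)] by blast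
  from choice[OF this] obtain j where j: "\<forall>u. u \<in> Q \<longrightarrow> w \<in> set_pmf (nstep P (j u) u)" by blast
  define J where "J = (\<Sum>u\<in>A. j u)"
  \<comment> \<open>The element 1 keeps the set nonempty when no impurity lies in Q.\<close>
  define r where "r = Min (insert 1 ((\<lambda>u. pmf (nstep P (j u) u) w) ` (A \<inter> Q)))"
  have fin: "finite (insert 1 ((\<lambda>u. pmf (nstep P (j u) u) w) ` (A \<inter> Q)))" using A by simp
  have r: "r > 0" unfolding r_def using j fin by (subst Min_gr_iff) (auto simp: pmf_positive_iff)
  have "visits P A n z \<le> real J / (r * \<kappa>) * real n powr \<gamma>" if n: "n \<ge> 1" for n
  proof -
    define a where "a = \<kappa> * real n powr (- \<gamma>)"
    have a: "a > 0" using \<kappa>(1) n by (simp add: a_def)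
    have "visits P A n z \<le> real J / (r * a)"
    proof (rule visits_le[where Q=Q])
      show "y \<in> Q" if "x \<in> Q" "y \<in> set_pmf (P x)" for x y
        using closed that by (simp add: set_pmf_iff)
      fix u assume u: "u \<in> A \<inter> Q"
      have "j u \<le> J" unfolding J_def using A u by (intro member_le_sum) auto
      moreover have "r \<le> pmf (nstep P (j u) u) w" unfolding r_def using fin u by (intro Min_le) auto
      moreover have "avoid P A n w = avoid (walk_kernel p) A n w"
        by (rule killed_cong_kernel) (rule impurity_kernel[OF imp])
      then have "a \<le> avoid P A n w" unfolding a_def using \<kappa>(2)[OF n w(2)] by simp
      ultimately show "\<exists>j'\<le>J. \<exists>w. pmf (nstep P j' u) w \<ge> r \<and> avoid P A n w \<ge> a" by blast
    qed (use A r a z in auto)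
    also have "\<dots> = real J / (r * \<kappa>) * real n powr \<gamma>"
      unfolding a_def using n by (simp add: powr_minus field_simps)
    finally show ?thesis .
  qed
  moreover have "real J / (r * \<kappa>) \<ge> 0" using r \<kappa>(1) by simp
  ultimately show ?thesis by blast
qed

subsection \<open>Coupling with the unperturbed walk\<close>

text \<open>The difference of the two coordinates changes only when the first one is in \<open>A\<close>.\<close>

definition coupled_kernel ::
    "(int^'d) pmf \<Rightarrow> (int^'d \<Rightarrow> (int^'d) pmf) \<Rightarrow> (int^'d) set \<Rightarrow> (int^'d) \<times> (int^'d) \<Rightarrow> ((int^'d) \<times> (int^'d)) pmf"
  where "coupled_kernel p P A s =
    (if fst s \<in> A then bind_pmf (P (fst s)) (\<lambda>x. map_pmf (\<lambda>\<xi>. (x, snd s + \<xi>)) p)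
     else map_pmf (\<lambda>\<xi>. (fst s + \<xi>, snd s + \<xi>)) p)"

lemma coupled_fst:
  assumes "impurity_set P p A"
  shows "map_pmf fst (coupled_kernel p P A s) = P (fst s)"
proof (cases "fst s \<in> A")
  case True
  then show ?thesis
    by (simp add: coupled_kernel_def map_bind_pmf pmf.map_comp o_def map_pmf_const bind_return_pmf')
next
  case False
  then show ?thesis using impurity_kernel[OF assms False]
    by (simp add: coupled_kernel_def pmf.map_comp o_def walk_kernel_def)
qed

lemma coupled_snd: "map_pmf snd (coupled_kernel p P A s) = walk_kernel p (snd s)"
  by (simp add: coupled_kernel_def map_bind_pmf pmf.map_comp o_def walk_kernel_def bind_pmf_const)

definition jump_sizes :: "(int^'d) \<times> (int^'d) \<Rightarrow> (int^'d) \<times> (int^'d) \<Rightarrow> real"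
  where "jump_sizes s s' = norm (real_vec (fst s' - fst s)) + norm (real_vec (snd s' - snd s))"

lemma chain_path_steps:
  "l \<in> set_pmf (chain_path K n x) \<Longrightarrow> i < n \<Longrightarrow> l ! Suc i \<in> set_pmf (K (l ! i))"
proof (induction n arbitrary: x l i)
  case (Suc n)
  then obtain y l' where y: "y \<in> set_pmf (K x)" "l' \<in> set_pmf (chain_path K n y)" "l = x # l'" by auto
  show ?case
  proof (cases i)
    case 0
    then show ?thesis using y hd_chain_path[OF y(2)] by simp
  next
    case (Suc k)
    then show ?thesis using Suc.IH[OF y(2), of k] Suc.prems y(3) by simp
  qed
qed simp

text \<open>Away from A the two increments are equal and cancel; the initial difference is z because
  the second coordinate starts at 0.\<close>

lemma coupling_distance:
  assumes l: "l \<in> set_pmf (chain_path (coupled_kernel p P A) n (z, 0))" and k: "k \<le> n"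
  shows "norm (real_vec (fst (l ! k)) - real_vec (snd (l ! k))) \<le>
    norm (real_vec z) + (\<Sum>i<n. indicator A (fst (l ! i)) * jump_sizes (l ! i) (l ! Suc i))"
proof -
  have "norm (real_vec (fst (l ! k)) - real_vec (snd (l ! k))) \<le>
    norm (real_vec z) + (\<Sum>i<k. indicator A (fst (l ! i)) * jump_sizes (l ! i) (l ! Suc i))"
    using k
  proof (induction k)
    case 0
    then show ?case using hd_chain_path[OF l] by simp
  next
    case (Suc k)
    have step: "l ! Suc k \<in> set_pmf (coupled_kernel p P A (l ! k))"
      using chain_path_steps[OF l, of k] Suc.prems by simp
    have "norm (real_vec (fst (l ! Suc k)) - real_vec (snd (l ! Suc k))) \<le>
        norm (real_vec (fst (l ! k)) - real_vec (snd (l ! k))) + indicator A (fst (l ! k)) * jump_sizes (l ! k) (l ! Suc k)"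
    proof (cases "fst (l ! k) \<in> A")
      case True
      have "real_vec (fst (l ! Suc k)) - real_vec (snd (l ! Suc k)) =
          (real_vec (fst (l ! k)) - real_vec (snd (l ! k))) +
          (real_vec (fst (l ! Suc k) - fst (l ! k)) - real_vec (snd (l ! Suc k) - snd (l ! k)))"
        by (simp add: real_vec_diff)
      also have "norm \<dots> \<le> norm (real_vec (fst (l ! k)) - real_vec (snd (l ! k))) +
          norm (real_vec (fst (l ! Suc k) - fst (l ! k)) - real_vec (snd (l ! Suc k) - snd (l ! k)))"
        by (rule norm_triangle_ineq)
      also have "\<dots> \<le> norm (real_vec (fst (l ! k)) - real_vec (snd (l ! k))) + jump_sizes (l ! k) (l ! Suc k)"
        unfolding jump_sizes_def by (intro add_left_mono norm_triangle_ineq4)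
      finally show ?thesis using True by simp
    next
      case False
      then obtain \<xi> where "l ! Suc k = (fst (l ! k) + \<xi>, snd (l ! k) + \<xi>)"
        using step by (auto simp: coupled_kernel_def)
      then show ?thesis using False by (simp add: real_vec_add)
    qed
    then show ?case using Suc by simp
  qed
  also have "(\<Sum>i<k. indicator A (fst (l ! i)) * jump_sizes (l ! i) (l ! Suc i)) \<le>
      (\<Sum>i<n. indicator A (fst (l ! i)) * jump_sizes (l ! i) (l ! Suc i))"
    using k by (intro sum_mono2) (auto simp: jump_sizes_def indicator_def)
  finally show ?thesis by simp
qed

section \<open>Cost of the jumps made at the impurities\<close>

lemma powr_add_le:
  fixes a b :: real
  assumes "0 \<le> a" "0 \<le> b" "0 < \<epsilon>" "\<epsilon> \<le> 1"
  shows "(a + b) powr \<epsilon> \<le> a powr \<epsilon> + b powr \<epsilon>"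
proof (cases "a + b = 0")
  case False
  then have s: "a + b > 0" using assms by linarith
  \<comment> \<open>Subadditivity follows from x \<le> x powr \<epsilon> on [0,1], applied to the
    two shares of a + b.\<close>
  have ge: "x / (a + b) \<le> (x / (a + b)) powr \<epsilon>" if "0 \<le> x" "x \<le> a + b" for x
  proof (cases "x = 0")
    case False
    then have "(x / (a + b)) powr 1 \<le> (x / (a + b)) powr \<epsilon>"
      using that s assms by (intro powr_mono') auto
    then show ?thesis using that s False by simp
  qed simp
  have "1 = a / (a + b) + b / (a + b)" using s by (simp add: add_divide_distrib[symmetric])
  also have "\<dots> \<le> (a / (a + b)) powr \<epsilon> + (b / (a + b)) powr \<epsilon>"
    using assms by (intro add_mono ge) auto
  also have "\<dots> = (a powr \<epsilon> + b powr \<epsilon>) / (a + b) powr \<epsilon>"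
    using assms s by (simp add: powr_divide add_divide_distrib)
  finally show ?thesis using s by (simp add: pos_le_divide_eq)
qed (use assms in auto)

lemma powr_sum_le:
  fixes g :: "'i \<Rightarrow> real"
  assumes "finite I" "\<And>i. i \<in> I \<Longrightarrow> 0 \<le> g i" "0 < \<epsilon>" "\<epsilon> \<le> 1"
  shows "(\<Sum>i\<in>I. g i) powr \<epsilon> \<le> (\<Sum>i\<in>I. g i powr \<epsilon>)"
  using assms(1,2)
proof (induction I rule: finite_induct)
  case (insert i I)
  have "(\<Sum>i\<in>insert i I. g i) powr \<epsilon> = (g i + (\<Sum>i\<in>I. g i)) powr \<epsilon>" using insert by simp
  also have "\<dots> \<le> g i powr \<epsilon> + (\<Sum>i\<in>I. g i) powr \<epsilon>"
    using insert.prems assms by (intro powr_add_le sum_nonneg) auto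
  also have "\<dots> \<le> (\<Sum>i\<in>insert i I. g i powr \<epsilon>)" using insert by simp
  finally show ?case .
qed simp

text \<open>A Wald-type bound: given a visit to A, the next jump costs at most D on average, so the
  expected total is at most D times the expected number of visits. With nonnegative integrals no
  integrability of the cost along paths has to be established first.\<close>

lemma impurity_cost:
  assumes imp: "impurity_set P p A" and D: "0 \<le> D"
    and cost: "\<And>s. fst s \<in> A \<Longrightarrow> (\<integral>\<^sup>+s'. ennreal (c s s') \<partial>measure_pmf (coupled_kernel p P A s)) \<le> ennreal D"
  shows "(\<integral>\<^sup>+l. (\<Sum>i<n. indicator A (fst (l ! i)) * ennreal (c (l ! i) (l ! Suc i))) \<partial>measure_pmf (chain_path (coupled_kernel p P A) n s))
    \<le> ennreal (D * visits P A n (fst s))"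
proof (induction n arbitrary: s)
  case 0
  show ?case by simp
next
  case (Suc n)
  define K where "K = coupled_kernel p P A"
  define F where "F = (\<lambda>n (l :: ((int^'a) \<times> (int^'a)) list). \<Sum>i<n. indicator A (fst (l ! i)) * ennreal (c (l ! i) (l ! Suc i)))"
  have IH: "(\<integral>\<^sup>+l. F n l \<partial>measure_pmf (chain_path K n s)) \<le> ennreal (D * visits P A n (fst s))" for s
    unfolding F_def K_def by (rule Suc.IH)
  have "(\<integral>\<^sup>+l. F (Suc n) l \<partial>measure_pmf (chain_path K (Suc n) s)) =
      (\<integral>\<^sup>+s'. \<integral>\<^sup>+l. F (Suc n) (s # l) \<partial>measure_pmf (chain_path K n s') \<partial>measure_pmf (K s))" by simp
  also have "\<dots> = (\<integral>\<^sup>+s'. indicator A (fst s) * ennreal (c s s') + (\<integral>\<^sup>+l. F n l \<partial>measure_pmf (chain_path K n s')) \<partial>measure_pmf (K s))"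
  proof (rule nn_integral_cong)
    fix s'
    have "(\<integral>\<^sup>+l. F (Suc n) (s # l) \<partial>measure_pmf (chain_path K n s')) =
        (\<integral>\<^sup>+l. indicator A (fst s) * ennreal (c s s') + F n l \<partial>measure_pmf (chain_path K n s'))"
    proof (rule nn_integral_cong_AE, rule AE_pmfI)
      fix l assume "l \<in> set_pmf (chain_path K n s')"
      then have "l ! 0 = s'" by (rule hd_chain_path)
      then show "F (Suc n) (s # l) = indicator A (fst s) * ennreal (c s s') + F n l"
        unfolding F_def sum.lessThan_Suc_shift by simp
    qed
    also have "\<dots> = indicator A (fst s) * ennreal (c s s') + (\<integral>\<^sup>+l. F n l \<partial>measure_pmf (chain_path K n s'))"
      by (subst nn_integral_add) (auto simp: measure_pmf.emeasure_space_1[simplified])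
    finally show "(\<integral>\<^sup>+l. F (Suc n) (s # l) \<partial>measure_pmf (chain_path K n s')) =
      indicator A (fst s) * ennreal (c s s') + (\<integral>\<^sup>+l. F n l \<partial>measure_pmf (chain_path K n s'))" .
  qed
  also have "\<dots> = indicator A (fst s) * (\<integral>\<^sup>+s'. ennreal (c s s') \<partial>measure_pmf (K s)) +
      (\<integral>\<^sup>+s'. \<integral>\<^sup>+l. F n l \<partial>measure_pmf (chain_path K n s') \<partial>measure_pmf (K s))"
    by (subst nn_integral_add) (auto simp: nn_integral_cmult)
  also have "\<dots> \<le> indicator A (fst s) * ennreal D + (\<integral>\<^sup>+s'. ennreal (D * visits P A n (fst s')) \<partial>measure_pmf (K s))"
    using cost[of s] unfolding K_def[symmetric]
    by (intro add_mono nn_integral_mono IH) (auto simp: indicator_def)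
  also have "(\<integral>\<^sup>+s'. ennreal (D * visits P A n (fst s')) \<partial>measure_pmf (K s)) =
      (\<integral>\<^sup>+x. ennreal (D * visits P A n x) \<partial>measure_pmf (map_pmf fst (K s)))" by simp
  also have "\<dots> = (\<integral>\<^sup>+x. ennreal (D * visits P A n x) \<partial>measure_pmf (P (fst s)))"
    unfolding K_def coupled_fst[OF imp] ..
  also have "\<dots> = ennreal (\<integral>x. D * visits P A n x \<partial>measure_pmf (P (fst s)))"
    using D visits_bounds(1)[of P A n]
    by (intro nn_integral_eq_integral integrable_mult_right integrable_visits) auto
  also have "indicator A (fst s) * ennreal D = ennreal (D * indicator A (fst s))" by (auto simp: indicator_def)
  also have "ennreal (D * indicator A (fst s)) + ennreal (\<integral>x. D * visits P A n x \<partial>measure_pmf (P (fst s))) =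
      ennreal (D * visits P A (Suc n) (fst s))"
    using D visits_bounds(1)[of P A n]
    by (subst ennreal_plus[symmetric]) (auto simp: distrib_left intro!: Bochner_Integration.integral_nonneg)
  finally show ?case unfolding F_def K_def .
qed

lemma powr_le_one_plus:
  fixes t :: real
  assumes "0 \<le> t" "0 < \<epsilon>" "\<epsilon> \<le> \<epsilon>'"
  shows "t powr \<epsilon> \<le> 1 + t powr \<epsilon>'"
proof (cases "t \<le> 1")
  case True
  then have "t powr \<epsilon> \<le> 1" using assms by (intro powr_le1) auto
  then show ?thesis by (simp add: add_increasing2)
next
  case False
  then have "t powr \<epsilon> \<le> t powr \<epsilon>'" using assms by (intro powr_mono) auto
  then show ?thesis by simp
qed

text \<open>The order is lowered to at most 1: the power becomes subadditive, and the jumps of the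
  auxiliary walk, which have a first moment, are covered too. Passing from the maximum norm to the
  Euclidean norm costs a factor depending on the dimension.\<close>

lemma jump_cost_bound:
  fixes p :: "(int^'d) pmf"
  assumes imp: "impurity_set P p A" and int: "integrable (measure_pmf p) real_vec"
    and mom: "\<exists>\<epsilon>>0. \<forall>u\<in>A. (\<integral>\<^sup>+ v. ennreal (infnorm (real_vec (v - u)) powr \<epsilon>) \<partial>measure_pmf (P u)) < \<infinity>"
  shows "\<exists>\<epsilon> D. 0 < \<epsilon> \<and> \<epsilon> \<le> 1 \<and> 0 \<le> D \<and> (\<forall>s. fst s \<in> A \<longrightarrow>
    (\<integral>\<^sup>+s'. ennreal (jump_sizes s s' powr \<epsilon>) \<partial>measure_pmf (coupled_kernel p P A s)) \<le> ennreal D)"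
proof -
  obtain \<epsilon>' where \<epsilon>': "\<epsilon>' > 0" "\<And>u. u \<in> A \<Longrightarrow> (\<integral>\<^sup>+ v. ennreal (infnorm (real_vec (v - u)) powr \<epsilon>') \<partial>measure_pmf (P u)) < \<infinity>"
    using mom by blast
  define \<epsilon> where "\<epsilon> = min 1 \<epsilon>'"
  have \<epsilon>: "0 < \<epsilon>" "\<epsilon> \<le> 1" "\<epsilon> \<le> \<epsilon>'" using \<epsilon>'(1) by (auto simp: \<epsilon>_def)
  have A: "finite A" using imp by (simp add: impurity_set_def)
  define d where "d = sqrt (real CARD('d)) powr \<epsilon>"
  have d0: "0 \<le> d" by (simp add: d_def)
  define m where "m = (\<lambda>u. \<integral>\<^sup>+ v. ennreal (norm (real_vec (v - u)) powr \<epsilon>) \<partial>measure_pmf (P u))"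
  have m: "m u < \<infinity>" if "u \<in> A" for u
  proof -
    have "m u \<le> (\<integral>\<^sup>+ v. ennreal d + ennreal d * ennreal (infnorm (real_vec (v - u)) powr \<epsilon>') \<partial>measure_pmf (P u))"
      unfolding m_def
    proof (rule nn_integral_mono)
      fix v
      have "norm (real_vec (v - u)) \<le> sqrt (real CARD('d)) * infnorm (real_vec (v - u))"
        using norm_le_infnorm[of "real_vec (v - u)"] by simp
      then have "norm (real_vec (v - u)) powr \<epsilon> \<le> (sqrt (real CARD('d)) * infnorm (real_vec (v - u))) powr \<epsilon>"
        using \<epsilon> by (intro powr_mono2) auto
      also have "\<dots> = d * infnorm (real_vec (v - u)) powr \<epsilon>"
        unfolding d_def by (rule powr_mult)
      also have "\<dots> \<le> d * (1 + infnorm (real_vec (v - u)) powr \<epsilon>')"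
        using d0 \<epsilon> by (intro mult_left_mono powr_le_one_plus infnorm_pos_le) auto
      finally have "ennreal (norm (real_vec (v - u)) powr \<epsilon>) \<le> ennreal (d + d * infnorm (real_vec (v - u)) powr \<epsilon>')"
        by (intro ennreal_leI) (simp add: algebra_simps)
      then show "ennreal (norm (real_vec (v - u)) powr \<epsilon>) \<le> ennreal d + ennreal d * ennreal (infnorm (real_vec (v - u)) powr \<epsilon>')"
        using d0 by (simp add: ennreal_plus ennreal_mult')
    qed
    also have "\<dots> = ennreal d + ennreal d * (\<integral>\<^sup>+ v. ennreal (infnorm (real_vec (v - u)) powr \<epsilon>') \<partial>measure_pmf (P u))"
      by (simp add: nn_integral_add nn_integral_cmult measure_pmf.emeasure_space_1[simplified])
    also have "\<dots> < \<infinity>" using \<epsilon>'(2)[OF that] by (simp add: ennreal_mult_less_top)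
    finally show ?thesis .
  qed
  define M where "M = (\<Sum>u\<in>A. enn2real (m u))"
  have M: "m u \<le> ennreal M" if "u \<in> A" for u
  proof -
    have "m u = ennreal (enn2real (m u))" using m[OF that] by simp
    also have "\<dots> \<le> ennreal M" unfolding M_def using A that by (intro ennreal_leI member_le_sum) auto
    finally show ?thesis .
  qed
  have M0: "0 \<le> M" unfolding M_def by (intro sum_nonneg) auto
  define E where "E = (\<integral>y. 1 + norm (real_vec y) \<partial>measure_pmf p)"
  have E0: "0 \<le> E" unfolding E_def by (intro Bochner_Integration.integral_nonneg) auto
  have Ei: "(\<integral>\<^sup>+y. ennreal (norm (real_vec y) powr \<epsilon>) \<partial>measure_pmf p) \<le> ennreal E"
  proof -
    have "(\<integral>\<^sup>+y. ennreal (norm (real_vec y) powr \<epsilon>) \<partial>measure_pmf p) \<le> (\<integral>\<^sup>+y. ennreal (1 + norm (real_vec y)) \<partial>measure_pmf p)"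
      using powr_le_one_plus[of "norm (real_vec _)" \<epsilon> 1] \<epsilon> by (intro nn_integral_mono ennreal_leI) simp
    also have "\<dots> = ennreal E" unfolding E_def
      using int by (intro nn_integral_eq_integral) (auto intro!: AE_I2 add_nonneg_nonneg)
    finally show ?thesis .
  qed
  have "(\<integral>\<^sup>+s'. ennreal (jump_sizes s s' powr \<epsilon>) \<partial>measure_pmf (coupled_kernel p P A s)) \<le> ennreal (M + E)"
    if s: "fst s \<in> A" for s
  proof -
    have "(\<integral>\<^sup>+s'. ennreal (jump_sizes s s' powr \<epsilon>) \<partial>measure_pmf (coupled_kernel p P A s)) \<le>
        (\<integral>\<^sup>+s'. ennreal (norm (real_vec (fst s' - fst s)) powr \<epsilon>) + ennreal (norm (real_vec (snd s' - snd s)) powr \<epsilon>)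
          \<partial>measure_pmf (coupled_kernel p P A s))"
    proof (rule nn_integral_mono)
      fix s' :: "(int^'d) \<times> (int^'d)"
      have "ennreal (jump_sizes s s' powr \<epsilon>) \<le> ennreal (norm (real_vec (fst s' - fst s)) powr \<epsilon> + norm (real_vec (snd s' - snd s)) powr \<epsilon>)"
        unfolding jump_sizes_def using \<epsilon> by (intro ennreal_leI powr_add_le) auto
      then show "ennreal (jump_sizes s s' powr \<epsilon>) \<le>
          ennreal (norm (real_vec (fst s' - fst s)) powr \<epsilon>) + ennreal (norm (real_vec (snd s' - snd s)) powr \<epsilon>)"
        by (simp add: ennreal_plus)
    qed
    also have "\<dots> = (\<integral>\<^sup>+s'. ennreal (norm (real_vec (fst s' - fst s)) powr \<epsilon>) \<partial>measure_pmf (coupled_kernel p P A s)) +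
        (\<integral>\<^sup>+s'. ennreal (norm (real_vec (snd s' - snd s)) powr \<epsilon>) \<partial>measure_pmf (coupled_kernel p P A s))"
      by (rule nn_integral_add) auto
    also have "(\<integral>\<^sup>+s'. ennreal (norm (real_vec (fst s' - fst s)) powr \<epsilon>) \<partial>measure_pmf (coupled_kernel p P A s)) =
        (\<integral>\<^sup>+x. ennreal (norm (real_vec (x - fst s)) powr \<epsilon>) \<partial>measure_pmf (map_pmf fst (coupled_kernel p P A s)))" by simp
    also have "\<dots> = m (fst s)" unfolding coupled_fst[OF imp] m_def ..
    also have "(\<integral>\<^sup>+s'. ennreal (norm (real_vec (snd s' - snd s)) powr \<epsilon>) \<partial>measure_pmf (coupled_kernel p P A s)) =
        (\<integral>\<^sup>+x. ennreal (norm (real_vec (x - snd s)) powr \<epsilon>) \<partial>measure_pmf (map_pmf snd (coupled_kernel p P A s)))" by simp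
    also have "\<dots> = (\<integral>\<^sup>+y. ennreal (norm (real_vec y) powr \<epsilon>) \<partial>measure_pmf p)"
      unfolding coupled_snd by (simp add: walk_kernel_def)
    also have "m (fst s) + \<dots> \<le> ennreal M + ennreal E" using M[OF s] Ei by (rule add_mono)
    also have "\<dots> = ennreal (M + E)" using M0 E0 by simp
    finally show ?thesis .
  qed
  then show ?thesis using \<epsilon>(1,2) M0 E0 by (intro exI[of _ \<epsilon>] exI[of _ "M + E"]) auto
qed

text \<open>Expected visits of order n powr (\<epsilon>/4) are set against a threshold of order (B
  n) powr \<epsilon> \<ge> n powr (\<epsilon>/2), which leaves n powr (- \<epsilon>/4). Any exponent
  for the visits below \<epsilon>/2 would serve; \<epsilon>/4 is one choice.\<close>

lemma coupling_close:
  fixes p :: "(int^'d) pmf"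
  assumes B_type: "B_type p B S" and dim: "CARD('d) \<ge> 2" and imp: "impurity_set P p A"
    and Q: "Q \<in> verts ` pre_digraph.sccs (transition_graph P)" "infinite Q"
    and closed: "\<forall>u\<in>Q. \<forall>v. pmf (P u) v \<noteq> 0 \<longrightarrow> v \<in> Q" and z: "z \<in> Q"
    and mom: "\<exists>\<epsilon>>0. \<forall>u\<in>A. (\<integral>\<^sup>+ v. ennreal (infnorm (real_vec (v - u)) powr \<epsilon>) \<partial>measure_pmf (P u)) < \<infinity>"
    and \<delta>: "\<delta> > 0"
  shows "(\<lambda>n. measure (measure_pmf (chain_path (coupled_kernel p P A) n (z, 0)))
    {l. \<exists>k\<le>n. norm (real_vec (fst (l ! k)) - real_vec (snd (l ! k))) > \<delta> * B n}) \<longlonglongrightarrow> 0"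
    (is "(\<lambda>n. measure (?M n) (?bad n)) \<longlonglongrightarrow> 0")
proof -
  have int: "integrable (measure_pmf p) real_vec" using B_type by (simp add: B_type_def)
  obtain \<epsilon> D where \<epsilon>: "0 < \<epsilon>" "\<epsilon> \<le> 1" and D: "0 \<le> D"
    and cost: "\<And>s. fst s \<in> A \<Longrightarrow> (\<integral>\<^sup>+s'. ennreal (jump_sizes s s' powr \<epsilon>) \<partial>measure_pmf (coupled_kernel p P A s)) \<le> ennreal D"
    using jump_cost_bound[OF imp int mom] by blast
  have "\<epsilon> / 4 > 0" using \<epsilon>(1) by simp
  then obtain V where V: "V \<ge> 0" "\<And>n. n \<ge> 1 \<Longrightarrow> visits P A n z \<le> V * real n powr (\<epsilon> / 4)"
    using visits_polynomial[OF B_type dim imp Q closed z] by blast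
  define c where "c = D * V / (\<delta> / 2) powr \<epsilon>"
  have up: "\<forall>\<^sub>F n in sequentially. measure (?M n) (?bad n) \<le> c * real n powr (- (\<epsilon> / 4))"
  proof -
    have "\<forall>\<^sub>F n in sequentially. 2 * norm (real_vec z) / \<delta> \<le> B n"
      using B_at_top[OF B_type] by (auto simp: filterlim_at_top)
    moreover have "\<forall>\<^sub>F n in sequentially. real n / (B n)\<^sup>2 < 1"
      by (rule order_tendstoD(2)[OF n_over_B_square_tendsto[OF B_type]]) simp
    moreover have "\<forall>\<^sub>F n in sequentially. n \<ge> (1 :: nat)" by (rule eventually_ge_at_top)
    ultimately show ?thesis
    proof eventually_elim
      case (elim n)
      have Bn: "B n > 0" using B_pos[OF B_type] elim by simp
      \<comment> \<open>Half of \<delta> B n pays for the initial difference z, so the other half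
        has to come from jumps at A.\<close>
      have z_le: "norm (real_vec z) \<le> \<delta> / 2 * B n" using elim(1) \<delta> by (simp add: field_simps)
      have sqrt_le: "real n powr (1 / 2) \<le> B n"
      proof -
        have "real n < (B n)\<^sup>2" using elim(2) Bn by (simp add: divide_less_eq)
        then have "sqrt (real n) \<le> B n" using Bn by (intro real_le_lsqrt) auto
        then show ?thesis by (simp add: powr_half_sqrt)
      qed
      define a where "a = (\<delta> / 2 * B n) powr \<epsilon>"
      have a: "a > 0" using \<delta> Bn by (simp add: a_def)
      have "(real n powr (1 / 2)) powr \<epsilon> \<le> B n powr \<epsilon>"
        using sqrt_le \<epsilon> by (intro powr_mono2) auto
      then have a_ge: "(\<delta> / 2) powr \<epsilon> * real n powr (\<epsilon> / 2) \<le> a"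
        unfolding a_def powr_mult by (intro mult_left_mono) (simp_all add: powr_powr)
      define F where "F = (\<lambda>l. \<Sum>i<n. indicator A (fst (l ! i)) * ennreal (jump_sizes (l ! i) (l ! Suc i) powr \<epsilon>))"
      have bad: "ennreal a \<le> F l" if l: "l \<in> set_pmf (chain_path (coupled_kernel p P A) n (z, 0))" and l_bad: "l \<in> ?bad n" for l
      proof -
        define J where "J = (\<lambda>i. indicator A (fst (l ! i)) * jump_sizes (l ! i) (l ! Suc i))"
        have J0: "0 \<le> J i" for i unfolding J_def jump_sizes_def by (auto simp: indicator_def)
        obtain k where k: "k \<le> n" "\<delta> * B n < norm (real_vec (fst (l ! k)) - real_vec (snd (l ! k)))"
          using l_bad by blast
        note k(2)
        also have "norm (real_vec (fst (l ! k)) - real_vec (snd (l ! k))) \<le> norm (real_vec z) + (\<Sum>i<n. J i)"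
          unfolding J_def by (rule coupling_distance[OF l k(1)])
        finally have "\<delta> * B n < norm (real_vec z) + (\<Sum>i<n. J i)" .
        then have "\<delta> / 2 * B n \<le> (\<Sum>i<n. J i)" using z_le by linarith
        then have "a \<le> (\<Sum>i<n. J i) powr \<epsilon>"
          unfolding a_def using \<delta> Bn \<epsilon> by (intro powr_mono2) auto
        also have "\<dots> \<le> (\<Sum>i<n. J i powr \<epsilon>)" using J0 \<epsilon> by (intro powr_sum_le) auto
        finally have "ennreal a \<le> ennreal (\<Sum>i<n. J i powr \<epsilon>)" by (rule ennreal_leI)
        also have "\<dots> = (\<Sum>i<n. ennreal (J i powr \<epsilon>))" by (subst sum_ennreal) auto
        also have "\<dots> = F l" unfolding F_def J_def by (intro sum.cong) (auto simp: indicator_def)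
        finally show ?thesis .
      qed
      have "ennreal a * emeasure (?M n) (?bad n) = (\<integral>\<^sup>+l. ennreal a * indicator (?bad n) l \<partial>?M n)"
        by (simp add: nn_integral_cmult_indicator)
      also have "\<dots> \<le> (\<integral>\<^sup>+l. F l \<partial>?M n)"
        by (intro nn_integral_mono_AE AE_pmfI) (use bad in \<open>auto simp: indicator_def\<close>)
      also have "\<dots> \<le> ennreal (D * visits P A n z)"
        unfolding F_def using impurity_cost[OF imp D cost, of n "(z, 0)"] by simp
      finally have "ennreal (a * measure (?M n) (?bad n)) \<le> ennreal (D * visits P A n z)"
        using a by (simp add: measure_pmf.emeasure_eq_measure ennreal_mult')
      then have "a * measure (?M n) (?bad n) \<le> D * visits P A n z"
        by (subst (asm) ennreal_le_iff) (auto intro!: mult_nonneg_nonneg D visits_bounds(1))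
      also have "\<dots> \<le> D * (V * real n powr (\<epsilon> / 4))" using V(2)[OF elim(3)] D by (rule mult_left_mono)
      finally have up: "a * measure (?M n) (?bad n) \<le> D * V * real n powr (\<epsilon> / 4)" by (simp add: mult.assoc)
      have "(\<delta> / 2) powr \<epsilon> * real n powr (\<epsilon> / 2) * measure (?M n) (?bad n) \<le> a * measure (?M n) (?bad n)"
        using a_ge by (rule mult_right_mono) simp
      then have le: "(\<delta> / 2) powr \<epsilon> * real n powr (\<epsilon> / 2) * measure (?M n) (?bad n) \<le> D * V * real n powr (\<epsilon> / 4)"
        using up by linarith
      have pos: "(\<delta> / 2) powr \<epsilon> * real n powr (\<epsilon> / 2) > 0" using \<delta> elim(3) by simp
      have "measure (?M n) (?bad n) \<le> D * V * real n powr (\<epsilon> / 4) / ((\<delta> / 2) powr \<epsilon> * real n powr (\<epsilon> / 2))"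
        using le pos by (simp add: pos_le_divide_eq mult.commute)
      also have "\<dots> = c * (real n powr (\<epsilon> / 4) / real n powr (\<epsilon> / 2))" by (simp add: c_def)
      also have "real n powr (\<epsilon> / 4) / real n powr (\<epsilon> / 2) = real n powr (- (\<epsilon> / 4))"
        using elim(3) by (simp add: powr_diff[symmetric])
      finally show "measure (?M n) (?bad n) \<le> c * real n powr (- (\<epsilon> / 4))" .
    qed
  qed
  have "(\<lambda>n. c * real n powr (- (\<epsilon> / 4))) \<longlonglongrightarrow> c * 0"
    using \<epsilon>(1) by (intro tendsto_mult tendsto_const tendsto_neg_powr filterlim_real_sequentially) auto
  then have lim: "(\<lambda>n. c * real n powr (- (\<epsilon> / 4))) \<longlonglongrightarrow> 0" by simp
  show ?thesis
    by (rule tendsto_sandwich[OF always_eventually up tendsto_const lim]) simp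
qed

text \<open>Both path laws are marginals of the coupled chain. Off the bad event the two normed
  paths are uniformly within \<delta>, so the Lipschitz bound applies; on it f is merely bounded,
  and its probability vanishes.\<close>

lemma perturbed_invariance_principle:
  fixes p :: "(int^'d) pmf" and f :: "(real \<Rightarrow> real^'d) \<Rightarrow> real"
  assumes B_type: "B_type p B S" and dim: "CARD('d) \<ge> 2" and imp: "impurity_set P p A"
    and Q: "Q \<in> verts ` pre_digraph.sccs (transition_graph P)" "infinite Q"
    and closed: "\<forall>u\<in>Q. \<forall>v. pmf (P u) v \<noteq> 0 \<longrightarrow> v \<in> Q" and z: "z \<in> Q"
    and mom: "\<exists>\<epsilon>>0. \<forall>u\<in>A. (\<integral>\<^sup>+ v. ennreal (infnorm (real_vec (v - u)) powr \<epsilon>) \<partial>measure_pmf (P u)) < \<infinity>"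
    and W: "wiener_process N S W"
    and f_bdd: "\<And>x. x \<in> C01 \<Longrightarrow> \<bar>f x\<bar> \<le> C"
    and f_lip: "\<And>x y. x \<in> C01 \<Longrightarrow> y \<in> C01 \<Longrightarrow> \<bar>f x - f y\<bar> \<le> L * C01_dist x y"
  shows "(\<lambda>n. \<integral>l. f (path_of n (\<lambda>k. (1 / B n) *\<^sub>R real_vec (l ! k))) \<partial>measure_pmf (chain_path P n z))
    \<longlonglongrightarrow> (\<integral>\<omega>. f (\<lambda>t\<in>{0..1}. W t \<omega>) \<partial>N)"
proof -
  define K where "K = coupled_kernel p P A"
  define g where "g = (\<lambda>h n l. f (path_of n (\<lambda>k. (1 / B n) *\<^sub>R real_vec (h (l ! k :: (int^'d) \<times> (int^'d)) :: int^'d))))"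
  have g_bdd: "\<bar>g h n l\<bar> \<le> C" for h n l unfolding g_def by (intro f_bdd path_of_C01)
  have g_int: "integrable (measure_pmf q) (g h n)" for h n q
    by (rule integrable_pmf_bounded[where C=C]) (rule g_bdd)
  have marginal: "(\<integral>l. f (path_of n (\<lambda>k. (1 / B n) *\<^sub>R real_vec (l ! k))) \<partial>measure_pmf (chain_path K' n (h (z, 0)))) =
      (\<integral>l. g h n l \<partial>measure_pmf (chain_path K n (z, 0)))"
    if h: "\<And>s. map_pmf h (K s) = K' (h s)" for h K' n
  proof -
    have "(\<integral>l. f (path_of n (\<lambda>k. (1 / B n) *\<^sub>R real_vec (l ! k))) \<partial>measure_pmf (chain_path K' n (h (z, 0)))) =
        (\<integral>l. f (path_of n (\<lambda>k. (1 / B n) *\<^sub>R real_vec (map h l ! k))) \<partial>measure_pmf (chain_path K n (z, 0)))"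
      unfolding chain_path_map[where h=h and K=K and K'=K', OF h, symmetric] by simp
    also have "\<dots> = (\<integral>l. g h n l \<partial>measure_pmf (chain_path K n (z, 0)))"
      unfolding g_def
    proof (intro integral_cong_AE AE_pmfI arg_cong[where f=f] path_of_cong)
      fix l k assume "l \<in> set_pmf (chain_path K n (z, 0))" "k \<le> n"
      then show "(1 / B n) *\<^sub>R real_vec (map h l ! k) = (1 / B n) *\<^sub>R real_vec (h (l ! k))"
        using length_chain_path[of l K n "(z, 0)"] by simp
    qed auto
    finally show ?thesis .
  qed
  define bad where "bad = (\<lambda>\<delta> n. {l :: ((int^'d) \<times> (int^'d)) list.
    \<exists>k\<le>n. norm (real_vec (fst (l ! k)) - real_vec (snd (l ! k))) > \<delta> * B n})"
  have close: "(\<lambda>n. measure (measure_pmf (chain_path K n (z, 0))) (bad \<delta> n)) \<longlonglongrightarrow> 0" if "\<delta> > 0" for \<delta>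
    unfolding K_def bad_def by (rule coupling_close[OF B_type dim imp Q closed z mom that])
  have "(\<lambda>n. (\<integral>l. g fst n l \<partial>measure_pmf (chain_path K n (z, 0))) - (\<integral>l. g snd n l \<partial>measure_pmf (chain_path K n (z, 0)))) \<longlonglongrightarrow> 0"
  proof (rule tendsto_of_eventually_abs_le)
    fix e :: real assume e: "e > 0"
    define \<delta> where "\<delta> = e / (2 * (\<bar>L\<bar> + 1))"
    have \<delta>: "\<delta> > 0" unfolding \<delta>_def using e by (intro divide_pos_pos) auto
    have L\<delta>: "\<bar>L\<bar> * \<delta> \<le> e / 2"
    proof -
      have "(\<bar>L\<bar> + 1) * \<delta> = e / 2" unfolding \<delta>_def by (simp add: field_simps)
      then show ?thesis using \<delta> by (simp add: algebra_simps)
    qed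
    have "(\<lambda>n. 2 * C * measure (measure_pmf (chain_path K n (z, 0))) (bad \<delta> n)) \<longlonglongrightarrow> 2 * C * 0"
      by (intro tendsto_mult tendsto_const close \<delta>)
    then have "\<forall>\<^sub>F n in sequentially. 2 * C * measure (measure_pmf (chain_path K n (z, 0))) (bad \<delta> n) < e / 2"
      by (rule order_tendstoD(2)) (use e in simp)
    moreover have "\<forall>\<^sub>F n in sequentially. n \<ge> (1 :: nat)" by (rule eventually_ge_at_top)
    ultimately show "\<forall>\<^sub>F n in sequentially. \<bar>(\<integral>l. g fst n l \<partial>measure_pmf (chain_path K n (z, 0))) -
        (\<integral>l. g snd n l \<partial>measure_pmf (chain_path K n (z, 0))) - 0\<bar> \<le> e"
    proof eventually_elim
      case (elim n)
      let ?M = "measure_pmf (chain_path K n (z, 0))"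
      have Bn: "B n > 0" by (rule B_pos[OF B_type elim(2)])
      have pt: "\<bar>g fst n l - g snd n l\<bar> \<le> \<bar>L\<bar> * \<delta> + 2 * C * indicator (bad \<delta> n) l" for l
      proof (cases "l \<in> bad \<delta> n")
        case True
        then show ?thesis using g_bdd[of fst n l] g_bdd[of snd n l] \<delta>
          by (auto intro!: add_increasing simp: abs_le_iff)
      next
        case False
        have "C01_dist (path_of n (\<lambda>k. (1 / B n) *\<^sub>R real_vec (fst (l ! k)))) (path_of n (\<lambda>k. (1 / B n) *\<^sub>R real_vec (snd (l ! k)))) \<le> \<delta>"
        proof (rule path_of_dist_le)
          fix k assume "k \<le> n"
          then have "norm (real_vec (fst (l ! k)) - real_vec (snd (l ! k))) \<le> \<delta> * B n"
            using False by (auto simp: bad_def not_less)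
          then show "norm ((1 / B n) *\<^sub>R real_vec (fst (l ! k)) - (1 / B n) *\<^sub>R real_vec (snd (l ! k))) \<le> \<delta>"
            unfolding scaleR_diff_right[symmetric] using Bn by (simp add: divide_le_eq)
        qed
        then have "\<bar>L\<bar> * C01_dist (path_of n (\<lambda>k. (1 / B n) *\<^sub>R real_vec (fst (l ! k)))) (path_of n (\<lambda>k. (1 / B n) *\<^sub>R real_vec (snd (l ! k)))) \<le> \<bar>L\<bar> * \<delta>"
          by (rule mult_left_mono) simp
        moreover have "L * x \<le> \<bar>L\<bar> * x" if "x \<ge> 0" for x using that by (intro mult_right_mono) auto
        ultimately have "\<bar>g fst n l - g snd n l\<bar> \<le> \<bar>L\<bar> * \<delta>"
          unfolding g_def by (meson C01_dist_nonneg f_lip order_trans path_of_C01)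
        then show ?thesis using False by simp
      qed
      have ind_int: "integrable ?M (indicator (bad \<delta> n) :: _ \<Rightarrow> real)"
        by (rule integrable_pmf_bounded[where C=1]) (simp add: indicator_def)
      have "\<bar>(\<integral>l. g fst n l \<partial>?M) - (\<integral>l. g snd n l \<partial>?M)\<bar> = \<bar>\<integral>l. g fst n l - g snd n l \<partial>?M\<bar>"
        by (simp add: g_int Bochner_Integration.integral_diff)
      also have "\<dots> \<le> (\<integral>l. \<bar>L\<bar> * \<delta> + 2 * C * indicator (bad \<delta> n) l \<partial>?M)"
        using pt by (intro order_trans[OF integral_abs_bound] integral_mono integrable_abs
            Bochner_Integration.integrable_diff g_int Bochner_Integration.integrable_add integrable_mult_right ind_int) auto
      also have "\<dots> = \<bar>L\<bar> * \<delta> + 2 * C * measure ?M (bad \<delta> n)"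
        by (subst Bochner_Integration.integral_add) (auto intro: ind_int)
      also have "\<dots> \<le> e" using L\<delta> elim(1) by linarith
      finally show ?case by simp
    qed
  qed
  moreover have "(\<lambda>n. \<integral>l. g snd n l \<partial>measure_pmf (chain_path K n (z, 0))) \<longlonglongrightarrow> (\<integral>\<omega>. f (\<lambda>t\<in>{0..1}. W t \<omega>) \<partial>N)"
    using walk_invariance_principle[OF B_type W f_bdd f_lip] marginal[where h=snd and K'="walk_kernel p"]
    unfolding K_def by (simp add: coupled_snd)
  ultimately have "(\<lambda>n. \<integral>l. g fst n l \<partial>measure_pmf (chain_path K n (z, 0))) \<longlonglongrightarrow> 0 + (\<integral>\<omega>. f (\<lambda>t\<in>{0..1}. W t \<omega>) \<partial>N)"
    by (rule Lim_transform[rotated, simplified, OF _ _, THEN tendsto_eq_rhs]) simp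
  then show ?thesis
    using marginal[where h=fst and K'=P] unfolding K_def by (simp add: coupled_fst[OF imp])
qed

section \<open>The law of a Markov chain\<close>

lemma pmf_map_snoc:
  "pmf (map_pmf (\<lambda>y. l @ [y]) q) (l' @ [v]) = (if l = l' then pmf q v else 0)"
proof (cases "l = l'")
  case True
  have "inj (\<lambda>y. l @ [y])" by (simp add: inj_def)
  then show ?thesis using True pmf_map_inj'[of "\<lambda>y. l @ [y]" q v] by simp
next
  case False
  then have "l' @ [v] \<notin> set_pmf (map_pmf (\<lambda>y. l @ [y]) q)" by auto
  then have "pmf (map_pmf (\<lambda>y. l @ [y]) q) (l' @ [v]) = 0" by (simp only: set_pmf_iff not_not)
  then show ?thesis using False by simp
qed

context
  fixes M :: "'w measure" and P :: "'s::countable \<Rightarrow> 's pmf" and z X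
  assumes chain: "markov_chain M P z X"
begin

interpretation prob_space M using chain by (simp add: markov_chain_def)

lemma chain_measurable: "X i \<in> measurable M (count_space UNIV)"
  using chain by (simp add: markov_chain_def)

lemma chain_cylinder: "{\<omega> \<in> space M. \<forall>i\<le>n. X i \<omega> = x i} \<in> sets M"
proof -
  note [measurable] = chain_measurable
  have "{\<omega> \<in> space M. \<forall>i\<in>{..n}. X i \<omega> = x i} \<in> sets M" by measurable
  then show ?thesis by simp
qed

text \<open>Induction at the last time: \<open>markov_chain\<close> supplies the factor for one
  further step, and \<open>chain_path_snoc\<close> supplies the same factor for the list
  law.\<close>

lemma chain_path_prob:
  "measure M {\<omega> \<in> space M. \<forall>i\<le>n. X i \<omega> = x i} = pmf (chain_path P n z) (map x [0..<Suc n])"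
proof (induction n)
  case 0
  have ae: "AE \<omega> in M. X 0 \<omega> = z" using chain by (simp add: markov_chain_def)
  have ev: "{\<omega> \<in> space M. X 0 \<omega> = x 0} \<in> sets M" using chain_cylinder[of 0 x] by simp
  show ?case
  proof (cases "x 0 = z")
    case True
    then have "measure M {\<omega> \<in> space M. X 0 \<omega> = x 0} = 1"
      using ae by (subst prob_Collect_eq_1[OF ev]) simp
    then show ?thesis using True by simp
  next
    case False
    then have "measure M {\<omega> \<in> space M. X 0 \<omega> = x 0} = 0"
      using ae by (subst prob_Collect_eq_0[OF ev]) (auto elim: eventually_mono)
    then show ?thesis using False by simp
  qed
next
  case (Suc n)
  have "{\<omega> \<in> space M. \<forall>i\<le>Suc n. X i \<omega> = x i} = {\<omega> \<in> space M. (\<forall>i\<le>n. X i \<omega> = x i) \<and> X (Suc n) \<omega> = x (Suc n)}"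
    by (auto simp: le_Suc_eq)
  then have "measure M {\<omega> \<in> space M. \<forall>i\<le>Suc n. X i \<omega> = x i} =
      measure M {\<omega> \<in> space M. \<forall>i\<le>n. X i \<omega> = x i} * pmf (P (x n)) (x (Suc n))"
    using chain by (simp add: markov_chain_def)
  also have "\<dots> = pmf (chain_path P n z) (map x [0..<Suc n]) * pmf (P (x n)) (x (Suc n))"
    unfolding Suc ..
  also have "\<dots> = (\<integral>l. indicator {map x [0..<Suc n]} l * pmf (P (x n)) (x (Suc n)) \<partial>measure_pmf (chain_path P n z))"
    by (simp add: measure_pmf_single)
  also have "\<dots> = (\<integral>l. pmf (map_pmf (\<lambda>y. l @ [y]) (P (last l))) (map x [0..<Suc n] @ [x (Suc n)]) \<partial>measure_pmf (chain_path P n z))"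
    unfolding pmf_map_snoc by (intro Bochner_Integration.integral_cong) (auto simp: indicator_def)
  also have "\<dots> = pmf (chain_path P (Suc n) z) (map x [0..<Suc (Suc n)])"
    unfolding chain_path_snoc pmf_bind by simp
  finally show ?case .
qed

lemma chain_preimage:
  "(\<lambda>\<omega>. map (\<lambda>i. X i \<omega>) [0..<Suc n]) -` {l} \<inter> space M =
    (if length l = Suc n then {\<omega> \<in> space M. \<forall>i\<le>n. X i \<omega> = l ! i} else {})"
proof -
  have "map (\<lambda>i. X i \<omega>) [0..<Suc n] = l \<longleftrightarrow> length l = Suc n \<and> (\<forall>i<Suc n. X i \<omega> = l ! i)" for \<omega>
    by (auto simp: list_eq_iff_nth_eq[where ys=l] simp del: upt_Suc)
  then show ?thesis unfolding less_Suc_eq_le vimage_def by auto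
qed

lemma measurable_chain_list: "(\<lambda>\<omega>. map (\<lambda>i. X i \<omega>) [0..<Suc n]) \<in> measurable M (count_space UNIV)"
  by (subst measurable_count_space_eq2_countable)
    (auto simp only: chain_preimage chain_cylinder Pi_UNIV if_True if_False sets.empty_sets split: if_splits)

text \<open>Makes the underlying probability space disappear: a functional of the first n + 1 states
  is integrated against the list law alone.\<close>

lemma distr_chain: "distr M (count_space UNIV) (\<lambda>\<omega>. map (\<lambda>i. X i \<omega>) [0..<Suc n]) = measure_pmf (chain_path P n z)"
proof (rule measure_eqI_countable[where A=UNIV])
  fix l :: "'s list"
  have "emeasure (distr M (count_space UNIV) (\<lambda>\<omega>. map (\<lambda>i. X i \<omega>) [0..<Suc n])) {l} =
      ennreal (if length l = Suc n then measure M {\<omega> \<in> space M. \<forall>i\<le>n. X i \<omega> = l ! i} else 0)"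
    by (subst emeasure_distr[OF measurable_chain_list]) (simp_all add: chain_preimage emeasure_eq_measure del: upt_Suc)
  also have "\<dots> = ennreal (pmf (chain_path P n z) l)"
  proof (cases "length l = Suc n")
    case True
    then have "map ((!) l) [0..<Suc n] = l" using map_nth[of l] by simp
    then show ?thesis using True unfolding chain_path_prob by (simp del: upt_Suc)
  next
    case False
    then have "l \<notin> set_pmf (chain_path P n z)" using length_chain_path[of l P n z] by blast
    then show ?thesis using False by (simp add: set_pmf_iff)
  qed
  finally show "emeasure (distr M (count_space UNIV) (\<lambda>\<omega>. map (\<lambda>i. X i \<omega>) [0..<Suc n])) {l} = emeasure (measure_pmf (chain_path P n z)) {l}"
    by (simp add: emeasure_pmf_single)
qed auto

end

lemma measurable_scaled_path:
  assumes "\<And>k. X k \<in> measurable M (count_space UNIV)"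
  shows "scaled_path B X n \<in> measurable M (borel_of C01_topology)"
proof -
  have X: "(\<lambda>\<omega>. real_vec (X k \<omega>)) \<in> borel_measurable M" for k
    by (rule measurable_compose[OF assms]) simp
  have "(\<lambda>\<omega>. restrict (lin_interp n (\<lambda>k. (1 / B n) *\<^sub>R real_vec (X k \<omega>))) {0..1}) \<in> measurable M (borel_of C01_topology)"
  proof (rule measurable_path_C01)
    show "(\<lambda>\<omega>. lin_interp n (\<lambda>k. (1 / B n) *\<^sub>R real_vec (X k \<omega>)) t) \<in> borel_measurable M" for t
      unfolding lin_interp_def
      by (intro borel_measurable_add borel_measurable_sum borel_measurable_scaleR borel_measurable_const borel_measurable_diff X)
  qed (rule continuous_on_lin_interp)
  moreover have "scaled_path B X n = (\<lambda>\<omega>. restrict (lin_interp n (\<lambda>k. (1 / B n) *\<^sub>R real_vec (X k \<omega>))) {0..1})"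
    by (rule ext) (simp add: scaled_path_eq path_of_def)
  ultimately show ?thesis by simp
qed

theorem theorem2:
  fixes p :: "(int^'d) pmf"
    and P :: "int^'d \<Rightarrow> (int^'d) pmf"
    and B :: "nat \<Rightarrow> real"
    and S :: "real^'d^'d"
    and A Q :: "(int^'d) set"
    and z :: "int^'d"
    and M :: "'a measure" and X :: "nat \<Rightarrow> 'a \<Rightarrow> int^'d"
    and N :: "'b measure" and W :: "real \<Rightarrow> 'b \<Rightarrow> real^'d"
  assumes dim: "CARD('d) \<ge> 2"
    and aperiodic: "aperiodic_walk p"
    and B_type: "B_type p B S"
    and impurities: "impurity_set P p A"
    and chain: "markov_chain M P z X"
    and component: "Q \<in> verts ` pre_digraph.sccs (transition_graph P)" "infinite Q"
    and closed: "\<forall>u\<in>Q. \<forall>v. pmf (P u) v \<noteq> 0 \<longrightarrow> v \<in> Q"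
    and start: "z \<in> Q" "0 \<in> Q"
    and moment: "\<exists>\<epsilon>>0. \<forall>u\<in>A.
      (\<integral>\<^sup>+ v. ennreal (infnorm (real_vec (v - u)) powr \<epsilon>) \<partial>measure_pmf (P u)) < \<infinity>"
    and wiener: "wiener_process N S W"
  shows "weakly_converges C01_topology
    (\<lambda>n. distr M (borel_of C01_topology) (scaled_path B X n))
    (distr N (borel_of C01_topology) (\<lambda>\<omega>. \<lambda>t\<in>{0..1}. W t \<omega>))"
proof -
  interpret C01: Metric_space "C01 :: (real \<Rightarrow> real^'d) set" C01_dist by (rule Metric_space_C01)
  interpret M: prob_space M using chain by (simp add: markov_chain_def)
  interpret N: prob_space N using wiener by (simp add: wiener_process_def)
  have X_meas: "scaled_path B X n \<in> measurable M (borel_of C01_topology)" for n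
    by (rule measurable_scaled_path) (rule chain_measurable[OF chain])
  have W_meas: "(\<lambda>\<omega>. \<lambda>t\<in>{0..1}. W t \<omega>) \<in> measurable N (borel_of C01_topology)"
    by (rule measurable_path_C01) (use wiener in \<open>auto simp: wiener_process_def\<close>)
  show ?thesis unfolding C01_topology_def
  proof (rule C01.weakly_converges_if_lipschitz, unfold C01_topology_def[symmetric])
    fix f :: "(real \<Rightarrow> real^'d) \<Rightarrow> real" and C L :: real
    assume bdd: "\<And>x. x \<in> C01 \<Longrightarrow> \<bar>f x\<bar> \<le> C"
      and lip: "\<And>x y. x \<in> C01 \<Longrightarrow> y \<in> C01 \<Longrightarrow> \<bar>f x - f y\<bar> \<le> L * C01_dist x y"
    have f_meas: "f \<in> borel_measurable (borel_of C01_topology)"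
      unfolding C01_topology_def by (intro borel_measurable_continuous_map C01.continuous_map_lipschitz[OF lip])
    have "(\<integral>x. f x \<partial>distr M (borel_of C01_topology) (scaled_path B X n)) =
        (\<integral>l. f (path_of n (\<lambda>k. (1 / B n) *\<^sub>R real_vec (l ! k))) \<partial>measure_pmf (chain_path P n z))" for n
    proof -
      have "(\<integral>x. f x \<partial>distr M (borel_of C01_topology) (scaled_path B X n)) = (\<integral>\<omega>. f (scaled_path B X n \<omega>) \<partial>M)"
        by (rule integral_distr[OF X_meas f_meas])
      \<comment> \<open>\<open>path_of n\<close> depends on the indices up to n only, so the list of
        the first n + 1 states determines the path, although \<open>scaled_path\<close> reads time n
        + 1, with weight 0, at t = 1.\<close>
      also have "\<dots> = (\<integral>\<omega>. f (path_of n (\<lambda>k. (1 / B n) *\<^sub>R real_vec (map (\<lambda>i. X i \<omega>) [0..<Suc n] ! k))) \<partial>M)"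
        unfolding scaled_path_eq
        by (intro Bochner_Integration.integral_cong arg_cong[where f=f] path_of_cong refl) (simp del: upt_Suc)
      also have "\<dots> = (\<integral>l. f (path_of n (\<lambda>k. (1 / B n) *\<^sub>R real_vec (l ! k)))
          \<partial>distr M (count_space UNIV) (\<lambda>\<omega>. map (\<lambda>i. X i \<omega>) [0..<Suc n]))"
        by (rule integral_distr[symmetric, OF measurable_chain_list[OF chain]]) simp
      finally show ?thesis unfolding distr_chain[OF chain] .
    qed
    moreover have "(\<integral>x. f x \<partial>distr N (borel_of C01_topology) (\<lambda>\<omega>. \<lambda>t\<in>{0..1}. W t \<omega>)) = (\<integral>\<omega>. f (\<lambda>t\<in>{0..1}. W t \<omega>) \<partial>N)"
      by (rule integral_distr[OF W_meas f_meas])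
    ultimately show "(\<lambda>n. \<integral>x. f x \<partial>distr M (borel_of C01_topology) (scaled_path B X n))
        \<longlonglongrightarrow> (\<integral>x. f x \<partial>distr N (borel_of C01_topology) (\<lambda>\<omega>. \<lambda>t\<in>{0..1}. W t \<omega>))"
      using perturbed_invariance_principle[OF B_type dim impurities component closed start(1) moment wiener bdd lip]
      by simp
  qed (simp_all add: M.prob_space_distr[OF X_meas] N.prob_space_distr[OF W_meas])
qed

end
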